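(* We have $$\inf_{\phi\in\mathcal{K}_0}\mathcal{A}(\phi)=\inf_{(\phi,\alpha)\in\mathcal{K}}\mathcal{A}(\phi,\alpha).$$
   Context: Fix $T>0$ and let $\mathbb{T}^d=\mathbb{R}^d/\mathbb{Z}^d$. $D$ is the space gradient. Standing assumptions. (Coupling) $f:\mathbb{T}^d\times[0,\infty)\to\mathbb{R}$ is continuous, strictly increasing in its second variable, $f(x,0)=0$ for all $x$, and there are $q>1$, $C>0$ with $\frac1C m^{q-1}-C\le f(x,m)\le Cm^{q-1}+C$ for all $m\ge0$. Let $\frac1p+\frac1q=1$. (Hamiltonian) $H:\mathbb{T}^d\times\mathbb{R}^d\to\mathbb{R}$ is continuous, convex and differentiable in the second variable, $D_pH$ (derivative in the second variable) is continuous in both variables, and there are $r>\max\{d(q-1),1\}$ and $C>0$ with $\frac{1}{rC}|\xi|^r-C\le H(x,\xi)\le\frac Cr|\xi|^r+C$ for all $(x,\xi)$. ($x$-dependence) There are $\theta\in[0,\frac{r}{d+1})$ and $C>0$ with $|H(x,\xi)-H(y,\xi)|\le C|x-y|\max(|\xi|,1)^\theta$ for all $x,y\in\mathbb{T}^d$, $\xi\in\mathbb{R}^d$. (Data) $\phi_T:\mathbb{T}^d\to\mathbb{R}$ is $C^1$; $m_0:\mathbb{T}^d\to\mathbb{R}$ is continuous, $m_0\ge0$, $\int_{\mathbb{T}^d}m_0\,dx=1$. $F(x,m)=\int_0^mf(x,\tau)d\tau$ for $m\ge0$, $F(x,m)=+\infty$ for $m<0$; $F^*$ is the convex conjugate of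 $F$ with respect to the second variable. $\mathcal{K}_0$ is the set of $\phi\in C^1([0,T]\times\mathbb{T}^d)$ with $\phi(T,x)=\phi_T(x)$, and for $\phi\in\mathcal{K}_0$ $$\mathcal{A}(\phi)=\int_0^T\!\int_{\mathbb{T}^d}F^*\big(x,-\partial_t\phi(t,x)+H(x,D\phi(t,x))\big)dx\,dt-\int_{\mathbb{T}^d}\phi(0,x)m_0(x)dx .$$ $\mathcal{K}$ is the set of $(\phi,\alpha)\in BV((0,T)\times\mathbb{T}^d)\times L^p((0,T)\times\mathbb{T}^d)$ with $D\phi\in L^r((0,T)\times\mathbb{T}^d)$, $\phi(T,\cdot)=\phi_T$ in the sense of traces, and $-\partial_t\phi+H(x,D\phi)\le\alpha$ in $(0,T)\times\mathbb{T}^d$ in the sense of distributions. For $(\phi,\alpha)\in\mathcal{K}$ (with $\phi(0,\cdot)$ understood as a trace), $$\mathcal{A}(\phi,\alpha)=\int_0^T\!\int_{\mathbb{T}^d}F^*(x,\alpha(t,x))dx\,dt-\int_{\mathbb{T}^d}\phi(0,x)m_0(x)dx .$$ *)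

theory Defs
  imports "HOL-Analysis.Analysis"
begin

text \<open>
  The torus is $\mathbb{R}^d/\mathbb{Z}^d$ with $d$ = \<^term>\<open>CARD('n)\<close>. A function on the torus is
  represented by its $\mathbb{Z}^d$-periodic lift to \<^typ>\<open>real^'n\<close>, and integrals over the torus are
  integrals over the half-open cell \<open>unit_cell\<close>, which contains exactly one
  representative of every point.  Time-space points are pairs $(t,x)$ in
  \<^typ>\<open>real \<times> (real^'n)\<close>.
\<close>

definition int_lattice :: "(real^'n) set" where
  "int_lattice = {k. \<forall>i. k $ i \<in> \<int>}"

definition periodic :: "(real^'n \<Rightarrow> 'b) \<Rightarrow> bool" where
  "periodic g \<longleftrightarrow> (\<forall>x. \<forall>k\<in>int_lattice. g (x + k) = g x)"

definition torus_dist :: "real^'n \<Rightarrow> real^'n \<Rightarrow> real" where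
  "torus_dist x y = infdist (x - y) int_lattice"

definition unit_cell :: "(real^'n) set" where
  "unit_cell = {x. \<forall>i. 0 \<le> x $ i \<and> x $ i < 1}"

definition cylinder :: "real \<Rightarrow> (real \<times> (real^'n)) set" where
  "cylinder T = {0<..<T} \<times> unit_cell"

text \<open>The lift of the closed cylinder $[0,T] \times \mathbb{T}^d$:\<close>

definition slab :: "real \<Rightarrow> (real \<times> (real^'n)) set" where
  "slab T = {0..T} \<times> UNIV"

subsection \<open>Smooth functions\<close>

text \<open>
  Derivatives are taken within \<open>S\<close>, hence one-sided in time at the faces of \<open>slab T\<close>.
  Only \<open>S = UNIV\<close> and \<open>S = slab T\<close> with $T > 0$ are used; there the derivative within \<open>S\<close>
  is unique.
\<close>

definition partial_within ::
    "'a::euclidean_space set \<Rightarrow> 'a \<Rightarrow> ('a \<Rightarrow> real) \<Rightarrow> 'a \<Rightarrow> real" where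
  "partial_within S b g z = frechet_derivative g (at z within S) b"

primrec Ck_on :: "nat \<Rightarrow> 'a::euclidean_space set \<Rightarrow> ('a \<Rightarrow> real) \<Rightarrow> bool" where
  "Ck_on 0 S g \<longleftrightarrow> continuous_on S g"
| "Ck_on (Suc k) S g \<longleftrightarrow>
     (\<forall>z\<in>S. g differentiable (at z within S)) \<and> (\<forall>b\<in>Basis. Ck_on k S (partial_within S b g))"

definition smooth :: "('a::euclidean_space \<Rightarrow> real) \<Rightarrow> bool" where
  "smooth g \<longleftrightarrow> (\<forall>k. Ck_on k UNIV g)"

definition time_deriv_within ::
    "(real \<times> (real^'n)) set \<Rightarrow> (real \<times> (real^'n) \<Rightarrow> real) \<Rightarrow> real \<times> (real^'n) \<Rightarrow> real" where
  "time_deriv_within S g z = partial_within S (1, 0) g z"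

definition space_grad_within ::
    "(real \<times> (real^'n)) set \<Rightarrow> (real \<times> (real^'n) \<Rightarrow> real) \<Rightarrow> real \<times> (real^'n) \<Rightarrow> real^'n" where
  "space_grad_within S g z = (\<chi> i. partial_within S (0, axis i 1) g z)"

definition C1_closed_cylinder :: "real \<Rightarrow> (real \<times> (real^'n) \<Rightarrow> real) \<Rightarrow> bool" where
  "C1_closed_cylinder T g \<longleftrightarrow>
     Ck_on 1 (slab T) g \<and> (\<forall>t\<in>{0..T}. periodic (\<lambda>x. g (t, x)))"

text \<open>
  Smooth functions with compact support in $(0,T) \times \mathbb{T}^d$.  As the torus is compact, only the
  time variable has to stay in a compact subset of $(0,T)$.
\<close>

definition test_function :: "real \<Rightarrow> (real \<times> (real^'n) \<Rightarrow> real) \<Rightarrow> bool" where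
  "test_function T \<psi> \<longleftrightarrow> smooth \<psi> \<and> (\<forall>t. periodic (\<lambda>x. \<psi> (t, x))) \<and>
     (\<exists>a b. 0 < a \<and> b < T \<and> (\<forall>t x. t \<notin> {a..b} \<longrightarrow> \<psi> (t, x) = 0))"

subsection \<open>Lebesgue spaces, weak derivatives, functions of bounded variation\<close>

definition Lp_torus :: "real \<Rightarrow> (real^'n \<Rightarrow> real) \<Rightarrow> bool" where
  "Lp_torus s g \<longleftrightarrow> periodic g \<and> set_borel_measurable lborel unit_cell g \<and>
     set_integrable lborel unit_cell (\<lambda>x. \<bar>g x\<bar> powr s)"

definition Lp_cylinder ::
    "real \<Rightarrow> real \<Rightarrow> (real \<times> (real^'n) \<Rightarrow> 'b::euclidean_space) \<Rightarrow> bool" where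
  "Lp_cylinder T s u \<longleftrightarrow> (\<forall>t\<in>{0<..<T}. periodic (\<lambda>x. u (t, x))) \<and>
     set_borel_measurable lborel (cylinder T) u \<and>
     set_integrable lborel (cylinder T) (\<lambda>z. norm (u z) powr s)"

definition weak_space_gradient ::
    "real \<Rightarrow> (real \<times> (real^'n) \<Rightarrow> real) \<Rightarrow> (real \<times> (real^'n) \<Rightarrow> real^'n) \<Rightarrow> bool" where
  "weak_space_gradient T \<phi> w \<longleftrightarrow> (\<forall>\<psi> i. test_function T \<psi> \<longrightarrow>
     (LINT z:cylinder T|lborel. \<phi> z * space_grad_within UNIV \<psi> z $ i)
       = - (LINT z:cylinder T|lborel. w z $ i * \<psi> z))"

text \<open>
  The vector measure $D_{t,x}\phi$ is given in polar form $\sigma\mu$, with $\mu = |D_{t,x}\phi|$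
  finite and $|\sigma| = 1$ holding $\mu$-almost everywhere.
\<close>

definition derivative_measure ::
    "real \<Rightarrow> (real \<times> (real^'n) \<Rightarrow> real) \<Rightarrow> (real \<times> (real^'n)) measure
       \<Rightarrow> (real \<times> (real^'n) \<Rightarrow> real \<times> (real^'n)) \<Rightarrow> bool" where
  "derivative_measure T \<phi> \<mu> \<sigma> \<longleftrightarrow>
     sets \<mu> = sets borel \<and> finite_measure \<mu> \<and> emeasure \<mu> (UNIV - cylinder T) = 0 \<and>
     \<sigma> \<in> borel_measurable borel \<and> (AE z in \<mu>. norm (\<sigma> z) = 1) \<and>
     (\<forall>\<psi>. test_function T \<psi> \<longrightarrow> (\<forall>b\<in>Basis.
        (LINT z:cylinder T|lborel. \<phi> z * partial_within UNIV b \<psi> z)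
          = - (LINT z:cylinder T|\<mu>. \<psi> z * (\<sigma> z \<bullet> b))))"

definition BV_cylinder :: "real \<Rightarrow> (real \<times> (real^'n) \<Rightarrow> real) \<Rightarrow> bool" where
  "BV_cylinder T \<phi> \<longleftrightarrow> Lp_cylinder T 1 \<phi> \<and> (\<exists>\<mu> \<sigma>. derivative_measure T \<phi> \<mu> \<sigma>)"

text \<open>
  The $L^1$ functions \<open>g0\<close> and \<open>gT\<close> are the traces of the $BV$ function $\phi$ on $t = 0$ and
  $t = T$, i.e.\ the almost everywhere unique boundary values in the Gauss-Green formula.
  The outer unit normal is $(1,0)$ at $t = T$ and $(-1,0)$ at $t = 0$; the torus has no boundary.
\<close>

definition BV_traces ::
    "real \<Rightarrow> (real \<times> (real^'n) \<Rightarrow> real) \<Rightarrow> (real^'n \<Rightarrow> real) \<Rightarrow> (real^'n \<Rightarrow> real) \<Rightarrow> bool" where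
  "BV_traces T \<phi> g0 gT \<longleftrightarrow> Lp_torus 1 g0 \<and> Lp_torus 1 gT \<and>
     (\<exists>\<mu> \<sigma>. derivative_measure T \<phi> \<mu> \<sigma> \<and>
       (\<forall>\<psi>. C1_closed_cylinder T \<psi> \<longrightarrow> (\<forall>b\<in>Basis.
          (LINT z:cylinder T|lborel. \<phi> z * partial_within (slab T) b \<psi> z)
            = - (LINT z:cylinder T|\<mu>. \<psi> z * (\<sigma> z \<bullet> b))
              + fst b * (LINT x:unit_cell|lborel. \<psi> (T, x) * gT x)
              - fst b * (LINT x:unit_cell|lborel. \<psi> (0, x) * g0 x))))"

definition initial_trace :: "real \<Rightarrow> (real \<times> (real^'n) \<Rightarrow> real) \<Rightarrow> real^'n \<Rightarrow> real" where
  "initial_trace T \<phi> = (SOME g0. \<exists>gT. BV_traces T \<phi> g0 gT)"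

subsection \<open>The two variational problems\<close>

definition coupling_primitive :: "(real^'n \<Rightarrow> real \<Rightarrow> real) \<Rightarrow> real^'n \<Rightarrow> real \<Rightarrow> ereal" where
  "coupling_primitive f x m = (if m < 0 then \<infinity> else ereal (integral {0..m} (f x)))"

definition convex_conjugate :: "(real \<Rightarrow> ereal) \<Rightarrow> real \<Rightarrow> ereal" where
  "convex_conjugate G a = (SUP m. ereal (a * m) - G m)"

definition coupling_conjugate :: "(real^'n \<Rightarrow> real \<Rightarrow> real) \<Rightarrow> real^'n \<Rightarrow> real \<Rightarrow> ereal" where
  "coupling_conjugate f x = convex_conjugate (coupling_primitive f x)"

text \<open>Hence nothing is cut off by \<^const>\<open>e2ennreal\<close> in the functionals below.\<close>

lemma coupling_conjugate_nonneg: "0 \<le> coupling_conjugate f x a"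
proof -
  have "ereal (a * 0) - coupling_primitive f x 0 \<le> coupling_conjugate f x a"
    unfolding coupling_conjugate_def convex_conjugate_def by (rule SUP_upper) simp
  then show ?thesis by (simp add: coupling_primitive_def zero_ereal_def)
qed

definition K0 :: "real \<Rightarrow> (real^'n \<Rightarrow> real) \<Rightarrow> (real \<times> (real^'n) \<Rightarrow> real) set" where
  "K0 T \<phi>T = {\<phi>. C1_closed_cylinder T \<phi> \<and> (\<forall>x. \<phi> (T, x) = \<phi>T x)}"

definition A0 ::
    "real \<Rightarrow> (real^'n \<Rightarrow> real \<Rightarrow> real) \<Rightarrow> (real^'n \<Rightarrow> real^'n \<Rightarrow> real) \<Rightarrow> (real^'n \<Rightarrow> real)
       \<Rightarrow> (real \<times> (real^'n) \<Rightarrow> real) \<Rightarrow> ereal" where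
  "A0 T f H m0 \<phi> =
     enn2ereal (\<integral>\<^sup>+z\<in>cylinder T. e2ennreal (coupling_conjugate f (snd z)
         (- time_deriv_within (slab T) \<phi> z + H (snd z) (space_grad_within (slab T) \<phi> z))) \<partial>lborel)
     - ereal (LINT x:unit_cell|lborel. \<phi> (0, x) * m0 x)"

text \<open>
  $-\partial_t\phi + H(x,w) \le \alpha$ in the sense of distributions; \<open>w\<close> stands for $D\phi$.
\<close>

definition HJ_subsolution ::
    "real \<Rightarrow> (real^'n \<Rightarrow> real^'n \<Rightarrow> real) \<Rightarrow> (real \<times> (real^'n) \<Rightarrow> real)
       \<Rightarrow> (real \<times> (real^'n) \<Rightarrow> real^'n) \<Rightarrow> (real \<times> (real^'n) \<Rightarrow> real) \<Rightarrow> bool" where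
  "HJ_subsolution T H \<phi> w \<alpha> \<longleftrightarrow>
     (\<forall>\<psi>. test_function T \<psi> \<and> (\<forall>z. 0 \<le> \<psi> z) \<longrightarrow>
        (LINT z:cylinder T|lborel. \<phi> z * time_deriv_within UNIV \<psi> z)
          + (LINT z:cylinder T|lborel. H (snd z) (w z) * \<psi> z)
        \<le> (LINT z:cylinder T|lborel. \<alpha> z * \<psi> z))"

definition K ::
    "real \<Rightarrow> real \<Rightarrow> real \<Rightarrow> (real^'n \<Rightarrow> real^'n \<Rightarrow> real) \<Rightarrow> (real^'n \<Rightarrow> real)
       \<Rightarrow> ((real \<times> (real^'n) \<Rightarrow> real) \<times> (real \<times> (real^'n) \<Rightarrow> real)) set" where
  "K T p r H \<phi>T = {(\<phi>, \<alpha>). BV_cylinder T \<phi> \<and> Lp_cylinder T p \<alpha> \<and>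
     (\<exists>g0. BV_traces T \<phi> g0 \<phi>T) \<and>
     (\<exists>w. weak_space_gradient T \<phi> w \<and> Lp_cylinder T r w \<and> HJ_subsolution T H \<phi> w \<alpha>)}"

definition A ::
    "real \<Rightarrow> (real^'n \<Rightarrow> real \<Rightarrow> real) \<Rightarrow> (real^'n \<Rightarrow> real)
       \<Rightarrow> (real \<times> (real^'n) \<Rightarrow> real) \<Rightarrow> (real \<times> (real^'n) \<Rightarrow> real) \<Rightarrow> ereal" where
  "A T f m0 \<phi> \<alpha> =
     enn2ereal (\<integral>\<^sup>+z\<in>cylinder T. e2ennreal (coupling_conjugate f (snd z) (\<alpha> z)) \<partial>lborel)
     - ereal (LINT x:unit_cell|lborel. initial_trace T \<phi> x * m0 x)"

end

theory Submission imports Defs begin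

text \<open>
  A competitor \<open>\<phi>\<close> of class C1 is a relaxed competitor together with its own residual
  \<open>\<alpha> = - \<partial>\<^sub>t \<phi> + H(x, D\<phi>)\<close>, and both functionals agree there: by the Gauss--Green formula its
  boundary values are its traces, and integrals of traces against a continuous weight do not depend on
  the choice of the trace.  So the relaxed infimum is at most the smooth one (\<open>C1_in_K\<close>,
  \<open>initial_trace_integral\<close>).

  For the converse, a relaxed competitor \<open>(\<phi>, \<alpha>)\<close> is approximated by smooth competitors whose cost
  is at most that of \<open>(\<phi>, \<alpha>)\<close> up to an arbitrarily small error (\<open>approximation\<close>).

  \<^item> The pair is continued beyond the final time by the terminal datum \<open>\<phi>T\<close> and by \<open>H(x, D\<phi>T)\<close>.
    It remains a distributional subsolution, as the trace condition excludes a jump at time \<open>T\<close>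
    (\<open>extended_subsolution\<close>).

  \<^item> The continuation is mollified at scale \<open>1 / N\<close> in space and time, by a kernel that looks only
    forward in time.  This makes sense up to both faces of the closed cylinder; at time \<open>T\<close> only
    the smooth terminal datum is averaged, and at time \<open>0\<close> the averages converge weakly to the trace
    of \<open>\<phi>\<close> (\<open>final_value_close\<close>, \<open>final_gradient_close\<close>, \<open>trace_limit\<close>).

  \<^item> By convexity of \<open>H\<close> in the momentum, the mollified function satisfies
    \<open>- \<partial>\<^sub>t \<phi>\<^sub>N + H(x, D\<phi>\<^sub>N) \<le> \<alpha>\<^sub>N + \<epsilon>\<^sub>N\<close>, where \<open>\<epsilon>\<^sub>N\<close> accounts for the dependence
    of \<open>H\<close> on \<open>x\<close>.  The gradient being only in \<open>L^r\<close>, an average of \<open>|D\<phi>| powr \<theta>\<close> over a space-time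
    box of side \<open>1 / N\<close> may be as large as \<open>N powr (\<theta> (d + 1) / r)\<close>; it is multiplied by the
    oscillation \<open>1 / N\<close> of the space variable, and \<open>\<theta> < r / (d + 1)\<close> says that the product tends
    to zero.  The error is uniform in the point (\<open>H_mollified_gradient\<close>, \<open>mollified_inequality\<close>).

  \<^item> The terminal condition is restored by shrinking \<open>\<phi>\<^sub>N\<close> by \<open>1 - s\<close> and adding the function
    \<open>\<phi>T - (1 - s) \<phi>\<^sub>N(T)\<close> of space.  The gradient of the correction is \<open>s\<close> times a bounded vector, so
    by convexity the residual becomes at most \<open>(1 - s) \<alpha>\<^sub>N + O(s)\<close> (\<open>competitor_cost\<close>).

  \<^item> The conjugate \<open>F\<^sup>*\<close> is a monotone supremum of affine functions, so Jensen's inequality bounds the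
    cost of \<open>\<alpha>\<^sub>N\<close> by integrals of averages of \<open>F\<^sup>*\<close> along \<open>\<alpha>\<close>; these converge by dominated
    convergence because \<open>F\<^sup>*\<close> is continuous and grows at most like the power \<open>p\<close> (\<open>mollified_cost_le\<close>,
    \<open>layered_cost_limit\<close>).
\<close>

section \<open>Smooth functions\<close>

lemma partial_within_UNIV:
  "(g has_derivative D) (at z) \<Longrightarrow> partial_within UNIV b g z = D b"
  unfolding partial_within_def using frechet_derivative_at by metis

lemma Ck_on_SucD: "Ck_on (Suc k) S g \<Longrightarrow> Ck_on k S g"
proof (induction k arbitrary: g)
  case 0
  then show ?case
    by (auto simp: continuous_on_eq_continuous_within differentiable_imp_continuous_within)
next
  case (Suc k)
  then show ?case by (metis Ck_on.simps(2))
qed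

lemma Ck_on_has_derivative:
  assumes "Ck_on (Suc k) UNIV g"
  shows "(g has_derivative (\<lambda>h. partial_within UNIV h g z)) (at z)"
  using assms unfolding partial_within_def by (simp add: frechet_derivative_works[symmetric])

lemma Ck_on_const: "Ck_on k UNIV (\<lambda>z::'a::euclidean_space. c)"
proof (induction k arbitrary: c)
  case (Suc k)
  have "partial_within UNIV b (\<lambda>z::'a. c) = (\<lambda>z. 0)" for b :: 'a
    by (rule ext, rule partial_within_UNIV) (rule has_derivative_const)
  then show ?case using Suc by simp
qed auto

lemma Ck_on_linear:
  fixes c :: "'a::euclidean_space"
  shows "Ck_on k UNIV (\<lambda>z. z \<bullet> c)"
proof (cases k)
  case (Suc k)
  have d: "((\<lambda>z. z \<bullet> c) has_derivative (\<lambda>h. h \<bullet> c)) (at z)" for z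
    by (auto intro!: derivative_eq_intros)
  have "partial_within UNIV b (\<lambda>z. z \<bullet> c) = (\<lambda>z. b \<bullet> c)" for b :: 'a
    by (rule ext, rule partial_within_UNIV[OF d])
  then show ?thesis using Suc d by (auto simp: Ck_on_const differentiable_def)
qed (auto intro!: continuous_intros)

lemma Ck_on_add:
  assumes "Ck_on k UNIV g" "Ck_on k UNIV h"
  shows "Ck_on k UNIV (\<lambda>z. g z + h z)"
  using assms
proof (induction k arbitrary: g h)
  case (Suc k)
  note dg = Ck_on_has_derivative[OF Suc.prems(1)] and dh = Ck_on_has_derivative[OF Suc.prems(2)]
  have "partial_within UNIV b (\<lambda>z. g z + h z)
      = (\<lambda>z. partial_within UNIV b g z + partial_within UNIV b h z)" for b
    by (rule ext, rule partial_within_UNIV[OF has_derivative_add[OF dg dh]])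
  then show ?case using Suc by auto
qed (auto intro!: continuous_intros)

lemma Ck_on_mult:
  assumes "Ck_on k UNIV g" "Ck_on k UNIV h"
  shows "Ck_on k UNIV (\<lambda>z. g z * h z)"
  using assms
proof (induction k arbitrary: g h)
  case (Suc k)
  note dg = Ck_on_has_derivative[OF Suc.prems(1)] and dh = Ck_on_has_derivative[OF Suc.prems(2)]
  have "partial_within UNIV b (\<lambda>z. g z * h z)
      = (\<lambda>z. g z * partial_within UNIV b h z + partial_within UNIV b g z * h z)" for b
    by (rule ext, rule partial_within_UNIV[OF has_derivative_mult[OF dg dh]])
  moreover have "(\<lambda>z. g z * h z) differentiable (at z)" for z
    using Suc.prems by (auto intro!: differentiable_mult)
  ultimately show ?case using Suc Ck_on_SucD[OF Suc.prems(1)] Ck_on_SucD[OF Suc.prems(2)]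
    by (auto intro!: Ck_on_add)
qed (auto intro!: continuous_intros)

lemma Ck_on_compose:
  fixes h :: "real \<Rightarrow> real"
  assumes "Ck_on k UNIV h" "Ck_on k UNIV g"
  shows "Ck_on k UNIV (\<lambda>z. h (g z))"
  using assms
proof (induction k arbitrary: g h)
  case 0
  then show ?case by (auto intro: continuous_on_compose2)
next
  case (Suc k)
  note dg = Ck_on_has_derivative[OF Suc.prems(2)] and dh = Ck_on_has_derivative[OF Suc.prems(1)]
  have lin: "partial_within UNIV (c :: real) h y = c * partial_within UNIV 1 h y" for c y
    using linear_cmul[OF bounded_linear.linear[OF has_derivative_bounded_linear[OF dh[of y]]], of c 1]
    by simp
  have "partial_within UNIV b (\<lambda>z. h (g z)) z
      = partial_within UNIV b g z * partial_within UNIV 1 h (g z)" for b z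
    by (subst partial_within_UNIV[OF has_derivative_compose[OF dg dh]]) (rule lin)
  then have "partial_within UNIV b (\<lambda>z. h (g z))
      = (\<lambda>z. partial_within UNIV b g z * partial_within UNIV 1 h (g z))" for b
    by (rule ext)
  moreover have "(\<lambda>z. h (g z)) differentiable (at z)" for z
    using has_derivative_compose[OF dg dh] by (auto simp: differentiable_def)
  ultimately show ?case using Suc Ck_on_SucD[OF Suc.prems(2)]
    by (auto intro!: Ck_on_mult)
qed

lemma Ck_on_prod:
  "finite I \<Longrightarrow> (\<And>i. i \<in> I \<Longrightarrow> Ck_on k UNIV (g i)) \<Longrightarrow> Ck_on k UNIV (\<lambda>z. \<Prod>i\<in>I. g i z)"
  by (induction I rule: finite_induct) (auto intro!: Ck_on_const Ck_on_mult)

text \<open>The induction step by which a whole family of functions is shown to be smooth at once, if the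
  derivative of each member is a linear combination of members.\<close>

lemma Ck_on_real_Suc:
  fixes h :: "real \<Rightarrow> real"
  assumes d: "\<And>t. (h has_real_derivative h' t) (at t)" and "Ck_on k UNIV h'"
  shows "Ck_on (Suc k) UNIV h"
proof -
  have "partial_within UNIV 1 h = h'"
    using partial_within_UNIV[OF d[unfolded has_field_derivative_def]] by auto
  moreover have "h differentiable at t" for t
    using d real_differentiable_def by blast
  ultimately show ?thesis using assms by simp
qed

lemma Ck_on_sin_cos: "Ck_on k UNIV (sin :: real \<Rightarrow> real) \<and> Ck_on k UNIV (cos :: real \<Rightarrow> real)"
proof (induction k)
  case 0
  show ?case by (auto intro!: continuous_intros)
next
  case (Suc k)
  have "Ck_on k UNIV (\<lambda>t. (-1) * sin t :: real)"
    using Suc by (intro Ck_on_mult Ck_on_const) auto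
  then have "Ck_on k UNIV (\<lambda>t. - sin t :: real)" by simp
  then have "Ck_on (Suc k) UNIV (cos :: real \<Rightarrow> real)"
    by (rule Ck_on_real_Suc[OF DERIV_cos])
  moreover have "Ck_on (Suc k) UNIV (sin :: real \<Rightarrow> real)"
    using Suc by (intro Ck_on_real_Suc[OF DERIV_sin]) simp
  ultimately show ?case by blast
qed

lemma smooth_const: "smooth (\<lambda>z. c)"
  by (simp add: smooth_def Ck_on_const)

lemma smooth_linear: "smooth (\<lambda>z. z \<bullet> e)"
  by (simp add: smooth_def Ck_on_linear)

lemma smooth_mult: "smooth g \<Longrightarrow> smooth h \<Longrightarrow> smooth (\<lambda>z. g z * h z)"
  by (simp add: smooth_def Ck_on_mult)

lemma smooth_add: "smooth g \<Longrightarrow> smooth h \<Longrightarrow> smooth (\<lambda>z. g z + h z)"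
  by (simp add: smooth_def Ck_on_add)

lemma smooth_compose:
  fixes u :: "real \<Rightarrow> real"
  assumes "smooth u" "smooth g" shows "smooth (\<lambda>z. u (g z))"
  using assms unfolding smooth_def by (metis Ck_on_compose)

lemma smooth_prod:
  assumes "finite I" "\<And>i. i \<in> I \<Longrightarrow> smooth (k i)"
  shows "smooth (\<lambda>z. \<Prod>i\<in>I. k i z)"
  using assms unfolding smooth_def by (metis Ck_on_prod)

lemma smooth_sin: "smooth (sin :: real \<Rightarrow> real)"
  by (simp add: smooth_def Ck_on_sin_cos)

lemma smooth_has_derivative:
  "smooth g \<Longrightarrow> (g has_derivative (\<lambda>h. partial_within UNIV h g z)) (at z)"
  unfolding smooth_def by (blast intro: Ck_on_has_derivative)

lemma smooth_continuous_on: "smooth g \<Longrightarrow> continuous_on S g"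
  unfolding smooth_def by (metis Ck_on.simps(1) continuous_on_subset subset_UNIV)

lemma smooth_partial:
  assumes "smooth g" "b \<in> Basis" shows "smooth (partial_within UNIV b g)"
  using assms unfolding smooth_def by (metis Ck_on.simps(2))

text \<open>The flat functions: \<open>flat n\<close> is \<open>exp (-1/t) / t ^ n\<close> continued by zero.  The derivative of
  one is a combination of others, which makes them smooth.\<close>

definition flat :: "nat \<Rightarrow> real \<Rightarrow> real" where
  "flat n t = (if t \<le> 0 then 0 else exp (- inverse t) * inverse t ^ n)"

lemma flat_limit: "(flat n \<longlongrightarrow> 0) (at_right 0)"
proof -
  have "((\<lambda>t. (inverse t) ^ n / exp (inverse t)) \<longlongrightarrow> 0) (at_right (0::real))"
    by (rule filterlim_compose[OF tendsto_power_div_exp_0 filterlim_inverse_at_top_right])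
  moreover have "\<forall>\<^sub>F t in at_right (0::real). (inverse t) ^ n / exp (inverse t) = flat n t"
    by (auto simp: flat_def eventually_at_filter exp_minus field_simps)
  ultimately show ?thesis by (rule Lim_transform_eventually)
qed

lemma flat_has_derivative:
  "(flat n has_real_derivative flat (n + 2) t - real n * flat (n + 1) t) (at t)"
proof -
  consider "t < 0" | "t > 0" | "t = 0" by linarith
  then show ?thesis
  proof cases
    case 1
    have "((\<lambda>t. 0) has_real_derivative 0) (at t)" by simp
    moreover have "\<forall>\<^sub>F x in nhds t. 0 = flat n x"
      using eventually_nhds_in_open[of "{..<0}" t] 1
      by (auto simp: flat_def elim!: eventually_mono)
    ultimately have "(flat n has_real_derivative 0) (at t)"
      using DERIV_cong_ev[of t t "\<lambda>t. 0" "flat n" 0 0] by blast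
    then show ?thesis using 1 by (simp add: flat_def)
  next
    case 2
    have ev: "\<forall>\<^sub>F x in nhds t. flat n x = exp (- inverse x) * inverse x ^ n"
      using eventually_nhds_in_open[of "{0<..}" t] 2
      by (auto simp: flat_def elim!: eventually_mono)
    have "((\<lambda>x. exp (- inverse x) * inverse x ^ n) has_real_derivative
        flat (n + 2) t - real n * flat (n + 1) t) (at t)"
    proof -
      have "((\<lambda>x. exp (- inverse x) * inverse x ^ n) has_real_derivative
          exp (- inverse t) * (real n * inverse t ^ (n - 1) * (- (inverse t * inverse t)))
            + exp (- inverse t) * (inverse t * inverse t) * inverse t ^ n) (at t)"
        using 2 by (auto intro!: derivative_eq_intros)
      also have "exp (- inverse t) * (real n * inverse t ^ (n - 1) * (- (inverse t * inverse t)))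
            + exp (- inverse t) * (inverse t * inverse t) * inverse t ^ n
          = flat (n + 2) t - real n * flat (n + 1) t"
        using 2 by (cases n) (simp_all add: flat_def algebra_simps)
      finally show ?thesis .
    qed
    then show ?thesis using DERIV_cong_ev[OF refl ev refl] by blast
  next
    case 3
    have "((\<lambda>y. (flat n y - flat n 0) / (y - 0)) \<longlongrightarrow> 0) (at_right 0)"
    proof (rule Lim_transform_eventually[OF flat_limit[of "n + 1"]])
      show "\<forall>\<^sub>F x in at_right 0. flat (n + 1) x = (flat n x - flat n 0) / (x - 0)"
        by (intro eventually_at_right_less[THEN eventually_mono])
          (simp add: flat_def divide_inverse mult_ac)
    qed
    moreover have "((\<lambda>y. (flat n y - flat n 0) / (y - 0)) \<longlongrightarrow> 0) (at_left 0)"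
    proof (rule Lim_transform_eventually[OF tendsto_const[of 0]])
      show "\<forall>\<^sub>F x in at_left 0. 0 = (flat n x - flat n 0) / (x - 0)"
        by (auto simp: flat_def eventually_at_filter)
    qed
    ultimately have "((\<lambda>y. (flat n y - flat n 0) / (y - 0)) \<longlongrightarrow> 0) (at 0)"
      by (simp add: filterlim_split_at_real)
    then show ?thesis using 3 by (simp add: flat_def has_field_derivative_iff)
  qed
qed

lemma smooth_flat: "smooth (flat n)"
proof -
  have "Ck_on k UNIV (flat n)" for k
  proof (induction k arbitrary: n)
    case 0
    show ?case
      by simp (rule DERIV_continuous_on, rule flat_has_derivative)
  next
    case (Suc k)
    have "Ck_on k UNIV (\<lambda>t. flat (n + 2) t + (- real n) * flat (n + 1) t)"
      by (intro Ck_on_add Ck_on_mult Suc Ck_on_const)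
    then have "Ck_on k UNIV (\<lambda>t. flat (n + 2) t - real n * flat (n + 1) t)" by simp
    then show ?case by (rule Ck_on_real_Suc[OF flat_has_derivative])
  qed
  then show ?thesis by (simp add: smooth_def)
qed

lemma flat_nonneg: "0 \<le> flat n t" and flat_zero: "t \<le> 0 \<Longrightarrow> flat n t = 0"
  and flat_pos: "0 < t \<Longrightarrow> 0 < flat n t"
  by (auto simp: flat_def)

lemma flat_0_le_1: "flat 0 t \<le> 1" by (auto simp: flat_def)

lemma flat_0_mono: "s \<le> t \<Longrightarrow> flat 0 s \<le> flat 0 t" by (auto simp: flat_def)

section \<open>The torus\<close>

lemma int_lattice_add: "k \<in> int_lattice \<Longrightarrow> l \<in> int_lattice \<Longrightarrow> k + l \<in> int_lattice"
  and int_lattice_uminus: "k \<in> int_lattice \<Longrightarrow> - k \<in> int_lattice"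
  and int_lattice_zero: "0 \<in> int_lattice"
  by (auto simp: int_lattice_def)

lemma int_lattice_axis: "axis i (of_int c) \<in> int_lattice"
  by (auto simp: int_lattice_def axis_def)

lemma periodic_minus: "periodic g \<Longrightarrow> k \<in> int_lattice \<Longrightarrow> g (x - k) = g x"
  unfolding periodic_def using int_lattice_uminus by (metis diff_conv_add_uminus)

lemma periodic_shift: "periodic g \<Longrightarrow> periodic (\<lambda>x. g (x + v))"
  unfolding periodic_def by (metis add.assoc add.commute)

lemma cell_representative:
  fixes x :: "real^'n"
  obtains k where "k \<in> int_lattice" "x - k \<in> unit_cell"
proof
  show "(\<chi> i. of_int \<lfloor>x $ i\<rfloor>) \<in> int_lattice" by (simp add: int_lattice_def)
  show "x - (\<chi> i. of_int \<lfloor>x $ i\<rfloor>) \<in> unit_cell"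
    using real_of_int_floor_add_one_gt by (auto simp: unit_cell_def diff_less_eq add.commute)
qed

lemma unit_cell_subset_cbox: "unit_cell \<subseteq> cbox 0 (1 :: real^'n)"
  by (auto simp: unit_cell_def mem_box_cart less_imp_le)

lemma unit_cell_borel [measurable]: "(unit_cell :: (real^'n) set) \<in> sets borel"
proof -
  have eq: "unit_cell = (\<Inter>i. {x :: real^'n. 0 \<le> x $ i} \<inter> {x. x $ i < 1})"
    by (auto simp: unit_cell_def)
  have "{x :: real^'n. 0 \<le> x $ i} \<inter> {x. x $ i < 1} \<in> sets borel" for i
    by (intro sets.Int borel_closed borel_open closed_halfspace_component_ge_cart
        open_halfspace_component_lt_cart)
  then show ?thesis unfolding eq by (intro sets.finite_INT) auto
qed

lemma emeasure_unit_cell: "emeasure lborel (unit_cell :: (real^'n) set) = 1"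
proof (rule antisym)
  have one: "(1 :: real^'n) \<bullet> b = 1" "0 \<bullet> b \<le> (1 :: real^'n) \<bullet> b" if "b \<in> Basis" for b
    using that by (auto simp: Basis_vec_def inner_axis)
  have "emeasure lborel (unit_cell :: (real^'n) set) \<le> emeasure lborel (cbox 0 (1 :: real^'n))"
    by (intro emeasure_mono unit_cell_subset_cbox) auto
  also have "\<dots> = 1" by (subst emeasure_lborel_cbox) (use one in auto)
  finally show "emeasure lborel (unit_cell :: (real^'n) set) \<le> 1" .
  have "1 = emeasure lborel (box 0 (1 :: real^'n))"
    by (subst emeasure_lborel_box) (use one in auto)
  also have "\<dots> \<le> emeasure lborel (unit_cell :: (real^'n) set)"
    by (intro emeasure_mono) (auto simp: unit_cell_def mem_box_cart less_imp_le)
  finally show "1 \<le> emeasure lborel (unit_cell :: (real^'n) set)" .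
qed

text \<open>Lebesgue measure on the torus and on \<open>(a, b)\<close> times the torus, as measures on the whole
  space that are concentrated on the fundamental cell.\<close>

definition cellM :: "(real^'n) measure" where
  "cellM = density lborel (indicator unit_cell)"

definition timeM :: "real \<Rightarrow> real \<Rightarrow> real measure" where
  "timeM a b = density lborel (indicator {a<..<b})"

definition cylM :: "real \<Rightarrow> real \<Rightarrow> (real \<times> (real^'n)) measure" where
  "cylM a b = timeM a b \<Otimes>\<^sub>M cellM"

lemma sets_cellM [simp, measurable_cong]: "sets cellM = sets borel"
  and space_cellM [simp]: "space cellM = UNIV"
  and sets_timeM [simp, measurable_cong]: "sets (timeM a b) = sets borel"
  and space_timeM [simp]: "space (timeM a b) = UNIV"
  by (simp_all add: cellM_def timeM_def)

lemma sets_cylM [simp, measurable_cong]: "sets (cylM a b) = sets borel"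
  unfolding cylM_def borel_prod[symmetric] by (intro sets_pair_measure_cong) simp_all

lemma space_cylM [simp]: "space (cylM a b) = UNIV"
  by (simp add: cylM_def space_pair_measure)

lemma prob_cellM: "emeasure cellM UNIV = 1"
  by (simp add: cellM_def emeasure_density emeasure_unit_cell)

lemma finite_cellM: "finite_measure cellM"
  by (rule finite_measureI) (simp add: prob_cellM)

lemma emeasure_timeM: "a \<le> b \<Longrightarrow> emeasure (timeM a b) UNIV = ennreal (b - a)"
  by (simp add: timeM_def emeasure_density)

lemma finite_timeM: "finite_measure (timeM a b)"
proof (cases "a \<le> b")
  case False
  then show ?thesis by (intro finite_measureI) (simp add: timeM_def emeasure_density)
qed (auto intro!: finite_measureI simp: emeasure_timeM)

interpretation cell: finite_measure cellM by (rule finite_cellM)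
interpretation time: finite_measure "timeM a b" for a b by (rule finite_timeM)
interpretation cyl: pair_sigma_finite "timeM a b" cellM for a b ..
interpretation cyl2: pair_sigma_finite cellM "timeM a b" for a b ..

lemma emeasure_cylM_Times:
  "emeasure (cylM a b :: (real \<times> (real^'n)) measure) UNIV
    = emeasure (timeM a b) UNIV * emeasure (cellM :: (real^'n) measure) UNIV"
  unfolding cylM_def
  by (subst UNIV_Times_UNIV[symmetric], rule cell.emeasure_pair_measure_Times) auto

lemma emeasure_cylM: "a \<le> b \<Longrightarrow> emeasure (cylM a b) UNIV = ennreal (b - a)"
  by (simp add: emeasure_cylM_Times prob_cellM emeasure_timeM)

lemma finite_cylM: "finite_measure (cylM a b :: (real \<times> (real^'n)) measure)"
proof (rule finite_measureI)
  show "emeasure (cylM a b) (space (cylM a b :: (real \<times> (real^'n)) measure)) \<noteq> \<infinity>"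
    by (simp add: emeasure_cylM_Times prob_cellM time.emeasure_finite)
qed

interpretation cylinder: finite_measure "cylM a b" for a b by (rule finite_cylM)

lemma cylM_density:
  "cylM a b = density lborel (indicator ({a<..<b} \<times> (unit_cell :: (real^'n) set)))"
proof -
  have "sigma_finite_measure (density lborel (indicator unit_cell :: real^'n \<Rightarrow> ennreal))"
    using cell.sigma_finite_measure_axioms unfolding cellM_def .
  then show ?thesis
    unfolding cylM_def timeM_def cellM_def
    by (subst pair_measure_density)
      (auto simp: lborel_prod lborel.sigma_finite_measure_axioms indicator_def
        intro!: arg_cong[where f = "density lborel"])
qed

lemma layer_borel [measurable]: "{a<..<b :: real} \<times> (unit_cell :: (real^'n) set) \<in> sets borel"
proof -
  have "{a<..<b} \<times> (unit_cell :: (real^'n) set) \<in> sets (borel \<Otimes>\<^sub>M borel)" by (intro pair_measureI) auto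
  then show ?thesis by (simp only: borel_prod)
qed

lemma cylinder_borel [measurable]: "(cylinder T :: (real \<times> (real^'n)) set) \<in> sets borel"
  unfolding cylinder_def by simp

lemma set_integral_cell:
  fixes g :: "real^'n \<Rightarrow> real"
  assumes "g \<in> borel_measurable borel"
  shows "(LINT x:unit_cell|lborel. g x) = (LINT x|cellM. (g x :: real))"
proof -
  have eq: "cellM = density lborel (\<lambda>x :: real^'n. ennreal (indicator unit_cell x))"
    by (simp add: cellM_def ennreal_indicator)
  show ?thesis
    unfolding set_lebesgue_integral_def eq using assms by (subst integral_density) auto
qed

lemma set_integral_cylinder:
  fixes g :: "real \<times> (real^'n) \<Rightarrow> real"
  assumes "g \<in> borel_measurable borel"
  shows "(LINT z:cylinder T|lborel. g z) = (LINT z|cylM 0 T. (g z :: real))"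
proof -
  have "cylM 0 T = density lborel (\<lambda>x :: real \<times> (real^'n). ennreal (indicator (cylinder T) x))"
    by (simp add: cylM_density ennreal_indicator cylinder_def)
  then show ?thesis
    unfolding set_lebesgue_integral_def using assms by (simp add: integral_density)
qed

lemma AE_cylM: "AE z in cylM a b. z \<in> {a<..<b} \<times> unit_cell"
  unfolding cylM_density by (subst AE_density) (auto simp: indicator_def split: if_splits)

lemma lborel_integral_shift:
  fixes g :: "'a::euclidean_space \<Rightarrow> real"
  assumes "g \<in> borel_measurable borel"
  shows "(LINT x|lborel. g (x + c)) = (LINT x|lborel. g x)"
proof -
  have "(LINT x|lborel. g x) = (LINT x|distr lborel borel ((+) c). g x)"
    by (simp add: lborel_distr_plus)
  also have "\<dots> = (LINT x|lborel. g (c + x))"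
    using assms by (subst integral_distr) auto
  finally show ?thesis by (simp add: add.commute)
qed

text \<open>Translating by a fraction of a period along one axis cuts the cell into two pieces, which
  are reassembled to the cell after moving one of them by a full period.\<close>

lemma cell_integral_shift_axis:
  fixes g :: "real^'n \<Rightarrow> real"
  assumes g: "periodic g" "g \<in> borel_measurable borel" "\<And>x. \<bar>g x\<bar> \<le> B" and h: "0 \<le> h" "h < 1"
  shows "(LINT x|cellM. g (x + axis i h)) = (LINT x|cellM. g x)"
proof -
  note [measurable] = g(2)
  define A where "A = unit_cell \<inter> {x :: real^'n. h \<le> x $ i}"
  define A' where "A' = unit_cell \<inter> {x :: real^'n. x $ i < h}"
  have [measurable]: "A \<in> sets borel" "A' \<in> sets borel"
    unfolding A_def A'_def
    by (intro sets.Int unit_cell_borel borel_closed borel_open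
        closed_halfspace_component_ge_cart open_halfspace_component_lt_cart)+
  have int: "integrable lborel (\<lambda>x. indicator S x * g x)"
    if "S \<in> sets borel" "S \<subseteq> unit_cell" for S :: "(real^'n) set"
  proof (rule Bochner_Integration.integrable_bound[of lborel "\<lambda>x. B * indicator unit_cell x"])
    show "integrable lborel (\<lambda>x. B * indicator (unit_cell :: (real^'n) set) x)"
      by (intro integrable_mult_right integrable_real_indicator) (simp_all add: emeasure_unit_cell)
    have "\<bar>g x\<bar> \<le> \<bar>B\<bar>" for x using g(3)[of x] by linarith
    then show "AE x in lborel. norm (indicator S x * g x) \<le> norm (B * indicator unit_cell x)"
      using that(2) by (intro AE_I2) (auto simp: indicator_def)
  qed (use that in auto)
  have ind: "indicator unit_cell (x - axis i h)
      = (indicator A x + indicator A' (x - axis i 1) :: real)" for x :: "real^'n"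
  proof -
    define Q where "Q = (\<forall>j. j \<noteq> i \<longrightarrow> 0 \<le> x $ j \<and> x $ j < 1)"
    have split: "y \<in> unit_cell \<longleftrightarrow> Q \<and> 0 \<le> y $ i \<and> y $ i < 1"
      if "\<And>j. j \<noteq> i \<Longrightarrow> y $ j = x $ j" for y
    proof
      assume "y \<in> unit_cell"
      then have L: "0 \<le> y $ j \<and> y $ j < 1" for j by (simp add: unit_cell_def)
      have Q unfolding Q_def using L that by metis
      then show "Q \<and> 0 \<le> y $ i \<and> y $ i < 1" using L[of i] by simp
    next
      assume R: "Q \<and> 0 \<le> y $ i \<and> y $ i < 1"
      have "0 \<le> y $ j \<and> y $ j < 1" for j
        using R that[of j] unfolding Q_def by (cases "j = i") simp_all
      then show "y \<in> unit_cell" by (simp add: unit_cell_def)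
    qed
    have "x - axis i h \<in> unit_cell \<longleftrightarrow> Q \<and> h \<le> x $ i \<and> x $ i < 1 + h"
      by (subst split) (auto simp: axis_def)
    moreover have "x \<in> A \<longleftrightarrow> Q \<and> h \<le> x $ i \<and> x $ i < 1"
      unfolding A_def Int_iff by (subst split) (use h in auto)
    moreover have "x - axis i 1 \<in> A' \<longleftrightarrow> Q \<and> 1 \<le> x $ i \<and> x $ i < 1 + h"
      unfolding A'_def Int_iff by (subst split) (use h in \<open>auto simp: axis_def\<close>)
    ultimately show ?thesis using h unfolding indicator_def by auto
  qed
  have cell: "(LINT x|cellM. u x) = (LINT x|lborel. indicator unit_cell x * u x)"
    if "u \<in> borel_measurable borel" for u :: "real^'n \<Rightarrow> real"
    using that by (simp add: set_integral_cell[symmetric] set_lebesgue_integral_def)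
  have g1: "g (x - axis i 1) = g x" for x
    using periodic_minus[OF g(1) int_lattice_axis[of i 1]] by simp
  have A': "(LINT x|lborel. indicator A' (x - axis i 1) * g x) = (LINT x|lborel. indicator A' x * g x)"
    using lborel_integral_shift[of "\<lambda>x. indicator A' x * g x" "- axis i 1"] by (simp add: g1)
  have iA': "integrable lborel (\<lambda>x. indicator A' (x - axis i 1) * g x)"
  proof -
    have "integrable (distr lborel borel ((+) (- axis i 1))) (\<lambda>x. indicator A' x * g x)"
      using int[of A'] by (simp add: lborel_distr_plus A'_def)
    then have "integrable lborel (\<lambda>x. indicator A' (- axis i 1 + x) * g (- axis i 1 + x))"
      by (subst (asm) integrable_distr_eq) simp_all
    then show ?thesis by (simp add: g1)
  qed
  have "(LINT x|cellM. g (x + axis i h)) = (LINT x|lborel. indicator unit_cell x * g (x + axis i h))"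
    by (rule cell) measurable
  also have "\<dots> = (LINT x|lborel. indicator unit_cell (x - axis i h) * g x)"
    using lborel_integral_shift[of "\<lambda>x. indicator unit_cell (x - axis i h) * g x" "axis i h"]
    by simp
  also have "\<dots> = (LINT x|lborel. indicator A x * g x + indicator A' (x - axis i 1) * g x)"
    by (simp add: ind distrib_right)
  also have "\<dots> = (LINT x|lborel. indicator A x * g x) + (LINT x|lborel. indicator A' x * g x)"
    using int[of A] iA' A' by (subst Bochner_Integration.integral_add) (auto simp: A_def)
  also have "\<dots> = (LINT x|lborel. indicator A x * g x + indicator A' x * g x)"
    using int[of A] int[of A'] by (subst Bochner_Integration.integral_add) (auto simp: A_def A'_def)
  also have "\<dots> = (LINT x|lborel. indicator unit_cell x * g x)"
    by (intro Bochner_Integration.integral_cong) (auto simp: A_def A'_def indicator_def)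
  also have "\<dots> = (LINT x|cellM. g x)"
    by (rule cell[symmetric]) measurable
  finally show ?thesis .
qed

text \<open>The shift is carried out one coordinate at a time; along each axis its integral part is absorbed by
  periodicity.\<close>

lemma cell_integral_shift:
  fixes g :: "real^'n \<Rightarrow> real"
  assumes g: "periodic g" "g \<in> borel_measurable borel" "\<And>x. \<bar>g x\<bar> \<le> B"
  shows "(LINT x|cellM. g (x + v)) = (LINT x|cellM. g x)"
proof -
  have "(LINT x|cellM. g (x + (\<Sum>i\<in>I. axis i (v $ i)))) = (LINT x|cellM. g x)" if "finite I" for I
    using that
  proof (induction I rule: finite_induct)
    case (insert i I)
    let ?w = "\<Sum>i\<in>I. axis i (v $ i)" and ?h = "frac (v $ i)"
    define u where "u = (\<lambda>x. g (x + ?w))"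
    note [measurable] = g(2)
    have "periodic u" unfolding u_def by (rule periodic_shift[OF g(1)])
    moreover have "u \<in> borel_measurable borel" unfolding u_def by measurable
    ultimately have u: "periodic u" "u \<in> borel_measurable borel" "\<bar>u x\<bar> \<le> B" for x
      using g(3) unfolding u_def by blast+
    have "axis i (v $ i) = axis i ?h + axis i (of_int \<lfloor>v $ i\<rfloor>)"
      by (simp add: frac_def axis_def vec_eq_iff)
    then have "u (x + axis i (v $ i)) = u (x + axis i ?h)" for x
      using u(1) int_lattice_axis[of i "\<lfloor>v $ i\<rfloor>"] unfolding periodic_def by (metis add.assoc)
    then have "(LINT x|cellM. u (x + axis i (v $ i))) = (LINT x|cellM. u x)"
      using cell_integral_shift_axis[OF u, of ?h i] by (simp add: frac_lt_1)
    then have "(LINT x|cellM. g (x + (axis i (v $ i) + ?w))) = (LINT x|cellM. g (x + ?w))"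
      by (simp add: u_def add.assoc)
    then show ?case using insert by simp
  qed simp
  moreover have "(\<Sum>i\<in>UNIV. axis i (v $ i)) = v"
    by (simp add: vec_eq_iff axis_def)
  ultimately show ?thesis using finite_class.finite_UNIV by metis
qed

text \<open>Continuous periodic functions are bounded and uniformly continuous, because the closed
  cell is compact; so are functions on time-space with compact time support.\<close>

lemma periodic_bounded:
  fixes g :: "real^'n \<Rightarrow> 'b::real_normed_vector"
  assumes "periodic g" "continuous_on UNIV g"
  obtains B where "0 \<le> B" "\<And>x. norm (g x) \<le> B"
proof -
  have "compact (g ` cbox 0 1)"
    by (intro compact_continuous_image compact_cbox continuous_on_subset[OF assms(2)]) simp
  from compact_imp_bounded[OF this]
  obtain B where B: "\<And>y. y \<in> g ` cbox 0 1 \<Longrightarrow> norm y \<le> B"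
    unfolding bounded_iff by blast
  have "norm (g x) \<le> B" for x
  proof -
    obtain k where k: "k \<in> int_lattice" "x - k \<in> unit_cell" by (rule cell_representative)
    then have "norm (g (x - k)) \<le> B" using B unit_cell_subset_cbox by blast
    then show ?thesis by (simp add: periodic_minus[OF assms(1) k(1)])
  qed
  moreover from this[of 0] have "0 \<le> B" by (rule order_trans[OF norm_ge_zero])
  ultimately show ?thesis using that[of B] by simp
qed

lemma slab_periodic_bounded:
  fixes g :: "real \<times> (real^'n) \<Rightarrow> 'b::real_normed_vector"
  assumes "\<And>t. t \<in> {a..b} \<Longrightarrow> periodic (\<lambda>x. g (t, x))" "continuous_on ({a..b} \<times> UNIV) g"
  obtains B where "0 \<le> B" "\<And>t x. t \<in> {a..b} \<Longrightarrow> norm (g (t, x)) \<le> B"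
proof -
  have "compact (g ` ({a..b} \<times> cbox 0 1))"
    by (intro compact_continuous_image compact_Times compact_cbox compact_Icc
        continuous_on_subset[OF assms(2)]) auto
  from compact_imp_bounded[OF this]
  obtain B where B: "\<And>y. y \<in> g ` ({a..b} \<times> cbox 0 1) \<Longrightarrow> norm y \<le> B"
    unfolding bounded_iff by blast
  have "norm (g (t, x)) \<le> max B 0" if "t \<in> {a..b}" for t x
  proof -
    obtain k where k: "k \<in> int_lattice" "x - k \<in> unit_cell" by (rule cell_representative)
    then have "(t, x - k) \<in> {a..b} \<times> cbox 0 1" using that unit_cell_subset_cbox by auto
    then have "norm (g (t, x - k)) \<le> B" using B by blast
    then show ?thesis using periodic_minus[OF assms(1)[OF that] k(1)] by simp
  qed
  then show ?thesis using that[of "max B 0"] by auto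
qed

lemma cell_neighbour_in_box:
  fixes x k :: "real^'n"
  assumes "x - k \<in> unit_cell"
  shows "x - k \<in> cbox (- 1) 2" "(\<And>i. \<bar>y $ i - x $ i\<bar> < 1) \<Longrightarrow> y - k \<in> cbox (- 1) 2"
proof -
  have *: "0 \<le> x $ i - k $ i" "x $ i - k $ i < 1" for i
    using assms by (auto simp: unit_cell_def)
  show "x - k \<in> cbox (- 1) 2"
    unfolding mem_box_cart
  proof
    fix i show "(- 1) $ i \<le> (x - k) $ i \<and> (x - k) $ i \<le> 2 $ i" using *[of i] by simp
  qed
  assume y: "\<And>i. \<bar>y $ i - x $ i\<bar> < 1"
  show "y - k \<in> cbox (- 1) 2"
    unfolding mem_box_cart
  proof
    fix i show "(- 1) $ i \<le> (y - k) $ i \<and> (y - k) $ i \<le> 2 $ i"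
      using *[of i] y[of i] by (simp add: abs_less_iff)
  qed
qed

lemma periodic_uniformly_continuous:
  fixes g :: "real \<times> (real^'n) \<Rightarrow> 'b::real_normed_vector"
  assumes per: "\<And>t. periodic (\<lambda>x. g (t, x))" and cont: "continuous_on UNIV g"
    and supp: "\<And>t x. t \<notin> {a..b} \<Longrightarrow> g (t, x) = 0"
  shows "uniformly_continuous_on UNIV g"
  unfolding uniformly_continuous_on_def
proof (intro allI impI)
  fix e :: real assume "e > 0"
  let ?K = "{a - 1..b + 1} \<times> cbox (- 1) (2 :: real^'n)"
  have "uniformly_continuous_on ?K g"
    by (intro compact_uniformly_continuous compact_Times compact_cbox compact_Icc
        continuous_on_subset[OF cont]) auto
  then obtain d where d: "d > 0" "\<And>z z'. z \<in> ?K \<Longrightarrow> z' \<in> ?K \<Longrightarrow> dist z' z < d \<Longrightarrow> dist (g z') (g z) < e"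
    using \<open>e > 0\<close> unfolding uniformly_continuous_on_def by metis
  show "\<exists>d>0. \<forall>z\<in>UNIV. \<forall>z'\<in>UNIV. dist z' z < d \<longrightarrow> dist (g z') (g z) < e"
  proof (intro exI[of _ "min d 1"] conjI ballI impI)
    fix z z' :: "real \<times> (real^'n)" assume *: "dist z' z < min d 1"
    obtain t x t' x' where z: "z = (t, x)" "z' = (t', x')" by (cases z, cases z') auto
    obtain k where k: "k \<in> int_lattice" "x - k \<in> unit_cell" by (rule cell_representative)
    have t: "\<bar>t' - t\<bar> < 1" and x: "norm (x' - x) < 1"
      using * dist_fst_le[of z' z] dist_snd_le[of z' z] unfolding z dist_norm by auto
    have "\<bar>(x' - x) $ i\<bar> < 1" for i using component_le_norm_cart[of "x' - x" i] x by linarith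
    then have "\<bar>x' $ i - x $ i\<bar> < 1" for i by simp
    then have xk: "x - k \<in> cbox (- 1) 2" "x' - k \<in> cbox (- 1) 2"
      using cell_neighbour_in_box[OF k(2)] by auto
    have gk: "g (t, x) = g (t, x - k)" "g (t', x') = g (t', x' - k)"
      using periodic_minus[OF per k(1), of t x] periodic_minus[OF per k(1), of t' x'] by simp_all
    show "dist (g z') (g z) < e"
    proof (cases "t \<in> {a..b} \<or> t' \<in> {a..b}")
      case True
      then have "(t, x - k) \<in> ?K" "(t', x' - k) \<in> ?K" using t xk by (auto simp: abs_less_iff)
      moreover have "dist (t', x' - k) (t, x - k) < d"
        using * by (simp add: z dist_Pair_Pair dist_norm)
      ultimately show ?thesis using d(2) by (simp add: z gk)
    next
      case False
      then show ?thesis using supp \<open>e > 0\<close> by (simp add: z)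
    qed
  qed (use d in auto)
qed

lemma periodic_uniform:
  fixes g :: "real^'n \<Rightarrow> 'b::real_normed_vector"
  assumes per: "periodic g" and cont: "continuous_on UNIV g" and "e > 0"
  obtains d where "d > 0" "\<And>x y k. k \<in> int_lattice \<Longrightarrow> norm (x - y - k) < d \<Longrightarrow> norm (g x - g y) < e"
proof -
  let ?K = "cbox (- 1) (2 :: real^'n)"
  have "uniformly_continuous_on ?K g"
    by (intro compact_uniformly_continuous compact_cbox continuous_on_subset[OF cont]) auto
  then obtain d where d: "d > 0" "\<And>z z'. z \<in> ?K \<Longrightarrow> z' \<in> ?K \<Longrightarrow> dist z' z < d \<Longrightarrow> dist (g z') (g z) < e"
    using \<open>e > 0\<close> unfolding uniformly_continuous_on_def by metis
  have "norm (g x - g y) < e" if l: "l \<in> int_lattice" "norm (x - y - l) < min d 1" for x y l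
  proof -
    obtain k where k: "k \<in> int_lattice" "y - k \<in> unit_cell" by (rule cell_representative)
    have "\<bar>(x - l) $ i - y $ i\<bar> < 1" for i
      using component_le_norm_cart[of "x - y - l" i] l by (simp add: algebra_simps)
    then have xk: "y - k \<in> ?K" "x - l - k \<in> ?K"
      using cell_neighbour_in_box[OF k(2)] by auto
    have "dist (g (x - l - k)) (g (y - k)) < e"
      by (rule d(2)[OF xk]) (use l in \<open>simp add: dist_norm algebra_simps\<close>)
    then show ?thesis
      by (simp add: periodic_minus[OF per k(1)] periodic_minus[OF per l(1)] dist_norm)
  qed
  then show ?thesis using that[of "min d 1"] d(1) by auto
qed

section \<open>Mollifiers\<close>

subsection \<open>The kernel in time\<close>

text \<open>The support lies strictly inside the unit interval.  A kernel built from it looks strictly forward in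
  time, and its reach stays strictly below the scale, so that the kernel centred at any time in
  \<open>[0, T]\<close> is a test function on \<open>(0, T + 1)\<close>.\<close>

definition bump_profile :: "real \<Rightarrow> real" where
  "bump_profile s = flat 0 (4 * s - 1) * flat 0 (3 - 4 * s)"

definition bump_mass :: real where
  "bump_mass = (LINT s|lborel. bump_profile s)"

definition time_bump :: "real \<Rightarrow> real \<Rightarrow> real" where
  "time_bump N s = N * bump_profile (N * s) / bump_mass"

lemma bump_profile_support: "bump_profile s \<noteq> 0 \<Longrightarrow> 1/4 \<le> s \<and> s \<le> 3/4"
  using flat_zero[of "4 * s - 1" 0] flat_zero[of "3 - 4 * s" 0]
  unfolding bump_profile_def by (cases "4 * s - 1 \<le> 0"; cases "3 - 4 * s \<le> 0") auto

lemma bump_profile_nonneg: "0 \<le> bump_profile s" and bump_profile_le_1: "bump_profile s \<le> 1"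
  unfolding bump_profile_def
  using mult_le_one[OF flat_0_le_1 flat_nonneg flat_0_le_1, of "4 * s - 1" "3 - 4 * s"]
  by (simp_all add: flat_nonneg)

lemma smooth_affine: "smooth (\<lambda>s :: real. a * s + b)"
  using smooth_add[OF smooth_mult[OF smooth_const[of a] smooth_linear[of "1 :: real"]] smooth_const[of b]]
  by simp

lemma smooth_bump_profile: "smooth bump_profile"
proof -
  have "smooth (\<lambda>s. flat 0 (4 * s + (- 1)) * flat 0 ((- 4) * s + 3))"
    by (intro smooth_mult smooth_compose[OF smooth_flat] smooth_affine)
  moreover have "bump_profile = (\<lambda>s. flat 0 (4 * s + (- 1)) * flat 0 ((- 4) * s + 3))"
    by (rule ext) (simp add: bump_profile_def)
  ultimately show ?thesis by simp
qed

lemma smooth_borel: "smooth g \<Longrightarrow> g \<in> borel_measurable borel"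
  by (intro borel_measurable_continuous_onI smooth_continuous_on)

lemma integrable_bump_profile: "integrable lborel bump_profile"
proof (rule Bochner_Integration.integrable_bound[of lborel "indicator {1/4..3/4 :: real} :: real \<Rightarrow> real"])
  show "AE s in lborel. norm (bump_profile s) \<le> norm (indicator {1/4..3/4} s :: real)"
  proof (rule AE_I2)
    fix s
    show "norm (bump_profile s) \<le> norm (indicator {1/4..3/4} s :: real)"
      using bump_profile_support[of s] bump_profile_nonneg[of s] bump_profile_le_1[of s]
      by (cases "bump_profile s = 0") (simp_all add: indicator_def)
  qed
  show "integrable lborel (indicator {1/4..3/4 :: real} :: real \<Rightarrow> real)"
    by (intro integrable_real_indicator emeasure_bounded_finite) auto
qed (simp add: smooth_borel[OF smooth_bump_profile])

lemma bump_mass_pos: "0 < bump_mass"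
proof -
  have "0 \<le> bump_mass" unfolding bump_mass_def by (simp add: bump_profile_nonneg)
  moreover have "bump_mass \<noteq> 0"
  proof
    assume "bump_mass = 0"
    then have "AE s in lborel. bump_profile s = 0"
      unfolding bump_mass_def
      by (subst (asm) integral_nonneg_eq_0_iff_AE) (auto simp: integrable_bump_profile bump_profile_nonneg)
    moreover have "bump_profile s > 0" if "s \<in> {1/4<..<3/4}" for s
      using that by (simp add: bump_profile_def flat_pos)
    ultimately have "AE s in lborel. s \<notin> {1/4<..<3/4 :: real}"
      by (auto elim!: eventually_mono) force
    then have "emeasure lborel {1/4<..<3/4 :: real} = 0"
      by (subst (asm) AE_iff_measurable[of "{1/4<..<3/4 :: real}"]) auto
    then show False by simp
  qed
  ultimately show ?thesis by simp
qed

lemma smooth_time_bump: "smooth (time_bump N)"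
proof -
  have "smooth (\<lambda>s. (N / bump_mass) * bump_profile (N * s + 0))"
    by (intro smooth_mult smooth_const smooth_compose[OF smooth_bump_profile] smooth_affine)
  then show ?thesis by (simp add: time_bump_def[abs_def])
qed

lemma time_bump_nonneg: "0 \<le> N \<Longrightarrow> 0 \<le> time_bump N s"
  and time_bump_bound: "0 \<le> N \<Longrightarrow> time_bump N s \<le> N / bump_mass"
  using bump_mass_pos bump_profile_nonneg bump_profile_le_1
  by (simp_all add: time_bump_def divide_right_mono mult_left_le)

lemma time_bump_support:
  assumes "0 < N" "time_bump N s \<noteq> 0"
  shows "1 / (4 * N) \<le> s \<and> s \<le> 3 / (4 * N)" "0 < s" "s < 1 / N"
proof -
  have "1/4 \<le> N * s \<and> N * s \<le> 3/4"
    using assms bump_profile_support unfolding time_bump_def by force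
  then show *: "1 / (4 * N) \<le> s \<and> s \<le> 3 / (4 * N)" using assms by (simp add: field_simps)
  moreover have "0 < 1 / (4 * N)" "3 / (4 * N) < 1 / N" using assms by (simp_all add: field_simps)
  ultimately show "0 < s" "s < 1 / N" by linarith+
qed

lemma integrable_time_bump: "0 < N \<Longrightarrow> integrable lborel (time_bump N)"
  using lborel_integrable_real_affine[OF integrable_bump_profile, of N 0]
  by (simp add: time_bump_def[abs_def])

lemma integral_time_bump: assumes "0 < N" shows "(LINT s|lborel. time_bump N (s - t)) = 1"
proof -
  have "(LINT s|lborel. time_bump N (s - t)) = (LINT s|lborel. time_bump N s)"
    using lborel_integral_shift[of "time_bump N" "- t"] smooth_borel[OF smooth_time_bump] by simp
  also have "\<dots> = (N / bump_mass) * (LINT s|lborel. bump_profile (0 + N * s))"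
    by (simp add: time_bump_def)
  also have "\<dots> = 1"
    using lborel_integral_real_affine[of N bump_profile 0] assms bump_mass_pos
    by (simp add: bump_mass_def[symmetric])
  finally show ?thesis .
qed

subsection \<open>The kernel on the torus\<close>

text \<open>The function \<open>sin (pi * t)\<close> squared is periodic and vanishes exactly at the integers, so
  composing with it turns a bump on the line into a smooth bump on the circle.\<close>

definition circle_bump :: "real \<Rightarrow> real \<Rightarrow> real" where
  "circle_bump N t = flat 0 (1 - N\<^sup>2 * (sin (pi * t))\<^sup>2)"

definition torus_profile :: "real \<Rightarrow> real^'n \<Rightarrow> real" where
  "torus_profile N x = (\<Prod>i\<in>UNIV. circle_bump N (x $ i))"

definition space_bump :: "real \<Rightarrow> real^'n \<Rightarrow> real" where
  "space_bump N x = torus_profile N x / (LINT y|cellM. torus_profile N (y :: real^'n))"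

lemma sin_pi_shift: "m \<in> \<int> \<Longrightarrow> (sin (pi * (t + m)))\<^sup>2 = (sin (pi * t))\<^sup>2"
proof (elim Ints_cases)
  fix j :: int assume "m = of_int j"
  then show ?thesis
    using cos_npi_int[of j] sin_npi_int[of j] by (simp add: distrib_left sin_add power_mult_distrib)
qed

text \<open>A crude lower bound for the sine turns smallness of \<open>sin (pi * t)\<close> into closeness of \<open>t\<close> to an
  integer.\<close>

lemma abs_sin_lower:
  assumes "\<bar>y\<bar> \<le> pi / 2" shows "\<bar>y\<bar> / 4 \<le> \<bar>sin y\<bar>"
proof -
  have pos: "y / 4 \<le> sin y" if y: "0 \<le> y" "y \<le> pi / 2" for y :: real
  proof (cases "y \<le> pi / 3")
    case True
    have "(\<lambda>s. sin s - s / 4) 0 \<le> (\<lambda>s. sin s - s / 4) y"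
    proof (rule DERIV_nonneg_imp_nondecreasing[OF y(1)])
      fix x assume x: "0 \<le> x" "x \<le> y"
      then have "cos (pi / 3) \<le> cos x" using True by (intro cos_monotone_0_pi_le) auto
      then show "\<exists>D. ((\<lambda>s. sin s - s / 4) has_real_derivative D) (at x) \<and> 0 \<le> D"
        by (intro exI[of _ "cos x - 1 / 4"]) (auto intro!: derivative_eq_intros simp: cos_60)
    qed
    then show ?thesis by simp
  next
    case False
    then have "sin (pi / 6) \<le> sin y" using y by (intro sin_monotone_2pi_le) auto
    then show ?thesis using y pi_less_4 by (simp add: sin_30)
  qed
  show ?thesis
  proof (cases "0 \<le> y")
    case True
    have "\<bar>y\<bar> / 4 \<le> sin y" using pos[of y] True assms by simp
    then show ?thesis by linarith
  next
    case False
    have "\<bar>y\<bar> / 4 \<le> - sin y" using pos[of "- y"] False assms by simp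
    then show ?thesis by linarith
  qed
qed

lemma smooth_torus_profile: "smooth (torus_profile N :: real^'n \<Rightarrow> real)"
proof -
  have lin: "smooth (\<lambda>x :: real^'n. x $ i)" for i
    using smooth_linear[of "axis i 1 :: real^'n"] by (simp add: inner_axis)
  have s: "smooth (\<lambda>x :: real^'n. sin (pi * x $ i))" for i
    by (intro smooth_compose[OF smooth_sin] smooth_mult smooth_const lin)
  have "smooth (\<lambda>x :: real^'n. \<Prod>i\<in>UNIV. flat 0 (1 + (- (N\<^sup>2)) * (sin (pi * x $ i) * sin (pi * x $ i))))"
    by (intro smooth_prod finite smooth_compose[OF smooth_flat] smooth_add smooth_mult smooth_const s)
  then show ?thesis by (simp add: torus_profile_def[abs_def] circle_bump_def power2_eq_square)
qed

lemma torus_profile_nonneg: "0 \<le> torus_profile N x" and torus_profile_le_1: "torus_profile N x \<le> 1"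
  unfolding torus_profile_def circle_bump_def
  by (auto intro!: prod_nonneg prod_le_1 simp: flat_nonneg flat_0_le_1)

lemma circle_bump_support:
  assumes "0 < N" "circle_bump N t \<noteq> 0" shows "\<bar>t - of_int (round t)\<bar> \<le> 2 / N"
proof -
  let ?u = "t - of_int (round t)"
  have "(sin (pi * ?u))\<^sup>2 = (sin (pi * t))\<^sup>2"
    using sin_pi_shift[of "- of_int (round t)" t] by simp
  moreover have "N\<^sup>2 * (sin (pi * t))\<^sup>2 < 1"
    using assms(2) flat_zero[of "1 - N\<^sup>2 * (sin (pi * t))\<^sup>2" 0] unfolding circle_bump_def by fastforce
  ultimately have "(N * \<bar>sin (pi * ?u)\<bar>)\<^sup>2 < 1\<^sup>2" by (simp add: power_mult_distrib)
  then have "N * \<bar>sin (pi * ?u)\<bar> < 1" by (rule power2_less_imp_less) simp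
  moreover have "\<bar>pi * ?u\<bar> / 4 \<le> \<bar>sin (pi * ?u)\<bar>"
    using of_int_round_abs_le[of t] by (intro abs_sin_lower) (simp add: abs_mult abs_minus_commute)
  moreover have "2 * \<bar>?u\<bar> \<le> pi * \<bar>?u\<bar>" using pi_ge_two by (intro mult_right_mono) auto
  ultimately have "2 * \<bar>?u\<bar> / 4 \<le> \<bar>sin (pi * ?u)\<bar>" "N * \<bar>sin (pi * ?u)\<bar> < 1"
    by (auto simp: abs_mult)
  then have "N * (2 * \<bar>?u\<bar> / 4) < 1"
    using assms(1) by (meson less_eq_real_def mult_left_mono order_le_less_trans)
  then show ?thesis using assms(1) by (simp add: field_simps)
qed

lemma torus_profile_support:
  fixes x :: "real^'n"
  assumes "0 < N" "torus_profile N x \<noteq> 0"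
  obtains k where "k \<in> int_lattice" "norm (x - k) \<le> 2 * real CARD('n) / N"
proof
  let ?k = "(\<chi> i. of_int (round (x $ i))) :: real^'n"
  show "?k \<in> int_lattice" by (simp add: int_lattice_def)
  have "circle_bump N (x $ i) \<noteq> 0" for i using assms(2) by (simp add: torus_profile_def)
  then have "norm (x - ?k) \<le> (\<Sum>i\<in>(UNIV :: 'n set). 2 / N)"
    using circle_bump_support[OF assms(1)]
    by (intro order_trans[OF norm_le_l1_cart] sum_mono) simp
  then show "norm (x - ?k) \<le> 2 * real CARD('n) / N" by (simp add: field_simps)
qed

lemma periodic_torus_profile: "periodic (torus_profile N)"
  unfolding periodic_def torus_profile_def circle_bump_def
  by (auto simp: sin_pi_shift int_lattice_def)

lemma torus_profile_even: "torus_profile N (- x) = torus_profile N x"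
  by (simp add: torus_profile_def circle_bump_def)

lemma integrable_torus_profile: "integrable cellM (torus_profile N)"
  by (rule cell.integrable_const_bound[of _ 1])
    (simp_all add: smooth_borel[OF smooth_torus_profile] torus_profile_le_1 torus_profile_nonneg
      cong: measurable_cong_sets)

text \<open>On a cube of side \<open>1 / (6 N)\<close> at the origin \<open>N |sin (pi t)| \<le> 2/3\<close> in each coordinate, so the
  argument of \<open>flat 0\<close> is at least one half there.\<close>

lemma torus_profile_mass:
  assumes "1 \<le> N"
  shows "flat 0 (1/2) ^ CARD('n) * (1 / (6 * N)) ^ CARD('n) \<le> (LINT y|cellM. torus_profile N (y :: real^'n))"
proof -
  let ?B = "cbox 0 (\<chi> i. 1 / (6 * N)) :: (real^'n) set"
  have N: "0 < N" "0 \<le> 1 / (6 * N)" "1 / (6 * N) < 1" using assms by (auto simp: field_simps)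
  have low: "flat 0 (1/2) \<le> circle_bump N t" if t: "0 \<le> t" "t \<le> 1 / (6 * N)" for t
  proof -
    have "\<bar>sin (pi * t)\<bar> \<le> \<bar>pi * t\<bar>" by (rule abs_sin_x_le_abs_x)
    also have "\<dots> \<le> 4 * (1 / (6 * N))" 
      using t pi_less_4 mult_mono[of pi 4 t "1 / (6 * N)"] by (simp add: abs_mult)
    finally have "N * \<bar>sin (pi * t)\<bar> \<le> 2 / 3" using N by (simp add: field_simps)
    then have "(N * \<bar>sin (pi * t)\<bar>)\<^sup>2 \<le> (2 / 3)\<^sup>2" using N by (intro power_mono) auto
    then have "N\<^sup>2 * (sin (pi * t))\<^sup>2 \<le> 4 / 9" by (simp add: power_mult_distrib power_divide)
    then have "1 / 2 \<le> 1 - N\<^sup>2 * (sin (pi * t))\<^sup>2" by linarith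
    then show ?thesis unfolding circle_bump_def by (rule flat_0_mono)
  qed
  have B: "?B \<subseteq> unit_cell"
  proof
    fix x assume "x \<in> ?B"
    then have "0 \<le> x $ i \<and> x $ i \<le> 1 / (6 * N)" for i by (simp add: mem_box_cart)
    then show "x \<in> unit_cell" unfolding unit_cell_def using N(3) by (auto intro: le_less_trans)
  qed
  have "emeasure cellM ?B = emeasure lborel ?B"
    unfolding cellM_def using B
    by (subst emeasure_density) (auto intro!: arg_cong[where f = "emeasure lborel"] simp: indicator_inter_arith[symmetric] Int_absorb1)
  also have "\<dots> = (\<Prod>b\<in>Basis. ((\<chi> i. 1 / (6 * N)) - 0) \<bullet> (b :: real^'n))"
    using N by (intro emeasure_lborel_cbox) (auto simp: Basis_vec_def inner_axis)
  also have "(\<Prod>b\<in>Basis. ((\<chi> i. 1 / (6 * N)) - 0) \<bullet> (b :: real^'n)) = (\<Prod>b\<in>(Basis :: (real^'n) set). 1 / (6 * N))"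
    by (intro prod.cong) (auto simp: Basis_vec_def inner_axis)
  finally have meas: "measure cellM ?B = (1 / (6 * N)) ^ CARD('n)"
    using N by (simp add: measure_def)
  have "flat 0 (1/2) ^ CARD('n) * (1 / (6 * N)) ^ CARD('n) = (LINT y|cellM. flat 0 (1/2) ^ CARD('n) * indicator ?B y)"
    by (simp add: meas)
  also have "\<dots> \<le> (LINT y|cellM. torus_profile N (y :: real^'n))"
  proof (rule Bochner_Integration.integral_mono)
    show "integrable cellM (\<lambda>y. flat 0 (1/2) ^ CARD('n) * indicator ?B y :: real)"
      by (intro integrable_mult_right integrable_real_indicator) (simp_all add: cell.emeasure_finite less_top[symmetric])
    fix y :: "real^'n"
    show "flat 0 (1/2) ^ CARD('n) * indicator ?B y \<le> torus_profile N y"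
    proof (cases "y \<in> ?B")
      case True
      then have "(\<Prod>i\<in>(UNIV :: 'n set). flat 0 (1/2)) \<le> torus_profile N y"
        unfolding torus_profile_def using low
        by (intro prod_mono) (auto simp: mem_box_cart flat_nonneg)
      then show ?thesis using True by simp
    qed (simp add: torus_profile_nonneg)
  qed (rule integrable_torus_profile)
  finally show ?thesis .
qed

lemma torus_profile_mass_pos: "1 \<le> N \<Longrightarrow> 0 < (LINT y|cellM. torus_profile N (y :: real^'n))"
  by (rule less_le_trans[OF _ torus_profile_mass]) (auto simp: flat_pos)

lemma smooth_space_bump: "smooth (space_bump N :: real^'n \<Rightarrow> real)"
  using smooth_mult[OF smooth_torus_profile smooth_const]
  unfolding space_bump_def[abs_def] divide_inverse .

lemma periodic_space_bump: "periodic (space_bump N)"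
  using periodic_torus_profile unfolding periodic_def space_bump_def by metis

lemma space_bump_even: "space_bump N (x - y) = space_bump N (y - x)"
  using torus_profile_even[of N "y - x"] by (simp add: space_bump_def)

lemma space_bump_nonneg: "1 \<le> N \<Longrightarrow> 0 \<le> space_bump N x"
  using torus_profile_mass_pos[of N] by (simp add: space_bump_def torus_profile_nonneg)

lemma space_bump_support:
  fixes x :: "real^'n"
  assumes "1 \<le> N" "space_bump N x \<noteq> 0"
  obtains k where "k \<in> int_lattice" "norm (x - k) \<le> 2 * real CARD('n) / N"
  using torus_profile_support[of N x] assms by (auto simp: space_bump_def)

text \<open>The normalised kernel has height of order \<open>N ^ d\<close>; together with the factor \<open>N\<close> from the kernel in
  time this is where the exponent \<open>d + 1\<close> of the commutator estimate comes from.\<close>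

lemma space_bump_bound:
  fixes x :: "real^'n"
  assumes "1 \<le> N"
  shows "space_bump N x \<le> (6 / flat 0 (1/2)) ^ CARD('n) * N ^ CARD('n)"
proof -
  have pos: "0 < flat 0 (1/2) ^ CARD('n) * (1 / (6 * N)) ^ CARD('n)"
    using assms by (auto simp: flat_pos)
  have "space_bump N x \<le> 1 / (LINT y|cellM. torus_profile N (y :: real^'n))"
    unfolding space_bump_def using torus_profile_mass_pos[OF assms, where 'n = 'n]
    by (intro divide_right_mono torus_profile_le_1) auto
  also have "\<dots> \<le> 1 / (flat 0 (1/2) ^ CARD('n) * (1 / (6 * N)) ^ CARD('n))"
    using torus_profile_mass[OF assms, where 'n = 'n] pos by (intro divide_left_mono) auto
  also have "\<dots> = (6 / flat 0 (1/2)) ^ CARD('n) * N ^ CARD('n)"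
    using assms flat_pos[of "1/2" 0] by (simp add: power_divide power_mult_distrib field_simps)
  finally show ?thesis .
qed

lemma space_bump_borel [measurable]: "space_bump N \<in> borel_measurable borel"
  by (rule smooth_borel[OF smooth_space_bump])

lemma time_bump_borel [measurable]: "time_bump N \<in> borel_measurable borel"
  by (rule smooth_borel[OF smooth_time_bump])

text \<open>The cell is not invariant under translations, but integrals of periodic functions over it are.\<close>

lemma integral_space_bump:
  assumes "1 \<le> N"
  shows "(LINT x|cellM. space_bump N (x - y :: real^'n)) = 1" "(LINT y|cellM. space_bump N (x - y :: real^'n)) = 1"
proof -
  have b: "\<bar>space_bump N x\<bar> \<le> (6 / flat 0 (1/2)) ^ CARD('n) * N ^ CARD('n)" for x :: "real^'n"
    using space_bump_bound[OF assms, of x] space_bump_nonneg[OF assms, of x] by simp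
  have *: "(LINT x|cellM. space_bump N (x - y :: real^'n)) = 1" for y
  proof -
    have "(LINT x|cellM. space_bump N (x + (- y))) = (LINT x|cellM. space_bump N (x :: real^'n))"
      by (rule cell_integral_shift[OF periodic_space_bump space_bump_borel b])
    also have "\<dots> = 1"
      using torus_profile_mass_pos[OF assms, where 'n = 'n] by (simp add: space_bump_def)
    finally show ?thesis by simp
  qed
  show "(LINT x|cellM. space_bump N (x - y :: real^'n)) = 1" by (rule *)
  show "(LINT y|cellM. space_bump N (x - y :: real^'n)) = 1"
    using *[of x] by (simp add: space_bump_even[of N x])
qed

subsection \<open>Gradients and convolutions\<close>

definition gradient :: "('a::euclidean_space \<Rightarrow> real) \<Rightarrow> 'a \<Rightarrow> 'a" where
  "gradient g z = (\<Sum>b\<in>Basis. partial_within UNIV b g z *\<^sub>R b)"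

lemma linear_functional_sum:
  fixes D :: "'a::euclidean_space \<Rightarrow> real"
  assumes "linear D" shows "D h = h \<bullet> (\<Sum>b\<in>Basis. D b *\<^sub>R b)"
proof -
  have "D h = D (\<Sum>b\<in>Basis. (h \<bullet> b) *\<^sub>R b)" by (simp add: euclidean_representation)
  also have "\<dots> = (\<Sum>b\<in>Basis. (h \<bullet> b) * D b)"
    using assms by (simp add: linear_sum linear_cmul)
  finally show ?thesis by (simp add: inner_sum_right mult.commute)
qed

lemma has_derivative_gradient:
  assumes "\<And>z. g differentiable (at z)"
  shows "(g has_derivative (\<lambda>h. h \<bullet> gradient g z)) (at z)"
proof -
  have D: "(g has_derivative (\<lambda>h. partial_within UNIV h g z)) (at z)"
    using assms[of z] unfolding partial_within_def by (simp add: frechet_derivative_works[symmetric])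
  have "linear (\<lambda>h. partial_within UNIV h g z)"
    using has_derivative_bounded_linear[OF D] by (rule bounded_linear.linear)
  then have "(\<lambda>h. partial_within UNIV h g z) = (\<lambda>h. h \<bullet> gradient g z)"
    unfolding gradient_def by (intro ext linear_functional_sum)
  then show ?thesis using D by simp
qed

lemma smooth_differentiable: "smooth g \<Longrightarrow> g differentiable (at z)"
  using smooth_has_derivative differentiable_def by blast

lemmas smooth_has_gradient = has_derivative_gradient[OF smooth_differentiable]

lemma gradient_inner_Basis: "b \<in> Basis \<Longrightarrow> b \<bullet> gradient g z = partial_within UNIV b g z"
  by (simp add: gradient_def inner_sum_right inner_Basis if_distrib sum.delta cong: if_cong)

lemma continuous_on_gradient: "smooth g \<Longrightarrow> continuous_on S (gradient g)"
  unfolding gradient_def[abs_def]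
  by (intro continuous_intros smooth_continuous_on smooth_partial)

lemma partial_translation_invariant:
  assumes "\<And>z. g differentiable (at z)" "\<And>z. g (z + c) = g z"
  shows "partial_within UNIV b g (z + c) = partial_within UNIV b g z"
proof -
  have D: "(g has_derivative (\<lambda>h. partial_within UNIV h g (z + c))) (at (z + c))"
    using assms(1) unfolding partial_within_def by (simp add: frechet_derivative_works[symmetric])
  have "((\<lambda>z. g (z + c)) has_derivative (\<lambda>h. partial_within UNIV h g (z + c))) (at z)"
    by (rule has_derivative_compose[of "\<lambda>z. z + c" "\<lambda>h. h", OF _ D]) (auto intro!: derivative_eq_intros)
  then have "(g has_derivative (\<lambda>h. partial_within UNIV h g (z + c))) (at z)"
    by (simp add: assms(2))
  then show ?thesis by (rule partial_within_UNIV[symmetric])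
qed

lemma partial_zero_on_open:
  assumes "open U" "z \<in> U" "\<And>z. z \<in> U \<Longrightarrow> g z = 0"
  shows "partial_within UNIV b g z = 0"
proof -
  have "(g has_derivative (\<lambda>h. 0)) (at z)"
    by (rule has_derivative_transform_within_open[OF has_derivative_const[of 0] assms(1,2)])
      (simp add: assms(3))
  then show ?thesis by (rule partial_within_UNIV)
qed

lemma gradient_periodic:
  fixes g :: "real \<times> (real^'n) \<Rightarrow> real"
  assumes "smooth g" "\<And>t. periodic (\<lambda>x. g (t, x))"
  shows "periodic (\<lambda>x. gradient g (t, x))"
  unfolding periodic_def
proof (intro allI ballI)
  fix x k :: "real^'n" assume k: "k \<in> int_lattice"
  have "g (z + (0, k)) = g z" for z
    using assms(2)[of "fst z"] k unfolding periodic_def by (cases z) simp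
  then have "partial_within UNIV b g ((t, x) + (0, k)) = partial_within UNIV b g (t, x)" for b
    by (intro partial_translation_invariant smooth_differentiable assms(1))
  then show "gradient g (t, x + k) = gradient g (t, x)" by (simp add: gradient_def)
qed

lemma gradient_zero_outside:
  fixes g :: "real \<times> 'b::euclidean_space \<Rightarrow> real"
  assumes "\<And>t x. t \<notin> {a..b} \<Longrightarrow> g (t, x) = 0" "t \<notin> {a..b}"
  shows "gradient g (t, x) = 0"
proof -
  have "open ((- {a..b}) \<times> (UNIV :: 'b set))" by (intro open_Times open_Compl) auto
  then have "partial_within UNIV c g (t, x) = 0" for c
    by (rule partial_zero_on_open) (use assms in auto)
  then show ?thesis by (simp add: gradient_def)
qed

lemma compact_time_support_bounds:
  fixes g :: "real \<times> (real^'n) \<Rightarrow> real"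
  assumes g: "smooth g" "\<And>t. periodic (\<lambda>x. g (t, x))" and supp: "\<And>t x. t \<notin> {a..b} \<Longrightarrow> g (t, x) = 0"
  obtains B where "\<And>z. \<bar>g z\<bar> \<le> B" "\<And>z. norm (gradient g z) \<le> B" "uniformly_continuous_on UNIV (gradient g)"
proof -
  obtain B1 where B1: "0 \<le> B1" "\<And>t x. t \<in> {a..b} \<Longrightarrow> norm (g (t, x)) \<le> B1"
    by (rule slab_periodic_bounded[of a b g]) (use g smooth_continuous_on in auto)
  obtain B2 where B2: "0 \<le> B2" "\<And>t x. t \<in> {a..b} \<Longrightarrow> norm (gradient g (t, x)) \<le> B2"
    by (rule slab_periodic_bounded[of a b "gradient g"])
      (use gradient_periodic[OF g] continuous_on_gradient[OF g(1)] in auto)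
  have z: "gradient g (t, x) = 0" if "t \<notin> {a..b}" for t x
    using gradient_zero_outside[of a b g, OF _ that] supp by blast
  show ?thesis
  proof (rule that[of "max B1 B2"])
    fix z :: "real \<times> (real^'n)"
    obtain t x where [simp]: "z = (t, x)" by (cases z)
    show "\<bar>g z\<bar> \<le> max B1 B2"
      using B1(2)[of t x] supp[of t x] B1(1) by (cases "t \<in> {a..b}") auto
    show "norm (gradient g z) \<le> max B1 B2"
      using B2(2)[of t x] z[of t x] B2(1) by (cases "t \<in> {a..b}") auto
  next
    show "uniformly_continuous_on UNIV (gradient g)"
      by (rule periodic_uniformly_continuous[of _ a b])
        (use gradient_periodic[OF g] continuous_on_gradient[OF g(1)] z in auto)
  qed
qed

text \<open>Convolving with a kernel whose gradient is uniformly continuous commutes with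
  differentiation: the first order Taylor remainder of the kernel is small uniformly in the base
  point, so it stays small after integration.\<close>

lemma taylor_remainder_uniform:
  fixes \<rho> :: "'a::euclidean_space \<Rightarrow> real"
  assumes der: "\<And>z. (\<rho> has_derivative (\<lambda>h. h \<bullet> G z)) (at z)"
    and uc: "uniformly_continuous_on UNIV G" and "e > 0"
  obtains d where "d > 0"
    "\<And>z h. norm h < d \<Longrightarrow> \<bar>\<rho> (z + h) - \<rho> z - h \<bullet> G z\<bar> \<le> e * norm h"
proof -
  obtain d where d: "d > 0" "\<And>z z'. dist z' z < d \<Longrightarrow> dist (G z') (G z) < e"
    using uc \<open>e > 0\<close> unfolding uniformly_continuous_on_def by (metis UNIV_I)
  have "\<bar>\<rho> (z + h) - \<rho> z - h \<bullet> G z\<bar> \<le> e * norm h" if h: "norm h < d" for z h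
  proof -
    let ?f = "\<lambda>y. \<rho> y - y \<bullet> G z"
    have "norm (?f (z + h) - ?f z) \<le> e * norm ((z + h) - z)"
    proof (rule differentiable_bound[of "ball z d" ?f "\<lambda>y k. k \<bullet> (G y - G z)"])
      fix y assume y: "y \<in> ball z d"
      have "(?f has_derivative (\<lambda>k. k \<bullet> G y - k \<bullet> G z)) (at y within ball z d)"
        by (intro has_derivative_diff has_derivative_at_withinI[OF der])
          (auto intro!: derivative_eq_intros)
      then show "(?f has_derivative (\<lambda>k. k \<bullet> (G y - G z))) (at y within ball z d)"
        by (simp add: inner_diff_right)
      show "onorm (\<lambda>k. k \<bullet> (G y - G z)) \<le> e"
      proof (rule onorm_le)
        fix k
        have "norm (k \<bullet> (G y - G z)) \<le> norm k * norm (G y - G z)"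
          using Cauchy_Schwarz_ineq2 by simp
        also have "\<dots> \<le> norm k * e"
          using d(2)[of y z] y by (intro mult_left_mono) (auto simp: dist_norm norm_minus_commute)
        finally show "norm (k \<bullet> (G y - G z)) \<le> e * norm k" by (simp add: mult.commute)
      qed
    qed (use h d in \<open>auto simp: dist_norm\<close>)
    then show ?thesis by (simp add: inner_add_left algebra_simps)
  qed
  then show ?thesis using that d(1) by blast
qed

locale convolution_kernel =
  fixes \<rho> :: "'a::euclidean_space \<Rightarrow> real" and G :: "'a \<Rightarrow> 'a" and B :: real
  assumes der: "\<And>z. (\<rho> has_derivative (\<lambda>h. h \<bullet> G z)) (at z)"
    and uc: "uniformly_continuous_on UNIV G"
    and bound: "\<And>z. \<bar>\<rho> z\<bar> \<le> B" "\<And>z. norm (G z) \<le> B"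
begin

lemma continuous_kernel: "continuous_on S \<rho>"
  using der by (meson continuous_at_imp_continuous_on has_derivative_continuous)

lemma continuous_G: "continuous_on S G"
  using uniformly_continuous_imp_continuous[OF uc] continuous_on_subset by blast

lemma borel [measurable]: "\<rho> \<in> borel_measurable borel" "G \<in> borel_measurable borel"
  using continuous_kernel continuous_G by (auto intro: borel_measurable_continuous_onI)

context
  fixes M :: "'a measure" and \<phi> :: "'a \<Rightarrow> real"
  assumes M [measurable_cong]: "sets M = sets borel" and \<phi> [measurable]: "integrable M \<phi>"
begin

lemma integrable_kernel: "integrable M (\<lambda>y. \<rho> (z - y) * \<phi> y)"
proof (rule Bochner_Integration.integrable_bound[of M "\<lambda>y. B * \<phi> y"])
  show "AE y in M. norm (\<rho> (z - y) * \<phi> y) \<le> norm (B * \<phi> y)"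
  proof (rule AE_I2)
    fix y
    have "\<bar>\<rho> (z - y)\<bar> \<le> \<bar>B\<bar>" using bound(1)[of "z - y"] by linarith
    then show "norm (\<rho> (z - y) * \<phi> y) \<le> norm (B * \<phi> y)"
      by (simp add: abs_mult mult_right_mono)
  qed
qed (use \<phi> in auto)

lemma integrable_G: "integrable M (\<lambda>y. \<phi> y *\<^sub>R G (z - y))"
proof (rule Bochner_Integration.integrable_bound[of M "\<lambda>y. B * \<phi> y"])
  show "AE y in M. norm (\<phi> y *\<^sub>R G (z - y)) \<le> norm (B * \<phi> y)"
  proof (rule AE_I2)
    fix y
    have "norm (G (z - y)) \<le> \<bar>B\<bar>" using bound(2)[of "z - y"] by linarith
    then show "norm (\<phi> y *\<^sub>R G (z - y)) \<le> norm (B * \<phi> y)"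
      by (simp add: abs_mult mult.commute[of "\<bar>B\<bar>"] mult_left_mono)
  qed
qed (use \<phi> in auto)

lemma has_derivative_convolution:
  "((\<lambda>z. LINT y|M. \<rho> (z - y) * \<phi> y) has_derivative (\<lambda>h. h \<bullet> (LINT y|M. \<phi> y *\<^sub>R G (z - y)))) (at z)"
  unfolding has_derivative_at_alt
proof (intro conjI allI impI)
  show "bounded_linear (\<lambda>h. h \<bullet> (LINT y|M. \<phi> y *\<^sub>R G (z - y)))" by (rule bounded_linear_inner_left)
  fix e :: real assume "e > 0"
  define I where "I = (LINT y|M. \<bar>\<phi> y\<bar>)"
  have I: "0 \<le> I" unfolding I_def by simp
  obtain d where d: "d > 0"
    "\<And>z h. norm h < d \<Longrightarrow> \<bar>\<rho> (z + h) - \<rho> z - h \<bullet> G z\<bar> \<le> (e / (I + 1)) * norm h"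
    using taylor_remainder_uniform[OF der uc, of "e / (I + 1)"] I \<open>e > 0\<close> by (metis add_nonneg_pos divide_pos_pos zero_less_one)
  have "\<bar>(LINT y|M. \<rho> (z' - y) * \<phi> y) - (LINT y|M. \<rho> (z - y) * \<phi> y)
        - (z' - z) \<bullet> (LINT y|M. \<phi> y *\<^sub>R G (z - y))\<bar> \<le> e * norm (z' - z)"
    if z': "norm (z' - z) < d" for z'
  proof -
    let ?R = "\<lambda>y. (\<rho> (z' - y) - \<rho> (z - y) - (z' - z) \<bullet> G (z - y)) * \<phi> y"
    have eq: "?R y = \<rho> (z' - y) * \<phi> y - \<rho> (z - y) * \<phi> y - (z' - z) \<bullet> (\<phi> y *\<^sub>R G (z - y))" for y
      by (simp add: algebra_simps)
    have int: "integrable M ?R"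
      unfolding eq by (intro Bochner_Integration.integrable_diff integrable_kernel integrable_inner_right integrable_G)
    have "(LINT y|M. \<rho> (z' - y) * \<phi> y) - (LINT y|M. \<rho> (z - y) * \<phi> y)
        - (z' - z) \<bullet> (LINT y|M. \<phi> y *\<^sub>R G (z - y)) = (LINT y|M. ?R y)"
      unfolding eq
      by (simp add: integrable_kernel integrable_G Bochner_Integration.integral_diff del: inner_scaleR_right)
    also have "\<bar>\<dots>\<bar> \<le> (LINT y|M. \<bar>?R y\<bar>)" by (rule integral_abs_bound)
    also have "\<dots> \<le> (LINT y|M. ((e / (I + 1)) * norm (z' - z)) * \<bar>\<phi> y\<bar>)"
    proof (rule Bochner_Integration.integral_mono)
      fix y
      have "\<bar>\<rho> (z' - y) - \<rho> (z - y) - (z' - z) \<bullet> G (z - y)\<bar> \<le> (e / (I + 1)) * norm (z' - z)"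
        using d(2)[of "z' - z" "z - y"] z' by simp
      then show "\<bar>?R y\<bar> \<le> ((e / (I + 1)) * norm (z' - z)) * \<bar>\<phi> y\<bar>"
        by (simp only: abs_mult) (intro mult_right_mono, auto)
    qed (use int \<phi> in auto)
    also have "\<dots> = (e * norm (z' - z)) * (I / (I + 1))" unfolding I_def by simp
    also have "\<dots> \<le> (e * norm (z' - z)) * 1"
      using I \<open>e > 0\<close> by (intro mult_left_mono) auto
    finally show ?thesis by simp
  qed
  then show "\<exists>d>0. \<forall>z'. norm (z' - z) < d \<longrightarrow> norm ((LINT y|M. \<rho> (z' - y) * \<phi> y) - (LINT y|M. \<rho> (z - y) * \<phi> y)
        - (z' - z) \<bullet> (LINT y|M. \<phi> y *\<^sub>R G (z - y))) \<le> e * norm (z' - z)"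
    using d(1) unfolding real_norm_def by blast
qed

lemma continuous_convolution_gradient: "continuous_on S (\<lambda>z. LINT y|M. \<phi> y *\<^sub>R G (z - y))"
  unfolding continuous_on_iff
proof (intro ballI allI impI)
  fix z e :: _ assume e: "(e :: real) > 0"
  define I where "I = (LINT y|M. \<bar>\<phi> y\<bar>)"
  have I: "0 \<le> I" unfolding I_def by simp
  then have "e / (I + 1) > 0" using e by simp
  then obtain d where d: "d > 0" "\<And>z z'. dist z' z < d \<Longrightarrow> dist (G z') (G z) < e / (I + 1)"
    using uc unfolding uniformly_continuous_on_def by (metis UNIV_I)
  have "dist (LINT y|M. \<phi> y *\<^sub>R G (z' - y)) (LINT y|M. \<phi> y *\<^sub>R G (z - y)) < e"
    if "dist z' z < d" for z'
  proof -
    have "(LINT y|M. \<phi> y *\<^sub>R G (z' - y)) - (LINT y|M. \<phi> y *\<^sub>R G (z - y))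
        = (LINT y|M. \<phi> y *\<^sub>R (G (z' - y) - G (z - y)))"
      by (simp add: integrable_G Bochner_Integration.integral_diff scaleR_diff_right)
    also have "norm \<dots> \<le> (LINT y|M. norm (\<phi> y *\<^sub>R (G (z' - y) - G (z - y))))"
      by (rule integral_norm_bound)
    also have "\<dots> \<le> (LINT y|M. \<bar>\<phi> y\<bar> * (e / (I + 1)))"
    proof (rule Bochner_Integration.integral_mono)
      fix y
      have "norm (G (z' - y) - G (z - y)) \<le> e / (I + 1)"
        using d(2)[of "z' - y" "z - y"] that by (simp add: dist_norm)
      then show "norm (\<phi> y *\<^sub>R (G (z' - y) - G (z - y))) \<le> \<bar>\<phi> y\<bar> * (e / (I + 1))"
        by (simp only: norm_scaleR) (intro mult_left_mono, auto)
    qed (use \<phi> integrable_G in \<open>auto simp: scaleR_diff_right\<close>)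
    also have "\<dots> = I * (e / (I + 1))" unfolding I_def by simp
    also have "\<dots> < e" using I e by (simp add: field_simps)
    finally show ?thesis by (simp add: dist_norm)
  qed
  then show "\<exists>d>0. \<forall>z'\<in>S. dist z' z < d \<longrightarrow>
      dist (LINT y|M. \<phi> y *\<^sub>R G (z' - y)) (LINT y|M. \<phi> y *\<^sub>R G (z - y)) < e"
    using d(1) by blast
qed

end

end

section \<open>Continuously differentiable functions on the slab\<close>

text \<open>At the two faces the time direction is still approached from one side, which is enough for the
  derivative within the slab to be unique.\<close>

lemma slab_derivative_unique:
  fixes z :: "real \<times> (real^'n)"
  assumes "0 < T" "z \<in> slab T" and D: "(g has_derivative D) (at z within slab T)"
  shows "frechet_derivative g (at z within slab T) = D"
proof -
  obtain t x where z: "z = (t, x)" and t: "0 \<le> t" "t \<le> T" using assms(2) by (auto simp: slab_def)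
  have "(g has_derivative frechet_derivative g (at z within slab T)) (at z within slab T)"
    using D frechet_derivative_works differentiable_def by blast
  then show ?thesis
  proof (rule frechet_derivative_unique_within[OF _ D])
    fix b :: "real \<times> (real^'n)" and e :: real assume b: "b \<in> Basis" and "e > 0"
    define d where "d = (if t < T then min (e / 2) (T - t) else - min (e / 2) T)"
    have d: "0 < \<bar>d\<bar>" "\<bar>d\<bar> < e" "0 \<le> t + d" "t + d \<le> T"
      using \<open>e > 0\<close> t assms(1) by (auto simp: d_def min_def)
    have "z + d *\<^sub>R b \<in> slab T"
      using b d t unfolding z slab_def by (auto simp: Basis_prod_def)
    then show "\<exists>d. 0 < \<bar>d\<bar> \<and> \<bar>d\<bar> < e \<and> z + d *\<^sub>R b \<in> slab T" using d by blast
  qed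
qed

lemma partial_within_slab:
  assumes "0 < T" "z \<in> slab T" "(g has_derivative D) (at z within slab T)"
  shows "partial_within (slab T) b g z = D b"
  using slab_derivative_unique[OF assms] by (simp add: partial_within_def)

lemma C1_slabI:
  fixes g :: "real \<times> (real^'n) \<Rightarrow> real"
  assumes "0 < T"
    and der: "\<And>z. z \<in> slab T \<Longrightarrow> (g has_derivative (\<lambda>h. h \<bullet> G z)) (at z within slab T)"
    and cont: "continuous_on (slab T) G"
  shows "Ck_on 1 (slab T) g" and "\<And>z b. z \<in> slab T \<Longrightarrow> partial_within (slab T) b g z = b \<bullet> G z"
proof -
  show eq: "partial_within (slab T) b g z = b \<bullet> G z" if "z \<in> slab T" for z b
    by (rule partial_within_slab[OF assms(1) that der[OF that]])
  have "continuous_on (slab T) (partial_within (slab T) b g)" for b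
    by (rule continuous_on_eq[of _ "\<lambda>z. b \<bullet> G z"]) (use cont eq in \<open>auto intro!: continuous_intros\<close>)
  moreover have "g differentiable (at z within slab T)" if "z \<in> slab T" for z
    using der[OF that] unfolding differentiable_def by blast
  ultimately show "Ck_on 1 (slab T) g" by simp
qed

definition slab_gradient :: "real \<Rightarrow> (real \<times> (real^'n) \<Rightarrow> real) \<Rightarrow> real \<times> (real^'n) \<Rightarrow> real \<times> (real^'n)" where
  "slab_gradient T g z = (\<Sum>b\<in>Basis. partial_within (slab T) b g z *\<^sub>R b)"

lemma C1_slabD:
  fixes g :: "real \<times> (real^'n) \<Rightarrow> real"
  assumes "Ck_on 1 (slab T) g"
  shows "z \<in> slab T \<Longrightarrow> (g has_derivative (\<lambda>h. h \<bullet> slab_gradient T g z)) (at z within slab T)"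
    and "continuous_on (slab T) (slab_gradient T g)"
proof -
  have diff: "\<And>z. z \<in> slab T \<Longrightarrow> g differentiable (at z within slab T)"
    and part: "\<And>b. b \<in> Basis \<Longrightarrow> continuous_on (slab T) (partial_within (slab T) b g)"
    using assms by auto
  show "continuous_on (slab T) (slab_gradient T g)"
    unfolding slab_gradient_def[abs_def] by (intro continuous_intros part)
  assume "z \<in> slab T"
  then have D: "(g has_derivative (\<lambda>h. partial_within (slab T) h g z)) (at z within slab T)"
    using diff unfolding partial_within_def by (simp add: frechet_derivative_works[symmetric])
  have "linear (\<lambda>h. partial_within (slab T) h g z)"
    using has_derivative_bounded_linear[OF D] by (rule bounded_linear.linear)
  then have "(\<lambda>h. partial_within (slab T) h g z) = (\<lambda>h. h \<bullet> slab_gradient T g z)"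
    unfolding slab_gradient_def by (intro ext linear_functional_sum)
  then show "(g has_derivative (\<lambda>h. h \<bullet> slab_gradient T g z)) (at z within slab T)" using D by simp
qed

lemma slab_gradient_inner_Basis:
  "b \<in> Basis \<Longrightarrow> b \<bullet> slab_gradient T g z = partial_within (slab T) b g z"
  by (simp add: slab_gradient_def inner_sum_right inner_Basis if_distrib sum.delta cong: if_cong)

section \<open>The Gauss--Green formula on the cylinder\<close>

lemma set_integral_cyl:
  fixes g :: "real \<times> (real^'n) \<Rightarrow> real"
  assumes "g \<in> borel_measurable borel"
  shows "(LINT z:{a<..<b} \<times> unit_cell|lborel. g z) = (LINT z|cylM a b. g z)"
proof -
  have eq: "cylM a b = density lborel (\<lambda>z :: real \<times> (real^'n). ennreal (indicator ({a<..<b} \<times> unit_cell) z))"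
    by (simp add: cylM_density ennreal_indicator)
  show ?thesis
    unfolding set_lebesgue_integral_def eq using assms by (subst integral_density) auto
qed

lemma integrable_cylM_bounded:
  fixes g :: "real \<times> (real^'n) \<Rightarrow> 'b::{banach, second_countable_topology}"
  assumes [measurable]: "g \<in> borel_measurable borel" and "\<And>z. norm (g z) \<le> B"
  shows "integrable (cylM a b) g"
  by (rule cylinder.integrable_const_bound[of _ B]) (use assms in simp_all)

lemma integrable_cellM_bounded:
  fixes g :: "real^'n \<Rightarrow> 'b::{banach, second_countable_topology}"
  assumes [measurable]: "g \<in> borel_measurable borel" and "\<And>z. norm (g z) \<le> B"
  shows "integrable cellM g"
  by (rule cell.integrable_const_bound[of _ B]) (use assms in simp_all)

lemma timeM_closed: "timeM a b = density lborel (indicator {a..b})"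
proof -
  have "AE t in lborel. t \<noteq> a \<and> t \<noteq> b" by (simp add: AE_lborel_singleton)
  then have "AE t in lborel. (indicator {a<..<b} t :: ennreal) = indicator {a..b} t"
    by (rule eventually_mono) (auto simp: indicator_def)
  then show ?thesis unfolding timeM_def by (intro density_cong) auto
qed

lemma timeM_FTC:
  fixes g :: "real \<Rightarrow> real"
  assumes "a \<le> b" and der: "\<And>t. t \<in> {a..b} \<Longrightarrow> (g has_real_derivative g' t) (at t within {a..b})"
    and cont: "continuous_on {a..b} g'" and [measurable]: "g' \<in> borel_measurable borel"
  shows "(LINT t|timeM a b. g' t) = g b - g a"
proof -
  have "timeM a b = density lborel (\<lambda>t. ennreal (indicator {a..b} t))"
    by (simp add: timeM_closed ennreal_indicator)
  then have "(LINT t|timeM a b. g' t) = (LINT t|lborel. indicator {a..b} t *\<^sub>R g' t)"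
    by (simp add: integral_density)
  also have "\<dots> = g b - g a"
    by (rule integral_FTC_atLeastAtMost[OF assms(1)])
      (use der cont in \<open>auto simp: has_real_derivative_iff_has_vector_derivative\<close>)
  finally show ?thesis .
qed

text \<open>A derivative along a period direction has mean zero: by translation invariance its mean
  equals that of its average over a full period, and this average is a difference of two equal
  values.\<close>

lemma cell_integral_derivative_zero:
  fixes g g' :: "real^'n \<Rightarrow> real"
  assumes g: "periodic g" and g': "periodic g'" "continuous_on UNIV g'"
    and der: "\<And>x s. ((\<lambda>s. g (x + s *\<^sub>R axis i 1)) has_real_derivative g' (x + s *\<^sub>R axis i 1)) (at s)"
  shows "(LINT x|cellM. g' x) = 0"
proof -
  let ?e = "axis i 1 :: real^'n"
  obtain B where B: "\<And>x. norm (g' x) \<le> B" using periodic_bounded[OF g'] by metis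
  have [measurable]: "g' \<in> borel_measurable borel" by (intro borel_measurable_continuous_onI g'(2))
  let ?h = "\<lambda>(s, x). g' (x + s *\<^sub>R ?e)"
  have int: "integrable (timeM 0 1 \<Otimes>\<^sub>M cellM) ?h"
    unfolding cylM_def[symmetric]
  proof (rule integrable_cylM_bounded[of _ B])
    show "?h \<in> borel_measurable borel"
      by (intro borel_measurable_continuous_onI)
        (auto simp: split_beta intro!: continuous_intros continuous_on_compose2[OF g'(2)])
  qed (use B in auto)
  have "(LINT x|cellM. g' x) = (LINT s|timeM 0 1. LINT x|cellM. g' (x + s *\<^sub>R ?e))"
    using cell_integral_shift[OF g'(1) _ B[unfolded real_norm_def]]
    by (simp add: measure_def emeasure_timeM)
  also have "\<dots> = (LINT x|cellM. LINT s|timeM 0 1. g' (x + s *\<^sub>R ?e))"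
    using cyl.Fubini_integral[OF int] by simp
  also have "\<dots> = (LINT x|(cellM :: (real^'n) measure). (0 :: real))"
  proof (intro Bochner_Integration.integral_cong refl)
    fix x
    have "(LINT s|timeM 0 1. g' (x + s *\<^sub>R ?e)) = g (x + 1 *\<^sub>R ?e) - g (x + 0 *\<^sub>R ?e)"
    proof (rule timeM_FTC[where g = "\<lambda>s. g (x + s *\<^sub>R ?e)"])
      show "continuous_on {0..1} (\<lambda>s. g' (x + s *\<^sub>R ?e))"
        by (intro continuous_intros continuous_on_compose2[OF g'(2)]) auto
    qed (use der in \<open>auto intro: has_field_derivative_at_within\<close>)
    also have "\<dots> = 0"
      using g int_lattice_axis[of i 1] unfolding periodic_def by simp
    finally show "(LINT s|timeM 0 1. g' (x + s *\<^sub>R ?e)) = 0" .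
  qed
  finally show ?thesis by simp
qed

lemma clamp_continuous:
  fixes g :: "real \<times> (real^'n) \<Rightarrow> 'b::topological_space"
  assumes "a \<le> b" "continuous_on ({a..b} \<times> UNIV) g"
  shows "continuous_on UNIV (\<lambda>z. g (max a (min b (fst z)), snd z))"
  by (rule continuous_on_compose2[OF assms(2)]) (use assms(1) in \<open>auto intro!: continuous_intros\<close>)

text \<open>Fubini's theorem reduces the time component to the fundamental theorem of calculus and the space
  components to the vanishing of mean derivatives.  The clamped function \<open>h\<close> in the proof replaces
  \<open>c \<bullet> G\<close> by a function that is continuous on the whole space, hence measurable.\<close>

lemma Gauss_Green_cylinder:
  fixes u :: "real \<times> (real^'n) \<Rightarrow> real"
  assumes ab: "a \<le> b"
    and der: "\<And>z. z \<in> {a..b} \<times> UNIV \<Longrightarrow> (u has_derivative (\<lambda>h. h \<bullet> G z)) (at z within {a..b} \<times> UNIV)"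
    and cont: "continuous_on ({a..b} \<times> UNIV) G"
    and per: "\<And>t. t \<in> {a..b} \<Longrightarrow> periodic (\<lambda>x. u (t, x))" "\<And>t. t \<in> {a..b} \<Longrightarrow> periodic (\<lambda>x. G (t, x))"
    and c: "c \<in> Basis"
  shows "(LINT z:{a<..<b} \<times> unit_cell|lborel. c \<bullet> G z)
    = fst c * ((LINT x:unit_cell|lborel. u (b, x)) - (LINT x:unit_cell|lborel. u (a, x)))"
proof -
  let ?cl = "\<lambda>t. max a (min b t)"
  define h where "h = (\<lambda>z. c \<bullet> G (?cl (fst z), snd z))"
  have h_cont: "continuous_on UNIV h"
    unfolding h_def by (intro continuous_intros clamp_continuous[OF ab cont])
  then have [measurable]: "h \<in> borel_measurable borel" by (rule borel_measurable_continuous_onI)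
  obtain B where B: "\<And>t x. t \<in> {a..b} \<Longrightarrow> norm (G (t, x)) \<le> B"
    using slab_periodic_bounded[OF per(2) cont] by metis
  have hB: "norm (h z) \<le> norm c * B" for z
  proof -
    have "?cl (fst z) \<in> {a..b}" using ab by auto
    then have "norm (G (?cl (fst z), snd z)) \<le> B" by (rule B)
    then show ?thesis unfolding h_def
      by (intro order_trans[OF Cauchy_Schwarz_ineq2[folded real_norm_def]] mult_left_mono) auto
  qed
  have int: "integrable (timeM a b \<Otimes>\<^sub>M cellM) (case_prod (\<lambda>t x. h (t, x)))"
    using integrable_cylM_bounded[of h, OF _ hB] by (simp add: cylM_def)
  have "(LINT z:{a<..<b} \<times> unit_cell|lborel. c \<bullet> G z) = (LINT z:{a<..<b} \<times> unit_cell|lborel. h z)"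
    by (rule set_lebesgue_integral_cong) (auto simp: h_def)
  also have "\<dots> = (LINT z|(timeM a b \<Otimes>\<^sub>M cellM). case_prod (\<lambda>t x. h (t, x)) z)"
    by (simp add: set_integral_cyl cylM_def)
  finally have eq: "(LINT z:{a<..<b} \<times> unit_cell|lborel. c \<bullet> G z)
      = (LINT z|(timeM a b \<Otimes>\<^sub>M cellM). case_prod (\<lambda>t x. h (t, x)) z)" .
  have u_cont: "continuous_on ({a..b} \<times> UNIV) u"
    using der has_derivative_continuous continuous_on_eq_continuous_within by blast
  have u_meas: "(\<lambda>x. u (t, x)) \<in> borel_measurable borel" if "t \<in> {a..b}" for t
    by (intro borel_measurable_continuous_onI continuous_on_compose2[OF u_cont])
      (use that in \<open>auto intro!: continuous_intros\<close>)
  obtain Bu where Bu: "\<And>t x. t \<in> {a..b} \<Longrightarrow> norm (u (t, x)) \<le> Bu"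
    using slab_periodic_bounded[OF per(1) u_cont] by metis
  consider "c = (1, 0)" | i where "c = (0, axis i 1)"
    using c by (auto simp: Basis_prod_def Basis_vec_def)
  then show ?thesis
  proof cases
    case 1
    have "(LINT t|timeM a b. h (t, x)) = u (b, x) - u (a, x)" for x
    proof (rule timeM_FTC[OF ab, where g = "\<lambda>t. u (t, x)"])
      fix t assume t: "t \<in> {a..b}"
      have "((\<lambda>t. u (t, x)) has_derivative (\<lambda>s. (s, 0) \<bullet> G (t, x))) (at t within {a..b})"
        using t by (intro has_derivative_in_compose2[where g = u and t = "{a..b} \<times> UNIV" and f = "\<lambda>t. (t, x)"
            and g' = "\<lambda>w h. h \<bullet> G w"] der)
          (auto intro!: derivative_eq_intros)
      moreover have "(\<lambda>s. (s, 0) \<bullet> G (t, x)) = (*) (h (t, x))"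
        using t by (cases "G (t, x)") (auto simp: h_def 1 fun_eq_iff)
      ultimately show "((\<lambda>t. u (t, x)) has_real_derivative h (t, x)) (at t within {a..b})"
        by (simp add: has_field_derivative_def)
    next
      show "continuous_on {a..b} (\<lambda>t. h (t, x))"
        by (rule continuous_on_compose2[OF h_cont]) (auto intro!: continuous_intros)
    qed measurable
    then have "(LINT z:{a<..<b} \<times> unit_cell|lborel. c \<bullet> G z) = (LINT x|cellM. u (b, x) - u (a, x))"
      unfolding eq cyl.integral_snd[OF int, symmetric] by simp
    also have "\<dots> = (LINT x|cellM. u (b, x)) - (LINT x|cellM. u (a, x))"
      using ab u_meas Bu by (intro Bochner_Integration.integral_diff integrable_cellM_bounded[of _ Bu]) auto
    finally show ?thesis using u_meas ab by (simp add: 1 set_integral_cell)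
  next
    case (2 i)
    have "(LINT x|cellM. h (t, x)) = 0" for t
    proof (rule cell_integral_derivative_zero[where i = i])
      let ?t = "?cl t"
      have t: "?t \<in> {a..b}" using ab by auto
      show "periodic (\<lambda>x. u (?t, x))" by (rule per(1)[OF t])
      show "periodic (\<lambda>x. h (t, x))" using per(2)[OF t] by (simp add: periodic_def h_def)
      show "continuous_on UNIV (\<lambda>x. h (t, x))"
        by (rule continuous_on_compose2[OF h_cont]) (auto intro!: continuous_intros)
      fix x :: "real^'n" and s :: real
      let ?y = "x + s *\<^sub>R axis i 1"
      have "((\<lambda>s. u (?t, x + s *\<^sub>R axis i 1)) has_derivative (\<lambda>r. (0, r *\<^sub>R axis i 1) \<bullet> G (?t, ?y))) (at s within UNIV)"
        using t by (intro has_derivative_in_compose2[where g = u and t = "{a..b} \<times> UNIV" and f = "\<lambda>s. (?t, x + s *\<^sub>R axis i 1)"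
            and g' = "\<lambda>w h. h \<bullet> G w"] der)
          (auto intro!: derivative_eq_intros)
      moreover have "(\<lambda>r. (0, r *\<^sub>R axis i 1) \<bullet> G (?t, ?y)) = (*) (h (t, ?y))"
        by (cases "G (?t, ?y)") (auto simp: h_def 2 fun_eq_iff)
      ultimately show "((\<lambda>s. u (?t, x + s *\<^sub>R axis i 1)) has_real_derivative h (t, ?y)) (at s)"
        by (simp add: has_field_derivative_def)
    qed
    then show ?thesis unfolding eq cyl2.integral_snd cyl.integral_fst'[OF int, symmetric] by (simp add: 2)
  qed
qed

section \<open>Functions of class C1 on the closed cylinder\<close>

lemma slab_gradient_periodic:
  fixes g :: "real \<times> (real^'n) \<Rightarrow> real"
  assumes "0 < T" "C1_closed_cylinder T g" "t \<in> {0..T}"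
  shows "periodic (\<lambda>x. slab_gradient T g (t, x))"
  unfolding periodic_def
proof (intro allI ballI)
  fix x k :: "real^'n" assume k: "k \<in> int_lattice"
  have C1: "Ck_on 1 (slab T) g" and per: "\<And>s y. s \<in> {0..T} \<Longrightarrow> g (s, y + k) = g (s, y)"
    using assms(2) k unfolding C1_closed_cylinder_def periodic_def by auto
  let ?D = "\<lambda>h. h \<bullet> slab_gradient T g (t, x + k)"
  have mem: "(t, x) \<in> slab T" using assms(3) by (simp add: slab_def)
  have "((\<lambda>z. g (z + (0, k))) has_derivative ?D) (at (t, x) within slab T)"
  proof (rule has_derivative_in_compose2[where g = g and t = "slab T" and f = "\<lambda>z. z + (0, k)"
        and g' = "\<lambda>w h. h \<bullet> slab_gradient T g w" and x = "(t, x)" and f' = "\<lambda>h. h", simplified])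
    show "(g has_derivative (\<lambda>h. h \<bullet> slab_gradient T g w)) (at w within slab T)"
      if "w \<in> slab T" for w
      using C1_slabD(1)[OF C1 that] .
  qed (use mem in \<open>auto simp: slab_def intro!: derivative_eq_intros\<close>)
  then have "(g has_derivative ?D) (at (t, x) within slab T)"
    by (rule has_derivative_transform[OF mem, rotated]) (use per in \<open>auto simp: slab_def\<close>)
  then have "partial_within (slab T) b g (t, x) = b \<bullet> slab_gradient T g (t, x + k)" for b
    by (rule partial_within_slab[OF assms(1) mem])
  then show "slab_gradient T g (t, x + k) = slab_gradient T g (t, x)"
    by (simp add: slab_gradient_def[of _ _ "(t, x)"] inner_commute[of _ "slab_gradient T g (t, x + k)"] euclidean_representation)
qed

lemma C1_closed_cylinderI:
  fixes g :: "real \<times> (real^'n) \<Rightarrow> real"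
  assumes "0 < T"
    and "\<And>z. z \<in> slab T \<Longrightarrow> (g has_derivative (\<lambda>h. h \<bullet> G z)) (at z within slab T)"
    and "continuous_on (slab T) G" and "\<And>t. t \<in> {0..T} \<Longrightarrow> periodic (\<lambda>x. g (t, x))"
  shows "C1_closed_cylinder T g"
  using C1_slabI(1)[OF assms(1-3)] assms(4) by (simp add: C1_closed_cylinder_def)

lemma C1_closed_cylinderD:
  fixes g :: "real \<times> (real^'n) \<Rightarrow> real"
  assumes "C1_closed_cylinder T g"
  shows "z \<in> slab T \<Longrightarrow> (g has_derivative (\<lambda>h. h \<bullet> slab_gradient T g z)) (at z within slab T)"
    and "continuous_on (slab T) (slab_gradient T g)"
    and "continuous_on (slab T) g"
    and "t \<in> {0..T} \<Longrightarrow> periodic (\<lambda>x. g (t, x))"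
proof -
  have C1: "Ck_on 1 (slab T) g" using assms by (simp add: C1_closed_cylinder_def)
  show "z \<in> slab T \<Longrightarrow> (g has_derivative (\<lambda>h. h \<bullet> slab_gradient T g z)) (at z within slab T)"
    and "continuous_on (slab T) (slab_gradient T g)"
    using C1_slabD[OF C1] by auto
  show "continuous_on (slab T) g" using Ck_on_SucD[of 0] C1 by simp
  show "t \<in> {0..T} \<Longrightarrow> periodic (\<lambda>x. g (t, x))"
    using assms by (simp add: C1_closed_cylinder_def)
qed

text \<open>Clamping the time variable to \<open>[0, T]\<close> extends a function from the slab without changing its
  values; measurability on the cylinder is inherited from the extension.\<close>

lemma slab_extension:
  fixes g :: "real \<times> (real^'n) \<Rightarrow> 'b::real_normed_vector"
  assumes "0 < T" "continuous_on (slab T) g" "\<And>t. t \<in> {0..T} \<Longrightarrow> periodic (\<lambda>x. g (t, x))"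
  obtains g' B where "continuous_on UNIV g'" "\<And>z. norm (g' z) \<le> B" "\<And>z. z \<in> slab T \<Longrightarrow> g' z = g z"
proof -
  obtain B where B: "\<And>t x. t \<in> {0..T} \<Longrightarrow> norm (g (t, x)) \<le> B"
    using slab_periodic_bounded[of 0 T g] assms(2,3) unfolding slab_def by metis
  let ?g' = "\<lambda>z. g (max 0 (min T (fst z)), snd z)"
  have "continuous_on UNIV ?g'"
    by (rule clamp_continuous) (use assms in \<open>auto simp: slab_def\<close>)
  moreover have "norm (?g' z) \<le> B" for z using assms(1) by (intro B) auto
  moreover have "?g' z = g z" if "z \<in> slab T" for z using that by (auto simp: slab_def)
  ultimately show ?thesis by (rule that)
qed

lemma cylinder_subset_slab: "cylinder T \<subseteq> slab T"
  by (auto simp: cylinder_def slab_def)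

lemma emeasure_cylinder: "0 \<le> T \<Longrightarrow> emeasure lborel (cylinder T :: (real \<times> (real^'n)) set) = ennreal T"
proof -
  assume "0 \<le> T"
  then have "emeasure (cylM 0 T :: (real \<times> (real^'n)) measure) UNIV = ennreal T"
    using emeasure_cylM[of 0 T] by simp
  then show ?thesis by (simp add: cylM_density emeasure_density cylinder_def)
qed

lemma slab_set_integrable:
  fixes g :: "real \<times> (real^'n) \<Rightarrow> 'b::{banach, second_countable_topology}"
  assumes T: "0 < T" and g: "continuous_on (slab T) g" "\<And>t. t \<in> {0..T} \<Longrightarrow> periodic (\<lambda>x. g (t, x))"
  shows "set_integrable lborel (cylinder T) g" "set_borel_measurable lborel (cylinder T) g"
proof -
  obtain g' B where g': "continuous_on UNIV g'" "\<And>z. norm (g' z) \<le> B" "\<And>z. z \<in> slab T \<Longrightarrow> g' z = g z"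
    using slab_extension[OF assms] by blast
  have eq: "indicator (cylinder T) z *\<^sub>R g z = indicator (cylinder T) z *\<^sub>R g' z" for z
    using g'(3)[of z] cylinder_subset_slab[of T] by (auto simp: indicator_def)
  have [measurable]: "g' \<in> borel_measurable borel" by (rule borel_measurable_continuous_onI[OF g'(1)])
  show "set_borel_measurable lborel (cylinder T) g" unfolding set_borel_measurable_def eq by simp
  have "integrable lborel (\<lambda>z. indicator (cylinder T) z *\<^sub>R g' z)"
  proof (rule Bochner_Integration.integrable_bound[of lborel "\<lambda>z. B * indicator (cylinder T) z"])
    show "integrable lborel (\<lambda>z. B * indicator (cylinder T :: (real \<times> (real^'n)) set) z)"
      using T by (intro integrable_mult_right integrable_real_indicator) (simp_all add: emeasure_cylinder)
    show "AE z in lborel. norm (indicator (cylinder T) z *\<^sub>R g' z) \<le> norm (B * indicator (cylinder T) z)"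
      using g'(2) by (intro AE_I2) (auto simp: indicator_def intro: order_trans[OF _ abs_ge_self])
  qed simp
  then show "set_integrable lborel (cylinder T) g" unfolding set_integrable_def eq .
qed

lemma slab_Lp_cylinder:
  fixes g :: "real \<times> (real^'n) \<Rightarrow> 'b::euclidean_space"
  assumes "0 < T" "0 < s" and g: "continuous_on (slab T) g" "\<And>t. t \<in> {0..T} \<Longrightarrow> periodic (\<lambda>x. g (t, x))"
  shows "Lp_cylinder T s g"
proof -
  have "set_integrable lborel (cylinder T) (\<lambda>z. norm (g z) powr s)"
  proof (rule slab_set_integrable(1)[OF assms(1)])
    show "continuous_on (slab T) (\<lambda>z. norm (g z) powr s)"
      using assms(2) by (intro continuous_on_powr' continuous_intros g(1)) auto
    show "periodic (\<lambda>x. norm (g (t, x)) powr s)" if "t \<in> {0..T}" for t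
      using g(2)[OF that] by (simp add: periodic_def)
  qed
  then show ?thesis
    using slab_set_integrable(2)[OF assms(1) g] g(2) by (auto simp: Lp_cylinder_def)
qed

lemma continuous_Lp_torus:
  fixes g :: "real^'n \<Rightarrow> real"
  assumes "0 < s" "periodic g" "continuous_on UNIV g"
  shows "Lp_torus s g"
proof -
  obtain B where B: "\<And>x. norm (g x) \<le> B" using periodic_bounded[OF assms(2,3)] by blast
  have [measurable]: "g \<in> borel_measurable borel" by (rule borel_measurable_continuous_onI[OF assms(3)])
  have "integrable lborel (\<lambda>x. indicator unit_cell x *\<^sub>R (\<bar>g x\<bar> powr s))"
  proof (rule Bochner_Integration.integrable_bound[of lborel "\<lambda>x. (B powr s) * indicator unit_cell x"])
    show "integrable lborel (\<lambda>z. (B powr s) * indicator (unit_cell :: (real^'n) set) z)"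
      by (intro integrable_mult_right integrable_real_indicator) (simp_all add: emeasure_unit_cell)
    show "AE x in lborel. norm (indicator unit_cell x *\<^sub>R (\<bar>g x\<bar> powr s)) \<le> norm ((B powr s) * indicator unit_cell x)"
      using B assms(1) by (intro AE_I2) (auto simp: indicator_def intro!: powr_mono2)
  qed simp
  then show ?thesis using assms(2)
    by (simp add: Lp_torus_def set_borel_measurable_def set_integrable_def)
qed

lemma integration_by_parts:
  fixes \<phi> \<psi> :: "real \<times> (real^'n) \<Rightarrow> real"
  assumes T: "0 < T" and \<phi>: "C1_closed_cylinder T \<phi>" and \<psi>: "C1_closed_cylinder T \<psi>" and b: "b \<in> Basis"
  shows "(LINT z:cylinder T|lborel. \<phi> z * partial_within (slab T) b \<psi> z)
    = - (LINT z:cylinder T|lborel. \<psi> z * (slab_gradient T \<phi> z \<bullet> b))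
      + fst b * (LINT x:unit_cell|lborel. \<psi> (T, x) * \<phi> (T, x))
      - fst b * (LINT x:unit_cell|lborel. \<psi> (0, x) * \<phi> (0, x))"
proof -
  let ?P = "slab_gradient T \<phi>" and ?Q = "slab_gradient T \<psi>"
  let ?G = "\<lambda>z. \<psi> z *\<^sub>R ?P z + \<phi> z *\<^sub>R ?Q z"
  note p = C1_closed_cylinderD[OF \<phi>] and q = C1_closed_cylinderD[OF \<psi>]
  note pp = slab_gradient_periodic[OF T \<phi>] and qp = slab_gradient_periodic[OF T \<psi>]
  have slab: "slab T = {0..T} \<times> (UNIV :: (real^'n) set)" by (simp add: slab_def)
  have "(LINT z:{0<..<T} \<times> unit_cell|lborel. b \<bullet> ?G z)
      = fst b * ((LINT x:unit_cell|lborel. \<psi> (T, x) * \<phi> (T, x)) - (LINT x:unit_cell|lborel. \<psi> (0, x) * \<phi> (0, x)))"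
  proof (rule Gauss_Green_cylinder[where u = "\<lambda>z. \<psi> z * \<phi> z" and a = 0 and b = T, OF _ _ _ _ _ b])
    fix z :: "real \<times> (real^'n)" assume "z \<in> {0..T} \<times> UNIV"
    then have z: "z \<in> slab T" by (simp add: slab)
    have "((\<lambda>z. \<psi> z * \<phi> z) has_derivative (\<lambda>h. \<psi> z * (h \<bullet> ?P z) + (h \<bullet> ?Q z) * \<phi> z)) (at z within slab T)"
      by (rule has_derivative_mult[OF q(1)[OF z] p(1)[OF z]])
    moreover have "(\<lambda>h. \<psi> z * (h \<bullet> ?P z) + (h \<bullet> ?Q z) * \<phi> z) = (\<lambda>h. h \<bullet> ?G z)"
      by (simp add: inner_add_right fun_eq_iff)
    ultimately show "((\<lambda>z. \<psi> z * \<phi> z) has_derivative (\<lambda>h. h \<bullet> ?G z)) (at z within {0..T} \<times> UNIV)"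
      by (simp only: slab)
  next
    show "continuous_on ({0..T} \<times> UNIV) ?G"
      using p(2,3) q(2,3) unfolding slab by (intro continuous_intros)
  next
    fix t assume t: "t \<in> {0..T}"
    show "periodic (\<lambda>x. \<psi> (t, x) * \<phi> (t, x))" "periodic (\<lambda>x. ?G (t, x))"
      using p(4)[OF t] q(4)[OF t] pp[OF t] qp[OF t] by (simp_all add: periodic_def)
  qed (use T in auto)
  moreover have "(LINT z:{0<..<T} \<times> unit_cell|lborel. b \<bullet> ?G z)
      = (LINT z:cylinder T|lborel. \<psi> z * (?P z \<bullet> b) + \<phi> z * partial_within (slab T) b \<psi> z)"
    unfolding cylinder_def
    by (rule set_lebesgue_integral_cong)
      (auto simp: inner_add_right slab_gradient_inner_Basis[OF b, of T \<psi>] inner_commute[of _ b])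
  moreover have "\<dots> = (LINT z:cylinder T|lborel. \<psi> z * (?P z \<bullet> b)) + (LINT z:cylinder T|lborel. \<phi> z * partial_within (slab T) b \<psi> z)"
  proof (intro set_integral_add(2) slab_set_integrable(1)[OF T])
    show "continuous_on (slab T) (\<lambda>z. \<psi> z * (?P z \<bullet> b))" by (intro continuous_intros p q)
    have "continuous_on (slab T) (\<lambda>z. \<phi> z * (b \<bullet> ?Q z))" by (intro continuous_intros p q)
    then show "continuous_on (slab T) (\<lambda>z. \<phi> z * partial_within (slab T) b \<psi> z)"
      by (simp add: slab_gradient_inner_Basis[OF b])
    fix t assume t: "t \<in> {0..T}"
    show "periodic (\<lambda>x. \<psi> (t, x) * (?P (t, x) \<bullet> b))"
      using q(4)[OF t] pp[OF t] by (simp_all add: periodic_def)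
    have "periodic (\<lambda>x. \<phi> (t, x) * (b \<bullet> ?Q (t, x)))"
      using p(4)[OF t] qp[OF t] by (simp_all add: periodic_def)
    then show "periodic (\<lambda>x. \<phi> (t, x) * partial_within (slab T) b \<psi> (t, x))"
      by (simp add: slab_gradient_inner_Basis[OF b])
  qed
  ultimately show ?thesis by (simp add: right_diff_distrib)
qed

lemma test_function_C1:
  assumes "0 < T" "test_function T \<psi>"
  shows "C1_closed_cylinder T \<psi>"
    and "z \<in> slab T \<Longrightarrow> partial_within (slab T) b \<psi> z = partial_within UNIV b \<psi> z"
proof -
  have s: "smooth \<psi>" and per: "\<And>t. periodic (\<lambda>x. \<psi> (t, x))"
    using assms(2) by (auto simp: test_function_def)
  show "C1_closed_cylinder T \<psi>"
    by (rule C1_closed_cylinderI[OF assms(1), where G = "gradient \<psi>"])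
      (use has_derivative_at_withinI[OF smooth_has_gradient[OF s]] continuous_on_gradient[OF s] per in auto)
  show "partial_within (slab T) b \<psi> z = partial_within UNIV b \<psi> z" if "z \<in> slab T"
    by (rule partial_within_slab[OF assms(1) that])
      (rule has_derivative_at_withinI[OF smooth_has_derivative[OF s]])
qed

lemma test_function_partial:
  assumes "0 < T" "test_function T \<psi>" "z \<in> cylinder T"
  shows "partial_within UNIV b \<psi> z = partial_within (slab T) b \<psi> z"
  using test_function_C1(2)[OF assms(1,2)] assms(3) cylinder_subset_slab[of T] by (metis subsetD)

lemma test_function_boundary:
  assumes "test_function T \<psi>" shows "\<psi> (0, x) = 0" "\<psi> (T, x) = 0"
proof -
  obtain a b where "0 < a" "b < T" "\<And>t x. t \<notin> {a..b} \<Longrightarrow> \<psi> (t, x) = 0"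
    using assms by (auto simp: test_function_def)
  then show "\<psi> (0, x) = 0" "\<psi> (T, x) = 0" by auto
qed

section \<open>Smooth competitors are admissible in the relaxed problem\<close>

text \<open>The derivative measure is the gradient times Lebesgue measure, written in polar form.\<close>

lemma C1_BV_traces:
  fixes \<phi> :: "real \<times> (real^'n) \<Rightarrow> real"
  assumes T: "0 < T" and \<phi>: "C1_closed_cylinder T \<phi>"
  shows "BV_traces T \<phi> (\<lambda>x. \<phi> (0, x)) (\<lambda>x. \<phi> (T, x))"
proof -
  let ?P = "slab_gradient T \<phi>"
  note p = C1_closed_cylinderD[OF \<phi>] and pp = slab_gradient_periodic[OF T \<phi>]
  obtain P' B where P': "continuous_on UNIV P'" "\<And>z. norm (P' z) \<le> B" "\<And>z. z \<in> slab T \<Longrightarrow> P' z = ?P z"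
    using slab_extension[OF T p(2) pp] by blast
  define w where "w = (\<lambda>z. indicator (cylinder T) z *\<^sub>R P' z)"
  have [measurable]: "P' \<in> borel_measurable borel" by (rule borel_measurable_continuous_onI[OF P'(1)])
  have [measurable]: "w \<in> borel_measurable borel" unfolding w_def by measurable
  \<comment> \<open>Where \<open>w\<close> vanishes the direction \<open>\<sigma>\<close> is zero instead of a unit vector, but these points are
    \<open>\<mu>\<close>-null.\<close>
  define \<mu> where "\<mu> = density lborel (\<lambda>z. ennreal (norm (w z)))"
  define \<sigma> where "\<sigma> = (\<lambda>z. inverse (norm (w z)) *\<^sub>R w z)"
  have [measurable]: "\<sigma> \<in> borel_measurable borel" unfolding \<sigma>_def by measurable
  have w\<sigma>: "norm (w z) * (\<sigma> z \<bullet> b) = w z \<bullet> b" for z b by (cases "w z = 0") (simp_all add: \<sigma>_def)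
  have int: "(LINT z:cylinder T|\<mu>. \<psi> z * (\<sigma> z \<bullet> b)) = (LINT z:cylinder T|lborel. \<psi> z * (?P z \<bullet> b))"
    if "C1_closed_cylinder T \<psi>" for \<psi> b
  proof -
    have [measurable]: "(\<lambda>z. indicator (cylinder T) z *\<^sub>R \<psi> z) \<in> borel_measurable lborel"
      using slab_set_integrable(2)[OF T C1_closed_cylinderD(3,4)[OF that]] by (simp add: set_borel_measurable_def)
    have "(\<lambda>z. indicator (cylinder T) z *\<^sub>R (\<psi> z * (\<sigma> z \<bullet> b)))
        = (\<lambda>z. (indicator (cylinder T) z *\<^sub>R \<psi> z) * (\<sigma> z \<bullet> b))" by auto
    also have "\<dots> \<in> borel_measurable lborel" by measurable
    finally have "(LINT z:cylinder T|\<mu>. \<psi> z * (\<sigma> z \<bullet> b))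
        = (LINT z|lborel. norm (w z) *\<^sub>R (indicator (cylinder T) z *\<^sub>R (\<psi> z * (\<sigma> z \<bullet> b))))"
      unfolding set_lebesgue_integral_def \<mu>_def by (intro integral_density) auto
    also have "\<dots> = (LINT z|lborel. indicator (cylinder T) z *\<^sub>R (\<psi> z * (?P z \<bullet> b)))"
    proof (intro Bochner_Integration.integral_cong refl)
      fix z
      have "norm (w z) *\<^sub>R (indicator (cylinder T) z *\<^sub>R (\<psi> z * (\<sigma> z \<bullet> b)))
          = indicator (cylinder T) z * \<psi> z * (norm (w z) * (\<sigma> z \<bullet> b))" by simp
      also have "\<dots> = indicator (cylinder T) z *\<^sub>R (\<psi> z * (?P z \<bullet> b))"
        unfolding w\<sigma> using P'(3)[of z] cylinder_subset_slab[of T] by (auto simp: w_def indicator_def)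
      finally show "norm (w z) *\<^sub>R (indicator (cylinder T) z *\<^sub>R (\<psi> z * (\<sigma> z \<bullet> b)))
          = indicator (cylinder T) z *\<^sub>R (\<psi> z * (?P z \<bullet> b))" .
    qed
    finally show ?thesis by (simp add: set_lebesgue_integral_def)
  qed
  have "derivative_measure T \<phi> \<mu> \<sigma>"
    unfolding derivative_measure_def
  proof (intro conjI allI impI ballI)
    show "finite_measure \<mu>"
    proof (rule finite_measureI)
      have "ennreal (norm (w z)) * indicator UNIV z \<le> ennreal B * indicator (cylinder T) z" for z
        using P'(2)[of z] by (cases "z \<in> cylinder T") (simp_all add: w_def ennreal_leI)
      then have le: "(\<integral>\<^sup>+z. ennreal (norm (w z)) * indicator UNIV z \<partial>lborel)
          \<le> (\<integral>\<^sup>+(z :: real \<times> (real^'n)). ennreal B * indicator (cylinder T) z \<partial>lborel)"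
        by (intro nn_integral_mono)
      have "emeasure \<mu> UNIV \<le> (\<integral>\<^sup>+(z :: real \<times> (real^'n)). ennreal B * indicator (cylinder T) z \<partial>lborel)"
        unfolding \<mu>_def by (subst emeasure_density) (use le in auto)
      also have "\<dots> = ennreal B * ennreal T"
        using T by (subst nn_integral_cmult_indicator) (auto simp: emeasure_cylinder)
      finally show "emeasure \<mu> (space \<mu>) \<noteq> \<infinity>"
        by (auto simp: \<mu>_def top_unique ennreal_mult_eq_top_iff)
    qed
    show "emeasure \<mu> (UNIV - cylinder T) = 0"
    proof -
      have "emeasure \<mu> (UNIV - cylinder T) = (\<integral>\<^sup>+z. ennreal (norm (w z)) * indicator (UNIV - cylinder T) z \<partial>lborel)"
        unfolding \<mu>_def by (intro emeasure_density) auto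
      also have "\<dots> = (\<integral>\<^sup>+(z :: real \<times> (real^'n)). 0 \<partial>lborel)"
        by (intro nn_integral_cong) (auto simp: w_def indicator_def)
      finally show ?thesis by simp
    qed
    show "AE z in \<mu>. norm (\<sigma> z) = 1"
      unfolding \<mu>_def by (subst AE_density) (auto simp: \<sigma>_def)
    fix \<psi> :: "real \<times> (real^'n) \<Rightarrow> real" and b :: "real \<times> (real^'n)"
    assume \<psi>: "test_function T \<psi>" and b: "b \<in> Basis"
    note C1 = test_function_C1(1)[OF T \<psi>]
    have "(LINT z:cylinder T|lborel. \<phi> z * partial_within UNIV b \<psi> z)
        = (LINT z:cylinder T|lborel. \<phi> z * partial_within (slab T) b \<psi> z)"
      by (rule set_lebesgue_integral_cong)
        (simp_all add: test_function_partial[OF T \<psi>])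
    then show "(LINT z:cylinder T|lborel. \<phi> z * partial_within UNIV b \<psi> z)
        = - (LINT z:cylinder T|\<mu>. \<psi> z * (\<sigma> z \<bullet> b))"
      using integration_by_parts[OF T \<phi> C1 b] int[OF C1] test_function_boundary[OF \<psi>] by simp
  qed (auto simp: \<mu>_def)
  moreover have "Lp_torus 1 (\<lambda>x. \<phi> (t, x))" if "t \<in> {0..T}" for t
  proof (rule continuous_Lp_torus)
    show "continuous_on UNIV (\<lambda>x. \<phi> (t, x))"
      by (rule continuous_on_compose2[OF p(3)]) (use that in \<open>auto simp: slab_def intro!: continuous_intros\<close>)
  qed (use p(4)[OF that] in auto)
  ultimately show ?thesis
    unfolding BV_traces_def using T
    by (intro conjI exI[of _ \<mu>] exI[of _ \<sigma>] allI impI ballI)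
      (simp_all add: integration_by_parts[OF T \<phi>] int)
qed

lemma space_grad_slab:
  fixes g :: "real \<times> (real^'n) \<Rightarrow> real"
  shows "space_grad_within (slab T) g z = snd (slab_gradient T g z)"
proof -
  have "space_grad_within (slab T) g z $ i = snd (slab_gradient T g z) $ i" for i
  proof -
    have "(0, axis i 1) \<in> (Basis :: (real \<times> (real^'n)) set)"
      by (auto simp: Basis_prod_def Basis_vec_def)
    from slab_gradient_inner_Basis[OF this, of T g z] show ?thesis
      by (cases "slab_gradient T g z") (simp add: space_grad_within_def inner_axis inner_commute[of "axis i 1"])
  qed
  then show ?thesis by (simp add: vec_eq_iff)
qed

lemma time_deriv_slab:
  fixes g :: "real \<times> (real^'n) \<Rightarrow> real"
  shows "time_deriv_within (slab T) g z = fst (slab_gradient T g z)"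
proof -
  have "(1, 0) \<in> (Basis :: (real \<times> (real^'n)) set)" by (auto simp: Basis_prod_def)
  from slab_gradient_inner_Basis[OF this, of T g z] show ?thesis
    by (cases "slab_gradient T g z") (simp add: time_deriv_within_def)
qed

text \<open>For a C1 function the weak gradient and the subsolution inequality, here an equality, come from
  integration by parts.\<close>

lemma C1_in_K:
  fixes \<phi> :: "real \<times> (real^'n) \<Rightarrow> real"
  assumes T: "0 < T" and exps: "0 < p" "0 < r"
    and H: "\<And>\<xi>. periodic (\<lambda>x. H x \<xi>)" "continuous_on UNIV (\<lambda>(x, \<xi>). H x \<xi>)"
    and \<phi>: "\<phi> \<in> K0 T \<phi>T"
  shows "(\<phi>, \<lambda>z. - time_deriv_within (slab T) \<phi> z + H (snd z) (space_grad_within (slab T) \<phi> z)) \<in> K T p r H \<phi>T"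
proof -
  let ?P = "slab_gradient T \<phi>"
  let ?\<alpha> = "\<lambda>z. - time_deriv_within (slab T) \<phi> z + H (snd z) (space_grad_within (slab T) \<phi> z)"
  let ?w = "space_grad_within (slab T) \<phi>"
  have C1: "C1_closed_cylinder T \<phi>" and \<phi>T: "(\<lambda>x. \<phi> (T, x)) = \<phi>T" using \<phi> by (auto simp: K0_def)
  note p = C1_closed_cylinderD[OF C1] and pp = slab_gradient_periodic[OF T C1]
  have traces: "BV_traces T \<phi> (\<lambda>x. \<phi> (0, x)) \<phi>T" using C1_BV_traces[OF T C1] by (simp add: \<phi>T)
  have \<alpha>: "?\<alpha> = (\<lambda>z. - fst (?P z) + H (snd z) (snd (?P z)))" and w: "?w = (\<lambda>z. snd (?P z))"
    by (simp_all add: fun_eq_iff time_deriv_slab space_grad_slab)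
  have w_cont: "continuous_on (slab T) ?w" unfolding w by (intro continuous_intros p)
  have w_per: "periodic (\<lambda>x. ?w (t, x))" if "t \<in> {0..T}" for t
    unfolding w using pp[OF that] by (simp add: periodic_def)
  have H_cont: "continuous_on (slab T) (\<lambda>z. H (snd z) (?w z))"
  proof -
    have "continuous_on (slab T) (\<lambda>z. (snd z, ?w z))" by (intro continuous_intros w_cont)
    from continuous_on_compose2[OF H(2) this] show ?thesis by simp
  qed
  have H_per: "periodic (\<lambda>x. H x (?w (t, x)))" if "t \<in> {0..T}" for t
    using w_per[OF that] H(1) by (simp add: periodic_def)
  have \<alpha>_cont: "continuous_on (slab T) ?\<alpha>"
    using H_cont[unfolded w] unfolding \<alpha> by (intro continuous_intros p)
  have \<alpha>_per: "periodic (\<lambda>x. ?\<alpha> (t, x))" if "t \<in> {0..T}" for t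
    using H_per[OF that] pp[OF that] by (simp add: periodic_def time_deriv_slab space_grad_slab)
  have "BV_cylinder T \<phi>"
    unfolding BV_cylinder_def
    using slab_Lp_cylinder[OF T _ p(3,4)] traces by (auto simp: BV_traces_def)
  moreover have "Lp_cylinder T p ?\<alpha>"
    by (rule slab_Lp_cylinder[OF T exps(1) \<alpha>_cont]) (use \<alpha>_per in simp)
  moreover have "Lp_cylinder T r ?w" by (rule slab_Lp_cylinder[OF T exps(2) w_cont w_per])
  moreover have "weak_space_gradient T \<phi> ?w"
    unfolding weak_space_gradient_def
  proof (intro allI impI)
    fix \<psi> :: "real \<times> (real^'n) \<Rightarrow> real" and i assume \<psi>: "test_function T \<psi>"
    have b: "(0, axis i 1) \<in> (Basis :: (real \<times> (real^'n)) set)"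
      by (auto simp: Basis_prod_def Basis_vec_def)
    have "(LINT z:cylinder T|lborel. \<phi> z * space_grad_within UNIV \<psi> z $ i)
        = (LINT z:cylinder T|lborel. \<phi> z * partial_within (slab T) (0, axis i 1) \<psi> z)"
      by (rule set_lebesgue_integral_cong)
        (simp_all add: test_function_partial[OF T \<psi>] space_grad_within_def)
    also have "\<dots> = - (LINT z:cylinder T|lborel. \<psi> z * (?P z \<bullet> (0, axis i 1)))"
      using integration_by_parts[OF T C1 test_function_C1(1)[OF T \<psi>] b] by simp
    also have "(\<lambda>z. \<psi> z * (?P z \<bullet> (0, axis i 1))) = (\<lambda>z. ?w z $ i * \<psi> z)"
      unfolding w
    proof
      fix z show "\<psi> z * (?P z \<bullet> (0, axis i 1)) = snd (?P z) $ i * \<psi> z"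
        by (cases "?P z") (simp add: inner_axis)
    qed
    finally show "(LINT z:cylinder T|lborel. \<phi> z * space_grad_within UNIV \<psi> z $ i)
       = - (LINT z:cylinder T|lborel. ?w z $ i * \<psi> z)" .
  qed
  moreover have "HJ_subsolution T H \<phi> ?w ?\<alpha>"
    unfolding HJ_subsolution_def
  proof (intro allI impI, elim conjE)
    fix \<psi> :: "real \<times> (real^'n) \<Rightarrow> real" assume \<psi>: "test_function T \<psi>"
    note q = C1_closed_cylinderD[OF test_function_C1(1)[OF T \<psi>]]
    have b: "(1, 0) \<in> (Basis :: (real \<times> (real^'n)) set)" by (auto simp: Basis_prod_def)
    have "(LINT z:cylinder T|lborel. \<phi> z * time_deriv_within UNIV \<psi> z)
        = (LINT z:cylinder T|lborel. \<phi> z * partial_within (slab T) (1, 0) \<psi> z)"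
      by (rule set_lebesgue_integral_cong)
        (simp_all add: test_function_partial[OF T \<psi>] time_deriv_within_def)
    also have "\<dots> = - (LINT z:cylinder T|lborel. \<psi> z * (?P z \<bullet> (1, 0)))"
      using integration_by_parts[OF T C1 test_function_C1(1)[OF T \<psi>] b] test_function_boundary[OF \<psi>] by simp
    finally have 1: "(LINT z:cylinder T|lborel. \<phi> z * time_deriv_within UNIV \<psi> z)
        = - (LINT z:cylinder T|lborel. \<psi> z * (?P z \<bullet> (1, 0)))" .
    have "(LINT z:cylinder T|lborel. H (snd z) (?w z) * \<psi> z) - (LINT z:cylinder T|lborel. \<psi> z * (?P z \<bullet> (1, 0)))
        = (LINT z:cylinder T|lborel. H (snd z) (?w z) * \<psi> z - \<psi> z * (?P z \<bullet> (1, 0)))"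
    proof (rule set_integral_diff(2)[symmetric])
      show "set_integrable lborel (cylinder T) (\<lambda>z. H (snd z) (?w z) * \<psi> z)"
        by (rule slab_set_integrable(1)[OF T])
          (use H_per q(4) in \<open>auto intro!: continuous_intros H_cont q simp: periodic_def\<close>)
      show "set_integrable lborel (cylinder T) (\<lambda>z. \<psi> z * (?P z \<bullet> (1, 0)))"
        by (rule slab_set_integrable(1)[OF T])
          (use pp q(4) in \<open>auto intro!: continuous_intros p q simp: periodic_def\<close>)
    qed
    also have "\<dots> = (LINT z:cylinder T|lborel. ?\<alpha> z * \<psi> z)"
    proof -
      have "H (snd z) (?w z) * \<psi> z - \<psi> z * (?P z \<bullet> (1, 0)) = ?\<alpha> z * \<psi> z" for z
        unfolding time_deriv_slab space_grad_slab by (cases "?P z") (simp add: algebra_simps)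
      then show ?thesis by simp
    qed
    finally show "(LINT z:cylinder T|lborel. \<phi> z * time_deriv_within UNIV \<psi> z)
        + (LINT z:cylinder T|lborel. H (snd z) (?w z) * \<psi> z) \<le> (LINT z:cylinder T|lborel. ?\<alpha> z * \<psi> z)"
      using 1 by simp
  qed
  ultimately show ?thesis unfolding K_def using traces by blast
qed

section \<open>Recovering a trace from averages near the boundary\<close>

text \<open>The kernel is a probability density concentrated near the lattice translates of \<open>x\<close>, so an average
  inherits every bound that \<open>h\<close> satisfies near those points.\<close>

lemma space_average_close:
  fixes h :: "real^'n \<Rightarrow> real"
  assumes N: "1 \<le> N" and h: "integrable cellM h"
    and close: "\<And>y k. k \<in> int_lattice \<Longrightarrow> norm (x - y - k) \<le> 2 * real CARD('n) / N \<Longrightarrow> \<bar>h y - c\<bar> \<le> \<eta>"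
    and \<eta>: "0 \<le> \<eta>"
  shows "\<bar>(LINT y|cellM. space_bump N (x - y) * h y) - c\<bar> \<le> \<eta>"
proof -
  note [measurable] = h
  define B where "B = (6 / flat 0 (1/2)) ^ CARD('n) * N ^ CARD('n)"
  have X: "0 \<le> space_bump N (x - y)" "space_bump N (x - y) \<le> B" for y :: "real^'n"
    using space_bump_nonneg[OF N] space_bump_bound[OF N, of "x - y"] by (simp_all add: B_def)
  have iX: "integrable cellM (\<lambda>y. space_bump N (x - y))"
    by (rule integrable_cellM_bounded[of _ B]) (use X in auto)
  have iXh: "integrable cellM (\<lambda>y. space_bump N (x - y) * h y)"
  proof (rule Bochner_Integration.integrable_bound[of cellM "\<lambda>y. B * h y"])
    show "AE y in cellM. norm (space_bump N (x - y) * h y) \<le> norm (B * h y)"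
    proof (rule AE_I2)
      fix y :: "real^'n"
      have "\<bar>space_bump N (x - y)\<bar> \<le> \<bar>B\<bar>" using X[of y] by simp
      then show "norm (space_bump N (x - y) * h y) \<le> norm (B * h y)"
        by (simp add: abs_mult mult_right_mono)
    qed
  qed (use h in auto)
  have one: "(LINT y|cellM. space_bump N (x - y)) = 1" by (rule integral_space_bump(2)[OF N])
  have "(LINT y|cellM. space_bump N (x - y) * h y) - c
      = (LINT y|cellM. space_bump N (x - y) * h y) - (LINT y|cellM. space_bump N (x - y) * c)"
    by (simp add: one)
  also have "\<dots> = (LINT y|cellM. space_bump N (x - y) * h y - space_bump N (x - y) * c)"
    by (rule Bochner_Integration.integral_diff[symmetric]) (use iX iXh in auto)
  also have "\<bar>\<dots>\<bar> \<le> (LINT y|cellM. \<bar>space_bump N (x - y) * h y - space_bump N (x - y) * c\<bar>)"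
    by (rule integral_abs_bound)
  also have "\<dots> \<le> (LINT y|cellM. space_bump N (x - y) * \<eta>)"
  proof (rule Bochner_Integration.integral_mono)
    fix y :: "real^'n"
    have "space_bump N (x - y) * \<bar>h y - c\<bar> \<le> space_bump N (x - y) * \<eta>"
    proof (cases "space_bump N (x - y) = 0")
      case False
      then obtain k where "k \<in> int_lattice" "norm (x - y - k) \<le> 2 * real CARD('n) / N"
        by (rule space_bump_support[OF N])
      then have "\<bar>h y - c\<bar> \<le> \<eta>" by (rule close)
      then show ?thesis using X by (intro mult_left_mono) auto
    qed simp
    then show "\<bar>space_bump N (x - y) * h y - space_bump N (x - y) * c\<bar> \<le> space_bump N (x - y) * \<eta>"
      using X by (simp add: right_diff_distrib[symmetric] abs_mult)
  qed (use iX iXh in auto)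
  also have "\<dots> = \<eta>" by (simp add: one)
  finally show ?thesis .
qed

definition space_mollify :: "nat \<Rightarrow> (real^'n \<Rightarrow> real) \<Rightarrow> real^'n \<Rightarrow> real" where
  "space_mollify n h x = (LINT y|cellM. space_bump (real (Suc n)) (x - y) * h y)"

lemma eventually_small_scale:
  assumes "d > 0" shows "\<forall>\<^sub>F n in sequentially. c / real (Suc n) < d"
proof -
  have "(\<lambda>n. c * inverse (real (Suc n))) \<longlonglongrightarrow> c * 0"
    by (intro tendsto_mult tendsto_const LIMSEQ_inverse_real_of_nat)
  then show ?thesis using assms order_tendstoD(2)[of _ 0 sequentially d] by (simp add: divide_inverse)
qed

lemma space_mollify_uniform:
  fixes h :: "real^'n \<Rightarrow> real"
  assumes h: "periodic h" "continuous_on UNIV h" and "\<eta> > 0"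
  shows "\<forall>\<^sub>F n in sequentially. \<forall>x. \<bar>space_mollify n h x - h x\<bar> \<le> \<eta>"
proof -
  obtain d where d: "d > 0" "\<And>x y k. k \<in> int_lattice \<Longrightarrow> norm (x - y - k) < d \<Longrightarrow> norm (h x - h y) < \<eta>"
    using periodic_uniform[OF h \<open>\<eta> > 0\<close>] by metis
  obtain B where "\<And>x. norm (h x) \<le> B" using periodic_bounded[OF h] by metis
  then have int: "integrable cellM h"
    by (intro integrable_cellM_bounded[of _ B] borel_measurable_continuous_onI h(2)) auto
  show ?thesis
    using eventually_small_scale[OF d(1), of "2 * real CARD('n)"]
  proof (rule eventually_mono, intro allI)
    fix n x assume n: "2 * real CARD('n) / real (Suc n) < d"
    show "\<bar>space_mollify n h x - h x\<bar> \<le> \<eta>"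
      unfolding space_mollify_def
    proof (rule space_average_close[OF _ int])
      fix y k :: "real^'n"
      assume "k \<in> int_lattice" "norm (x - y - k) \<le> 2 * real CARD('n) / real (Suc n)"
      then have "norm (h x - h y) < \<eta>" using n by (intro d(2)) auto
      then show "\<bar>h y - h x\<bar> \<le> \<eta>" by simp
    qed (use \<open>\<eta> > 0\<close> in auto)
  qed
qed

lemma space_gradient_periodic:
  fixes g :: "real^'n \<Rightarrow> real"
  assumes "smooth g" "periodic g"
  shows "periodic (gradient g)"
  unfolding periodic_def gradient_def
  using partial_translation_invariant[of g, OF smooth_differentiable[OF assms(1)]] assms(2)
  by (simp add: periodic_def)

lemma gradient_eqI:
  assumes "(g has_derivative (\<lambda>h. h \<bullet> v)) (at z)" shows "gradient g z = v"
  by (simp add: gradient_def partial_within_UNIV[OF assms] inner_commute[of _ v] euclidean_representation)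

lemma space_mollify_C1:
  fixes h :: "real^'n \<Rightarrow> real"
  assumes h: "integrable cellM h"
  shows "(space_mollify n h has_derivative (\<lambda>k. k \<bullet> gradient (space_mollify n h) x)) (at x)"
    "continuous_on UNIV (gradient (space_mollify n h))" "periodic (space_mollify n h)"
proof -
  let ?X = "space_bump (real (Suc n)) :: real^'n \<Rightarrow> real"
  note X = smooth_space_bump[of "real (Suc n)", where 'n = 'n] periodic_space_bump[of "real (Suc n)", where 'a = 'n]
  note GX = space_gradient_periodic[OF X] continuous_on_gradient[OF X(1), of UNIV]
  obtain B1 where B1: "\<And>x. norm (?X x) \<le> B1"
    using periodic_bounded[OF X(2) smooth_continuous_on[OF X(1)]] by metis
  obtain B2 where B2: "\<And>x. norm (gradient ?X x) \<le> B2" using periodic_bounded[OF GX] by metis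
  interpret convolution_kernel ?X "gradient ?X" "max B1 B2"
  proof
    show "uniformly_continuous_on UNIV (gradient ?X)"
      unfolding uniformly_continuous_on_def
    proof (intro allI impI)
      fix e :: real assume "e > 0"
      then obtain d where "d > 0" "\<And>x y k. k \<in> int_lattice \<Longrightarrow> norm (x - y - k) < d \<Longrightarrow> norm (gradient ?X x - gradient ?X y) < e"
        using periodic_uniform[OF GX] by metis
      then show "\<exists>d>0. \<forall>x\<in>UNIV. \<forall>x'\<in>UNIV. dist x' x < d \<longrightarrow> dist (gradient ?X x') (gradient ?X x) < e"
        using int_lattice_zero diff_zero[of "x' - x" for x' x :: "real^'n"]
        unfolding dist_norm by (metis (no_types))
    qed
    show "\<bar>?X z\<bar> \<le> max B1 B2" "norm (gradient ?X z) \<le> max B1 B2" for z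
      using B1[of z] B2[of z] by auto
  qed (rule smooth_has_gradient[OF X(1)])
  have "space_mollify n h (x + k) = space_mollify n h x" if "k \<in> int_lattice" for x k
  proof -
    have "?X (x + k - y) = ?X (x - y)" for y
      using X(2) that unfolding periodic_def by (metis add_diff_eq diff_add_eq)
    then show ?thesis by (simp add: space_mollify_def)
  qed
  then show "periodic (space_mollify n h)" by (simp add: periodic_def)
  let ?G = "\<lambda>z. LINT y|cellM. h y *\<^sub>R gradient ?X (z - y)"
  have D: "(space_mollify n h has_derivative (\<lambda>k. k \<bullet> ?G x)) (at x)" for x
    using has_derivative_convolution[OF sets_cellM h] by (simp add: space_mollify_def[abs_def])
  have "gradient (space_mollify n h) = ?G"
    by (rule ext) (rule gradient_eqI[OF D])
  then show "(space_mollify n h has_derivative (\<lambda>k. k \<bullet> gradient (space_mollify n h) x)) (at x)"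
    "continuous_on UNIV (gradient (space_mollify n h))"
    using D continuous_convolution_gradient[OF sets_cellM h] by simp_all
qed

text \<open>An antiderivative of the time kernel serves as a cut-off that descends from 1 to 0 in a short
  time.\<close>

definition time_tail :: "real \<Rightarrow> real \<Rightarrow> real \<Rightarrow> real" where
  "time_tail T N t = (LINT s|timeM t T. time_bump N s)"

lemma time_tail_eq: "time_tail T N t = (LINT s|lborel. indicator {t<..<T} s * time_bump N s)"
proof -
  have "timeM t T = density lborel (\<lambda>s. ennreal (indicator {t<..<T} s))"
    by (simp add: timeM_def ennreal_indicator)
  then show ?thesis by (simp add: time_tail_def integral_density)
qed

lemma time_tail_derivative:
  assumes "t \<in> {0..T}"
  shows "(time_tail T N has_real_derivative (- time_bump N t)) (at t within {0..T})"
proof -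
  have cont: "continuous_on A (time_bump N)" for A by (rule smooth_continuous_on[OF smooth_time_bump])
  obtain F where F: "\<And>t. t \<in> {0..T} \<Longrightarrow> (F has_vector_derivative time_bump N t) (at t within {0..T})"
    by (rule antiderivative_continuous[OF cont]) blast
  have eq: "time_tail T N t = F T - F t" if t: "t \<in> {0..T}" for t
    unfolding time_tail_def
  proof (rule timeM_FTC)
    show "(F has_real_derivative time_bump N s) (at s within {t..T})" if s: "s \<in> {t..T}" for s
    proof -
      have "(F has_real_derivative time_bump N s) (at s within {0..T})"
        using F[of s] s t by (simp add: has_real_derivative_iff_has_vector_derivative)
      then show ?thesis by (rule has_field_derivative_subset) (use t in auto)
    qed
  qed (use t cont in auto)
  have "((\<lambda>t. F T - F t) has_real_derivative (- time_bump N t)) (at t within {0..T})"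
    using F[OF assms]
    by (auto intro!: derivative_eq_intros simp: has_real_derivative_iff_has_vector_derivative[symmetric])
  then show ?thesis
    by (rule has_field_derivative_transform_within[OF _ zero_less_one assms]) (simp add: eq)
qed

lemma time_tail_bounds:
  assumes N: "0 < N"
  shows "0 \<le> time_tail T N t" "time_tail T N t \<le> 1"
proof -
  have int: "integrable lborel (\<lambda>s. indicator {t<..<T} s * time_bump N s)"
    by (rule Bochner_Integration.integrable_bound[OF integrable_time_bump[OF N]])
      (auto simp: indicator_def)
  have nn: "0 \<le> time_bump N s" for s using N by (simp add: time_bump_nonneg)
  show "0 \<le> time_tail T N t"
    unfolding time_tail_eq using nn by (intro Bochner_Integration.integral_nonneg) auto
  have "time_tail T N t \<le> (LINT s|lborel. time_bump N s)"
    unfolding time_tail_eq using nn int integrable_time_bump[OF N]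
    by (intro Bochner_Integration.integral_mono) (auto simp: indicator_def)
  then show "time_tail T N t \<le> 1" using integral_time_bump[OF N, of 0] by simp
qed

lemma time_tail_zero:
  assumes "0 < N" "1 / N \<le> t" shows "time_tail T N t = 0"
proof -
  have "indicator {t<..<T} s * time_bump N s = 0" for s
    using time_bump_support(3)[OF assms(1), of s] assms(2) by (force simp: indicator_def)
  then show ?thesis unfolding time_tail_eq by (simp only: Bochner_Integration.integral_zero)
qed

lemma time_tail_one:
  assumes "0 < N" "1 / N \<le> T" shows "time_tail T N 0 = 1"
proof -
  have "indicator {0<..<T} s * time_bump N s = time_bump N s" for s
    using time_bump_support(2,3)[OF assms(1), of s] assms(2) by (force simp: indicator_def)
  then show ?thesis
    unfolding time_tail_eq using integral_time_bump[OF assms(1), of 0] by (simp only: diff_zero)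
qed

lemma time_tail_end: "time_tail T N T = 0"
  unfolding time_tail_eq by simp

lemma Lp_torus_1_integrable:
  assumes "Lp_torus 1 (g :: real^'n \<Rightarrow> real)"
  shows "integrable lborel (\<lambda>x. indicator unit_cell x * g x)"
proof -
  have m: "(\<lambda>x. indicator unit_cell x *\<^sub>R g x) \<in> borel_measurable lborel"
    and i: "integrable lborel (\<lambda>x. indicator unit_cell x *\<^sub>R (\<bar>g x\<bar> powr 1))"
    using assms by (simp_all add: Lp_torus_def set_borel_measurable_def set_integrable_def)
  have "integrable lborel (\<lambda>x. indicator unit_cell x *\<^sub>R g x)"
    by (rule Bochner_Integration.integrable_bound[OF i m]) (auto simp: indicator_def)
  then show ?thesis by simp
qed

lemma derivative_measureD:
  assumes "derivative_measure T \<phi> \<mu> \<sigma>"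
  shows "sets \<mu> = sets borel" "finite_measure \<mu>" "\<sigma> \<in> borel_measurable borel" "AE z in \<mu>. norm (\<sigma> z) = 1"
proof -
  note D = assms[unfolded derivative_measure_def]
  show "sets \<mu> = sets borel" by (rule D[THEN conjunct1])
  show "finite_measure \<mu>" by (rule D[THEN conjunct2, THEN conjunct1])
  show "\<sigma> \<in> borel_measurable borel"
    by (rule D[THEN conjunct2, THEN conjunct2, THEN conjunct2, THEN conjunct1])
  show "AE z in \<mu>. norm (\<sigma> z) = 1"
    by (rule D[THEN conjunct2, THEN conjunct2, THEN conjunct2, THEN conjunct2, THEN conjunct1])
qed

text \<open>Testing the Gauss--Green formula with the cut-off times the mollified weight turns averages
  of a BV function over short times into its initial trace; the interior term is the mass that the
  derivative measure puts on a thin layer, which vanishes in the limit.\<close>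

lemma trace_limit:
  fixes \<phi> :: "real \<times> (real^'n) \<Rightarrow> real"
  assumes T: "0 < T" and tr: "BV_traces T \<phi> g0 gT" and m: "periodic m" "continuous_on UNIV m"
  shows "(\<lambda>n. LINT z:cylinder T|lborel. \<phi> z * (time_bump (real (Suc n)) (fst z) * space_mollify n m (snd z)))
    \<longlonglongrightarrow> (LINT x:unit_cell|lborel. g0 x * m x)"
proof -
  obtain B where B: "\<And>x. norm (m x) \<le> B" using periodic_bounded[OF m] by metis
  have im: "integrable cellM m"
    by (intro integrable_cellM_bounded[of _ B] borel_measurable_continuous_onI m(2) B)
  have g0: "Lp_torus 1 g0" using tr by (simp add: BV_traces_def)
  from tr obtain \<mu> \<sigma> where \<mu>: "derivative_measure T \<phi> \<mu> \<sigma>"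
    and GG': "\<forall>\<psi>. C1_closed_cylinder T \<psi> \<longrightarrow> (\<forall>b\<in>Basis.
          (LINT z:cylinder T|lborel. \<phi> z * partial_within (slab T) b \<psi> z)
            = - (LINT z:cylinder T|\<mu>. \<psi> z * (\<sigma> z \<bullet> b))
              + fst b * (LINT x:unit_cell|lborel. \<psi> (T, x) * gT x)
              - fst b * (LINT x:unit_cell|lborel. \<psi> (0, x) * g0 x))"
    unfolding BV_traces_def by (elim conjE exE)
  note GG = GG'[rule_format]
  have sets_\<mu> [measurable_cong]: "sets \<mu> = sets borel" and fin: "finite_measure \<mu>"
    and [measurable]: "\<sigma> \<in> borel_measurable borel" and \<sigma>1: "AE z in \<mu>. norm (\<sigma> z) = 1"
    by (fact derivative_measureD[OF \<mu>])+
  interpret \<mu>: finite_measure \<mu> by (rule fin)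
  define S where "S n = time_tail T (real (Suc n))" for n
  have S: "\<And>n t. t \<in> {0..T} \<Longrightarrow> (S n has_real_derivative (- time_bump (real (Suc n)) t)) (at t within {0..T})"
      "\<And>n t. 0 \<le> S n t \<and> S n t \<le> 1" "\<And>n t. 1 / real (Suc n) \<le> t \<Longrightarrow> S n t = 0"
      "\<And>n. 1 / real (Suc n) \<le> T \<Longrightarrow> S n 0 = 1" "\<And>n. S n T = 0"
    unfolding S_def
    by (simp_all add: time_tail_derivative time_tail_bounds time_tail_zero time_tail_one time_tail_end
        del: of_nat_Suc)
  define M where "M n = space_mollify n m" for n
  define G where "G n = gradient (M n)" for n
  have G: "\<And>n x. (M n has_derivative (\<lambda>k. k \<bullet> G n x)) (at x)" "\<And>n. continuous_on UNIV (G n)"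
    "\<And>n. periodic (M n)" unfolding M_def G_def by (rule space_mollify_C1[OF im])+
  have M_cont: "continuous_on A (M n)" for A n
    using has_derivative_continuous[OF G(1)] by (intro continuous_at_imp_continuous_on) blast
  have uni: "\<forall>\<^sub>F n in sequentially. \<forall>x. \<bar>M n x - m x\<bar> \<le> \<eta>" if "\<eta> > 0" for \<eta>
    using space_mollify_uniform[OF m that] by (simp add: M_def)
  define \<psi> where "\<psi> n z = - (S n (fst z) * M n (snd z))" for n and z :: "real \<times> (real^'n)"
  define R where "R n z = time_bump (real (Suc n)) (fst z) * M n (snd z)" for n and z :: "real \<times> (real^'n)"
  let ?G = "\<lambda>n z. (R n z, - (S n (fst z)) *\<^sub>R G n (snd z))"
  have S_cont: "continuous_on {0..T} (S n)" for n
    using S(1) by (intro DERIV_continuous_on) auto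
  have der: "(\<psi> n has_derivative (\<lambda>h. h \<bullet> ?G n z)) (at z within slab T)" if z: "z \<in> slab T" for n z
  proof -
    have t: "fst z \<in> {0..T}" using z by (auto simp: slab_def)
    have "((\<lambda>z. S n (fst z)) has_derivative (\<lambda>h. - time_bump (real (Suc n)) (fst z) * fst h)) (at z within slab T)"
      using t z by (intro has_derivative_in_compose2[where g = "S n" and t = "{0..T}" and f = fst and x = z
          and g' = "\<lambda>t h. - time_bump (real (Suc n)) t * h" and f' = fst] S(1)[unfolded has_field_derivative_def])
        (auto simp: slab_def intro!: derivative_eq_intros)
    moreover have "((\<lambda>z. M n (snd z)) has_derivative (\<lambda>h. snd h \<bullet> G n (snd z))) (at z within slab T)"
      by (rule has_derivative_compose[OF _ G(1)]) (auto intro!: derivative_eq_intros)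
    ultimately have "(\<psi> n has_derivative (\<lambda>h. - (S n (fst z) * (snd h \<bullet> G n (snd z))
        + (- time_bump (real (Suc n)) (fst z) * fst h) * M n (snd z)))) (at z within slab T)"
      unfolding \<psi>_def[abs_def] by (intro has_derivative_minus has_derivative_mult)
    then show ?thesis
      by (rule has_derivative_eq_rhs) (auto simp: R_def inner_prod_def fun_eq_iff)
  qed
  have S_cont': "continuous_on (slab T) (\<lambda>z. S n (fst z))" for n
    by (rule continuous_on_compose2[OF S_cont]) (auto simp: slab_def intro!: continuous_intros)
  have cont: "continuous_on (slab T) (?G n)" for n
    unfolding R_def
    by (intro continuous_intros S_cont' continuous_on_compose2[OF G(2)] continuous_on_compose2[OF M_cont[of UNIV]]
        continuous_on_compose2[OF smooth_continuous_on[OF smooth_time_bump, of UNIV]]) auto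
  have C1: "C1_closed_cylinder T (\<psi> n)" for n
    by (rule C1_closed_cylinderI[OF T der cont]) (use G(3) in \<open>auto simp: \<psi>_def periodic_def\<close>)
  have b: "(1, 0) \<in> (Basis :: (real \<times> (real^'n)) set)" by (auto simp: Basis_prod_def)
  have eq: "(LINT z:cylinder T|lborel. \<phi> z * R n z)
      = - (LINT z:cylinder T|\<mu>. \<psi> n z * (\<sigma> z \<bullet> (1, 0))) + (LINT x:unit_cell|lborel. M n x * g0 x)"
    if n: "1 / real (Suc n) \<le> T" for n
  proof -
    have "(LINT z:cylinder T|lborel. \<phi> z * R n z)
        = (LINT z:cylinder T|lborel. \<phi> z * partial_within (slab T) (1, 0) (\<psi> n) z)"
      by (rule set_lebesgue_integral_cong)
        (use C1_slabI(2)[OF T der cont] cylinder_subset_slab[of T] in auto)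
    also have "\<dots> = - (LINT z:cylinder T|\<mu>. \<psi> n z * (\<sigma> z \<bullet> (1, 0)))
        + (LINT x:unit_cell|lborel. \<psi> n (T, x) * gT x) - (LINT x:unit_cell|lborel. \<psi> n (0, x) * g0 x)"
      using GG[OF C1 b, of n] by simp
    also have "(LINT x:unit_cell|lborel. \<psi> n (T, x) * gT x) = 0" by (simp add: \<psi>_def S)
    also have "(LINT x:unit_cell|lborel. \<psi> n (0, x) * g0 x) = - (LINT x:unit_cell|lborel. M n x * g0 x)"
      by (simp add: \<psi>_def S(4)[OF n] set_lebesgue_integral_def)
    finally show ?thesis by simp
  qed
  have lim1: "(\<lambda>n. LINT z:cylinder T|\<mu>. \<psi> n z * (\<sigma> z \<bullet> (1, 0))) \<longlonglongrightarrow> 0"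
  proof -
    obtain n0 where n0: "\<And>n x. n \<ge> n0 \<Longrightarrow> \<bar>M n x - m x\<bar> \<le> 1"
      using uni[of 1] unfolding eventually_sequentially by (meson zero_less_one)
    have M_bound: "\<bar>M (n + n0) x\<bar> \<le> B + 1" for n x using n0[of "n + n0" x] B[of x] by auto
    have "(\<lambda>n. LINT z:cylinder T|\<mu>. \<psi> (n + n0) z * (\<sigma> z \<bullet> (1, 0))) \<longlonglongrightarrow> (LINT z|\<mu>. 0)"
      unfolding set_lebesgue_integral_def
    proof (rule integral_dominated_convergence[where w = "\<lambda>z. B + 1"])
      show "(\<lambda>z. indicator (cylinder T) z *\<^sub>R (\<psi> (n + n0) z * (\<sigma> z \<bullet> (1, 0)))) \<in> borel_measurable \<mu>" for n
      proof -
        have [measurable]: "(\<lambda>z. indicator (cylinder T) z *\<^sub>R \<psi> (n + n0) z) \<in> borel_measurable borel"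
          using slab_set_integrable(2)[OF T C1_closed_cylinderD(3,4)[OF C1]] by (simp add: set_borel_measurable_def)
        have "(\<lambda>z. (indicator (cylinder T) z *\<^sub>R \<psi> (n + n0) z) * (\<sigma> z \<bullet> (1, 0))) \<in> borel_measurable \<mu>"
          by measurable
        then show ?thesis by (simp add: mult.assoc)
      qed
      show "AE z in \<mu>. (\<lambda>n. indicator (cylinder T) z *\<^sub>R (\<psi> (n + n0) z * (\<sigma> z \<bullet> (1, 0)))) \<longlonglongrightarrow> 0"
      proof (rule AE_I2)
        fix z :: "real \<times> (real^'n)"
        have "\<forall>\<^sub>F n in sequentially. indicator (cylinder T) z *\<^sub>R (\<psi> (n + n0) z * (\<sigma> z \<bullet> (1, 0))) = 0"
        proof (cases "z \<in> cylinder T")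
          case True
          then have t: "0 < fst z" "fst z \<in> {0..T}" by (auto simp: cylinder_def)
          obtain n1 where n1: "\<And>n. n \<ge> n1 \<Longrightarrow> 1 / real (Suc n) < fst z"
            using eventually_small_scale[OF t(1), of 1] unfolding eventually_sequentially by blast
          have "\<forall>\<^sub>F n in sequentially. 1 / real (Suc (n + n0)) < fst z"
            by (rule eventually_sequentiallyI[of n1], rule n1) (rule trans_le_add1)
          then show ?thesis
            by (rule eventually_mono) (use S(3) in \<open>auto simp: \<psi>_def less_imp_le\<close>)
        qed simp
        then show "(\<lambda>n. indicator (cylinder T) z *\<^sub>R (\<psi> (n + n0) z * (\<sigma> z \<bullet> (1, 0)))) \<longlonglongrightarrow> 0"
          by (rule tendsto_eventually)
      qed
      show "AE z in \<mu>. norm (indicator (cylinder T) z *\<^sub>R (\<psi> (n + n0) z * (\<sigma> z \<bullet> (1, 0)))) \<le> B + 1" for n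
        using \<sigma>1
      proof (rule eventually_mono)
        fix z assume \<sigma>z: "norm (\<sigma> z) = 1"
        have B1: "0 \<le> B + 1" using B[of 0] norm_ge_zero[of "m 0"] by linarith
        show "norm (indicator (cylinder T) z *\<^sub>R (\<psi> (n + n0) z * (\<sigma> z \<bullet> (1, 0)))) \<le> B + 1"
        proof (cases "z \<in> cylinder T")
          case True
          then have t: "fst z \<in> {0..T}" by (auto simp: cylinder_def)
          have "\<bar>S (n + n0) (fst z)\<bar> * \<bar>M (n + n0) (snd z)\<bar> \<le> 1 * (B + 1)"
            using S(2)[of "n + n0" "fst z"] M_bound[of n "snd z"] by (intro mult_mono) auto
          moreover have "\<bar>\<sigma> z \<bullet> (1, 0)\<bar> \<le> 1"
            using Cauchy_Schwarz_ineq2[of "\<sigma> z" "(1, 0)"] \<sigma>z by (simp add: norm_Pair)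
          ultimately have "(\<bar>S (n + n0) (fst z)\<bar> * \<bar>M (n + n0) (snd z)\<bar>) * \<bar>\<sigma> z \<bullet> (1, 0)\<bar> \<le> (1 * (B + 1)) * 1"
            by (rule mult_mono) (use B1 in auto)
          then show ?thesis using True by (simp add: \<psi>_def abs_mult)
        qed (use B1 in simp)
      qed
    qed (auto simp: \<mu>.emeasure_finite less_top[symmetric])
    then show ?thesis
      using LIMSEQ_offset[of "\<lambda>n. LINT z:cylinder T|\<mu>. \<psi> n z * (\<sigma> z \<bullet> (1, 0))" n0 0] by simp
  qed
  have lim2: "(\<lambda>n. LINT x:unit_cell|lborel. M n x * g0 x) \<longlonglongrightarrow> (LINT x:unit_cell|lborel. g0 x * m x)"
  proof (rule LIMSEQ_I)
    fix e :: real assume e: "e > 0"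
    note ig = Lp_torus_1_integrable[OF g0]
    define I where "I = (LINT x|lborel. \<bar>indicator unit_cell x * g0 x\<bar>)"
    have I: "0 \<le> I" unfolding I_def by simp
    have M_int: "integrable lborel (\<lambda>x. h x * (indicator unit_cell x * g0 x))"
      if h: "periodic h" "continuous_on UNIV h" for h
    proof -
      obtain C where C: "\<And>x. norm (h x) \<le> C" using periodic_bounded[OF h] by metis
      have [measurable]: "h \<in> borel_measurable borel" by (rule borel_measurable_continuous_onI[OF h(2)])
      show ?thesis
      proof (rule Bochner_Integration.integrable_bound[of lborel "\<lambda>x. C * (indicator unit_cell x * g0 x)"])
        show "AE x in lborel. norm (h x * (indicator unit_cell x * g0 x)) \<le> norm (C * (indicator unit_cell x * g0 x))"
        proof (rule AE_I2)
          fix x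
          have "\<bar>h x\<bar> \<le> \<bar>C\<bar>" using C[of x] by simp
          then show "norm (h x * (indicator unit_cell x * g0 x)) \<le> norm (C * (indicator unit_cell x * g0 x))"
            by (simp add: abs_mult mult_right_mono)
        qed
      qed (use ig borel_measurable_integrable[OF ig] in auto)
    qed
    have "e / (I + 1) > 0" using e I by simp
    from uni[OF this] obtain n0 where n0: "\<And>n x. n \<ge> n0 \<Longrightarrow> \<bar>M n x - m x\<bar> \<le> e / (I + 1)"
      unfolding eventually_sequentially by blast
    have "norm ((LINT x:unit_cell|lborel. M n x * g0 x) - (LINT x:unit_cell|lborel. g0 x * m x)) < e"
      if "n \<ge> n0" for n
    proof -
      have "(LINT x:unit_cell|lborel. M n x * g0 x) - (LINT x:unit_cell|lborel. g0 x * m x)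
          = (LINT x|lborel. M n x * (indicator unit_cell x * g0 x) - m x * (indicator unit_cell x * g0 x))"
        unfolding set_lebesgue_integral_def
        by (subst Bochner_Integration.integral_diff[OF M_int[OF G(3) M_cont] M_int[OF m]]) (simp add: mult_ac)
      also have "norm \<dots> \<le> (LINT x|lborel. norm (M n x * (indicator unit_cell x * g0 x) - m x * (indicator unit_cell x * g0 x)))"
        by (rule integral_norm_bound)
      also have "\<dots> \<le> (LINT x|lborel. (e / (I + 1)) * \<bar>indicator unit_cell x * g0 x\<bar>)"
      proof (rule Bochner_Integration.integral_mono)
        fix x
        show "norm (M n x * (indicator unit_cell x * g0 x) - m x * (indicator unit_cell x * g0 x))
            \<le> (e / (I + 1)) * \<bar>indicator unit_cell x * g0 x\<bar>"
          using n0[OF that, of x]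
          by (simp only: left_diff_distrib[symmetric] real_norm_def abs_mult) (intro mult_right_mono, auto)
      qed (use ig M_int[OF G(3) M_cont] M_int[OF m] in auto)
      also have "\<dots> = (e / (I + 1)) * I" by (simp add: I_def)
      also have "\<dots> < e" using I e by (simp add: field_simps)
      finally show ?thesis .
    qed
    then show "\<exists>no. \<forall>n\<ge>no. norm ((LINT x:unit_cell|lborel. M n x * g0 x) - (LINT x:unit_cell|lborel. g0 x * m x)) < e"
      by blast
  qed
  have "(\<lambda>n. - (LINT z:cylinder T|\<mu>. \<psi> n z * (\<sigma> z \<bullet> (1, 0))) + (LINT x:unit_cell|lborel. M n x * g0 x))
      \<longlonglongrightarrow> - 0 + (LINT x:unit_cell|lborel. g0 x * m x)"
    by (intro tendsto_intros lim1 lim2)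
  moreover have "\<forall>\<^sub>F n in sequentially. - (LINT z:cylinder T|\<mu>. \<psi> n z * (\<sigma> z \<bullet> (1, 0))) + (LINT x:unit_cell|lborel. M n x * g0 x)
      = (LINT z:cylinder T|lborel. \<phi> z * R n z)"
    using eventually_small_scale[OF T, of 1] by (rule eventually_mono) (simp add: eq)
  ultimately have "(\<lambda>n. LINT z:cylinder T|lborel. \<phi> z * R n z) \<longlonglongrightarrow> - 0 + (LINT x:unit_cell|lborel. g0 x * m x)"
    by (rule Lim_transform_eventually)
  then show ?thesis by (simp add: R_def M_def)
qed

text \<open>By \<open>trace_limit\<close> any two traces have the same integrals against \<open>m\<close>, and \<open>initial_trace\<close> is one
  of them.\<close>

lemma initial_trace_integral:
  assumes "0 < T" "BV_traces T \<phi> g0 gT" "periodic m" "continuous_on UNIV m"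
  shows "(LINT x:unit_cell|lborel. initial_trace T \<phi> x * m x) = (LINT x:unit_cell|lborel. g0 x * m x)"
proof -
  have "\<exists>gT. BV_traces T \<phi> (initial_trace T \<phi>) gT"
    unfolding initial_trace_def by (rule someI[of _ g0]) (use assms(2) in blast)
  then obtain gT' where "BV_traces T \<phi> (initial_trace T \<phi>) gT'" by blast
  then show ?thesis
    using LIMSEQ_unique[OF trace_limit[OF assms(1) _ assms(3,4)] trace_limit[OF assms]] by blast
qed

section \<open>Continuing a subsolution beyond the final time\<close>

text \<open>The cylinder has finite measure, so \<open>|u| \<le> 1 + |u| powr s\<close> suffices.\<close>

lemma Lp_cylinder_set_integrable:
  fixes u :: "real \<times> (real^'n) \<Rightarrow> 'b::euclidean_space"
  assumes T: "0 \<le> T" and s: "1 \<le> s" and u: "Lp_cylinder T s u"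
  shows "set_integrable lborel (cylinder T) u"
  unfolding set_integrable_def
proof (rule Bochner_Integration.integrable_bound)
  show "integrable lborel (\<lambda>z. indicator (cylinder T) z + indicator (cylinder T) z *\<^sub>R (norm (u z) powr s))"
    using u T unfolding Lp_cylinder_def set_integrable_def
    by (intro Bochner_Integration.integrable_add integrable_real_indicator) (simp_all add: emeasure_cylinder)
  show "(\<lambda>z. indicator (cylinder T) z *\<^sub>R u z) \<in> borel_measurable lborel"
    using u by (simp add: Lp_cylinder_def set_borel_measurable_def)
  have "x \<le> 1 + x powr s" if "0 \<le> x" for x
  proof (cases "x \<le> 1")
    case False
    then have "x powr 1 \<le> x powr s" using s by (intro powr_mono) auto
    then show ?thesis using False by simp
  qed (use that powr_ge_zero[of x s] in linarith)
  from this[OF norm_ge_zero]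
  show "AE z in lborel. norm (indicator (cylinder T) z *\<^sub>R u z)
      \<le> norm (indicator (cylinder T) z + indicator (cylinder T) z *\<^sub>R (norm (u z) powr s))"
    by (intro AE_I2) (auto simp: indicator_def)
qed

text \<open>The cut-offs vanish near the final time and increase to 1 before it.  Multiplied by them, a test
  function on the longer cylinder becomes admissible on \<open>(0, T)\<close>.\<close>

definition cutoff :: "real \<Rightarrow> nat \<Rightarrow> real \<Rightarrow> real" where
  "cutoff T n t = flat 0 (real n * (T - t) - 1)"

lemma smooth_cutoff: "smooth (cutoff T n)"
proof -
  have "smooth (\<lambda>t. flat 0 ((- real n) * t + (real n * T - 1)))"
    by (intro smooth_compose[OF smooth_flat] smooth_affine)
  then show ?thesis by (simp add: cutoff_def[abs_def] algebra_simps)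
qed

lemma smooth_fst: "smooth (\<lambda>z :: real \<times> (real^'n). fst z)"
  using smooth_linear[of "(1, 0) :: real \<times> (real^'n)"] by (simp add: inner_prod_def)

lemma cutoff_bounds: "0 \<le> cutoff T n t" "cutoff T n t \<le> 1"
  by (simp_all add: cutoff_def flat_nonneg flat_0_le_1)

lemma cutoff_tendsto:
  assumes "t < T" shows "(\<lambda>n. cutoff T n t) \<longlonglongrightarrow> 1"
proof -
  have "filterlim (\<lambda>n. (T - t) * real n) at_top sequentially"
    using assms by (intro filterlim_tendsto_pos_mult_at_top[OF tendsto_const _ filterlim_real_sequentially]) auto
  then have "filterlim (\<lambda>n. - 1 + (T - t) * real n) at_top sequentially"
    by (rule filterlim_tendsto_add_at_top[OF tendsto_const])
  then have lim: "filterlim (\<lambda>n. real n * (T - t) - 1) at_top sequentially"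
    by (simp add: mult.commute)
  have "((\<lambda>s :: real. exp (- inverse s)) \<longlongrightarrow> exp (- 0)) at_top"
    by (intro tendsto_exp tendsto_minus tendsto_inverse_0_at_top filterlim_ident)
  moreover have "\<forall>\<^sub>F s in at_top. exp (- inverse s) = flat 0 s"
    using eventually_gt_at_top[of "0 :: real"] by (rule eventually_mono) (simp add: flat_def)
  ultimately have "(flat 0 \<longlongrightarrow> exp (- 0)) at_top" by (rule Lim_transform_eventually)
  from filterlim_compose[OF this lim] show ?thesis by (simp add: cutoff_def)
qed

lemma cutoff_integral_tendsto:
  fixes f :: "real \<times> (real^'n) \<Rightarrow> real"
  assumes sets: "sets M = sets borel" and f: "set_integrable M (cylinder T) f"
  shows "(\<lambda>n. LINT z:cylinder T|M. f z * cutoff T n (fst z)) \<longlonglongrightarrow> (LINT z:cylinder T|M. f z)"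
  unfolding set_lebesgue_integral_def
proof (rule integral_dominated_convergence[where w = "\<lambda>z. \<bar>indicator (cylinder T) z *\<^sub>R f z\<bar>"])
  note [measurable_cong] = sets
  have i: "integrable M (\<lambda>z. indicator (cylinder T) z *\<^sub>R f z)" using f by (simp add: set_integrable_def)
  show "(\<lambda>z. indicator (cylinder T) z *\<^sub>R f z) \<in> borel_measurable M"
    by (rule borel_measurable_integrable[OF i])
  show "integrable M (\<lambda>z. \<bar>indicator (cylinder T) z *\<^sub>R f z\<bar>)" using i by simp
  have "(\<lambda>z :: real \<times> (real^'n). cutoff T n (fst z)) \<in> borel_measurable borel" for n
    by (intro smooth_borel smooth_compose[OF smooth_cutoff] smooth_fst)
  then have c: "(\<lambda>z. cutoff T n (fst z)) \<in> borel_measurable M" for n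
    using sets by (simp cong: measurable_cong_sets)
  have "(\<lambda>z. (indicator (cylinder T) z *\<^sub>R f z) * cutoff T n (fst z)) \<in> borel_measurable M" for n
    by (rule borel_measurable_times[OF borel_measurable_integrable[OF i] c])
  then show "(\<lambda>z. indicator (cylinder T) z *\<^sub>R (f z * cutoff T n (fst z))) \<in> borel_measurable M" for n
    by (simp add: mult.assoc)
  show "AE z in M. (\<lambda>n. indicator (cylinder T) z *\<^sub>R (f z * cutoff T n (fst z))) \<longlonglongrightarrow> indicator (cylinder T) z *\<^sub>R f z"
  proof (rule AE_I2)
    fix z
    show "(\<lambda>n. indicator (cylinder T) z *\<^sub>R (f z * cutoff T n (fst z))) \<longlonglongrightarrow> indicator (cylinder T) z *\<^sub>R f z"
    proof (cases "z \<in> cylinder T")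
      case True
      then have "fst z < T" by (auto simp: cylinder_def)
      from tendsto_mult[OF tendsto_const[of "f z"] cutoff_tendsto[OF this]] show ?thesis using True by simp
    qed simp
  qed
  show "AE z in M. norm (indicator (cylinder T) z *\<^sub>R (f z * cutoff T n (fst z))) \<le> \<bar>indicator (cylinder T) z *\<^sub>R f z\<bar>" for n
    using cutoff_bounds[of T n] by (intro AE_I2) (auto simp: abs_mult mult_left_le indicator_def)
qed

lemma set_integrable_mult_bounded:
  fixes f g :: "real \<times> (real^'n) \<Rightarrow> real"
  assumes sets: "sets M = sets borel" and f: "set_integrable M S f"
    and g: "g \<in> borel_measurable borel" "\<And>z. \<bar>g z\<bar> \<le> B"
  shows "set_integrable M S (\<lambda>z. f z * g z)"
  unfolding set_integrable_def
proof (rule Bochner_Integration.integrable_bound)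
  note [measurable_cong] = sets
  have g': "g \<in> borel_measurable M" using g(1) sets by (simp cong: measurable_cong_sets)
  have i: "integrable M (\<lambda>z. indicator S z *\<^sub>R f z)" using f by (simp add: set_integrable_def)
  show "integrable M (\<lambda>z. B * (indicator S z *\<^sub>R f z))" using i by simp
  have "(\<lambda>z. (indicator S z *\<^sub>R f z) * g z) \<in> borel_measurable M"
    by (rule borel_measurable_times[OF borel_measurable_integrable[OF i] g'])
  then show "(\<lambda>z. indicator S z *\<^sub>R (f z * g z)) \<in> borel_measurable M" by (simp add: mult.assoc)
  show "AE z in M. norm (indicator S z *\<^sub>R (f z * g z)) \<le> norm (B * (indicator S z *\<^sub>R f z))"
  proof (rule AE_I2)
    fix z
    have "\<bar>f z\<bar> * \<bar>g z\<bar> \<le> \<bar>f z\<bar> * \<bar>B\<bar>" using g(2)[of z] by (intro mult_left_mono) auto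
    then show "norm (indicator S z *\<^sub>R (f z * g z)) \<le> norm (B * (indicator S z *\<^sub>R f z))"
      by (auto simp: abs_mult indicator_def mult.commute)
  qed
qed

lemma AE_time_neq: "AE z in lborel. fst (z :: real \<times> (real^'n)) \<noteq> c"
proof -
  have "emeasure (lborel \<Otimes>\<^sub>M lborel) ({c} \<times> (UNIV :: (real^'n) set)) = 0"
    by (subst lborel.emeasure_pair_measure_Times) auto
  moreover have "{c} \<times> (UNIV :: (real^'n) set) \<in> sets borel"
    by (intro borel_closed closed_Times) auto
  ultimately have "{c} \<times> (UNIV :: (real^'n) set) \<in> null_sets lborel"
    by (simp add: null_sets_def lborel_prod)
  then show ?thesis by (rule AE_I') auto
qed

lemma cylinder_Un: "0 < T \<Longrightarrow> cylinder (T + 1) = cylinder T \<union> {T..<T + 1} \<times> unit_cell"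
  by (auto simp: cylinder_def)

lemma cylinder_split:
  fixes u :: "real \<times> (real^'n) \<Rightarrow> real"
  assumes T: "0 < T" and 1: "set_integrable lborel (cylinder T) u"
    and 2: "set_integrable lborel ({T..<T + 1} \<times> unit_cell) u"
  shows "(LINT z:cylinder (T + 1)|lborel. u z)
      = (LINT z:cylinder T|lborel. u z) + (LINT z:{T..<T + 1} \<times> unit_cell|lborel. u z)"
  unfolding cylinder_Un[OF T]
  by (rule set_integral_Un[OF _ 1 2]) (auto simp: cylinder_def)

lemma closed_layer_borel [measurable]: "{T..<T + 1 :: real} \<times> (unit_cell :: (real^'n) set) \<in> sets borel"
proof -
  have "{T..<T + 1} \<times> (unit_cell :: (real^'n) set) \<in> sets (borel \<Otimes>\<^sub>M borel)" by (intro pair_measureI) auto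
  then show ?thesis by (simp only: borel_prod)
qed

lemma layer_set_integral:
  fixes u :: "real \<times> (real^'n) \<Rightarrow> real"
  assumes u [measurable]: "u \<in> borel_measurable borel"
  shows "(LINT z:{T..<T + 1} \<times> unit_cell|lborel. u z) = (LINT z:{T<..<T + 1} \<times> unit_cell|lborel. u z)"
  unfolding set_lebesgue_integral_def
proof (rule integral_cong_AE)
  show "AE z in lborel. indicator ({T..<T + 1} \<times> unit_cell) z *\<^sub>R u z
      = indicator ({T<..<T + 1} \<times> unit_cell) z *\<^sub>R u z"
    using AE_time_neq[of T] by (rule eventually_mono) (auto simp: indicator_def)
qed measurable

lemma layer_set_integrable:
  fixes u :: "real \<times> (real^'n) \<Rightarrow> real"
  assumes [measurable]: "u \<in> borel_measurable borel" and B: "\<And>z. \<bar>u z\<bar> \<le> B"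
  shows "set_integrable lborel ({T..<T + 1} \<times> unit_cell) u"
  unfolding set_integrable_def
proof (rule Bochner_Integration.integrable_bound)
  have "AE z in lborel. (indicator ({T..<T + 1} \<times> unit_cell) z :: real) = indicator ({T<..<T + 1} \<times> (unit_cell :: (real^'n) set)) z"
    using AE_time_neq[of T] by (rule eventually_mono) (auto simp: indicator_def)
  moreover have "integrable lborel (indicator ({T<..<T + 1} \<times> (unit_cell :: (real^'n) set)) :: _ \<Rightarrow> real)"
  proof (rule integrable_real_indicator)
    have "emeasure (cylM T (T + 1) :: (real \<times> (real^'n)) measure) UNIV = 1"
      using emeasure_cylM[of T "T + 1"] by simp
    then show "emeasure lborel ({T<..<T + 1} \<times> (unit_cell :: (real^'n) set)) < \<infinity>"
      by (simp add: cylM_density emeasure_density)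
  qed simp
  ultimately have "integrable lborel (indicator ({T..<T + 1} \<times> (unit_cell :: (real^'n) set)) :: _ \<Rightarrow> real)"
    by (subst integrable_cong_AE) auto
  then show "integrable lborel (\<lambda>z. B * indicator ({T..<T + 1} \<times> (unit_cell :: (real^'n) set)) z)"
    by (rule integrable_mult_right)
  show "AE z in lborel. norm (indicator ({T..<T + 1} \<times> unit_cell) z *\<^sub>R u z) \<le> norm (B * indicator ({T..<T + 1} \<times> unit_cell) z)"
  proof (rule AE_I2)
    fix z
    have "\<bar>u z\<bar> \<le> \<bar>B\<bar>" using B[of z] by simp
    then show "norm (indicator ({T..<T + 1} \<times> unit_cell) z *\<^sub>R u z) \<le> norm (B * indicator ({T..<T + 1} \<times> unit_cell) z)"
      by (auto simp: indicator_def)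
  qed
qed measurable

lemma test_function_cutoff:
  fixes \<psi> :: "real \<times> (real^'n) \<Rightarrow> real"
  assumes T: "0 < T" and \<psi>: "test_function (T + 1) \<psi>"
  shows "test_function T (\<lambda>z. \<psi> z * cutoff T n (fst z))"
  unfolding test_function_def
proof (intro conjI allI)
  have s: "smooth \<psi>" and per: "\<And>t. periodic (\<lambda>x. \<psi> (t, x))" using \<psi> by (auto simp: test_function_def)
  obtain a b where ab: "0 < a" "b < T + 1" "\<And>t x. t \<notin> {a..b} \<Longrightarrow> \<psi> (t, x) = 0"
    using \<psi> by (auto simp: test_function_def)
  show "smooth (\<lambda>z. \<psi> z * cutoff T n (fst z))"
    by (intro smooth_mult s smooth_compose[OF smooth_cutoff] smooth_fst)
  show "periodic (\<lambda>x. \<psi> (t, x) * cutoff T n (fst (t, x)))" for t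
    using per[of t] by (simp add: periodic_def)
  show "\<exists>a b. 0 < a \<and> b < T \<and> (\<forall>t x. t \<notin> {a..b} \<longrightarrow> \<psi> (t, x) * cutoff T n (fst (t, x)) = 0)"
  proof (cases "n = 0")
    case True
    then show ?thesis using ab T by (intro exI[of _ a] exI[of _ "0 :: real"]) (auto simp: cutoff_def flat_zero)
  next
    case False
    have "cutoff T n t = 0" if "T - 1 / real n < t" for t
    proof -
      have "real n * (T - t) - 1 \<le> 0" using False that by (simp add: field_simps)
      then show ?thesis unfolding cutoff_def by (rule flat_zero)
    qed
    then show ?thesis using ab False
      by (intro exI[of _ a] exI[of _ "T - 1 / real n"]) auto
  qed
qed

lemma partial_cutoff:
  fixes \<psi> :: "real \<times> (real^'n) \<Rightarrow> real"
  assumes s: "smooth \<psi>"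
  shows "partial_within UNIV (0, v) (\<lambda>z. \<psi> z * cutoff T n (fst z)) z = partial_within UNIV (0, v) \<psi> z * cutoff T n (fst z)"
proof -
  have sc: "smooth (\<lambda>z :: real \<times> (real^'n). cutoff T n (fst z))"
    by (intro smooth_compose[OF smooth_cutoff] smooth_fst)
  have z0: "partial_within UNIV (0, v) (\<lambda>z :: real \<times> (real^'n). cutoff T n (fst z)) z = 0"
  proof -
    have "(cutoff T n has_derivative (\<lambda>h. partial_within UNIV h (cutoff T n) (fst z))) (at (fst z))"
      by (rule smooth_has_derivative[OF smooth_cutoff])
    then have "((\<lambda>z :: real \<times> (real^'n). cutoff T n (fst z)) has_derivative (\<lambda>h. partial_within UNIV (fst h) (cutoff T n) (fst z))) (at z)"
      by (rule has_derivative_compose[rotated]) (auto intro!: derivative_eq_intros)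
    from partial_within_UNIV[OF this, of "(0, v)"]
    have "partial_within UNIV (0, v) (\<lambda>z :: real \<times> (real^'n). cutoff T n (fst z)) z
        = partial_within UNIV 0 (cutoff T n) (fst z)" by simp
    also have "\<dots> = 0"
      using linear_0[OF bounded_linear.linear[OF has_derivative_bounded_linear[OF smooth_has_derivative[OF smooth_cutoff]]]] .
    finally show ?thesis .
  qed
  show ?thesis
    using partial_within_UNIV[OF has_derivative_mult[OF smooth_has_derivative[OF s] smooth_has_derivative[OF sc]], of "(0, v)" z]
    by (simp add: z0)
qed

text \<open>The standing assumptions on the Hamiltonian and the terminal datum, in the form in which they
  are used: convexity enters through supporting hyperplanes.\<close>

locale Hamiltonian_data =
  fixes T r \<theta> CH Cx :: real and H :: "real^'n \<Rightarrow> real^'n \<Rightarrow> real" and \<phi>T :: "real^'n \<Rightarrow> real"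
    and DpH :: "real^'n \<Rightarrow> real^'n \<Rightarrow> real^'n"
  assumes T: "0 < T" and r: "1 < r" and CH: "0 < CH" and Cx: "0 < Cx"
    and H_periodic: "\<And>\<xi>. periodic (\<lambda>x. H x \<xi>)"
    and H_cont: "continuous_on UNIV (\<lambda>(x, \<xi>). H x \<xi>)"
    and H_tangent: "\<And>x \<xi> \<eta>. H x \<xi> + DpH x \<xi> \<bullet> (\<eta> - \<xi>) \<le> H x \<eta>"
    and H_lower: "\<And>x \<xi>. 1 / (r * CH) * norm \<xi> powr r - CH \<le> H x \<xi>"
    and H_upper: "\<And>x \<xi>. H x \<xi> \<le> CH / r * norm \<xi> powr r + CH"
    and H_x: "\<And>x y \<xi>. \<bar>H x \<xi> - H y \<xi>\<bar> \<le> Cx * torus_dist x y * max (norm \<xi>) 1 powr \<theta>"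
    and \<theta>: "0 \<le> \<theta>" "\<theta> < r / (real CARD('n) + 1)"
    and \<phi>T: "periodic \<phi>T" "Ck_on 1 UNIV \<phi>T"
begin

abbreviation D\<phi>T :: "real^'n \<Rightarrow> real^'n" where "D\<phi>T \<equiv> gradient \<phi>T"

lemma \<phi>T_derivative: "(\<phi>T has_derivative (\<lambda>h. h \<bullet> D\<phi>T x)) (at x)"
  using \<phi>T(2) by (intro has_derivative_gradient) simp

lemma D\<phi>T_cont: "continuous_on UNIV D\<phi>T"
  unfolding gradient_def[abs_def] using \<phi>T(2) by (intro continuous_intros) simp

lemma \<phi>T_cont: "continuous_on UNIV \<phi>T"
  using has_derivative_continuous[OF \<phi>T_derivative] by (intro continuous_at_imp_continuous_on) blast

lemma D\<phi>T_periodic: "periodic D\<phi>T"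
  using partial_translation_invariant[of \<phi>T] \<phi>T unfolding periodic_def gradient_def by simp

definition \<alpha>T :: "real^'n \<Rightarrow> real" where "\<alpha>T x = H x (D\<phi>T x)"

lemma \<alpha>T_cont: "continuous_on UNIV \<alpha>T"
proof -
  have "continuous_on UNIV (\<lambda>x. (x, D\<phi>T x))" by (intro continuous_intros D\<phi>T_cont)
  from continuous_on_compose2[OF H_cont this] show ?thesis by (simp add: \<alpha>T_def[abs_def])
qed

lemma \<alpha>T_periodic: "periodic \<alpha>T"
  using D\<phi>T_periodic H_periodic by (simp add: periodic_def \<alpha>T_def)

lemma H_abs: "\<bar>H x \<xi>\<bar> \<le> CH * norm \<xi> powr r + CH"
proof -
  have "CH / r * norm \<xi> powr r \<le> CH * norm \<xi> powr r"
    using CH r by (intro mult_right_mono) (simp_all add: divide_le_eq)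
  moreover have "0 \<le> 1 / (r * CH) * norm \<xi> powr r" "0 \<le> CH * norm \<xi> powr r" using CH r by simp_all
  ultimately show ?thesis using H_lower[of \<xi> x] H_upper[of x \<xi>] by linarith
qed

lemma H_along_integrable:
  assumes w: "Lp_cylinder T r w"
  shows "set_integrable lborel (cylinder T) (\<lambda>z. H (snd z) (w z))"
  unfolding set_integrable_def
proof (rule Bochner_Integration.integrable_bound)
  let ?W = "\<lambda>z. indicator (cylinder T) z *\<^sub>R w z"
  have W: "?W \<in> borel_measurable borel"
    using w by (simp add: Lp_cylinder_def set_borel_measurable_def)
  have "(\<lambda>z. (snd z, ?W z)) \<in> borel_measurable borel"
    by (intro borel_measurable_Pair W borel_measurable_continuous_onI continuous_intros)
  moreover have "(\<lambda>(x, \<xi>). H x \<xi>) \<in> borel_measurable borel"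
    by (rule borel_measurable_continuous_onI[OF H_cont])
  ultimately have "(\<lambda>z. (\<lambda>(x, \<xi>). H x \<xi>) (snd z, ?W z)) \<in> borel_measurable borel"
    by (rule measurable_compose)
  then have m: "(\<lambda>z. H (snd z) (?W z)) \<in> borel_measurable borel" by simp
  have "(\<lambda>z. indicator (cylinder T) z * H (snd z) (?W z)) \<in> borel_measurable lborel"
    using m by measurable
  moreover have "(\<lambda>z. indicator (cylinder T) z * H (snd z) (?W z)) = (\<lambda>z. indicator (cylinder T) z *\<^sub>R H (snd z) (w z))"
    by (auto simp: indicator_def fun_eq_iff)
  ultimately show "(\<lambda>z. indicator (cylinder T) z *\<^sub>R H (snd z) (w z)) \<in> borel_measurable lborel" by simp
  show "integrable lborel (\<lambda>z. CH * (indicator (cylinder T) z *\<^sub>R (norm (w z) powr r)) + CH * indicator (cylinder T) z)"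
    using w T unfolding Lp_cylinder_def set_integrable_def
    by (intro Bochner_Integration.integrable_add integrable_mult_right integrable_real_indicator)
      (simp_all add: emeasure_cylinder)
  show "AE z in lborel. norm (indicator (cylinder T) z *\<^sub>R H (snd z) (w z))
      \<le> norm (CH * (indicator (cylinder T) z *\<^sub>R (norm (w z) powr r)) + CH * indicator (cylinder T) z)"
  proof (rule AE_I2)
    fix z
    show "norm (indicator (cylinder T) z *\<^sub>R H (snd z) (w z))
      \<le> norm (CH * (indicator (cylinder T) z *\<^sub>R (norm (w z) powr r)) + CH * indicator (cylinder T) z)"
      using H_abs[of "snd z" "w z"] CH by (cases "z \<in> cylinder T") auto
  qed
qed

text \<open>In the layer above the final time the extended function is independent of time; only its face
  \<open>t = T\<close> contributes a boundary term, since tests vanish near \<open>t = T + 1\<close>.\<close>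

lemma layer_integration_by_parts:
  fixes \<psi> :: "real \<times> (real^'n) \<Rightarrow> real"
  assumes \<psi>: "test_function (T + 1) \<psi>" and c: "c \<in> Basis"
  shows "(LINT z:{T<..<T + 1} \<times> unit_cell|lborel. \<phi>T (snd z) * partial_within UNIV c \<psi> z)
    = - (LINT z:{T<..<T + 1} \<times> unit_cell|lborel. (D\<phi>T (snd z) \<bullet> snd c) * \<psi> z)
      - fst c * (LINT x:unit_cell|lborel. \<psi> (T, x) * \<phi>T x)"
proof -
  have s: "smooth \<psi>" and per: "\<And>t. periodic (\<lambda>x. \<psi> (t, x))" using \<psi> by (auto simp: test_function_def)
  obtain a b where "0 < a" "b < T + 1" and supp: "\<And>t x. t \<notin> {a..b} \<Longrightarrow> \<psi> (t, x) = 0"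
    using \<psi> by (auto simp: test_function_def)
  obtain B where B: "\<And>z. \<bar>\<psi> z\<bar> \<le> B" "\<And>z. norm (gradient \<psi> z) \<le> B"
    using compact_time_support_bounds[OF s per supp] by metis
  obtain B1 where B1: "\<And>x. norm (\<phi>T x) \<le> B1" using periodic_bounded[OF \<phi>T(1) \<phi>T_cont] by metis
  obtain B2 where B2: "\<And>x. norm (D\<phi>T x) \<le> B2" using periodic_bounded[OF D\<phi>T_periodic D\<phi>T_cont] by metis
  have c1: "continuous_on S (\<lambda>z :: real \<times> (real^'n). \<phi>T (snd z))" for S
    by (intro continuous_on_compose2[OF \<phi>T_cont] continuous_intros) auto
  have c2: "continuous_on S (\<lambda>z :: real \<times> (real^'n). D\<phi>T (snd z))" for S
    by (intro continuous_on_compose2[OF D\<phi>T_cont] continuous_intros) auto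
  note c3 = smooth_continuous_on[OF s] and c4 = continuous_on_gradient[OF s]
  let ?G = "\<lambda>z. \<psi> z *\<^sub>R (0, D\<phi>T (snd z)) + \<phi>T (snd z) *\<^sub>R gradient \<psi> z"
  have GG: "(LINT z:{T<..<T + 1} \<times> unit_cell|lborel. c \<bullet> ?G z)
      = fst c * ((LINT x:unit_cell|lborel. \<psi> (T + 1, x) * \<phi>T x) - (LINT x:unit_cell|lborel. \<psi> (T, x) * \<phi>T x))"
  proof -
    let ?u = "\<lambda>z. \<psi> z * \<phi>T (snd z)"
    have "(LINT z:{T<..<T + 1} \<times> unit_cell|lborel. c \<bullet> ?G z)
      = fst c * ((LINT x:unit_cell|lborel. ?u (T + 1, x)) - (LINT x:unit_cell|lborel. ?u (T, x)))"
    proof (rule Gauss_Green_cylinder[OF _ _ _ _ _ c])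
      fix z :: "real \<times> (real^'n)"
      have "((\<lambda>z. \<phi>T (snd z)) has_derivative (\<lambda>h. snd h \<bullet> D\<phi>T (snd z))) (at z)"
        by (rule has_derivative_compose[OF _ \<phi>T_derivative]) (auto intro!: derivative_eq_intros)
      from has_derivative_mult[OF smooth_has_gradient[OF s, of z] this]
      have "(?u has_derivative (\<lambda>h. \<psi> z * (snd h \<bullet> D\<phi>T (snd z)) + h \<bullet> gradient \<psi> z * \<phi>T (snd z))) (at z)" .
      moreover have "(\<lambda>h. \<psi> z * (snd h \<bullet> D\<phi>T (snd z)) + h \<bullet> gradient \<psi> z * \<phi>T (snd z)) = (\<lambda>h. h \<bullet> ?G z)"
        by (simp add: inner_add_right fun_eq_iff inner_prod_def[of _ "(0, D\<phi>T (snd z))"])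
      ultimately have "(?u has_derivative (\<lambda>h. h \<bullet> ?G z)) (at z)" by (simp only:)
      then show "(?u has_derivative (\<lambda>h. h \<bullet> ?G z)) (at z within {T..T + 1} \<times> UNIV)"
        by (rule has_derivative_at_withinI)
    next
      show "continuous_on ({T..T + 1} \<times> UNIV) ?G" by (intro continuous_intros c1 c2 c3 c4)
      fix t
      show "periodic (\<lambda>x. ?u (t, x))" using per[of t] \<phi>T(1) by (simp add: periodic_def)
      show "periodic (\<lambda>x. ?G (t, x))"
        using per[of t] \<phi>T(1) D\<phi>T_periodic gradient_periodic[OF s per, of t] by (simp add: periodic_def)
    qed simp
    then show ?thesis by simp
  qed
  have top: "\<psi> (T + 1, x) = 0" for x by (rule test_function_boundary(2)[OF \<psi>])
  have eq: "c \<bullet> ?G z = (D\<phi>T (snd z) \<bullet> snd c) * \<psi> z + \<phi>T (snd z) * partial_within UNIV c \<psi> z" for z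
    using gradient_inner_Basis[OF c, of \<psi> z]
    by (cases c) (simp add: inner_add_right inner_commute[of _ "D\<phi>T (snd z)"])
  have cp: "continuous_on S (\<lambda>z. \<phi>T (snd z) * partial_within UNIV c \<psi> z)" for S
    by (intro continuous_intros c1 smooth_continuous_on smooth_partial s c)
  have cd: "continuous_on S (\<lambda>z. (D\<phi>T (snd z) \<bullet> snd c) * \<psi> z)" for S
    by (intro continuous_intros c2 c3)
  have int: "set_integrable lborel ({T<..<T + 1} \<times> unit_cell) u"
    if "continuous_on UNIV u" "\<And>z. \<bar>u z\<bar> \<le> C" for u :: "real \<times> (real^'n) \<Rightarrow> real" and C
    by (rule set_integrable_subset[OF layer_set_integrable[OF borel_measurable_continuous_onI[OF that(1)] that(2)], of _ T])
      auto
  have bp: "\<bar>\<phi>T (snd z) * partial_within UNIV c \<psi> z\<bar> \<le> B1 * (norm c * B)" for z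
  proof -
    have "\<bar>partial_within UNIV c \<psi> z\<bar> \<le> norm c * B"
      unfolding gradient_inner_Basis[OF c, symmetric]
      by (rule order_trans[OF Cauchy_Schwarz_ineq2 mult_left_mono[OF B(2)]]) simp
    moreover have "0 \<le> B1" using B1[of "snd z"] by (rule order_trans[OF norm_ge_zero])
    moreover have "\<bar>\<phi>T (snd z)\<bar> \<le> B1" using B1[of "snd z"] by simp
    ultimately show ?thesis unfolding abs_mult by (intro mult_mono) simp_all
  qed
  have bd: "\<bar>(D\<phi>T (snd z) \<bullet> snd c) * \<psi> z\<bar> \<le> (B2 * norm (snd c)) * B" for z
  proof -
    have "\<bar>D\<phi>T (snd z) \<bullet> snd c\<bar> \<le> B2 * norm (snd c)"
      by (rule order_trans[OF Cauchy_Schwarz_ineq2 mult_right_mono[OF B2]]) simp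
    moreover from this have "0 \<le> B2 * norm (snd c)" by (rule order_trans[OF abs_ge_zero])
    ultimately show ?thesis using B(1)[of z] unfolding abs_mult by (intro mult_mono) auto
  qed
  have "(LINT z:{T<..<T + 1} \<times> unit_cell|lborel. c \<bullet> ?G z)
      = (LINT z:{T<..<T + 1} \<times> unit_cell|lborel. (D\<phi>T (snd z) \<bullet> snd c) * \<psi> z)
        + (LINT z:{T<..<T + 1} \<times> unit_cell|lborel. \<phi>T (snd z) * partial_within UNIV c \<psi> z)"
    unfolding eq by (rule set_integral_add(2)[OF int[OF cd bd] int[OF cp bp]])
  then show ?thesis using GG by (simp add: top right_diff_distrib)
qed

end

text \<open>A relaxed competitor with the weak gradient \<open>w\<close> and the initial trace \<open>g0\<close> that witness its
  admissibility.\<close>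

locale relaxed_pair = Hamiltonian_data T r \<theta> CH Cx H \<phi>T DpH
  for T r \<theta> CH Cx :: real and H :: "real^'n \<Rightarrow> real^'n \<Rightarrow> real" and \<phi>T :: "real^'n \<Rightarrow> real"
    and DpH :: "real^'n \<Rightarrow> real^'n \<Rightarrow> real^'n" +
  fixes p :: real and \<phi> \<alpha> :: "real \<times> (real^'n) \<Rightarrow> real" and w :: "real \<times> (real^'n) \<Rightarrow> real^'n"
    and g0 :: "real^'n \<Rightarrow> real"
  assumes p: "1 < p" and \<phi>: "Lp_cylinder T 1 \<phi>" and traces: "BV_traces T \<phi> g0 \<phi>T"
    and \<alpha>: "Lp_cylinder T p \<alpha>" and w: "Lp_cylinder T r w"
    and weak_gradient: "weak_space_gradient T \<phi> w" and subsolution: "HJ_subsolution T H \<phi> w \<alpha>"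
begin

definition extend :: "(real \<times> (real^'n) \<Rightarrow> 'b) \<Rightarrow> (real^'n \<Rightarrow> 'b) \<Rightarrow> real \<times> (real^'n) \<Rightarrow> 'b" where
  "extend u v z = (if fst z < T then u z else v (snd z))"

abbreviation "\<phi>e \<equiv> extend \<phi> \<phi>T"
abbreviation "we \<equiv> extend w D\<phi>T"
abbreviation "\<alpha>e \<equiv> extend \<alpha> \<alpha>T"

lemma \<phi>_integrable: "set_integrable lborel (cylinder T) \<phi>"
  using Lp_cylinder_set_integrable[OF _ _ \<phi>] T by simp

lemma \<alpha>_integrable: "set_integrable lborel (cylinder T) \<alpha>"
  using Lp_cylinder_set_integrable[OF _ _ \<alpha>] T p by simp

lemma w_integrable: "set_integrable lborel (cylinder T) w"
  using Lp_cylinder_set_integrable[OF _ _ w] T r by simp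

lemma w_component_integrable: "set_integrable lborel (cylinder T) (\<lambda>z. w z $ i)"
proof -
  have "integrable lborel (\<lambda>z. (indicator (cylinder T) z *\<^sub>R w z) \<bullet> axis i 1)"
    using w_integrable unfolding set_integrable_def by (rule integrable_inner_left)
  then show ?thesis unfolding set_integrable_def by (simp add: inner_axis)
qed

text \<open>An integral of an extended function splits at time \<open>T\<close>.  The hyperplane \<open>t = T\<close> itself is a null
  set, so the layer may be taken open, as the Gauss--Green formula needs it.\<close>

lemma extend_integral:
  fixes g :: "real \<times> (real^'n) \<Rightarrow> real"
  assumes u: "set_integrable lborel (cylinder T) u" and v: "periodic v" "continuous_on UNIV v"
    and g: "g \<in> borel_measurable borel" "\<And>z. \<bar>g z\<bar> \<le> B"
  shows "(LINT z:cylinder (T + 1)|lborel. extend u v z * g z)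
      = (LINT z:cylinder T|lborel. u z * g z) + (LINT z:{T<..<T + 1} \<times> unit_cell|lborel. v (snd z) * g z)"
    and "set_integrable lborel (cylinder (T + 1)) (\<lambda>z. extend u v z * g z)"
proof -
  obtain C where C: "\<And>x. norm (v x) \<le> C" using periodic_bounded[OF v] by metis
  have [measurable]: "v \<in> borel_measurable borel" by (rule borel_measurable_continuous_onI[OF v(2)])
  have vm: "(\<lambda>z :: real \<times> (real^'n). v (snd z)) \<in> borel_measurable borel"
    by (intro borel_measurable_continuous_onI continuous_on_compose2[OF v(2)] continuous_intros) auto
  have m: "(\<lambda>z. v (snd z) * g z) \<in> borel_measurable borel" by (rule borel_measurable_times[OF vm g(1)])
  have bound: "\<bar>v (snd z) * g z\<bar> \<le> C * B" for z
  proof -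
    have "0 \<le> C" using C[of "snd z"] by (rule order_trans[OF norm_ge_zero])
    moreover have "\<bar>v (snd z)\<bar> \<le> C" using C[of "snd z"] by simp
    ultimately show ?thesis unfolding abs_mult using g(2)[of z] by (intro mult_mono) simp_all
  qed
  have 1: "set_integrable lborel (cylinder T) (\<lambda>z. u z * g z)"
    by (rule set_integrable_mult_bounded[OF _ u g]) simp
  have e1: "set_integrable lborel (cylinder T) (\<lambda>z. extend u v z * g z)"
  proof -
    have "set_integrable lborel (cylinder T) (\<lambda>z. extend u v z * g z)
        = set_integrable lborel (cylinder T) (\<lambda>z. u z * g z)"
      by (rule set_integrable_cong) (auto simp: extend_def cylinder_def)
    then show ?thesis using 1 by simp
  qed
  have 2: "set_integrable lborel ({T..<T + 1} \<times> unit_cell) (\<lambda>z. v (snd z) * g z)"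
    by (rule layer_set_integrable[OF m bound])
  have e2: "set_integrable lborel ({T..<T + 1} \<times> unit_cell) (\<lambda>z. extend u v z * g z)"
  proof -
    have "set_integrable lborel ({T..<T + 1} \<times> unit_cell) (\<lambda>z. extend u v z * g z)
        = set_integrable lborel ({T..<T + 1} \<times> unit_cell) (\<lambda>z. v (snd z) * g z)"
      by (rule set_integrable_cong) (auto simp: extend_def)
    then show ?thesis using 2 by simp
  qed
  show "set_integrable lborel (cylinder (T + 1)) (\<lambda>z. extend u v z * g z)"
    unfolding cylinder_Un[OF T] by (rule set_integrable_Un[OF e1 e2]) auto
  have "(LINT z:cylinder T|lborel. extend u v z * g z) = (LINT z:cylinder T|lborel. u z * g z)"
    by (rule set_lebesgue_integral_cong) (auto simp: extend_def cylinder_def)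
  moreover have "(LINT z:{T..<T + 1} \<times> unit_cell|lborel. extend u v z * g z)
      = (LINT z:{T..<T + 1} \<times> unit_cell|lborel. v (snd z) * g z)"
    by (rule set_lebesgue_integral_cong) (auto simp: extend_def)
  ultimately show "(LINT z:cylinder (T + 1)|lborel. extend u v z * g z)
      = (LINT z:cylinder T|lborel. u z * g z) + (LINT z:{T<..<T + 1} \<times> unit_cell|lborel. v (snd z) * g z)"
    using cylinder_split[OF T e1 e2] layer_set_integral[OF m, of T] by simp
qed

lemma test_bounds:
  fixes \<psi> :: "real \<times> (real^'n) \<Rightarrow> real"
  assumes "test_function S \<psi>"
  obtains B where "\<And>z. \<bar>\<psi> z\<bar> \<le> B" "\<And>z b. b \<in> Basis \<Longrightarrow> \<bar>partial_within UNIV b \<psi> z\<bar> \<le> B"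
proof -
  have s: "smooth \<psi>" and per: "\<And>t. periodic (\<lambda>x. \<psi> (t, x))" using assms by (auto simp: test_function_def)
  obtain a b where "0 < a" "b < S" and supp: "\<And>t x. t \<notin> {a..b} \<Longrightarrow> \<psi> (t, x) = 0"
    using assms by (auto simp: test_function_def)
  obtain B where B: "\<And>z. \<bar>\<psi> z\<bar> \<le> B" "\<And>z. norm (gradient \<psi> z) \<le> B"
    using compact_time_support_bounds[OF s per supp] by metis
  have "\<bar>partial_within UNIV b \<psi> z\<bar> \<le> B" if "b \<in> Basis" for z b
    using Basis_le_norm[OF that, of "gradient \<psi> z"] B(2)[of z] gradient_inner_Basis[OF that, of \<psi> z]
    by (simp add: inner_commute)
  then show ?thesis using that B(1) by blast
qed

lemma axis_Basis: "(0, axis i 1) \<in> (Basis :: (real \<times> (real^'n)) set)"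
  and time_Basis: "(1, 0) \<in> (Basis :: (real \<times> (real^'n)) set)"
  by (auto simp: Basis_prod_def Basis_vec_def)

text \<open>No boundary term arises below \<open>T\<close> because the cut-off depends on time only and hence commutes with
  space derivatives.\<close>

lemma extended_weak_gradient: "weak_space_gradient (T + 1) \<phi>e we"
  unfolding weak_space_gradient_def
proof (intro allI impI)
  fix \<psi> :: "real \<times> (real^'n) \<Rightarrow> real" and i assume \<psi>: "test_function (T + 1) \<psi>"
  have s: "smooth \<psi>" using \<psi> by (auto simp: test_function_def)
  let ?b = "(0, axis i 1) :: real \<times> (real^'n)"
  let ?P = "partial_within UNIV ?b \<psi>"
  obtain B where B: "\<And>z. \<bar>\<psi> z\<bar> \<le> B" "\<And>z b. b \<in> Basis \<Longrightarrow> \<bar>partial_within UNIV b \<psi> z\<bar> \<le> B"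
    using test_bounds[OF \<psi>] by metis
  note m = smooth_borel[OF s] smooth_borel[OF smooth_partial[OF s axis_Basis[of i]]]
  have "(LINT z:cylinder T|lborel. (\<phi> z * ?P z) * cutoff T n (fst z))
      = - (LINT z:cylinder T|lborel. (w z $ i * \<psi> z) * cutoff T n (fst z))" for n
    using weak_gradient[unfolded weak_space_gradient_def, rule_format, OF test_function_cutoff[OF T \<psi>], of n i]
    by (simp add: space_grad_within_def partial_cutoff[OF s] mult.assoc)
  moreover have "(\<lambda>n. LINT z:cylinder T|lborel. (\<phi> z * ?P z) * cutoff T n (fst z))
      \<longlonglongrightarrow> (LINT z:cylinder T|lborel. \<phi> z * ?P z)"
    by (intro cutoff_integral_tendsto set_integrable_mult_bounded[OF _ \<phi>_integrable m(2) B(2)[OF axis_Basis]]) simp_all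
  moreover have "(\<lambda>n. - (LINT z:cylinder T|lborel. (w z $ i * \<psi> z) * cutoff T n (fst z)))
      \<longlonglongrightarrow> - (LINT z:cylinder T|lborel. w z $ i * \<psi> z)"
    by (intro tendsto_minus cutoff_integral_tendsto set_integrable_mult_bounded[OF _ w_component_integrable m(1) B(1)]) simp_all
  ultimately have low: "(LINT z:cylinder T|lborel. \<phi> z * ?P z) = - (LINT z:cylinder T|lborel. w z $ i * \<psi> z)"
    using LIMSEQ_unique by simp
  have up: "(LINT z:{T<..<T + 1} \<times> unit_cell|lborel. \<phi>T (snd z) * ?P z)
      = - (LINT z:{T<..<T + 1} \<times> unit_cell|lborel. D\<phi>T (snd z) $ i * \<psi> z)"
    using layer_integration_by_parts[OF \<psi> axis_Basis[of i]] by (simp add: inner_axis)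
  have per: "periodic (\<lambda>x. D\<phi>T x $ i)" using D\<phi>T_periodic by (simp add: periodic_def)
  have cont: "continuous_on UNIV (\<lambda>x. D\<phi>T x $ i)" by (intro continuous_intros D\<phi>T_cont)
  have "(\<lambda>z. we z $ i * \<psi> z) = (\<lambda>z. extend (\<lambda>z. w z $ i) (\<lambda>x. D\<phi>T x $ i) z * \<psi> z)"
    by (simp add: extend_def fun_eq_iff)
  then show "(LINT z:cylinder (T + 1)|lborel. \<phi>e z * space_grad_within UNIV \<psi> z $ i)
      = - (LINT z:cylinder (T + 1)|lborel. we z $ i * \<psi> z)"
    using extend_integral(1)[OF \<phi>_integrable \<phi>T(1) \<phi>T_cont m(2) B(2)[OF axis_Basis]]
      extend_integral(1)[OF w_component_integrable[of i] per cont m(1) B(1)] low up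
    by (simp add: space_grad_within_def)
qed

text \<open>Below \<open>T\<close> the removal of the cut-off leaves the trace of \<open>\<phi>\<close> at \<open>T\<close> as a boundary term, and the
  layer above \<open>T\<close> contributes the same integral of \<open>\<phi>T\<close> with the opposite sign.\<close>

lemma extended_subsolution: "HJ_subsolution (T + 1) H \<phi>e we \<alpha>e"
  unfolding HJ_subsolution_def
proof (intro allI impI, elim conjE)
  fix \<psi> :: "real \<times> (real^'n) \<Rightarrow> real" assume \<psi>: "test_function (T + 1) \<psi>" and pos: "\<forall>z. 0 \<le> \<psi> z"
  have s: "smooth \<psi>" and per: "\<And>t. periodic (\<lambda>x. \<psi> (t, x))" using \<psi> by (auto simp: test_function_def)
  let ?b = "(1, 0) :: real \<times> (real^'n)"
  let ?P = "partial_within UNIV ?b \<psi>" and ?H = "\<lambda>z. H (snd z) (w z)"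
  obtain B where B: "\<And>z. \<bar>\<psi> z\<bar> \<le> B" "\<And>z b. b \<in> Basis \<Longrightarrow> \<bar>partial_within UNIV b \<psi> z\<bar> \<le> B"
    using test_bounds[OF \<psi>] by metis
  note m = smooth_borel[OF s] smooth_borel[OF smooth_partial[OF s time_Basis]]
  from traces obtain \<mu> \<sigma> where \<mu>: "derivative_measure T \<phi> \<mu> \<sigma>"
    and GG': "\<forall>\<psi>. C1_closed_cylinder T \<psi> \<longrightarrow> (\<forall>b\<in>Basis.
          (LINT z:cylinder T|lborel. \<phi> z * partial_within (slab T) b \<psi> z)
            = - (LINT z:cylinder T|\<mu>. \<psi> z * (\<sigma> z \<bullet> b))
              + fst b * (LINT x:unit_cell|lborel. \<psi> (T, x) * \<phi>T x)
              - fst b * (LINT x:unit_cell|lborel. \<psi> (0, x) * g0 x))"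
    unfolding BV_traces_def by (elim conjE exE)
  note GG = GG'[rule_format] and \<mu>D = derivative_measureD[OF \<mu>]
  interpret \<mu>: finite_measure \<mu> by (rule \<mu>D(2))
  note [measurable_cong] = \<mu>D(1)
  have C1: "C1_closed_cylinder T \<psi>"
    by (rule C1_closed_cylinderI[OF T, where G = "gradient \<psi>"])
      (use has_derivative_at_withinI[OF smooth_has_gradient[OF s]] continuous_on_gradient[OF s] per in auto)
  have part: "partial_within (slab T) ?b \<psi> z = ?P z" if "z \<in> slab T" for z
    by (rule partial_within_slab[OF T that]) (rule has_derivative_at_withinI[OF smooth_has_derivative[OF s]])
  have i\<mu>: "set_integrable \<mu> (cylinder T) (\<lambda>z. \<psi> z * (\<sigma> z \<bullet> ?b))"
    unfolding set_integrable_def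
  proof (rule \<mu>.integrable_const_bound[of _ B])
    have [measurable]: "\<sigma> \<in> borel_measurable borel" "\<psi> \<in> borel_measurable borel" by (rule \<mu>D(3), rule m(1))
    show "(\<lambda>z. indicator (cylinder T) z *\<^sub>R (\<psi> z * (\<sigma> z \<bullet> ?b))) \<in> borel_measurable \<mu>" by measurable
    show "AE z in \<mu>. norm (indicator (cylinder T) z *\<^sub>R (\<psi> z * (\<sigma> z \<bullet> ?b))) \<le> B"
      using \<mu>D(4)
    proof (rule eventually_mono)
      fix z assume \<sigma>1: "norm (\<sigma> z) = 1"
      have "\<bar>\<sigma> z \<bullet> ?b\<bar> \<le> 1" using Cauchy_Schwarz_ineq2[of "\<sigma> z" ?b] \<sigma>1 by (simp add: norm_Pair)
      then have "\<bar>\<psi> z\<bar> * \<bar>\<sigma> z \<bullet> ?b\<bar> \<le> B * 1"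
        by (intro mult_mono B) (use order_trans[OF abs_ge_zero B(1)] in auto)
      moreover have "0 \<le> B" using order_trans[OF abs_ge_zero B(1)] .
      ultimately show "norm (indicator (cylinder T) z *\<^sub>R (\<psi> z * (\<sigma> z \<bullet> ?b))) \<le> B"
        by (auto simp: indicator_def abs_mult)
    qed
  qed
  \<comment> \<open>The subsolution property only admits tests that vanish near the final time; expressing the
    time derivative through the derivative measure makes it stable under removing the cut-off.\<close>
  have cut: "- (LINT z:cylinder T|\<mu>. (\<psi> z * (\<sigma> z \<bullet> ?b)) * cutoff T n (fst z))
      + (LINT z:cylinder T|lborel. (?H z * \<psi> z) * cutoff T n (fst z))
      \<le> (LINT z:cylinder T|lborel. (\<alpha> z * \<psi> z) * cutoff T n (fst z))" for n
  proof -
    let ?\<psi>n = "\<lambda>z. \<psi> z * cutoff T n (fst z)"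
    note tn = test_function_cutoff[OF T \<psi>, of n]
    have "(LINT z:cylinder T|lborel. \<phi> z * time_deriv_within UNIV ?\<psi>n z)
        = (LINT z:cylinder T|lborel. \<phi> z * partial_within (slab T) ?b ?\<psi>n z)"
      by (rule set_lebesgue_integral_cong)
        (simp_all add: test_function_partial[OF T tn] time_deriv_within_def)
    also have "\<dots> = - (LINT z:cylinder T|\<mu>. ?\<psi>n z * (\<sigma> z \<bullet> ?b))"
    proof -
      have "\<psi> (0, x) * cutoff T n 0 = 0" "\<psi> (T, x) * cutoff T n T = 0" for x
        using test_function_boundary[OF tn, of x] by (simp_all only: fst_conv)
      note b0 = this
      show ?thesis using GG[OF test_function_C1(1)[OF T tn] time_Basis] by (simp add: b0)
    qed
    also have "\<dots> = - (LINT z:cylinder T|\<mu>. (\<psi> z * (\<sigma> z \<bullet> ?b)) * cutoff T n (fst z))"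
      by (simp add: mult_ac)
    finally show ?thesis
      using subsolution[unfolded HJ_subsolution_def, rule_format, of ?\<psi>n] tn pos cutoff_bounds(1)[of T n]
      by (simp add: mult.assoc)
  qed
  have iH: "set_integrable lborel (cylinder T) (\<lambda>z. ?H z * \<psi> z)"
    by (rule set_integrable_mult_bounded[OF _ H_along_integrable[OF w] m(1) B(1)]) simp
  have i\<alpha>: "set_integrable lborel (cylinder T) (\<lambda>z. \<alpha> z * \<psi> z)"
    by (rule set_integrable_mult_bounded[OF _ \<alpha>_integrable m(1) B(1)]) simp
  have "- (LINT z:cylinder T|\<mu>. \<psi> z * (\<sigma> z \<bullet> ?b)) + (LINT z:cylinder T|lborel. ?H z * \<psi> z)
      \<le> (LINT z:cylinder T|lborel. \<alpha> z * \<psi> z)"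
  proof (rule LIMSEQ_le)
    show "(\<lambda>n. - (LINT z:cylinder T|\<mu>. (\<psi> z * (\<sigma> z \<bullet> ?b)) * cutoff T n (fst z))
      + (LINT z:cylinder T|lborel. (?H z * \<psi> z) * cutoff T n (fst z)))
      \<longlonglongrightarrow> - (LINT z:cylinder T|\<mu>. \<psi> z * (\<sigma> z \<bullet> ?b)) + (LINT z:cylinder T|lborel. ?H z * \<psi> z)"
      by (intro tendsto_add tendsto_minus cutoff_integral_tendsto i\<mu> iH \<mu>D(1)) simp
    show "(\<lambda>n. LINT z:cylinder T|lborel. (\<alpha> z * \<psi> z) * cutoff T n (fst z)) \<longlonglongrightarrow> (LINT z:cylinder T|lborel. \<alpha> z * \<psi> z)"
      by (intro cutoff_integral_tendsto i\<alpha>) simp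
  qed (use cut in auto)
  moreover have "(LINT z:cylinder T|lborel. \<phi> z * ?P z)
      = - (LINT z:cylinder T|\<mu>. \<psi> z * (\<sigma> z \<bullet> ?b)) + (LINT x:unit_cell|lborel. \<psi> (T, x) * \<phi>T x)"
  proof -
    have "(LINT z:cylinder T|lborel. \<phi> z * ?P z) = (LINT z:cylinder T|lborel. \<phi> z * partial_within (slab T) ?b \<psi> z)"
      by (rule set_lebesgue_integral_cong) (simp_all add: part subsetD[OF cylinder_subset_slab])
    then show ?thesis
      using GG[OF C1 time_Basis] test_function_boundary(1)[OF \<psi>] by simp
  qed
  moreover have "(LINT z:{T<..<T + 1} \<times> unit_cell|lborel. \<phi>T (snd z) * ?P z)
      = - (LINT x:unit_cell|lborel. \<psi> (T, x) * \<phi>T x)"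
    using layer_integration_by_parts[OF \<psi> time_Basis] by simp
  moreover have "(\<lambda>z. H (snd z) (we z) * \<psi> z) = (\<lambda>z. extend ?H \<alpha>T z * \<psi> z)"
    by (simp add: extend_def \<alpha>T_def fun_eq_iff)
  ultimately show "(LINT z:cylinder (T + 1)|lborel. \<phi>e z * time_deriv_within UNIV \<psi> z)
      + (LINT z:cylinder (T + 1)|lborel. H (snd z) (we z) * \<psi> z)
      \<le> (LINT z:cylinder (T + 1)|lborel. \<alpha>e z * \<psi> z)"
    using extend_integral(1)[OF \<phi>_integrable \<phi>T(1) \<phi>T_cont m(2) B(2)[OF time_Basis]]
      extend_integral(1)[OF H_along_integrable[OF w] \<alpha>T_periodic \<alpha>T_cont m(1) B(1)]
      extend_integral(1)[OF \<alpha>_integrable \<alpha>T_periodic \<alpha>T_cont m(1) B(1)]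
    by (simp add: time_deriv_within_def)
qed

end

section \<open>Mollifying the extended subsolution\<close>

lemma Ck_on_sum:
  "finite I \<Longrightarrow> (\<And>i. i \<in> I \<Longrightarrow> Ck_on k UNIV (g i)) \<Longrightarrow> Ck_on k UNIV (\<lambda>z. \<Sum>i\<in>I. g i z)"
  by (induction I rule: finite_induct) (auto intro!: Ck_on_const Ck_on_add)

lemma Ck_on_affine:
  fixes g :: "'b::euclidean_space \<Rightarrow> real" and L :: "'a::euclidean_space \<Rightarrow> 'b"
  assumes L: "bounded_linear L" and "Ck_on k UNIV g"
  shows "Ck_on k UNIV (\<lambda>z. g (L z + c))"
  using assms(2)
proof (induction k arbitrary: g)
  case 0
  then have "continuous_on UNIV g" by simp
  moreover have "continuous_on UNIV (\<lambda>z. L z + c)"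
    by (intro continuous_intros linear_continuous_on L)
  ultimately have "continuous_on UNIV (\<lambda>z. g (L z + c))" by (rule continuous_on_compose2) simp
  then show ?case by simp
next
  case (Suc k)
  have A: "((\<lambda>z. L z + c) has_derivative L) (at z)" for z
    using has_derivative_add_const[OF bounded_linear_imp_has_derivative[OF L]] .
  have D: "((\<lambda>z. g (L z + c)) has_derivative (\<lambda>h. partial_within UNIV (L h) g (L z + c))) (at z)" for z
    by (rule has_derivative_compose[OF A Ck_on_has_derivative[OF Suc.prems]])
  have lin: "partial_within UNIV v g y = (\<Sum>b\<in>Basis. (v \<bullet> b) * partial_within UNIV b g y)" for v y
    using linear_functional_sum[OF bounded_linear.linear[OF has_derivative_bounded_linear[OF Ck_on_has_derivative[OF Suc.prems]]], of v y]
    by (simp add: inner_sum_right mult.commute)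
  have "partial_within UNIV a (\<lambda>z. g (L z + c))
      = (\<lambda>z. \<Sum>b\<in>Basis. (L a \<bullet> b) * partial_within UNIV b g (L z + c))" for a
    by (rule ext, subst partial_within_UNIV[OF D], rule lin)
  moreover have "Ck_on k UNIV (\<lambda>z. \<Sum>b\<in>Basis. (L a \<bullet> b) * partial_within UNIV b g (L z + c))" for a
    using Suc by (intro Ck_on_sum finite_Basis Ck_on_mult Ck_on_const Suc.IH) simp
  moreover have "(\<lambda>z. g (L z + c)) differentiable (at z)" for z
    using D unfolding differentiable_def by blast
  ultimately show ?case by simp
qed

lemma smooth_affine_compose:
  assumes "bounded_linear L" "smooth g" shows "smooth (\<lambda>z. g (L z + c))"
  using assms(2) Ck_on_affine[OF assms(1)] by (simp add: smooth_def)

text \<open>The minus sign in front of the time variable makes \<open>\<zeta> \<mapsto> mollifier n (z - \<zeta>)\<close> charge only times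
  later than that of \<open>z\<close>.\<close>

definition mollifier :: "nat \<Rightarrow> real \<times> (real^'n) \<Rightarrow> real" where
  "mollifier n z = time_bump (real (Suc n)) (- fst z) * space_bump (real (Suc n)) (snd z)"

lemma smooth_mollifier: "smooth (mollifier n :: real \<times> (real^'n) \<Rightarrow> real)"
proof -
  have "smooth (\<lambda>z :: real \<times> (real^'n). time_bump (real (Suc n)) (- fst z + 0))"
    by (rule smooth_affine_compose[OF _ smooth_time_bump]) (intro bounded_linear_minus bounded_linear_fst)
  moreover have "smooth (\<lambda>z :: real \<times> (real^'n). space_bump (real (Suc n)) (snd z + 0))"
    by (rule smooth_affine_compose[OF bounded_linear_snd smooth_space_bump])
  ultimately show ?thesis unfolding mollifier_def[abs_def] using smooth_mult by fastforce
qed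

lemma mollifier_periodic: "periodic (\<lambda>x. mollifier n (t, x))"
  using periodic_space_bump[of "real (Suc n)"] unfolding periodic_def mollifier_def by auto

lemma mollifier_outside: "t \<notin> {- 1..0} \<Longrightarrow> mollifier n (t, x) = 0"
proof -
  assume t: "t \<notin> {- 1..0}"
  have "time_bump (real (Suc n)) (- t) = 0"
  proof (rule ccontr)
    assume *: "time_bump (real (Suc n)) (- t) \<noteq> 0"
    have "1 / real (Suc n) \<le> 1" by simp
    moreover have "0 < - t" "- t < 1 / real (Suc n)" using time_bump_support(2,3)[OF _ *] by simp_all
    ultimately have "- t \<le> 1" by linarith
    then show False using t \<open>0 < - t\<close> by simp
  qed
  then show ?thesis by (simp add: mollifier_def)
qed

lemma mollifier_nonneg: "0 \<le> mollifier n z"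
  unfolding mollifier_def by (intro mult_nonneg_nonneg time_bump_nonneg space_bump_nonneg) simp_all

lemma mollifier_support:
  fixes z \<zeta> :: "real \<times> (real^'n)"
  assumes "mollifier n (z - \<zeta>) \<noteq> 0"
  obtains k where "fst z + 1 / (4 * real (Suc n)) \<le> fst \<zeta>" "fst \<zeta> \<le> fst z + 3 / (4 * real (Suc n))"
    "fst z < fst \<zeta>" "fst \<zeta> < fst z + 1 / real (Suc n)"
    "k \<in> int_lattice" "norm (snd z - snd \<zeta> - k) \<le> 2 * real CARD('n) / real (Suc n)"
proof -
  have t: "time_bump (real (Suc n)) (fst \<zeta> - fst z) \<noteq> 0"
    and x: "space_bump (real (Suc n)) (snd z - snd \<zeta>) \<noteq> 0"
    using assms by (auto simp: mollifier_def)
  obtain k where k: "k \<in> int_lattice" "norm (snd z - snd \<zeta> - k) \<le> 2 * real CARD('n) / real (Suc n)"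
    by (rule space_bump_support[OF _ x]) simp_all
  show ?thesis
    by (rule that[OF _ _ _ _ k]) (use time_bump_support[OF _ t] in simp_all)
qed

definition mollifier_bound :: "'n itself \<Rightarrow> real" where
  "mollifier_bound _ = (6 / flat 0 (1/2)) ^ CARD('n) / bump_mass"

lemma mollifier_bound_pos: "0 < mollifier_bound TYPE('n::finite)"
  using bump_mass_pos flat_pos[of "1/2" 0] by (simp add: mollifier_bound_def)

lemma mollifier_le:
  fixes z :: "real \<times> (real^'n)"
  shows "mollifier n z \<le> mollifier_bound TYPE('n) * real (Suc n) ^ (CARD('n) + 1)"
proof -
  have "mollifier n z \<le> (real (Suc n) / bump_mass) * ((6 / flat 0 (1/2)) ^ CARD('n) * real (Suc n) ^ CARD('n))"
    unfolding mollifier_def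
    by (intro mult_mono time_bump_bound space_bump_bound space_bump_nonneg)
      (use bump_mass_pos in auto)
  also have "\<dots> = mollifier_bound TYPE('n) * real (Suc n) ^ (CARD('n) + 1)"
    by (simp add: mollifier_bound_def)
  finally show ?thesis .
qed

lemma mollifier_reflected_borel: "(\<lambda>\<zeta>. mollifier n (z - \<zeta>)) \<in> borel_measurable borel"
  by (intro borel_measurable_continuous_onI continuous_on_compose2[OF smooth_continuous_on[OF smooth_mollifier, of UNIV]]
      continuous_intros) auto

lemma mollifier_abs_le: "\<bar>mollifier n z\<bar> \<le> mollifier_bound TYPE('n::finite) * real (Suc n) ^ (CARD('n) + 1)"
  for z :: "real \<times> (real^'n)"
  using mollifier_le[of n z] mollifier_nonneg[of n z] by simp

text \<open>The extended cylinder leaves room above \<open>T\<close> for the forward reach of the kernel, which is below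
  one.\<close>

lemma test_function_mollifier:
  fixes z :: "real \<times> (real^'n)"
  assumes "fst z \<in> {0..T}"
  shows "test_function (T + 1) (\<lambda>\<zeta>. mollifier n (z - \<zeta>))"
  unfolding test_function_def
proof (intro conjI allI)
  have "smooth (\<lambda>\<zeta>. mollifier n (- \<zeta> + z))"
    by (rule smooth_affine_compose[OF _ smooth_mollifier]) (intro bounded_linear_minus bounded_linear_ident)
  then show "smooth (\<lambda>\<zeta>. mollifier n (z - \<zeta>))" by simp
  show "periodic (\<lambda>x. mollifier n (z - (t, x)))" for t
    unfolding periodic_def
  proof (intro allI ballI)
    fix x k :: "real^'n" assume k: "k \<in> int_lattice"
    have "mollifier n (fst z - t, (snd z - x) - k) = mollifier n (fst z - t, snd z - x)"
      by (rule periodic_minus[OF mollifier_periodic k])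
    moreover have "z - (t, x + k) = (fst z - t, (snd z - x) - k)" "z - (t, x) = (fst z - t, snd z - x)"
      by (cases z, simp add: algebra_simps)+
    ultimately show "mollifier n (z - (t, x + k)) = mollifier n (z - (t, x))" by simp
  qed
  let ?a = "1 / (4 * real (Suc n))" and ?b = "T + 3 / (4 * real (Suc n))"
  have "3 / (4 * real (Suc n)) < 1" by (simp add: field_simps)
  moreover have "mollifier n (z - (t, x)) = 0" if "t \<notin> {?a..?b}" for t x
  proof (rule ccontr)
    assume "mollifier n (z - (t, x)) \<noteq> 0"
    then show False
      by (rule mollifier_support) (use that assms in auto)
  qed
  ultimately show "\<exists>a b. 0 < a \<and> b < T + 1 \<and> (\<forall>t x. t \<notin> {a..b} \<longrightarrow> mollifier n (z - (t, x)) = 0)"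
    by (intro exI[of _ ?a] exI[of _ ?b]) simp
qed

lemma mollifier_mass:
  fixes z :: "real \<times> (real^'n)"
  assumes z: "fst z \<in> {0..T}"
  shows "(LINT \<zeta>:cylinder (T + 1)|lborel. mollifier n (z - \<zeta>)) = 1"
proof -
  let ?N = "real (Suc n)"
  have N: "0 < ?N" "1 \<le> ?N" by simp_all
  have int: "integrable (timeM 0 (T + 1) \<Otimes>\<^sub>M cellM) (case_prod (\<lambda>s y. mollifier n (z - (s, y))))"
    using integrable_cylM_bounded[OF mollifier_reflected_borel[of n z], OF mollifier_abs_le[folded real_norm_def], of 0 "T + 1"]
    by (simp add: cylM_def case_prod_unfold)
  have "(LINT \<zeta>:cylinder (T + 1)|lborel. mollifier n (z - \<zeta>)) = (LINT \<zeta>|(timeM 0 (T + 1) \<Otimes>\<^sub>M cellM). case_prod (\<lambda>s y. mollifier n (z - (s, y))) \<zeta>)"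
    using set_integral_cylinder[OF mollifier_reflected_borel] by (simp add: cylM_def case_prod_unfold)
  also have "\<dots> = (LINT s|timeM 0 (T + 1). LINT y|cellM. mollifier n (z - (s, y)))"
    using cyl.integral_fst'[OF int] by (simp add: case_prod_unfold)
  also have "\<dots> = (LINT s|timeM 0 (T + 1). time_bump ?N (s - fst z))"
    using integral_space_bump(2)[OF N(2), of "snd z"] by (simp add: mollifier_def)
  also have "\<dots> = (LINT s|lborel. indicator {0<..<T + 1} s * time_bump ?N (s - fst z))"
  proof -
    have eq: "timeM 0 (T + 1) = density lborel (\<lambda>s. ennreal (indicator {0<..<T + 1} s))"
      by (simp add: timeM_def ennreal_indicator)
    show ?thesis unfolding eq by (subst integral_density) auto
  qed
  also have "(\<lambda>s. indicator {0<..<T + 1} s * time_bump ?N (s - fst z)) = (\<lambda>s. time_bump ?N (s - fst z))"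
  proof
    fix s
    have "1 / ?N \<le> 1" by simp
    show "indicator {0<..<T + 1} s * time_bump ?N (s - fst z) = time_bump ?N (s - fst z)"
    proof (cases "time_bump ?N (s - fst z) = 0")
      case False
      have "0 < s - fst z" "s - fst z < 1"
        using time_bump_support(2,3)[OF N(1) False] \<open>1 / ?N \<le> 1\<close> by linarith+
      then have "s \<in> {0<..<T + 1}" using z by auto
      then show ?thesis by simp
    qed simp
  qed
  finally show ?thesis using integral_time_bump[OF N(1)] by simp
qed

lemma mollifier_average_close:
  fixes z :: "real \<times> (real^'n)"
  assumes T: "0 \<le> T" and z: "fst z \<in> {0..T}"
    and u: "set_integrable lborel (cylinder (T + 1)) (\<lambda>\<zeta>. u \<zeta> * mollifier n (z - \<zeta>))"
    and close: "\<And>\<zeta>. mollifier n (z - \<zeta>) \<noteq> 0 \<Longrightarrow> \<bar>u \<zeta> - c\<bar> \<le> \<eta>"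
  shows "\<bar>(LINT \<zeta>:cylinder (T + 1)|lborel. u \<zeta> * mollifier n (z - \<zeta>)) - c\<bar> \<le> \<eta>"
proof -
  have ind: "set_integrable lborel (cylinder (T + 1)) (\<lambda>\<zeta> :: real \<times> (real^'n). 1 :: real)"
    using T unfolding set_integrable_def
    by (simp add: emeasure_cylinder integrable_real_indicator)
  have k: "set_integrable lborel (cylinder (T + 1)) (\<lambda>\<zeta>. mollifier n (z - \<zeta>))"
    using set_integrable_mult_bounded[OF _ ind mollifier_reflected_borel[of n z] mollifier_abs_le] by simp
  have upper: "(LINT \<zeta>:cylinder (T + 1)|lborel. u \<zeta> * mollifier n (z - \<zeta>)) \<le> (LINT \<zeta>:cylinder (T + 1)|lborel. (c + \<eta>) * mollifier n (z - \<zeta>))"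
  proof (rule set_integral_mono[OF u])
    show "set_integrable lborel (cylinder (T + 1)) (\<lambda>\<zeta>. (c + \<eta>) * mollifier n (z - \<zeta>))" using k by simp
    show "u \<zeta> * mollifier n (z - \<zeta>) \<le> (c + \<eta>) * mollifier n (z - \<zeta>)" for \<zeta>
      using close[of \<zeta>] mollifier_nonneg[of n "z - \<zeta>"]
      by (cases "mollifier n (z - \<zeta>) = 0") (auto intro!: mult_right_mono)
  qed
  have lower: "(LINT \<zeta>:cylinder (T + 1)|lborel. (c - \<eta>) * mollifier n (z - \<zeta>)) \<le> (LINT \<zeta>:cylinder (T + 1)|lborel. u \<zeta> * mollifier n (z - \<zeta>))"
  proof (rule set_integral_mono[OF _ u])
    show "set_integrable lborel (cylinder (T + 1)) (\<lambda>\<zeta>. (c - \<eta>) * mollifier n (z - \<zeta>))" using k by simp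
    show "(c - \<eta>) * mollifier n (z - \<zeta>) \<le> u \<zeta> * mollifier n (z - \<zeta>)" for \<zeta>
      using close[of \<zeta>] mollifier_nonneg[of n "z - \<zeta>"]
      by (cases "mollifier n (z - \<zeta>) = 0") (auto intro!: mult_right_mono)
  qed
  show ?thesis using upper lower mollifier_mass[OF z, of n] by (simp add: abs_le_iff)
qed

text \<open>Below the truncation height \<open>M\<close> the power \<open>\<theta>\<close> is bounded by \<open>M powr \<theta>\<close>; above it, it is a small
  multiple of the power \<open>r\<close>.\<close>

lemma truncated_power_bound:
  fixes a M r \<theta> :: real
  assumes "0 \<le> a" "0 < M" "0 \<le> \<theta>" "\<theta> \<le> r"
  shows "max a 1 powr \<theta> \<le> M powr \<theta> + M powr (\<theta> - r) * (1 + a powr r)"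
proof (cases "max a 1 \<le> M")
  case True
  then have "max a 1 powr \<theta> \<le> M powr \<theta>" using assms by (intro powr_mono2) auto
  moreover have "0 \<le> M powr (\<theta> - r) * (1 + a powr r)" by simp
  ultimately show ?thesis by linarith
next
  case False
  have "max a 1 powr (\<theta> - r) \<le> M powr (\<theta> - r)" using False assms by (intro powr_mono2') auto
  moreover have "max a 1 powr r \<le> 1 + a powr r" by (cases "a \<le> 1") (auto simp: max_def)
  ultimately have "max a 1 powr (\<theta> - r) * max a 1 powr r \<le> M powr (\<theta> - r) * (1 + a powr r)"
    by (intro mult_mono) auto
  moreover have "max a 1 powr (\<theta> - r) * max a 1 powr r = max a 1 powr \<theta>"
    by (simp add: powr_add[symmetric])
  moreover have "0 \<le> M powr \<theta>" by simp
  ultimately show ?thesis by linarith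
qed

context relaxed_pair
begin

definition mollify :: "nat \<Rightarrow> (real \<times> (real^'n) \<Rightarrow> real) \<Rightarrow> real \<times> (real^'n) \<Rightarrow> real" where
  "mollify n u z = (LINT \<zeta>:cylinder (T + 1)|lborel. u \<zeta> * mollifier n (z - \<zeta>))"

lemma extend_set_integrable:
  fixes u :: "real \<times> (real^'n) \<Rightarrow> real"
  assumes "set_integrable lborel (cylinder T) u" "periodic v" "continuous_on UNIV v"
  shows "set_integrable lborel (cylinder (T + 1)) (extend u v)"
  using extend_integral(2)[OF assms, of "\<lambda>_. 1" 1] by simp

lemma \<phi>e_integrable: "set_integrable lborel (cylinder (T + 1)) \<phi>e"
  by (rule extend_set_integrable[OF \<phi>_integrable \<phi>T(1) \<phi>T_cont])

lemma \<alpha>e_integrable: "set_integrable lborel (cylinder (T + 1)) \<alpha>e"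
  by (rule extend_set_integrable[OF \<alpha>_integrable \<alpha>T_periodic \<alpha>T_cont])

lemma times_mollifier_integrable:
  fixes z :: "real \<times> (real^'n)"
  assumes "set_integrable lborel S u"
  shows "set_integrable lborel S (\<lambda>\<zeta>. u \<zeta> * mollifier n (z - \<zeta>))"
  by (rule set_integrable_mult_bounded[OF _ assms mollifier_reflected_borel mollifier_abs_le]) simp

lemma we_component_integrable: "set_integrable lborel (cylinder (T + 1)) (\<lambda>\<zeta>. we \<zeta> $ i)"
proof -
  have "set_integrable lborel (cylinder (T + 1)) (extend (\<lambda>z. w z $ i) (\<lambda>x. D\<phi>T x $ i))"
    using D\<phi>T_periodic
    by (intro extend_set_integrable[OF w_component_integrable] continuous_intros D\<phi>T_cont)
      (simp add: periodic_def)
  moreover have "extend (\<lambda>z. w z $ i) (\<lambda>x. D\<phi>T x $ i) = (\<lambda>\<zeta>. we \<zeta> $ i)"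
    by (simp add: extend_def fun_eq_iff)
  ultimately show ?thesis by simp
qed

lemma mollify_C1:
  shows "(mollify n \<phi>e has_derivative (\<lambda>h. h \<bullet> gradient (mollify n \<phi>e) z)) (at z)"
    and "continuous_on UNIV (gradient (mollify n \<phi>e))"
    and "periodic (\<lambda>x. mollify n \<phi>e (t, x))"
    and "b \<bullet> gradient (mollify n \<phi>e) z
      = - (LINT \<zeta>:cylinder (T + 1)|lborel. \<phi>e \<zeta> * partial_within UNIV b (\<lambda>\<zeta>. mollifier n (z - \<zeta>)) \<zeta>)"
proof -
  let ?k = "mollifier n :: real \<times> (real^'n) \<Rightarrow> real"
  let ?f = "\<lambda>\<zeta>. indicator (cylinder (T + 1)) \<zeta> * \<phi>e \<zeta>"
  have f: "integrable lborel ?f" using \<phi>e_integrable by (simp add: set_integrable_def)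
  obtain B where B: "\<And>z. \<bar>?k z\<bar> \<le> B" "\<And>z. norm (gradient ?k z) \<le> B" "uniformly_continuous_on UNIV (gradient ?k)"
    using compact_time_support_bounds[OF smooth_mollifier mollifier_periodic mollifier_outside] by metis
  interpret convolution_kernel ?k "gradient ?k" B
    by standard (use smooth_has_gradient[OF smooth_mollifier] B in auto)
  have M: "mollify n \<phi>e = (\<lambda>z. LINT \<zeta>|lborel. ?k (z - \<zeta>) * ?f \<zeta>)"
    by (simp add: mollify_def[abs_def] set_lebesgue_integral_def mult_ac)
  let ?G = "\<lambda>z. LINT \<zeta>|lborel. ?f \<zeta> *\<^sub>R gradient ?k (z - \<zeta>)"
  have D: "(mollify n \<phi>e has_derivative (\<lambda>h. h \<bullet> ?G z)) (at z)" for z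
    unfolding M by (rule has_derivative_convolution[OF sets_lborel f])
  have G: "gradient (mollify n \<phi>e) = ?G" by (rule ext) (rule gradient_eqI[OF D])
  show "(mollify n \<phi>e has_derivative (\<lambda>h. h \<bullet> gradient (mollify n \<phi>e) z)) (at z)" unfolding G by (rule D)
  show "continuous_on UNIV (gradient (mollify n \<phi>e))"
    unfolding G by (rule continuous_convolution_gradient[OF sets_lborel f])
  show "periodic (\<lambda>x. mollify n \<phi>e (t, x))"
    unfolding periodic_def
  proof (intro allI ballI)
    fix x k :: "real^'n" assume k: "k \<in> int_lattice"
    have "?k ((t, x + k) - \<zeta>) = ?k ((t, x) - \<zeta>)" for \<zeta>
    proof -
      have "?k (t - fst \<zeta>, (x - snd \<zeta>) + k) = ?k (t - fst \<zeta>, x - snd \<zeta>)"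
        using mollifier_periodic[of n "t - fst \<zeta>"] k unfolding periodic_def by blast
      then show ?thesis by (cases \<zeta>) (simp add: algebra_simps)
    qed
    then show "mollify n \<phi>e (t, x + k) = mollify n \<phi>e (t, x)" by (simp add: mollify_def)
  qed
  have pk: "partial_within UNIV b (\<lambda>\<zeta>. ?k (z - \<zeta>)) \<zeta> = - (b \<bullet> gradient ?k (z - \<zeta>))" for \<zeta>
  proof (rule partial_within_UNIV)
    have "((\<lambda>\<zeta>. z - \<zeta>) has_derivative (\<lambda>h. - h)) (at \<zeta>)" by (auto intro!: derivative_eq_intros)
    from has_derivative_compose[OF this smooth_has_gradient[OF smooth_mollifier]]
    show "((\<lambda>\<zeta>. ?k (z - \<zeta>)) has_derivative (\<lambda>h. - (h \<bullet> gradient ?k (z - \<zeta>)))) (at \<zeta>)" by simp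
  qed
  have "b \<bullet> ?G z = (LINT \<zeta>|lborel. b \<bullet> (?f \<zeta> *\<^sub>R gradient ?k (z - \<zeta>)))"
    by (rule integral_inner_right[symmetric]) (rule integrable_G[OF sets_lborel f])
  then show "b \<bullet> gradient (mollify n \<phi>e) z
      = - (LINT \<zeta>:cylinder (T + 1)|lborel. \<phi>e \<zeta> * partial_within UNIV b (\<lambda>\<zeta>. mollifier n (z - \<zeta>)) \<zeta>)"
    by (simp add: G pk set_lebesgue_integral_def mult.assoc)
qed

text \<open>The kernel is an admissible test function, so derivatives of the mollification are mollifications of
  weak derivatives.\<close>

lemma mollify_space_gradient:
  assumes z: "fst z \<in> {0..T}"
  shows "snd (gradient (mollify n \<phi>e) z) $ i = mollify n (\<lambda>\<zeta>. we \<zeta> $ i) z"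
proof -
  have "snd (gradient (mollify n \<phi>e) z) $ i = (0, axis i 1) \<bullet> gradient (mollify n \<phi>e) z"
    by (cases "gradient (mollify n \<phi>e) z") (simp add: inner_axis inner_commute[of "axis i 1"])
  also have "\<dots> = mollify n (\<lambda>\<zeta>. we \<zeta> $ i) z"
    using mollify_C1(4)[of "(0, axis i 1)" n z]
      extended_weak_gradient[unfolded weak_space_gradient_def, rule_format, OF test_function_mollifier[OF z], of n i]
    by (simp add: space_grad_within_def mollify_def)
  finally show ?thesis .
qed

lemma mollify_time_derivative:
  assumes z: "fst z \<in> {0..T}"
  shows "- fst (gradient (mollify n \<phi>e) z)
    \<le> mollify n \<alpha>e z - mollify n (\<lambda>\<zeta>. H (snd \<zeta>) (we \<zeta>)) z"
proof -
  have "fst (gradient (mollify n \<phi>e) z) = (1, 0) \<bullet> gradient (mollify n \<phi>e) z"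
    by (cases "gradient (mollify n \<phi>e) z") simp
  moreover have "\<forall>\<zeta>. 0 \<le> mollifier n (z - \<zeta>)" by (simp add: mollifier_nonneg)
  note extended_subsolution[unfolded HJ_subsolution_def, THEN spec, THEN mp, OF conjI[OF test_function_mollifier[OF z] this]]
  ultimately show ?thesis
    using mollify_C1(4)[of "(1, 0)" n z] by (simp add: time_deriv_within_def mollify_def)
qed

definition gradient_mass :: real where
  "gradient_mass = (LINT \<zeta>:cylinder (T + 1)|lborel. 1 + norm (we \<zeta>) powr r)"

text \<open>The constants collect the Lipschitz bound of the Hamiltonian in space, the radius of the space
  kernel, and the two contributions of \<open>truncated_power_bound\<close>.\<close>

definition commutator_error :: "nat \<Rightarrow> real" where
  "commutator_error n = Cx * (2 * real CARD('n))
     * (1 + mollifier_bound TYPE('n) * gradient_mass) * real (Suc n) powr (\<theta> * (real CARD('n) + 1) / r - 1)"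

lemma we_power_integrable: "set_integrable lborel (cylinder (T + 1)) (\<lambda>\<zeta>. 1 + norm (we \<zeta>) powr r)"
proof -
  have "continuous_on UNIV (\<lambda>x. norm (D\<phi>T x) powr r)"
    using r by (intro continuous_on_powr' continuous_intros D\<phi>T_cont) auto
  moreover have "periodic (\<lambda>x. norm (D\<phi>T x) powr r)" using D\<phi>T_periodic by (simp add: periodic_def)
  moreover have "set_integrable lborel (cylinder T) (\<lambda>z. norm (w z) powr r)"
    using w by (simp add: Lp_cylinder_def)
  ultimately have "set_integrable lborel (cylinder (T + 1)) (extend (\<lambda>z. norm (w z) powr r) (\<lambda>x. norm (D\<phi>T x) powr r))"
    by (intro extend_set_integrable)
  moreover have "extend (\<lambda>z. norm (w z) powr r) (\<lambda>x. norm (D\<phi>T x) powr r) = (\<lambda>\<zeta>. norm (we \<zeta>) powr r)"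
    by (simp add: extend_def fun_eq_iff)
  moreover have "set_integrable lborel (cylinder (T + 1)) (\<lambda>\<zeta> :: real \<times> (real^'n). 1 :: real)"
    using T unfolding set_integrable_def by (simp add: emeasure_cylinder integrable_real_indicator)
  ultimately show ?thesis by (intro set_integral_add(1)) simp_all
qed

lemma gradient_mass_nonneg: "0 \<le> gradient_mass"
  unfolding gradient_mass_def set_lebesgue_integral_def
  by (intro Bochner_Integration.integral_nonneg) simp

lemma commutator_error_nonneg: "0 \<le> commutator_error n"
  using Cx gradient_mass_nonneg mollifier_bound_pos[where 'n = 'n]
  unfolding commutator_error_def by (intro mult_nonneg_nonneg add_nonneg_nonneg) auto

lemma commutator_error_tendsto: "commutator_error \<longlonglongrightarrow> 0"
proof -
  have "\<theta> * (real CARD('n) + 1) / r - 1 < 0"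
    using \<theta>(2) r by (simp add: field_simps)
  from tendsto_neg_powr[OF this filterlim_compose[OF filterlim_real_sequentially filterlim_Suc]]
  have "(\<lambda>n. real (Suc n) powr (\<theta> * (real CARD('n) + 1) / r - 1)) \<longlonglongrightarrow> 0" .
  from tendsto_mult_left[OF this, of "Cx * (2 * real CARD('n)) * (1 + mollifier_bound TYPE('n) * gradient_mass)"]
  show ?thesis unfolding commutator_error_def[abs_def] by (simp only: mult_zero_right)
qed

text \<open>Jensen's inequality for the mollified gradient, obtained by integrating the supporting hyperplane
  of the Hamiltonian at \<open>\<xi>\<close>.  Freezing the space variable in the Hamiltonian
  costs the commutator error: the oscillation in space is of the order of the mollification radius
  \<open>1 / N\<close>, while averages of \<open>|we| powr \<theta>\<close> are controlled, after truncation at height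
  \<open>N powr ((d + 1) / r)\<close>, by the height of the kernel \<open>N ^ (d + 1)\<close> and the \<open>L^r\<close> norm of \<open>we\<close>.\<close>

lemma H_mollified_gradient:
  assumes z: "fst z \<in> {0..T}"
  shows "H (snd z) (snd (gradient (mollify n \<phi>e) z)) - commutator_error n
    \<le> mollify n (\<lambda>\<zeta>. H (snd \<zeta>) (we \<zeta>)) z"
proof -
  let ?x = "snd z" and ?N = "real (Suc n)" and ?d = "real CARD('n)"
  let ?k = "\<lambda>\<zeta>. mollifier n (z - \<zeta>)" and ?S = "cylinder (T + 1) :: (real \<times> (real^'n)) set"
  define \<xi> where "\<xi> = snd (gradient (mollify n \<phi>e) z)"
  define q where "q = DpH ?x \<xi>"
  define L where "L = Cx * (2 * ?d / ?N)"
  define M where "M = ?N powr ((?d + 1) / r)"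
  define Kb where "Kb = mollifier_bound TYPE('n) * ?N ^ (CARD('n) + 1)"
  define c where "c = L * M powr (\<theta> - r) * Kb"
  define a where "a = H ?x \<xi> - q \<bullet> \<xi> - L * M powr \<theta>"
  have L: "0 \<le> L" using Cx by (simp add: L_def)
  have M: "0 < M" by (simp add: M_def)
  have \<theta>r: "\<theta> \<le> r"
  proof -
    have "r / (?d + 1) \<le> r / 1" using r by (intro divide_left_mono) auto
    then show ?thesis using \<theta>(2) by simp
  qed
  have iw: "set_integrable lborel ?S (\<lambda>\<zeta>. we \<zeta> $ i * ?k \<zeta>)" for i
    by (rule times_mollifier_integrable[OF we_component_integrable])
  have ind: "set_integrable lborel ?S (\<lambda>\<zeta>. 1 :: real)"
    using T unfolding set_integrable_def by (simp add: emeasure_cylinder integrable_real_indicator)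
  have ik: "set_integrable lborel ?S ?k" using times_mollifier_integrable[OF ind, of n z] by simp
  have iH: "set_integrable lborel ?S (\<lambda>\<zeta>. H (snd \<zeta>) (we \<zeta>) * ?k \<zeta>)"
  proof -
    have "set_integrable lborel ?S (extend (\<lambda>z. H (snd z) (w z)) \<alpha>T)"
      by (rule extend_set_integrable[OF H_along_integrable[OF w] \<alpha>T_periodic \<alpha>T_cont])
    moreover have "extend (\<lambda>z. H (snd z) (w z)) \<alpha>T = (\<lambda>\<zeta>. H (snd \<zeta>) (we \<zeta>))"
      by (simp add: extend_def \<alpha>T_def fun_eq_iff)
    ultimately show ?thesis using times_mollifier_integrable by metis
  qed
  let ?lin = "\<lambda>\<zeta>. \<Sum>i\<in>UNIV. q $ i * (we \<zeta> $ i * ?k \<zeta>)"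
  have ilin: "set_integrable lborel ?S ?lin"
    unfolding set_integrable_def scaleR_sum_right
    using iw by (intro Bochner_Integration.integrable_sum) (simp add: set_integrable_def mult.left_commute)
  have lin: "(LINT \<zeta>:?S|lborel. ?lin \<zeta>) = q \<bullet> \<xi>"
  proof -
    have "(LINT \<zeta>:?S|lborel. ?lin \<zeta>) = (\<Sum>i\<in>UNIV. LINT \<zeta>:?S|lborel. q $ i * (we \<zeta> $ i * ?k \<zeta>))"
      unfolding set_lebesgue_integral_def scaleR_sum_right
      using iw by (intro Bochner_Integration.integral_sum) (simp add: set_integrable_def mult.left_commute)
    also have "\<dots> = (\<Sum>i\<in>UNIV. q $ i * \<xi> $ i)"
      using mollify_space_gradient[OF z, of n] by (simp add: mollify_def \<xi>_def)
    finally show ?thesis by (simp add: inner_vec_def)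
  qed
  \<comment> \<open>The kernel is kept in front of the affine part, whose integral is then exact, but is replaced by
    its height in front of the power \<open>r\<close>, of which only the integral is known.\<close>
  have key: "a * ?k \<zeta> + ?lin \<zeta> - c * (1 + norm (we \<zeta>) powr r) \<le> H (snd \<zeta>) (we \<zeta>) * ?k \<zeta>" for \<zeta>
  proof (cases "?k \<zeta> = 0")
    case True
    have "0 \<le> c" unfolding c_def Kb_def using L mollifier_bound_pos[where 'n = 'n] by simp
    then show ?thesis using True by simp
  next
    case False
    obtain k where k: "k \<in> int_lattice" "norm (?x - snd \<zeta> - k) \<le> 2 * ?d / ?N"
      by (rule mollifier_support[OF False])
    have "torus_dist (snd \<zeta>) ?x \<le> dist (snd \<zeta> - ?x) (- k)"
      unfolding torus_dist_def by (rule infdist_le[OF int_lattice_uminus[OF k(1)]])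
    also have "\<dots> = norm (?x - snd \<zeta> - k)"
      by (simp add: dist_norm norm_minus_commute algebra_simps)
    finally have td: "torus_dist (snd \<zeta>) ?x \<le> 2 * ?d / ?N" using k(2) by simp
    have "\<bar>H (snd \<zeta>) (we \<zeta>) - H ?x (we \<zeta>)\<bar> \<le> Cx * torus_dist (snd \<zeta>) ?x * max (norm (we \<zeta>)) 1 powr \<theta>"
      by (rule H_x)
    also have "\<dots> \<le> L * (M powr \<theta> + M powr (\<theta> - r) * (1 + norm (we \<zeta>) powr r))"
      unfolding L_def
      using td Cx truncated_power_bound[OF norm_ge_zero M \<theta>(1) \<theta>r, of "we \<zeta>"]
      by (intro mult_mono mult_left_mono) (auto simp: torus_dist_def infdist_nonneg)
    finally have "H ?x (we \<zeta>) - L * (M powr \<theta> + M powr (\<theta> - r) * (1 + norm (we \<zeta>) powr r)) \<le> H (snd \<zeta>) (we \<zeta>)"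
      by linarith
    moreover have "H ?x \<xi> + q \<bullet> (we \<zeta> - \<xi>) \<le> H ?x (we \<zeta>)" unfolding q_def by (rule H_tangent)
    ultimately have "a + q \<bullet> we \<zeta> - L * M powr (\<theta> - r) * (1 + norm (we \<zeta>) powr r) \<le> H (snd \<zeta>) (we \<zeta>)"
      by (simp add: a_def inner_diff_right algebra_simps)
    note low = mult_right_mono[OF this mollifier_nonneg[of n "z - \<zeta>"]]
    let ?X = "L * M powr (\<theta> - r) * (1 + norm (we \<zeta>) powr r)"
    have "(q \<bullet> we \<zeta>) * ?k \<zeta> = ?lin \<zeta>"
      by (simp add: inner_vec_def sum_distrib_right mult.assoc)
    then have "a * ?k \<zeta> + ?lin \<zeta> - ?X * ?k \<zeta> = (a + q \<bullet> we \<zeta> - ?X) * ?k \<zeta>"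
      by (simp only: left_diff_distrib distrib_right)
    moreover have "?X * ?k \<zeta> \<le> ?X * Kb"
      unfolding Kb_def using L by (intro mult_left_mono mollifier_le) simp
    moreover have "?X * Kb = c * (1 + norm (we \<zeta>) powr r)" unfolding c_def by (simp only: mult_ac)
    moreover have "\<lbrakk>u - v = s; v \<le> t; t = t'; s \<le> h\<rbrakk> \<Longrightarrow> u - t' \<le> h" for u v s t t' h :: real
      by linarith
    ultimately show ?thesis using low by blast
  qed
  have ic: "set_integrable lborel ?S (\<lambda>\<zeta>. c * (1 + norm (we \<zeta>) powr r))"
    by (intro set_integrable_mult_right) (simp add: we_power_integrable)
  have ia: "set_integrable lborel ?S (\<lambda>\<zeta>. a * ?k \<zeta>)" using ik by simp
  have "(LINT \<zeta>:?S|lborel. a * ?k \<zeta> + ?lin \<zeta> - c * (1 + norm (we \<zeta>) powr r)) \<le> mollify n (\<lambda>\<zeta>. H (snd \<zeta>) (we \<zeta>)) z"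
    unfolding mollify_def
    by (rule set_integral_mono[OF _ iH key]) (intro set_integral_diff(1) set_integral_add(1) ia ilin ic)
  also have "(LINT \<zeta>:?S|lborel. a * ?k \<zeta> + ?lin \<zeta> - c * (1 + norm (we \<zeta>) powr r)) = a + q \<bullet> \<xi> - c * gradient_mass"
    by (subst set_integral_diff(2)[OF set_integral_add(1)[OF ia ilin] ic], subst set_integral_add(2)[OF ia ilin])
      (simp add: lin gradient_mass_def mollifier_mass[OF z])
  finally have "H ?x \<xi> - (L * M powr \<theta> + c * gradient_mass) \<le> mollify n (\<lambda>\<zeta>. H (snd \<zeta>) (we \<zeta>)) z"
    by (simp add: a_def)
  moreover have "L * M powr \<theta> + c * gradient_mass = commutator_error n"
  proof -
    let ?e = "\<theta> * (?d + 1) / r"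
    have M\<theta>: "M powr \<theta> = ?N powr ?e" by (simp add: M_def powr_powr mult.commute)
    have "M powr (\<theta> - r) * ?N ^ (CARD('n) + 1) = ?N powr ((?d + 1) / r * (\<theta> - r)) * ?N powr (?d + 1)"
      by (simp add: M_def powr_powr powr_realpow[symmetric] powr_add)
    also have "\<dots> = ?N powr ((?d + 1) / r * (\<theta> - r) + (?d + 1))" by (simp add: powr_add)
    also have "(?d + 1) / r * (\<theta> - r) + (?d + 1) = ?e" using r by (simp add: field_simps)
    finally have M\<theta>r: "M powr (\<theta> - r) * ?N ^ (CARD('n) + 1) = ?N powr ?e" .
    have "?N powr ?e / ?N = ?N powr (?e - 1)" by (simp add: powr_diff)
    have "c = L * mollifier_bound TYPE('n) * (M powr (\<theta> - r) * ?N ^ (CARD('n) + 1))"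
      by (simp add: c_def Kb_def)
    then have "L * M powr \<theta> + c * gradient_mass = L * (1 + mollifier_bound TYPE('n) * gradient_mass) * ?N powr ?e"
      by (simp only: M\<theta> M\<theta>r) (simp add: algebra_simps)
    also have "\<dots> = Cx * (2 * ?d) * (1 + mollifier_bound TYPE('n) * gradient_mass) * (?N powr ?e / ?N)"
      by (simp add: L_def)
    finally show ?thesis unfolding commutator_error_def \<open>?N powr ?e / ?N = ?N powr (?e - 1)\<close> .
  qed
  ultimately show ?thesis by (simp add: \<xi>_def)
qed

lemma mollified_inequality:
  assumes z: "fst z \<in> {0..T}"
  shows "- fst (gradient (mollify n \<phi>e) z) + H (snd z) (snd (gradient (mollify n \<phi>e) z))
    \<le> mollify n \<alpha>e z + commutator_error n"
  using mollify_time_derivative[OF z, of n] H_mollified_gradient[OF z, of n] by linarith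

text \<open>The kernel looks into the future only, so at the final time the mollification sees nothing but
  the terminal datum.\<close>

lemma mollify_final_close:
  assumes u: "set_integrable lborel (cylinder (T + 1)) (extend u v)"
    and v: "periodic v" "continuous_on UNIV v" and "\<eta> > 0"
  shows "\<forall>\<^sub>F n in sequentially. \<forall>x. \<bar>mollify n (extend u v) (T, x) - v x\<bar> \<le> \<eta>"
proof -
  obtain d where d: "d > 0" "\<And>x y k. k \<in> int_lattice \<Longrightarrow> norm (x - y - k) < d \<Longrightarrow> norm (v x - v y) < \<eta>"
    using periodic_uniform[OF v \<open>\<eta> > 0\<close>] by metis
  show ?thesis
    using eventually_small_scale[OF d(1), of "2 * real CARD('n)"]
  proof (rule eventually_mono, intro allI)
    fix n x assume n: "2 * real CARD('n) / real (Suc n) < d"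
    show "\<bar>mollify n (extend u v) (T, x) - v x\<bar> \<le> \<eta>"
      unfolding mollify_def
    proof (rule mollifier_average_close[where T = T])
      show "set_integrable lborel (cylinder (T + 1)) (\<lambda>\<zeta>. extend u v \<zeta> * mollifier n ((T, x) - \<zeta>))"
        by (rule times_mollifier_integrable[OF u])
      fix \<zeta> :: "real \<times> (real^'n)" assume "mollifier n ((T, x) - \<zeta>) \<noteq> 0"
      then obtain k where k: "fst (T, x) < fst \<zeta>" "k \<in> int_lattice"
        "norm (snd (T, x) - snd \<zeta> - k) \<le> 2 * real CARD('n) / real (Suc n)"
        by (rule mollifier_support)
      then have "norm (v x - v (snd \<zeta>)) < \<eta>" using n by (intro d(2)[OF k(2)]) simp
      then show "\<bar>extend u v \<zeta> - v x\<bar> \<le> \<eta>" using k(1) by (simp add: extend_def abs_minus_commute)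
    qed (use T in auto)
  qed
qed

lemma final_value_close:
  assumes "\<eta> > 0"
  shows "\<forall>\<^sub>F n in sequentially. \<forall>x. \<bar>mollify n \<phi>e (T, x) - \<phi>T x\<bar> \<le> \<eta>"
  by (rule mollify_final_close[OF \<phi>e_integrable \<phi>T(1) \<phi>T_cont assms])

lemma final_gradient_close:
  assumes "\<eta> > 0"
  shows "\<forall>\<^sub>F n in sequentially. \<forall>x. norm (snd (gradient (mollify n \<phi>e) (T, x)) - D\<phi>T x) \<le> \<eta>"
proof -
  let ?\<eta> = "\<eta> / real CARD('n)"
  have ext: "extend (\<lambda>z. w z $ i) (\<lambda>x. D\<phi>T x $ i) = (\<lambda>\<zeta>. we \<zeta> $ i)" for i
    by (simp add: extend_def fun_eq_iff)
  have "\<forall>\<^sub>F n in sequentially. \<forall>x. \<bar>mollify n (\<lambda>\<zeta>. we \<zeta> $ i) (T, x) - D\<phi>T x $ i\<bar> \<le> ?\<eta>" for i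
    unfolding ext[symmetric]
    by (rule mollify_final_close)
      (use we_component_integrable[of i] D\<phi>T_periodic assms in
        \<open>auto simp: ext periodic_def intro!: continuous_intros D\<phi>T_cont\<close>)
  then have "\<forall>\<^sub>F n in sequentially. \<forall>i. \<forall>x. \<bar>mollify n (\<lambda>\<zeta>. we \<zeta> $ i) (T, x) - D\<phi>T x $ i\<bar> \<le> ?\<eta>"
    by (intro eventually_all_finite)
  then show ?thesis
  proof (rule eventually_mono, intro allI)
    fix n x assume *: "\<forall>i. \<forall>x. \<bar>mollify n (\<lambda>\<zeta>. we \<zeta> $ i) (T, x) - D\<phi>T x $ i\<bar> \<le> ?\<eta>"
    have "norm (snd (gradient (mollify n \<phi>e) (T, x)) - D\<phi>T x)
        \<le> (\<Sum>i\<in>(UNIV :: 'n set). \<bar>(snd (gradient (mollify n \<phi>e) (T, x)) - D\<phi>T x) $ i\<bar>)"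
      by (rule norm_le_l1_cart)
    also have "\<dots> \<le> (\<Sum>i\<in>(UNIV :: 'n set). ?\<eta>)"
      using * mollify_space_gradient[of "(T, x)" n] T by (intro sum_mono) simp
    finally show "norm (snd (gradient (mollify n \<phi>e) (T, x)) - D\<phi>T x) \<le> \<eta>" by simp
  qed
qed

text \<open>Fubini's theorem moves the space kernel from \<open>\<phi>\<close> to the weight, since it is even.  This gives
  the averages of the trace lemma: no time beyond \<open>T\<close> is involved once \<open>1 / N \<le> T\<close>.\<close>

lemma mollify_initial_weighted:
  fixes m :: "real^'n \<Rightarrow> real"
  assumes m: "periodic m" "continuous_on UNIV m" and n: "1 / real (Suc n) \<le> T"
  shows "(LINT x:unit_cell|lborel. mollify n \<phi>e (0, x) * m x)
    = (LINT z:cylinder T|lborel. \<phi> z * (time_bump (real (Suc n)) (fst z) * space_mollify n m (snd z)))"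
proof -
  interpret lc: pair_sigma_finite "cellM :: (real^'n) measure" "lborel :: (real \<times> (real^'n)) measure" ..
  let ?f = "\<lambda>\<zeta>. indicator (cylinder (T + 1)) \<zeta> * \<phi>e \<zeta>"
  have f: "integrable lborel ?f" using \<phi>e_integrable by (simp add: set_integrable_def)
  note [measurable] = borel_measurable_integrable[OF f]
  obtain B where B: "\<And>x. norm (m x) \<le> B" using periodic_bounded[OF m] by metis
  have B0: "0 \<le> B" using B[of 0] norm_ge_zero order_trans by blast
  have mm [measurable]: "m \<in> borel_measurable borel" by (rule borel_measurable_continuous_onI[OF m(2)])
  define C where "C = mollifier_bound TYPE('n) * real (Suc n) ^ (CARD('n) + 1) * B"
  let ?g = "\<lambda>x \<zeta>. mollifier n ((0, x) - \<zeta>) * m x"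
  have g: "\<bar>?g x \<zeta>\<bar> \<le> C" for x \<zeta>
    unfolding C_def abs_mult using B[of x] by (intro mult_mono mollifier_abs_le) (auto simp: mollifier_bound_pos less_imp_le)
  have gc: "continuous_on UNIV (\<lambda>p. ?g (fst p) (snd p))"
    by (intro continuous_intros continuous_on_compose2[OF smooth_continuous_on[OF smooth_mollifier, of UNIV]]
        continuous_on_compose2[OF m(2)]) auto
  have gm: "(\<lambda>p. ?g (fst p) (snd p)) \<in> borel_measurable (cellM \<Otimes>\<^sub>M lborel)"
  proof -
    have "sets (cellM \<Otimes>\<^sub>M lborel :: ((real^'n) \<times> (real \<times> (real^'n))) measure) = sets borel"
    proof -
      have "sets (cellM \<Otimes>\<^sub>M lborel :: ((real^'n) \<times> (real \<times> (real^'n))) measure) = sets (borel \<Otimes>\<^sub>M borel)"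
        by (intro sets_pair_measure_cong) simp_all
      then show ?thesis by (simp only: borel_prod)
    qed
    from measurable_cong_sets[OF this refl] show ?thesis
      using borel_measurable_continuous_onI[OF gc] by (rule equalityD2[THEN subsetD])
  qed
  have int: "integrable (cellM \<Otimes>\<^sub>M lborel) (\<lambda>p. ?f (snd p) * ?g (fst p) (snd p))"
  proof (rule Bochner_Integration.integrable_bound)
    show "integrable (cellM \<Otimes>\<^sub>M lborel) (\<lambda>p :: (real^'n) \<times> (real \<times> (real^'n)). C * ?f (snd p))"
    proof (rule lc.Fubini_integrable)
      show "(\<lambda>p. C * ?f (snd p)) \<in> borel_measurable (cellM \<Otimes>\<^sub>M lborel)" by measurable
    qed (use f in auto)
    show "(\<lambda>p. ?f (snd p) * ?g (fst p) (snd p)) \<in> borel_measurable (cellM \<Otimes>\<^sub>M lborel)"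
      by (rule borel_measurable_times[OF _ gm]) measurable
    show "AE p in cellM \<Otimes>\<^sub>M lborel. norm (?f (snd p) * ?g (fst p) (snd p)) \<le> norm (C * ?f (snd p))"
    proof (rule AE_I2)
      fix p :: "(real^'n) \<times> (real \<times> (real^'n))"
      have "\<bar>?f (snd p)\<bar> * \<bar>?g (fst p) (snd p)\<bar> \<le> \<bar>?f (snd p)\<bar> * \<bar>C\<bar>"
        using g[of "fst p" "snd p"] by (intro mult_left_mono) auto
      then show "norm (?f (snd p) * ?g (fst p) (snd p)) \<le> norm (C * ?f (snd p))"
        by (simp only: real_norm_def abs_mult mult.commute)
    qed
  qed
  have mc: "continuous_on UNIV (\<lambda>x. mollify n \<phi>e (0, x))"
  proof (rule continuous_on_compose2[where g = "mollify n \<phi>e" and f = "\<lambda>x. (0, x)" and t = UNIV])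
    show "continuous_on UNIV (mollify n \<phi>e)"
      using has_derivative_continuous[OF mollify_C1(1)[of n]] by (intro continuous_at_imp_continuous_on) blast
    show "continuous_on UNIV (\<lambda>x :: real^'n. (0 :: real, x))" by (intro continuous_intros)
  qed simp
  have meas: "(\<lambda>x. mollify n \<phi>e (0, x) * m x) \<in> borel_measurable borel"
    by (intro borel_measurable_continuous_onI continuous_intros mc m)
  have "(LINT x:unit_cell|lborel. mollify n \<phi>e (0, x) * m x) = (LINT x|cellM. mollify n \<phi>e (0, x) * m x)"
    by (rule set_integral_cell[OF meas])
  also have "\<dots> = (LINT x|cellM. LINT \<zeta>|lborel. ?f \<zeta> * ?g x \<zeta>)"
    by (simp add: mollify_def set_lebesgue_integral_def mult.assoc[symmetric])
  also have "\<dots> = (LINT \<zeta>|lborel. LINT x|cellM. ?f \<zeta> * ?g x \<zeta>)"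
    using lc.Fubini_integral[of "\<lambda>x \<zeta>. ?f \<zeta> * ?g x \<zeta>"] int by (simp add: case_prod_unfold)
  also have "\<dots> = (LINT \<zeta>|lborel. indicator (cylinder T) \<zeta> * (\<phi> \<zeta> * (time_bump (real (Suc n)) (fst \<zeta>) * space_mollify n m (snd \<zeta>))))"
  proof (rule Bochner_Integration.integral_cong[OF refl])
    fix \<zeta> :: "real \<times> (real^'n)"
    have "(LINT x|cellM. ?f \<zeta> * ?g x \<zeta>)
        = (LINT x|cellM. (?f \<zeta> * time_bump (real (Suc n)) (fst \<zeta>)) * (space_bump (real (Suc n)) (snd \<zeta> - x) * m x))"
      by (simp add: mollifier_def space_bump_even[of _ "snd \<zeta>"] mult.assoc)
    also have "\<dots> = (?f \<zeta> * time_bump (real (Suc n)) (fst \<zeta>)) * space_mollify n m (snd \<zeta>)"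
      by (simp add: space_mollify_def)
    also have "\<dots> = indicator (cylinder T) \<zeta> * (\<phi> \<zeta> * (time_bump (real (Suc n)) (fst \<zeta>) * space_mollify n m (snd \<zeta>)))"
    proof (cases "time_bump (real (Suc n)) (fst \<zeta>) = 0")
      case False
      have "fst \<zeta> < T" using time_bump_support(3)[OF _ False] n by simp
      then show ?thesis by (auto simp: indicator_def cylinder_def extend_def)
    qed simp
    finally show "(LINT x|cellM. ?f \<zeta> * ?g x \<zeta>)
        = indicator (cylinder T) \<zeta> * (\<phi> \<zeta> * (time_bump (real (Suc n)) (fst \<zeta>) * space_mollify n m (snd \<zeta>)))" .
  qed
  finally show ?thesis by (simp add: set_lebesgue_integral_def)
qed

lemma mollify_initial_limit:
  assumes m: "periodic m" "continuous_on UNIV m"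
  shows "(\<lambda>n. LINT x:unit_cell|lborel. mollify n \<phi>e (0, x) * m x)
    \<longlonglongrightarrow> (LINT x:unit_cell|lborel. initial_trace T \<phi> x * m x)"
proof -
  have "\<forall>\<^sub>F n in sequentially. (LINT z:cylinder T|lborel. \<phi> z * (time_bump (real (Suc n)) (fst z) * space_mollify n m (snd z)))
      = (LINT x:unit_cell|lborel. mollify n \<phi>e (0, x) * m x)"
    using eventually_small_scale[OF T, of 1]
    by (rule eventually_mono) (rule mollify_initial_weighted[OF m, symmetric], simp)
  from Lim_transform_eventually[OF trace_limit[OF T traces m] this]
  show ?thesis by (simp add: initial_trace_integral[OF T traces m])
qed

end

section \<open>The conjugate of the coupling primitive\<close>

lemma slab_periodic_uniform:
  fixes g :: "real \<times> (real^'n) \<Rightarrow> real"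
  assumes per: "\<And>t. t \<in> {a..b} \<Longrightarrow> periodic (\<lambda>x. g (t, x))" and cont: "continuous_on ({a..b} \<times> UNIV) g" and "e > 0"
  obtains d where "d > 0" "\<And>t x y. t \<in> {a..b} \<Longrightarrow> norm (x - y) < d \<Longrightarrow> \<bar>g (t, x) - g (t, y)\<bar> < e"
proof -
  let ?K = "{a..b} \<times> cbox (- 1) (2 :: real^'n)"
  have "uniformly_continuous_on ?K g"
    by (intro compact_uniformly_continuous compact_Times compact_cbox compact_Icc continuous_on_subset[OF cont]) auto
  then obtain d where d: "d > 0" "\<And>z z'. z \<in> ?K \<Longrightarrow> z' \<in> ?K \<Longrightarrow> dist z' z < d \<Longrightarrow> dist (g z') (g z) < e"
    using \<open>e > 0\<close> unfolding uniformly_continuous_on_def by metis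
  have "\<bar>g (t, x) - g (t, y)\<bar> < e" if t: "t \<in> {a..b}" and xy: "norm (x - y) < min d 1" for t x y
  proof -
    obtain k where k: "k \<in> int_lattice" "y - k \<in> unit_cell" by (rule cell_representative)
    have "\<bar>x $ i - y $ i\<bar> < 1" for i
      using component_le_norm_cart[of "x - y" i] xy by simp
    then have K: "(t, y - k) \<in> ?K" "(t, x - k) \<in> ?K"
      using cell_neighbour_in_box[OF k(2)] t by auto
    have "dist (g (t, x - k)) (g (t, y - k)) < e"
      by (rule d(2)[OF K]) (use xy in \<open>simp add: dist_Pair_Pair dist_norm\<close>)
    then show ?thesis
      by (simp add: periodic_minus[OF per[OF t] k(1)] dist_real_def)
  qed
  then show ?thesis using that[of "min d 1"] d(1) by auto
qed

text \<open>The supremum defining the conjugate is well behaved because \<open>f\<close> is nonnegative and grows at least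
  like the power \<open>q - 1\<close>.\<close>

locale coupling_data =
  fixes f :: "real^'n \<Rightarrow> real \<Rightarrow> real" and q Cf p :: real
  assumes f_periodic: "\<And>m. 0 \<le> m \<Longrightarrow> periodic (\<lambda>x. f x m)"
    and f_cont: "continuous_on (UNIV \<times> {0..}) (\<lambda>(x, m). f x m)"
    and f_mono: "\<And>x. strict_mono_on {0..} (f x)"
    and f_zero: "\<And>x. f x 0 = 0"
    and q: "1 < q" and Cf: "0 < Cf"
    and f_lower: "\<And>x m. 0 \<le> m \<Longrightarrow> 1 / Cf * m powr (q - 1) - Cf \<le> f x m"
    and p: "1 / p + 1 / q = 1"
begin

definition F :: "real^'n \<Rightarrow> real \<Rightarrow> real" where "F x m = integral {0..m} (f x)"

lemma f_incr: "0 \<le> m \<Longrightarrow> m \<le> m' \<Longrightarrow> f x m \<le> f x m'"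
  using f_mono[of x] by (auto simp: strict_mono_on_def le_less)

lemma f_nonneg: "0 \<le> m \<Longrightarrow> 0 \<le> f x m"
  using f_incr[of 0 m x] by (simp add: f_zero)

lemma f_cont_m: "0 \<le> a \<Longrightarrow> continuous_on {a..b} (f x)"
proof -
  assume "0 \<le> a"
  have "continuous_on {a..b} (\<lambda>m. (x, m))" by (intro continuous_intros)
  moreover have "(\<lambda>m. (x, m)) ` {a..b} \<subseteq> UNIV \<times> {0..}" using \<open>0 \<le> a\<close> by auto
  ultimately have "continuous_on {a..b} (\<lambda>m. (\<lambda>(x, m). f x m) (x, m))" by (rule continuous_on_compose2[OF f_cont])
  then show ?thesis by simp
qed

lemma f_integrable: "0 \<le> a \<Longrightarrow> f x integrable_on {a..b}"
  by (intro integrable_continuous_interval f_cont_m)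

lemma F_nonneg: "0 \<le> F x m"
  unfolding F_def by (rule Henstock_Kurzweil_Integration.integral_nonneg[OF f_integrable]) (auto intro: f_nonneg)

lemma F_zero: "F x 0 = 0"
  by (simp add: F_def)

text \<open>Since \<open>f\<close> increases, the integral over the upper half of the interval is at least half the length
  times the value at the midpoint.\<close>

lemma F_lower:
  assumes m: "0 \<le> m"
  shows "m / 2 * (1 / Cf * (m / 2) powr (q - 1) - Cf) \<le> F x m"
proof -
  have "m / 2 * (1 / Cf * (m / 2) powr (q - 1) - Cf) \<le> m / 2 * f x (m / 2)"
    using m f_lower[of "m / 2" x] by (intro mult_left_mono) auto
  also have "\<dots> = integral {m / 2..m} (\<lambda>_. f x (m / 2))" using m by simp
  also have "\<dots> \<le> integral {m / 2..m} (f x)"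
    using m by (intro integral_le f_integrable f_incr) auto
  also have "\<dots> \<le> integral {0..m} (f x)"
    using m by (intro integral_subset_le f_integrable) (auto intro: f_nonneg)
  finally show ?thesis by (simp add: F_def)
qed

text \<open>Beyond \<open>reach R\<close> the primitive dominates all linear functions of slope at most \<open>R\<close>, so that
  only bounded densities compete in the supremum defining the conjugate.\<close>

definition reach :: "real \<Rightarrow> real" where
  "reach R = 2 * (Cf * (2 * R + Cf)) powr (1 / (q - 1))"

lemma reach_nonneg: "0 \<le> reach R" by (simp add: reach_def)

lemma beyond_reach:
  assumes "\<bar>a\<bar> \<le> R" "reach R \<le> m" shows "a * m \<le> F x m"
proof -
  have m: "0 \<le> m" and R: "0 \<le> R" using reach_nonneg[of R] assms by linarith+
  have K: "0 < Cf * (2 * R + Cf)" using Cf R by (intro mult_pos_pos) auto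
  have "(Cf * (2 * R + Cf)) powr (1 / (q - 1)) \<le> m / 2" using assms(2) by (simp add: reach_def)
  then have "((Cf * (2 * R + Cf)) powr (1 / (q - 1))) powr (q - 1) \<le> (m / 2) powr (q - 1)"
    using q by (intro powr_mono2) auto
  then have "Cf * (2 * R + Cf) \<le> (m / 2) powr (q - 1)" using q K by (simp add: powr_powr)
  then have "2 * R + Cf \<le> 1 / Cf * (m / 2) powr (q - 1)" using Cf by (simp add: field_simps)
  then have "m / 2 * (2 * R) \<le> m / 2 * (1 / Cf * (m / 2) powr (q - 1) - Cf)"
    using m by (intro mult_left_mono) auto
  moreover have "a * m \<le> R * m" using assms(1) m by (intro mult_right_mono) auto
  ultimately show ?thesis using F_lower[OF m, of x] by (simp add: mult.commute)
qed

definition Fstar :: "real^'n \<Rightarrow> real \<Rightarrow> real" where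
  "Fstar x a = (SUP m\<in>{0..}. a * m - F x m)"

lemma affine_le: "0 \<le> m \<Longrightarrow> a * m - F x m \<le> \<bar>a\<bar> * reach \<bar>a\<bar>"
proof (cases "reach \<bar>a\<bar> \<le> m")
  case True
  have "0 \<le> \<bar>a\<bar> * reach \<bar>a\<bar>" by (intro mult_nonneg_nonneg reach_nonneg) auto
  then show ?thesis using beyond_reach[of a "\<bar>a\<bar>" m x] True by simp
next
  case False
  assume m: "0 \<le> m"
  have "a * m \<le> \<bar>a\<bar> * m" using m by (intro mult_right_mono) auto
  also have "\<dots> \<le> \<bar>a\<bar> * reach \<bar>a\<bar>" using False by (intro mult_left_mono) auto
  finally show ?thesis using F_nonneg[of x m] by linarith
qed

lemma Fstar_bdd: "bdd_above ((\<lambda>m. a * m - F x m) ` {0..})"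
  by (rule bdd_aboveI2) (auto intro: affine_le)

lemma Fstar_upper: "0 \<le> m \<Longrightarrow> a * m - F x m \<le> Fstar x a"
  unfolding Fstar_def by (rule cSUP_upper[OF _ Fstar_bdd]) simp

lemma Fstar_least: "(\<And>m. 0 \<le> m \<Longrightarrow> a * m - F x m \<le> c) \<Longrightarrow> Fstar x a \<le> c"
  unfolding Fstar_def by (rule cSUP_least) auto

lemma Fstar_nonneg: "0 \<le> Fstar x a"
  using Fstar_upper[of 0 a x] by (simp add: F_zero)

lemma coupling_conjugate_eq: "coupling_conjugate f x a = ereal (Fstar x a)"
proof (rule antisym)
  show "coupling_conjugate f x a \<le> ereal (Fstar x a)"
    unfolding coupling_conjugate_def convex_conjugate_def
  proof (rule SUP_least)
    fix m
    show "ereal (a * m) - coupling_primitive f x m \<le> ereal (Fstar x a)"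
      using Fstar_upper[of m a x] by (auto simp: coupling_primitive_def F_def)
  qed
  have "ereal (a * m - F x m) \<le> coupling_conjugate f x a" if "0 \<le> m" for m
  proof -
    have "ereal (a * m) - coupling_primitive f x m \<le> coupling_conjugate f x a"
      unfolding coupling_conjugate_def convex_conjugate_def by (rule SUP_upper) simp
    then show ?thesis using that by (simp add: coupling_primitive_def F_def)
  qed
  note * = this
  show "ereal (Fstar x a) \<le> coupling_conjugate f x a"
  proof (cases "coupling_conjugate f x a")
    case (real c)
    have "Fstar x a \<le> c" using * by (intro Fstar_least) (simp add: real)
    then show ?thesis by (simp add: real)
  next
    case MInf
    then show ?thesis using *[of 0] by (simp add: F_zero)
  qed simp
qed

lemma Fstar_mono: "a \<le> b \<Longrightarrow> Fstar x a \<le> Fstar x b"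
proof (rule Fstar_least)
  fix m :: real assume "a \<le> b" "0 \<le> m"
  then have "a * m \<le> b * m" by (intro mult_right_mono)
  then show "a * m - F x m \<le> Fstar x b" using Fstar_upper[OF \<open>0 \<le> m\<close>, of b x] by linarith
qed

lemma Fstar_convex:
  assumes "0 \<le> s" "s \<le> 1"
  shows "Fstar x ((1 - s) * a + s * b) \<le> (1 - s) * Fstar x a + s * Fstar x b"
proof (rule Fstar_least)
  fix m :: real assume m: "0 \<le> m"
  have "((1 - s) * a + s * b) * m - F x m = (1 - s) * (a * m - F x m) + s * (b * m - F x m)"
    by (simp add: algebra_simps)
  also have "\<dots> \<le> (1 - s) * Fstar x a + s * Fstar x b"
    using assms Fstar_upper[OF m] by (intro add_mono mult_left_mono) auto
  finally show "((1 - s) * a + s * b) * m - F x m \<le> (1 - s) * Fstar x a + s * Fstar x b" .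
qed

lemma Fstar_periodic: "periodic (\<lambda>x. Fstar x a)"
  unfolding periodic_def
proof (intro allI ballI)
  fix x k :: "real^'n" assume k: "k \<in> int_lattice"
  have "F (x + k) m = F x m" if "0 \<le> m" for m
    unfolding F_def
    by (rule Henstock_Kurzweil_Integration.integral_cong) (use f_periodic k in \<open>auto simp: periodic_def\<close>)
  then show "Fstar (x + k) a = Fstar x a"
    unfolding Fstar_def by (intro SUP_cong refl) simp
qed

text \<open>On bounded sets of slopes only densities up to \<open>reach R\<close> matter, so there the conjugate is Lipschitz
  in the slope and inherits uniform closeness of the primitives in the space variable.\<close>

lemma Fstar_compare:
  assumes R: "\<bar>a\<bar> \<le> R" and close: "\<And>m. m \<in> {0..reach R} \<Longrightarrow> F y m \<le> F x m + \<eta>" and "0 \<le> \<eta>"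
  shows "Fstar x a \<le> Fstar y b + reach R * \<bar>a - b\<bar> + \<eta>"
proof (rule Fstar_least)
  fix m :: real assume m: "0 \<le> m"
  show "a * m - F x m \<le> Fstar y b + reach R * \<bar>a - b\<bar> + \<eta>"
  proof (cases "m \<le> reach R")
    case True
    have "(a - b) * m \<le> \<bar>a - b\<bar> * reach R"
      using m True by (intro mult_mono) auto
    then have "a * m - F x m \<le> (b * m - F y m) + reach R * \<bar>a - b\<bar> + \<eta>"
      using close[of m] True m by (simp add: algebra_simps)
    then show ?thesis using Fstar_upper[OF m, of b y] by linarith
  next
    case False
    then have "a * m - F x m \<le> 0" using beyond_reach[OF R, of m x] by simp
    moreover have "0 \<le> reach R * \<bar>a - b\<bar>" by (intro mult_nonneg_nonneg reach_nonneg) auto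
    ultimately show ?thesis using Fstar_nonneg[of y b] \<open>0 \<le> \<eta>\<close> by linarith
  qed
qed

lemma Fstar_continuous: "continuous_on UNIV (\<lambda>(x, a). Fstar x a)"
  unfolding continuous_on_iff
proof (intro ballI allI impI)
  fix z :: "(real^'n) \<times> real" and e :: real assume e: "0 < e"
  obtain x a where z: "z = (x, a)" by (cases z)
  define R where "R = \<bar>a\<bar> + 1"
  define M where "M = reach R"
  have M: "0 \<le> M" by (simp add: M_def reach_nonneg)
  define \<eta> where "\<eta> = e / (4 * (M + 1))"
  have \<eta>: "0 < \<eta>" using e M by (simp add: \<eta>_def)
  have M\<eta>: "M * \<eta> \<le> e / 4"
  proof -
    have "M * \<eta> \<le> (M + 1) * \<eta>" using \<eta> by (intro mult_right_mono) auto
    also have "\<dots> = e / 4" using M by (simp add: \<eta>_def field_simps)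
    finally show ?thesis .
  qed
  obtain d where d: "d > 0"
    "\<And>m x y. m \<in> {0..M} \<Longrightarrow> norm (x - y) < d \<Longrightarrow> \<bar>(\<lambda>(m, x). f x m) (m, x) - (\<lambda>(m, x). f x m) (m, y)\<bar> < \<eta>"
  proof (rule slab_periodic_uniform[of 0 M "\<lambda>(m, x). f x m" \<eta>])
    show "periodic (\<lambda>x. (\<lambda>(m, x). f x m) (t, x))" if "t \<in> {0..M}" for t
      using f_periodic that by simp
    have "continuous_on ({0..M} \<times> UNIV) (\<lambda>z. (snd z, fst z))" by (intro continuous_intros)
    moreover have "(\<lambda>z :: real \<times> (real^'n). (snd z, fst z)) ` ({0..M} \<times> UNIV) \<subseteq> UNIV \<times> {0..}" by auto
    ultimately have "continuous_on ({0..M} \<times> UNIV) (\<lambda>z :: real \<times> (real^'n). (\<lambda>(x, m). f x m) (snd z, fst z))"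
      by (rule continuous_on_compose2[OF f_cont])
    then show "continuous_on ({0..M} \<times> UNIV) (\<lambda>(m, x :: real^'n). f x m)"
      by (simp add: case_prod_unfold)
  qed (use \<eta> in auto)
  have F_close: "F y m \<le> F x' m + M * \<eta>" if "m \<in> {0..M}" "norm (x' - y) < d" for x' y m
  proof -
    have "integral {0..m} (f y) \<le> integral {0..m} (\<lambda>t. f x' t + \<eta>)"
    proof (rule integral_le)
      show "f y t \<le> f x' t + \<eta>" if "t \<in> {0..m}" for t
        using d(2)[of t x' y] that \<open>m \<in> {0..M}\<close> \<open>norm (x' - y) < d\<close> by auto
    qed (auto intro!: f_integrable Henstock_Kurzweil_Integration.integrable_add)
    also have "\<dots> = integral {0..m} (f x') + m * \<eta>"
      using that by (subst Henstock_Kurzweil_Integration.integral_add) (auto intro!: f_integrable)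
    also have "m * \<eta> \<le> M * \<eta>" using that \<eta> by (intro mult_right_mono) auto
    finally show ?thesis by (simp add: F_def)
  qed
  show "\<exists>d>0. \<forall>z'\<in>UNIV. dist z' z < d \<longrightarrow> dist ((\<lambda>(x, a). Fstar x a) z') ((\<lambda>(x, a). Fstar x a) z) < e"
  proof (intro exI[of _ "min d (min 1 \<eta>)"] conjI ballI impI)
    show "0 < min d (min 1 \<eta>)" using d \<eta> by simp
    fix z' :: "(real^'n) \<times> real" assume *: "dist z' z < min d (min 1 \<eta>)"
    obtain y b where z': "z' = (y, b)" by (cases z')
    have xy: "norm (y - x) < d" "norm (x - y) < d" and ab: "\<bar>b - a\<bar> < 1" "\<bar>b - a\<bar> < \<eta>"
      using * dist_fst_le[of z' z] dist_snd_le[of z' z]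
      by (auto simp: z z' dist_norm norm_minus_commute)
    have "\<bar>a\<bar> \<le> R" "\<bar>b\<bar> \<le> R" using ab(1) by (auto simp: R_def)
    then have "Fstar x a \<le> Fstar y b + M * \<bar>a - b\<bar> + M * \<eta>" "Fstar y b \<le> Fstar x a + M * \<bar>b - a\<bar> + M * \<eta>"
      unfolding M_def using F_close[unfolded M_def] xy M \<eta> by (intro Fstar_compare; simp add: M_def[symmetric])+
    moreover have "M * \<bar>b - a\<bar> \<le> M * \<eta>" "M * \<bar>a - b\<bar> \<le> M * \<eta>" using ab M by (intro mult_left_mono; simp)+
    ultimately show "dist ((\<lambda>(x, a). Fstar x a) z') ((\<lambda>(x, a). Fstar x a) z) < e"
      using M\<eta> e by (simp add: z z' dist_real_def abs_le_iff)
  qed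
qed

lemma Fstar_continuous_x: "continuous_on UNIV (\<lambda>x. Fstar x a)"
proof -
  have "continuous_on UNIV (\<lambda>x :: real^'n. (x, a))" by (intro continuous_intros)
  from continuous_on_compose2[OF Fstar_continuous this] show ?thesis by simp
qed

lemma p_eq: "p = 1 + 1 / (q - 1)" and p_gt_1: "1 < p"
proof -
  have "1 / p = (q - 1) / q" using p q by (simp add: field_simps)
  then have "p = q / (q - 1)" using q by (metis div_by_1 divide_divide_eq_right mult_1)
  then show "p = 1 + 1 / (q - 1)" using q by (simp add: field_simps)
  then show "1 < p" using q by simp
qed

definition growth :: real where
  "growth = 2 * Cf powr (1 / (q - 1)) * (2 + Cf) powr p"

lemma growth_nonneg: "0 \<le> growth" by (simp add: growth_def)

lemma Fstar_growth: "Fstar x a \<le> growth * (1 + \<bar>a\<bar> powr p)"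
proof -
  let ?s = "2 * \<bar>a\<bar> + Cf" and ?e = "1 / (q - 1)" and ?M = "max \<bar>a\<bar> 1"
  have s: "0 < ?s" using Cf by simp
  have "Fstar x a \<le> \<bar>a\<bar> * reach \<bar>a\<bar>" by (rule Fstar_least) (rule affine_le)
  also have "\<dots> \<le> ?s * reach \<bar>a\<bar>" using Cf reach_nonneg by (intro mult_right_mono) auto
  also have "\<dots> = 2 * Cf powr ?e * (?s powr 1 * ?s powr ?e)"
    using Cf s by (simp add: reach_def powr_mult)
  also have "?s powr 1 * ?s powr ?e = ?s powr p" by (simp only: powr_add[symmetric] p_eq)
  also have "?s powr p \<le> ((2 + Cf) * ?M) powr p"
  proof (rule powr_mono2)
    have "Cf * 1 \<le> Cf * ?M" using Cf by (intro mult_left_mono) auto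
    then show "?s \<le> (2 + Cf) * ?M" by (simp add: distrib_right)
  qed (use s p_gt_1 in auto)
  also have "((2 + Cf) * ?M) powr p = (2 + Cf) powr p * ?M powr p" using Cf by (simp add: powr_mult)
  also have "?M powr p \<le> 1 + \<bar>a\<bar> powr p" by (cases "\<bar>a\<bar> \<le> 1") (auto simp: max_def)
  finally show ?thesis using Cf by (simp add: growth_def mult_left_mono mult.assoc)
qed

end

section \<open>Passing to the limit in the running cost\<close>

text \<open>The joint setting of a relaxed competitor and a coupling; the exponent \<open>p\<close> is shared.\<close>

locale relaxed_problem =
  relaxed_pair T r \<theta> CH Cx H \<phi>T DpH p \<phi> \<alpha> w g0 + coupling_data f q Cf p
  for T r \<theta> CH Cx :: real and H :: "real^'n \<Rightarrow> real^'n \<Rightarrow> real" and \<phi>T :: "real^'n \<Rightarrow> real"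
    and DpH :: "real^'n \<Rightarrow> real^'n \<Rightarrow> real^'n" and p :: real and \<phi> \<alpha> :: "real \<times> (real^'n) \<Rightarrow> real"
    and w :: "real \<times> (real^'n) \<Rightarrow> real^'n" and g0 :: "real^'n \<Rightarrow> real"
    and f :: "real^'n \<Rightarrow> real \<Rightarrow> real" and q Cf :: real
begin

lemma \<alpha>e_growth_integrable: "set_integrable lborel (cylinder (T + 1)) (\<lambda>\<zeta>. growth * (1 + \<bar>\<alpha>e \<zeta>\<bar> powr p))"
proof -
  have "continuous_on UNIV (\<lambda>x. \<bar>\<alpha>T x\<bar> powr p)"
    using p_gt_1 by (intro continuous_on_powr' continuous_intros \<alpha>T_cont) auto
  moreover have "periodic (\<lambda>x. \<bar>\<alpha>T x\<bar> powr p)" using \<alpha>T_periodic by (simp add: periodic_def)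
  moreover have "set_integrable lborel (cylinder T) (\<lambda>z. \<bar>\<alpha> z\<bar> powr p)"
    using \<alpha> by (simp add: Lp_cylinder_def)
  ultimately have "set_integrable lborel (cylinder (T + 1)) (extend (\<lambda>z. \<bar>\<alpha> z\<bar> powr p) (\<lambda>x. \<bar>\<alpha>T x\<bar> powr p))"
    by (intro extend_set_integrable)
  moreover have "extend (\<lambda>z. \<bar>\<alpha> z\<bar> powr p) (\<lambda>x. \<bar>\<alpha>T x\<bar> powr p) = (\<lambda>\<zeta>. \<bar>\<alpha>e \<zeta>\<bar> powr p)"
    by (simp add: extend_def fun_eq_iff)
  moreover have "set_integrable lborel (cylinder (T + 1)) (\<lambda>\<zeta> :: real \<times> (real^'n). 1 :: real)"
    using T unfolding set_integrable_def by (simp add: emeasure_cylinder integrable_real_indicator)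
  ultimately have "set_integrable lborel (cylinder (T + 1)) (\<lambda>\<zeta>. 1 + \<bar>\<alpha>e \<zeta>\<bar> powr p)"
    by (intro set_integral_add(1)) simp_all
  then show ?thesis by (rule set_integrable_mult_right)
qed

text \<open>Unlike \<open>\<alpha>e\<close>, which is unrestricted outside the extended cylinder, this version is Borel
  measurable on the whole space.\<close>

definition \<alpha>_cut :: "real \<times> (real^'n) \<Rightarrow> real" where
  "\<alpha>_cut \<zeta> = indicator (cylinder (T + 1)) \<zeta> * \<alpha>e \<zeta>"

lemma \<alpha>_cut_borel [measurable]: "\<alpha>_cut \<in> borel_measurable borel"
  using \<alpha>e_integrable borel_measurable_integrable[of lborel \<alpha>_cut]
  by (simp add: \<alpha>_cut_def[abs_def] set_integrable_def)

lemma \<alpha>_cut_eq: "\<zeta> \<in> cylinder (T + 1) \<Longrightarrow> \<alpha>_cut \<zeta> = \<alpha>e \<zeta>"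
  by (simp add: \<alpha>_cut_def)

lemma Fstar_borel: "(\<lambda>u. Fstar (fst u) (snd u)) \<in> borel_measurable borel"
  using borel_measurable_continuous_onI[OF Fstar_continuous] by (simp add: case_prod_unfold)

lemma Fstar_measurable:
  assumes "X \<in> borel_measurable M" "a \<in> borel_measurable M"
  shows "(\<lambda>u. Fstar (X u) (a u)) \<in> borel_measurable M"
  using measurable_compose[OF borel_measurable_Pair[OF assms] Fstar_borel] by simp

lemma Fstar_along_integrable: "set_integrable lborel (cylinder (T + 1)) (\<lambda>\<zeta>. Fstar x (\<alpha>e \<zeta>))"
  unfolding set_integrable_def
proof (rule Bochner_Integration.integrable_bound)
  show "integrable lborel (\<lambda>\<zeta>. indicator (cylinder (T + 1)) \<zeta> *\<^sub>R (growth * (1 + \<bar>\<alpha>e \<zeta>\<bar> powr p)))"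
    using \<alpha>e_growth_integrable by (simp add: set_integrable_def)
  have "(\<lambda>\<zeta>. Fstar x (\<alpha>_cut \<zeta>)) \<in> borel_measurable lborel"
    by (rule Fstar_measurable) simp_all
  then have "(\<lambda>\<zeta>. indicator (cylinder (T + 1)) \<zeta> * Fstar x (\<alpha>_cut \<zeta>)) \<in> borel_measurable lborel"
    by measurable
  moreover have "indicator (cylinder (T + 1)) \<zeta> * Fstar x (\<alpha>_cut \<zeta>) = indicator (cylinder (T + 1)) \<zeta> *\<^sub>R Fstar x (\<alpha>e \<zeta>)" for \<zeta>
    by (cases "\<zeta> \<in> cylinder (T + 1)") (simp_all add: \<alpha>_cut_eq)
  ultimately show "(\<lambda>\<zeta>. indicator (cylinder (T + 1)) \<zeta> *\<^sub>R Fstar x (\<alpha>e \<zeta>)) \<in> borel_measurable lborel"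
    by simp
  show "AE \<zeta> in lborel. norm (indicator (cylinder (T + 1)) \<zeta> *\<^sub>R Fstar x (\<alpha>e \<zeta>))
      \<le> norm (indicator (cylinder (T + 1)) \<zeta> *\<^sub>R (growth * (1 + \<bar>\<alpha>e \<zeta>\<bar> powr p)))"
  proof (rule AE_I2)
    fix \<zeta>
    have "\<bar>Fstar x (\<alpha>e \<zeta>)\<bar> \<le> \<bar>growth * (1 + \<bar>\<alpha>e \<zeta>\<bar> powr p)\<bar>"
      using Fstar_growth[of x "\<alpha>e \<zeta>"] Fstar_nonneg[of x "\<alpha>e \<zeta>"] by linarith
    then show "norm (indicator (cylinder (T + 1)) \<zeta> *\<^sub>R Fstar x (\<alpha>e \<zeta>))
      \<le> norm (indicator (cylinder (T + 1)) \<zeta> *\<^sub>R (growth * (1 + \<bar>\<alpha>e \<zeta>\<bar> powr p)))"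
      by (cases "\<zeta> \<in> cylinder (T + 1)") simp_all
  qed
qed

text \<open>Jensen's inequality holds for each affine function in the supremum, and so for the supremum.\<close>

lemma Fstar_jensen:
  assumes z: "fst z \<in> {0..T}"
  shows "Fstar x (mollify n \<alpha>e z) \<le> (LINT \<zeta>:cylinder (T + 1)|lborel. Fstar x (\<alpha>e \<zeta>) * mollifier n (z - \<zeta>))"
proof (rule Fstar_least)
  fix m :: real assume m: "0 \<le> m"
  let ?S = "cylinder (T + 1) :: (real \<times> (real^'n)) set" and ?k = "\<lambda>\<zeta>. mollifier n (z - \<zeta>)"
  have ia: "set_integrable lborel ?S (\<lambda>\<zeta>. m * (\<alpha>e \<zeta> * ?k \<zeta>))"
    by (intro set_integrable_mult_right) (simp add: times_mollifier_integrable[OF \<alpha>e_integrable])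
  have ind: "set_integrable lborel ?S (\<lambda>\<zeta>. 1 :: real)"
    using T unfolding set_integrable_def by (simp add: emeasure_cylinder integrable_real_indicator)
  have ik: "set_integrable lborel ?S (\<lambda>\<zeta>. F x m * ?k \<zeta>)"
    using times_mollifier_integrable[OF ind, of n z] by simp
  have "mollify n \<alpha>e z * m - F x m = (LINT \<zeta>:?S|lborel. m * (\<alpha>e \<zeta> * ?k \<zeta>)) - (LINT \<zeta>:?S|lborel. F x m * ?k \<zeta>)"
    using mollifier_mass[OF z, of n] by (simp add: mollify_def)
  also have "\<dots> = (LINT \<zeta>:?S|lborel. m * (\<alpha>e \<zeta> * ?k \<zeta>) - F x m * ?k \<zeta>)"
    by (rule set_integral_diff(2)[OF ia ik, symmetric])
  also have "\<dots> \<le> (LINT \<zeta>:?S|lborel. Fstar x (\<alpha>e \<zeta>) * ?k \<zeta>)"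
  proof (rule set_integral_mono[OF set_integral_diff(1)[OF ia ik] times_mollifier_integrable[OF Fstar_along_integrable]])
    fix \<zeta>
    have "(\<alpha>e \<zeta> * m - F x m) * ?k \<zeta> \<le> Fstar x (\<alpha>e \<zeta>) * ?k \<zeta>"
      by (intro mult_right_mono Fstar_upper m mollifier_nonneg)
    then show "m * (\<alpha>e \<zeta> * ?k \<zeta>) - F x m * ?k \<zeta> \<le> Fstar x (\<alpha>e \<zeta>) * ?k \<zeta>"
      by (simp add: algebra_simps)
  qed
  finally show "mollify n \<alpha>e z * m - F x m \<le> (LINT \<zeta>:?S|lborel. Fstar x (\<alpha>e \<zeta>) * ?k \<zeta>)" .
qed

text \<open>Jensen's inequality leaves a double integral of \<open>Fstar x (\<alpha>e \<zeta>)\<close> in which the space variable \<open>x\<close>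
  need not be that of \<open>\<zeta>\<close>.  Integrating first over \<open>x\<close> gives a function of \<open>\<zeta>\<close> that
  converges pointwise, because \<open>Fstar\<close> is continuous in \<open>x\<close>, although \<open>\<alpha>e\<close> is not continuous.\<close>

definition smeared_cost :: "nat \<Rightarrow> real \<times> (real^'n) \<Rightarrow> real" where
  "smeared_cost n \<zeta> = space_mollify n (\<lambda>x. Fstar x (\<alpha>e \<zeta>)) (snd \<zeta>)"

lemma Fstar_cell_integrable: "integrable cellM (\<lambda>x. Fstar x a)"
proof -
  obtain B where B: "\<And>x. norm (Fstar x a) \<le> B" using periodic_bounded[OF Fstar_periodic Fstar_continuous_x] by metis
  show ?thesis
    by (rule integrable_cellM_bounded[of _ B]) (use B borel_measurable_continuous_onI[OF Fstar_continuous_x] in auto)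
qed

lemma smeared_cost_bounds: "0 \<le> smeared_cost n \<zeta>" "smeared_cost n \<zeta> \<le> growth * (1 + \<bar>\<alpha>e \<zeta>\<bar> powr p)"
proof -
  let ?c = "growth * (1 + \<bar>\<alpha>e \<zeta>\<bar> powr p)"
  have c: "0 \<le> ?c" using growth_nonneg by simp
  have "\<bar>(LINT x|cellM. space_bump (real (Suc n)) (snd \<zeta> - x) * Fstar x (\<alpha>e \<zeta>)) - ?c / 2\<bar> \<le> ?c / 2"
  proof (rule space_average_close[OF _ Fstar_cell_integrable])
    fix y k :: "real^'n"
    show "\<bar>Fstar y (\<alpha>e \<zeta>) - ?c / 2\<bar> \<le> ?c / 2"
      using Fstar_growth[of y "\<alpha>e \<zeta>"] Fstar_nonneg[of y "\<alpha>e \<zeta>"] by linarith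
  qed (use c in simp_all)
  then show "0 \<le> smeared_cost n \<zeta>" "smeared_cost n \<zeta> \<le> ?c"
    unfolding smeared_cost_def space_mollify_def by linarith+
qed

lemma smeared_cost_measurable: "(\<lambda>\<zeta>. indicator (cylinder (T + 1)) \<zeta> * smeared_cost n \<zeta>) \<in> borel_measurable borel"
proof -
  have s: "sets (lborel \<Otimes>\<^sub>M cellM :: ((real \<times> (real^'n)) \<times> (real^'n)) measure) = sets borel"
  proof -
    have "sets (lborel \<Otimes>\<^sub>M cellM :: ((real \<times> (real^'n)) \<times> (real^'n)) measure) = sets (borel \<Otimes>\<^sub>M borel)"
      by (intro sets_pair_measure_cong) simp_all
    then show ?thesis by (simp only: borel_prod)
  qed
  have "(\<lambda>u :: (real \<times> (real^'n)) \<times> (real^'n). space_bump (real (Suc n)) (snd (fst u) - snd u)) \<in> borel_measurable borel"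
    by (intro borel_measurable_continuous_onI continuous_on_compose2[OF smooth_continuous_on[OF smooth_space_bump, of UNIV]]
        continuous_intros) auto
  moreover have "(\<lambda>u :: (real \<times> (real^'n)) \<times> (real^'n). Fstar (snd u) (\<alpha>_cut (fst u))) \<in> borel_measurable borel"
  proof (rule Fstar_measurable)
    show "(\<lambda>u :: (real \<times> (real^'n)) \<times> (real^'n). \<alpha>_cut (fst u)) \<in> borel_measurable borel"
      by (rule measurable_compose[OF _ \<alpha>_cut_borel]) (intro borel_measurable_continuous_onI continuous_intros)
  qed (intro borel_measurable_continuous_onI continuous_intros)
  ultimately have "(\<lambda>u :: (real \<times> (real^'n)) \<times> (real^'n). space_bump (real (Suc n)) (snd (fst u) - snd u) * Fstar (snd u) (\<alpha>_cut (fst u))) \<in> borel_measurable borel"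
    by (rule borel_measurable_times)
  then have "case_prod (\<lambda>\<zeta> x. space_bump (real (Suc n)) (snd \<zeta> - x) * Fstar x (\<alpha>_cut \<zeta>)) \<in> borel_measurable (lborel \<Otimes>\<^sub>M cellM)"
    unfolding measurable_cong_sets[OF s refl] by (simp add: case_prod_unfold)
  from cell.borel_measurable_lebesgue_integral[OF this]
  have "(\<lambda>\<zeta>. LINT x|cellM. space_bump (real (Suc n)) (snd \<zeta> - x) * Fstar x (\<alpha>_cut \<zeta>)) \<in> borel_measurable borel" by simp
  then have "(\<lambda>\<zeta>. indicator (cylinder (T + 1)) \<zeta> * (LINT x|cellM. space_bump (real (Suc n)) (snd \<zeta> - x) * Fstar x (\<alpha>_cut \<zeta>))) \<in> borel_measurable borel"
    by (intro borel_measurable_times borel_measurable_indicator cylinder_borel)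
  moreover have "(\<lambda>\<zeta>. indicator (cylinder (T + 1)) \<zeta> * (LINT x|cellM. space_bump (real (Suc n)) (snd \<zeta> - x) * Fstar x (\<alpha>_cut \<zeta>)))
      = (\<lambda>\<zeta>. indicator (cylinder (T + 1)) \<zeta> * smeared_cost n \<zeta>)"
  proof
    fix \<zeta>
    show "indicator (cylinder (T + 1)) \<zeta> * (LINT x|cellM. space_bump (real (Suc n)) (snd \<zeta> - x) * Fstar x (\<alpha>_cut \<zeta>))
      = indicator (cylinder (T + 1)) \<zeta> * smeared_cost n \<zeta>"
      by (cases "\<zeta> \<in> cylinder (T + 1)") (simp_all add: \<alpha>_cut_eq smeared_cost_def space_mollify_def)
  qed
  ultimately show ?thesis by (simp only:)
qed

text \<open>The kernels centred at times up to \<open>T\<close> reach at most \<open>1 / N\<close> beyond \<open>T\<close>; the cost of the continued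
  datum on this layer is kept and disappears in the limit.\<close>

definition layered_cost :: "nat \<Rightarrow> real \<times> (real^'n) \<Rightarrow> real" where
  "layered_cost n \<zeta> = (if fst \<zeta> < T + 1 / real (Suc n) then indicator (cylinder (T + 1)) \<zeta> * smeared_cost n \<zeta> else 0)"

lemma layered_cost_borel: "layered_cost n \<in> borel_measurable borel"
proof -
  have "open {\<zeta> :: real \<times> (real^'n). fst \<zeta> < T + 1 / real (Suc n)}"
    by (intro open_Collect_less continuous_intros)
  then have "{\<zeta> :: real \<times> (real^'n). fst \<zeta> < T + 1 / real (Suc n)} \<in> sets borel" by (rule borel_open)
  then show ?thesis unfolding layered_cost_def[abs_def]
    by (intro measurable_If smeared_cost_measurable) simp_all
qed

lemma layered_cost_bounds:
  "0 \<le> layered_cost n \<zeta>"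
  "layered_cost n \<zeta> \<le> indicator (cylinder (T + 1)) \<zeta> *\<^sub>R (growth * (1 + \<bar>\<alpha>e \<zeta>\<bar> powr p))"
proof -
  have "0 \<le> growth * (1 + \<bar>\<alpha>e \<zeta>\<bar> powr p)" using growth_nonneg by simp
  then show "0 \<le> layered_cost n \<zeta>"
    "layered_cost n \<zeta> \<le> indicator (cylinder (T + 1)) \<zeta> *\<^sub>R (growth * (1 + \<bar>\<alpha>e \<zeta>\<bar> powr p))"
    using smeared_cost_bounds[of n \<zeta>] by (auto simp: layered_cost_def indicator_def)
qed

lemma layered_cost_integrable: "integrable lborel (layered_cost n)"
proof (rule Bochner_Integration.integrable_bound)
  show "integrable lborel (\<lambda>\<zeta>. indicator (cylinder (T + 1)) \<zeta> *\<^sub>R (growth * (1 + \<bar>\<alpha>e \<zeta>\<bar> powr p)))"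
    using \<alpha>e_growth_integrable by (simp add: set_integrable_def)
  show "AE \<zeta> in lborel. norm (layered_cost n \<zeta>) \<le> norm (indicator (cylinder (T + 1)) \<zeta> *\<^sub>R (growth * (1 + \<bar>\<alpha>e \<zeta>\<bar> powr p)))"
  proof (rule AE_I2)
    fix \<zeta>
    show "norm (layered_cost n \<zeta>) \<le> norm (indicator (cylinder (T + 1)) \<zeta> *\<^sub>R (growth * (1 + \<bar>\<alpha>e \<zeta>\<bar> powr p)))"
      unfolding real_norm_def using layered_cost_bounds[of n \<zeta>] by linarith
  qed
qed (simp add: layered_cost_borel)

lemma running_cost_measurable: "(\<lambda>z. indicator (cylinder T) z *\<^sub>R Fstar (snd z) (\<alpha> z)) \<in> borel_measurable lborel"
proof -
  have "(\<lambda>z. Fstar (snd z) (\<alpha>_cut z)) \<in> borel_measurable borel"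
    by (rule Fstar_measurable[OF _ \<alpha>_cut_borel])
      (intro borel_measurable_continuous_onI continuous_on_snd continuous_on_id)
  then have "(\<lambda>z. indicator (cylinder T) z * Fstar (snd z) (\<alpha>_cut z)) \<in> borel_measurable lborel" by measurable
  moreover have "indicator (cylinder T) z * Fstar (snd z) (\<alpha>_cut z) = indicator (cylinder T) z *\<^sub>R Fstar (snd z) (\<alpha> z)" for z
  proof (cases "z \<in> cylinder T")
    case True
    then have "z \<in> cylinder (T + 1)" "fst z < T" using cylinder_Un[OF T] by (auto simp: cylinder_def)
    then show ?thesis using True by (simp add: \<alpha>_cut_eq extend_def)
  qed simp
  ultimately show ?thesis by simp
qed

lemma layered_cost_limit:
  "(\<lambda>n. LINT \<zeta>|lborel. layered_cost n \<zeta>) \<longlonglongrightarrow> (LINT z:cylinder T|lborel. Fstar (snd z) (\<alpha> z))"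
  unfolding set_lebesgue_integral_def
proof (rule integral_dominated_convergence)
  show "integrable lborel (\<lambda>\<zeta>. indicator (cylinder (T + 1)) \<zeta> *\<^sub>R (growth * (1 + \<bar>\<alpha>e \<zeta>\<bar> powr p)))"
    using \<alpha>e_growth_integrable by (simp add: set_integrable_def)
  show "(\<lambda>z. indicator (cylinder T) z *\<^sub>R Fstar (snd z) (\<alpha> z)) \<in> borel_measurable lborel"
    by (rule running_cost_measurable)
  show "layered_cost n \<in> borel_measurable lborel" for n using layered_cost_borel by simp
  show "AE \<zeta> in lborel. norm (layered_cost n \<zeta>) \<le> indicator (cylinder (T + 1)) \<zeta> *\<^sub>R (growth * (1 + \<bar>\<alpha>e \<zeta>\<bar> powr p))" for n
  proof (rule AE_I2)
    fix \<zeta>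
    show "norm (layered_cost n \<zeta>) \<le> indicator (cylinder (T + 1)) \<zeta> *\<^sub>R (growth * (1 + \<bar>\<alpha>e \<zeta>\<bar> powr p))"
      unfolding real_norm_def using layered_cost_bounds[of n \<zeta>] by linarith
  qed
  show "AE \<zeta> in lborel. (\<lambda>n. layered_cost n \<zeta>) \<longlonglongrightarrow> indicator (cylinder T) \<zeta> *\<^sub>R Fstar (snd \<zeta>) (\<alpha> \<zeta>)"
    using AE_time_neq[of T]
  proof (rule eventually_mono)
    fix \<zeta> :: "real \<times> (real^'n)" assume neq: "fst \<zeta> \<noteq> T"
    consider "\<zeta> \<in> cylinder T" | "\<zeta> \<notin> cylinder (T + 1)" | "\<zeta> \<in> cylinder (T + 1)" "T < fst \<zeta>"
    proof -
      have "T < fst \<zeta>" if "\<zeta> \<notin> cylinder T" "\<zeta> \<in> cylinder (T + 1)"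
        using that neq by (auto simp: cylinder_def)
      then show ?thesis using that by blast
    qed
    then show "(\<lambda>n. layered_cost n \<zeta>) \<longlonglongrightarrow> indicator (cylinder T) \<zeta> *\<^sub>R Fstar (snd \<zeta>) (\<alpha> \<zeta>)"
    proof cases
      case 1
      then have c: "\<zeta> \<in> cylinder (T + 1)" "fst \<zeta> < T" using cylinder_Un[OF T] by (auto simp: cylinder_def)
      have lc: "layered_cost n \<zeta> = smeared_cost n \<zeta>" for n
      proof -
        have "0 < 1 / real (Suc n)" by simp
        then have "fst \<zeta> < T + 1 / real (Suc n)" using c(2) by linarith
        then show ?thesis using c(1) by (simp add: layered_cost_def)
      qed
      have "(\<lambda>n. smeared_cost n \<zeta>) \<longlonglongrightarrow> Fstar (snd \<zeta>) (\<alpha>e \<zeta>)"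
      proof (rule tendstoI)
        fix e :: real assume "e > 0"
        then have "\<forall>\<^sub>F n in sequentially. \<forall>x. \<bar>space_mollify n (\<lambda>x. Fstar x (\<alpha>e \<zeta>)) x - Fstar x (\<alpha>e \<zeta>)\<bar> \<le> e / 2"
          by (intro space_mollify_uniform Fstar_periodic Fstar_continuous_x) simp
        then show "\<forall>\<^sub>F n in sequentially. dist (smeared_cost n \<zeta>) (Fstar (snd \<zeta>) (\<alpha>e \<zeta>)) < e"
        proof (rule eventually_mono)
          fix n assume *: "\<forall>x. \<bar>space_mollify n (\<lambda>x. Fstar x (\<alpha>e \<zeta>)) x - Fstar x (\<alpha>e \<zeta>)\<bar> \<le> e / 2"
          show "dist (smeared_cost n \<zeta>) (Fstar (snd \<zeta>) (\<alpha>e \<zeta>)) < e"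
            using spec[OF *, of "snd \<zeta>"] \<open>e > 0\<close> unfolding dist_real_def smeared_cost_def by linarith
        qed
      qed
      then show ?thesis using 1 c(2) by (simp add: lc extend_def)
    next
      case 2
      then have "\<zeta> \<notin> cylinder T" using cylinder_Un[OF T] by auto
      moreover have "layered_cost n \<zeta> = 0" for n using 2 by (simp add: layered_cost_def)
      ultimately show ?thesis by simp
    next
      case 3
      have "\<forall>\<^sub>F n in sequentially. 1 / real (Suc n) < fst \<zeta> - T"
        using 3(2) by (intro eventually_small_scale) simp
      then have "\<forall>\<^sub>F n in sequentially. layered_cost n \<zeta> = 0"
      proof (rule eventually_mono)
        fix n assume "1 / real (Suc n) < fst \<zeta> - T"
        then have "\<not> fst \<zeta> < T + 1 / real (Suc n)" by linarith
        then show "layered_cost n \<zeta> = 0" unfolding layered_cost_def by (rule if_not_P)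
      qed
      moreover have "\<zeta> \<notin> cylinder T" using 3(2) by (auto simp: cylinder_def)
      ultimately show ?thesis by (simp add: tendsto_eventually)
    qed
  qed
qed

lemma mollify_continuous:
  assumes "set_integrable lborel (cylinder (T + 1)) u"
  shows "continuous_on UNIV (mollify n u)"
proof -
  let ?k = "mollifier n :: real \<times> (real^'n) \<Rightarrow> real"
  let ?f = "\<lambda>\<zeta>. indicator (cylinder (T + 1)) \<zeta> * u \<zeta>"
  have f: "integrable lborel ?f" using assms by (simp add: set_integrable_def)
  obtain B where B: "\<And>z. \<bar>?k z\<bar> \<le> B" "\<And>z. norm (gradient ?k z) \<le> B" "uniformly_continuous_on UNIV (gradient ?k)"
    using compact_time_support_bounds[OF smooth_mollifier mollifier_periodic mollifier_outside] by metis
  interpret convolution_kernel ?k "gradient ?k" B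
    by standard (use smooth_has_gradient[OF smooth_mollifier] B in auto)
  have M: "mollify n u = (\<lambda>z. LINT \<zeta>|lborel. ?k (z - \<zeta>) * ?f \<zeta>)"
    by (simp add: mollify_def[abs_def] set_lebesgue_integral_def mult_ac)
  show ?thesis
    unfolding M using has_derivative_continuous[OF has_derivative_convolution[OF sets_lborel f]]
    by (intro continuous_at_imp_continuous_on) blast
qed

lemma time_bump_reflected:
  assumes "0 < N"
  shows "(\<integral>\<^sup>+t. ennreal (time_bump N (s - t)) \<partial>timeM 0 T) \<le> 1"
proof -
  have nn: "0 \<le> time_bump N t" for t using assms by (simp add: time_bump_nonneg)
  have "integrable lborel (\<lambda>t. time_bump N (s + (- 1) * t))"
    by (rule lborel_integrable_real_affine[OF integrable_time_bump[OF assms]]) simp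
  then have i: "integrable lborel (\<lambda>t. time_bump N (s - t))" by simp
  have "(LINT t|lborel. time_bump N (s + (- 1) * t)) = (LINT t|lborel. time_bump N t)"
    using lborel_integral_real_affine[of "- 1" "time_bump N" s] by simp
  then have one: "(LINT t|lborel. time_bump N (s - t)) = 1"
    using integral_time_bump[OF assms, of 0] by simp
  have "(\<integral>\<^sup>+t. ennreal (time_bump N (s - t)) \<partial>timeM 0 T) = (\<integral>\<^sup>+t. indicator {0<..<T} t * ennreal (time_bump N (s - t)) \<partial>lborel)"
    unfolding timeM_def by (rule nn_integral_density) auto
  also have "\<dots> \<le> (\<integral>\<^sup>+t. ennreal (time_bump N (s - t)) \<partial>lborel)"
    by (intro nn_integral_mono) (auto simp: indicator_def)
  also have "\<dots> = 1" using nn_integral_eq_integral[OF i] nn one by simp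
  finally show ?thesis .
qed

text \<open>The kernel in time has mass at most one on \<open>(0, T)\<close> and mass zero if \<open>\<zeta>\<close> lies beyond its reach.\<close>

lemma inner_cost_le:
  assumes \<zeta>: "\<zeta> \<in> cylinder (T + 1)"
  shows "(\<integral>\<^sup>+z. ennreal (Fstar (snd z) (\<alpha>e \<zeta>) * mollifier n (z - \<zeta>)) \<partial>cylM 0 T) \<le> ennreal (layered_cost n \<zeta>)"
proof -
  let ?N = "real (Suc n)" and ?a = "\<alpha>e \<zeta>" and ?s = "fst \<zeta>" and ?y = "snd \<zeta>"
  have N: "0 < ?N" "1 \<le> ?N" by simp_all
  show ?thesis
  proof (cases "?s < T + 1 / ?N")
    case True
    have J: "(\<integral>\<^sup>+x. ennreal (space_bump ?N (x - ?y) * Fstar x ?a) \<partial>cellM) = ennreal (smeared_cost n \<zeta>)"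
    proof -
      obtain B where B: "\<And>x. norm (Fstar x ?a) \<le> B" using periodic_bounded[OF Fstar_periodic Fstar_continuous_x] by metis
      have m: "(\<lambda>x. space_bump ?N (?y - x) * Fstar x ?a) \<in> borel_measurable borel"
        by (intro borel_measurable_continuous_onI continuous_on_mult Fstar_continuous_x
            continuous_on_compose2[OF smooth_continuous_on[OF smooth_space_bump, of UNIV]] continuous_intros) auto
      have i: "integrable cellM (\<lambda>x. space_bump ?N (?y - x) * Fstar x ?a)"
      proof (rule integrable_cellM_bounded[OF m])
        fix x
        have X: "\<bar>space_bump ?N (?y - x)\<bar> \<le> (6 / flat 0 (1/2)) ^ CARD('n) * ?N ^ CARD('n)"
          using space_bump_bound[OF N(2), of "?y - x"] space_bump_nonneg[OF N(2), of "?y - x"] by simp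
        then have "0 \<le> (6 / flat 0 (1/2)) ^ CARD('n) * ?N ^ CARD('n)"
          by (rule order_trans[OF abs_ge_zero])
        from mult_mono[OF X B[of x, unfolded real_norm_def] this abs_ge_zero]
        show "norm (space_bump ?N (?y - x) * Fstar x ?a) \<le> ((6 / flat 0 (1/2)) ^ CARD('n) * ?N ^ CARD('n)) * B"
          unfolding real_norm_def abs_mult .
      qed
      have nn: "AE x in cellM. 0 \<le> space_bump ?N (?y - x) * Fstar x ?a"
        by (intro AE_I2 mult_nonneg_nonneg space_bump_nonneg[OF N(2)] Fstar_nonneg)
      have "(\<integral>\<^sup>+x. ennreal (space_bump ?N (x - ?y) * Fstar x ?a) \<partial>cellM)
          = (\<integral>\<^sup>+x. ennreal (space_bump ?N (?y - x) * Fstar x ?a) \<partial>cellM)"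
        by (subst space_bump_even) (rule refl)
      also have "\<dots> = ennreal (LINT x|cellM. space_bump ?N (?y - x) * Fstar x ?a)"
        by (rule nn_integral_eq_integral[OF i nn])
      finally show ?thesis by (simp add: smeared_cost_def space_mollify_def)
    qed
    have meas: "(\<lambda>z. ennreal (Fstar (snd z) ?a * mollifier n (z - \<zeta>))) \<in> borel_measurable (timeM 0 T \<Otimes>\<^sub>M cellM)"
    proof -
      have "continuous_on UNIV (\<lambda>z :: real \<times> (real^'n). Fstar (snd z) ?a * mollifier n (z - \<zeta>))"
        by (intro continuous_on_mult continuous_on_compose2[OF Fstar_continuous_x]
            continuous_on_compose2[OF smooth_continuous_on[OF smooth_mollifier, of UNIV]] continuous_intros) auto
      then have "(\<lambda>z :: real \<times> (real^'n). ennreal (Fstar (snd z) ?a * mollifier n (z - \<zeta>))) \<in> borel_measurable borel"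
        by (intro measurable_compose[OF borel_measurable_continuous_onI measurable_ennreal])
      then show ?thesis using measurable_cong_sets[OF sets_cylM[of 0 T, unfolded cylM_def] refl] by blast
    qed
    have "(\<integral>\<^sup>+z. ennreal (Fstar (snd z) ?a * mollifier n (z - \<zeta>)) \<partial>cylM 0 T)
        = (\<integral>\<^sup>+t. \<integral>\<^sup>+x. ennreal (Fstar x ?a * mollifier n ((t, x) - \<zeta>)) \<partial>cellM \<partial>timeM 0 T)"
      unfolding cylM_def by (subst cell.nn_integral_fst[OF meas, symmetric]) simp
    also have "\<dots> = (\<integral>\<^sup>+t. ennreal (time_bump ?N (?s - t)) * ennreal (smeared_cost n \<zeta>) \<partial>timeM 0 T)"
    proof (rule nn_integral_cong)
      fix t
      have "(\<integral>\<^sup>+x. ennreal (Fstar x ?a * mollifier n ((t, x) - \<zeta>)) \<partial>cellM)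
          = (\<integral>\<^sup>+x. ennreal (time_bump ?N (?s - t)) * ennreal (space_bump ?N (x - ?y) * Fstar x ?a) \<partial>cellM)"
      proof (rule nn_integral_cong)
        fix x
        have "Fstar x ?a * mollifier n ((t, x) - \<zeta>) = time_bump ?N (?s - t) * (space_bump ?N (x - ?y) * Fstar x ?a)"
          by (simp add: mollifier_def mult_ac)
        then show "ennreal (Fstar x ?a * mollifier n ((t, x) - \<zeta>))
            = ennreal (time_bump ?N (?s - t)) * ennreal (space_bump ?N (x - ?y) * Fstar x ?a)"
          by (simp only: ennreal_mult[OF time_bump_nonneg[of ?N "?s - t"] mult_nonneg_nonneg[OF space_bump_nonneg[OF N(2)] Fstar_nonneg]])
      qed
      also have "\<dots> = ennreal (time_bump ?N (?s - t)) * ennreal (smeared_cost n \<zeta>)"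
      proof (subst nn_integral_cmult)
        have "continuous_on UNIV (\<lambda>x. space_bump ?N (x - ?y) * Fstar x ?a)"
          by (intro continuous_on_mult Fstar_continuous_x
            continuous_on_compose2[OF smooth_continuous_on[OF smooth_space_bump, of UNIV]] continuous_intros) auto
        then show "(\<lambda>x. ennreal (space_bump ?N (x - ?y) * Fstar x ?a)) \<in> borel_measurable cellM"
          using measurable_compose[OF borel_measurable_continuous_onI measurable_ennreal]
            measurable_cong_sets[OF sets_cellM refl] by blast
      qed (simp only: J)
      finally show "(\<integral>\<^sup>+x. ennreal (Fstar x ?a * mollifier n ((t, x) - \<zeta>)) \<partial>cellM)
          = ennreal (time_bump ?N (?s - t)) * ennreal (smeared_cost n \<zeta>)" .
    qed
    also have "\<dots> = (\<integral>\<^sup>+t. ennreal (time_bump ?N (?s - t)) \<partial>timeM 0 T) * ennreal (smeared_cost n \<zeta>)"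
      by (rule nn_integral_multc) measurable
    also have "\<dots> \<le> 1 * ennreal (smeared_cost n \<zeta>)"
      by (rule mult_right_mono[OF time_bump_reflected[OF N(1)]]) simp
    also have "\<dots> = ennreal (layered_cost n \<zeta>)"
      using True \<zeta> by (simp add: layered_cost_def)
    finally show ?thesis .
  next
    case False
    have "AE z in cylM 0 T. ennreal (Fstar (snd z) ?a * mollifier n (z - \<zeta>)) = 0"
      using AE_cylM[of 0 T]
    proof (rule eventually_mono)
      fix z :: "real \<times> (real^'n)" assume z: "z \<in> {0<..<T} \<times> unit_cell"
      have "mollifier n (z - \<zeta>) = 0"
      proof (rule ccontr)
        assume "mollifier n (z - \<zeta>) \<noteq> 0"
        then have "?s < fst z + 1 / ?N" by (rule mollifier_support)
        then show False using z False by auto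
      qed
      then show "ennreal (Fstar (snd z) ?a * mollifier n (z - \<zeta>)) = 0" by simp
    qed
    then have "(\<integral>\<^sup>+z. ennreal (Fstar (snd z) ?a * mollifier n (z - \<zeta>)) \<partial>cylM 0 T) = (\<integral>\<^sup>+(z :: real \<times> (real^'n)). 0 \<partial>cylM 0 T)"
      by (rule nn_integral_cong_AE)
    then show ?thesis by simp
  qed
qed

text \<open>Jensen's inequality followed by Tonelli's theorem.\<close>

lemma mollified_cost_le:
  "(\<integral>\<^sup>+z. ennreal (Fstar (snd z) (mollify n \<alpha>e z)) \<partial>cylM 0 T) \<le> ennreal (LINT \<zeta>|lborel. layered_cost n \<zeta>)"
proof -
  let ?M = "cylM 0 T :: (real \<times> (real^'n)) measure"
  interpret cl: pair_sigma_finite ?M "lborel :: (real \<times> (real^'n)) measure" ..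
  let ?\<Phi> = "\<lambda>z \<zeta>. ennreal (indicator (cylinder (T + 1)) \<zeta> * (Fstar (snd z) (\<alpha>_cut \<zeta>) * mollifier n (z - \<zeta>)))"
  have sets: "sets (?M \<Otimes>\<^sub>M (lborel :: (real \<times> (real^'n)) measure)) = sets borel"
  proof -
    have "sets (?M \<Otimes>\<^sub>M (lborel :: (real \<times> (real^'n)) measure)) = sets (borel \<Otimes>\<^sub>M borel)"
      by (intro sets_pair_measure_cong) simp_all
    then show ?thesis by (simp only: borel_prod)
  qed
  have meas: "(\<lambda>u. ?\<Phi> (fst u) (snd u)) \<in> borel_measurable (?M \<Otimes>\<^sub>M lborel)"
    unfolding measurable_cong_sets[OF sets refl]
  proof (rule measurable_compose[OF _ measurable_ennreal], intro borel_measurable_times)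
    have sndm: "(snd :: (real \<times> (real^'n)) \<times> (real \<times> (real^'n)) \<Rightarrow> _) \<in> borel_measurable borel"
      by (intro borel_measurable_continuous_onI continuous_on_snd continuous_on_id)
    show "(\<lambda>u :: (real \<times> (real^'n)) \<times> (real \<times> (real^'n)). indicator (cylinder (T + 1)) (snd u) :: real) \<in> borel_measurable borel"
      by (rule measurable_compose[OF sndm borel_measurable_indicator[OF cylinder_borel]])
    show "(\<lambda>u :: (real \<times> (real^'n)) \<times> (real \<times> (real^'n)). Fstar (snd (fst u)) (\<alpha>_cut (snd u))) \<in> borel_measurable borel"
      by (rule Fstar_measurable[OF _ measurable_compose[OF sndm \<alpha>_cut_borel]])
        (intro borel_measurable_continuous_onI continuous_intros)
    show "(\<lambda>u :: (real \<times> (real^'n)) \<times> (real \<times> (real^'n)). mollifier n (fst u - snd u)) \<in> borel_measurable borel"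
      by (intro borel_measurable_continuous_onI
          continuous_on_compose2[OF smooth_continuous_on[OF smooth_mollifier, of UNIV]] continuous_intros) auto
  qed
  have "(\<integral>\<^sup>+z. ennreal (Fstar (snd z) (mollify n \<alpha>e z)) \<partial>?M) \<le> (\<integral>\<^sup>+z. \<integral>\<^sup>+\<zeta>. ?\<Phi> z \<zeta> \<partial>lborel \<partial>?M)"
  proof (rule nn_integral_mono_AE, use AE_cylM[of 0 T] in \<open>rule eventually_mono\<close>)
    fix z :: "real \<times> (real^'n)" assume "z \<in> {0<..<T} \<times> unit_cell"
    then have z: "fst z \<in> {0..T}" by auto
    let ?u = "\<lambda>\<zeta>. indicator (cylinder (T + 1)) \<zeta> *\<^sub>R (Fstar (snd z) (\<alpha>e \<zeta>) * mollifier n (z - \<zeta>))"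
    have i: "integrable lborel ?u"
      using times_mollifier_integrable[OF Fstar_along_integrable, of "snd z" n z] by (simp add: set_integrable_def)
    have nn: "0 \<le> ?u \<zeta>" for \<zeta> by (simp add: Fstar_nonneg mollifier_nonneg)
    have "ennreal (Fstar (snd z) (mollify n \<alpha>e z)) \<le> ennreal (LINT \<zeta>|lborel. ?u \<zeta>)"
      using Fstar_jensen[OF z, of "snd z" n] unfolding set_lebesgue_integral_def by (rule ennreal_leI)
    also have "\<dots> = (\<integral>\<^sup>+\<zeta>. ennreal (?u \<zeta>) \<partial>lborel)"
      using nn by (intro nn_integral_eq_integral[OF i, symmetric]) simp
    also have "\<dots> = (\<integral>\<^sup>+\<zeta>. ?\<Phi> z \<zeta> \<partial>lborel)"
    proof (intro nn_integral_cong)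
      fix \<zeta> show "ennreal (?u \<zeta>) = ?\<Phi> z \<zeta>"
        by (cases "\<zeta> \<in> cylinder (T + 1)") (simp_all add: \<alpha>_cut_eq)
    qed
    finally show "ennreal (Fstar (snd z) (mollify n \<alpha>e z)) \<le> (\<integral>\<^sup>+\<zeta>. ?\<Phi> z \<zeta> \<partial>lborel)" .
  qed
  also have "\<dots> = (\<integral>\<^sup>+\<zeta>. \<integral>\<^sup>+z. ?\<Phi> z \<zeta> \<partial>?M \<partial>lborel)"
    using cl.Fubini[OF meas] by simp
  also have "\<dots> \<le> (\<integral>\<^sup>+\<zeta>. ennreal (layered_cost n \<zeta>) \<partial>lborel)"
  proof (rule nn_integral_mono)
    fix \<zeta> :: "real \<times> (real^'n)"
    show "(\<integral>\<^sup>+z. ?\<Phi> z \<zeta> \<partial>?M) \<le> ennreal (layered_cost n \<zeta>)"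
      using inner_cost_le[of \<zeta> n] by (cases "\<zeta> \<in> cylinder (T + 1)") (simp_all add: \<alpha>_cut_eq)
  qed
  also have "\<dots> = ennreal (LINT \<zeta>|lborel. layered_cost n \<zeta>)"
    by (rule nn_integral_eq_integral[OF layered_cost_integrable]) (simp add: layered_cost_bounds)
  finally show ?thesis .
qed

end

section \<open>Smooth competitors with almost the relaxed cost\<close>

text \<open>For the running cost the conjugate takes finite values only, so it may be replaced by \<open>Fstar\<close>.\<close>

lemma A0_eq_real:
  fixes f :: "real^'n \<Rightarrow> real \<Rightarrow> real"
  assumes "coupling_data f q Cf p"
  shows "A0 T f H m0 \<psi> = enn2ereal (\<integral>\<^sup>+z. ennreal (coupling_data.Fstar f (snd z)
        (- time_deriv_within (slab T) \<psi> z + H (snd z) (space_grad_within (slab T) \<psi> z)))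
      * indicator (cylinder T) z \<partial>lborel) - ereal (LINT x:unit_cell|lborel. \<psi> (0, x) * m0 x)"
  unfolding A0_def coupling_data.coupling_conjugate_eq[OF assms] e2ennreal_ereal ..

context relaxed_problem
begin

lemma relaxed_cost_eq:
  "A T f m0 \<phi> \<alpha> = ereal ((LINT z:cylinder T|lborel. Fstar (snd z) (\<alpha> z))
      - (LINT x:unit_cell|lborel. initial_trace T \<phi> x * m0 x))"
proof -
  have i: "integrable lborel (\<lambda>z. indicator (cylinder T) z *\<^sub>R Fstar (snd z) (\<alpha> z))"
  proof (rule Bochner_Integration.integrable_bound)
    show "integrable lborel (\<lambda>\<zeta>. indicator (cylinder (T + 1)) \<zeta> *\<^sub>R (growth * (1 + \<bar>\<alpha>e \<zeta>\<bar> powr p)))"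
      using \<alpha>e_growth_integrable by (simp add: set_integrable_def)
    show "AE z in lborel. norm (indicator (cylinder T) z *\<^sub>R Fstar (snd z) (\<alpha> z))
        \<le> norm (indicator (cylinder (T + 1)) z *\<^sub>R (growth * (1 + \<bar>\<alpha>e z\<bar> powr p)))"
    proof (rule AE_I2)
      fix z :: "real \<times> (real^'n)"
      show "norm (indicator (cylinder T) z *\<^sub>R Fstar (snd z) (\<alpha> z))
        \<le> norm (indicator (cylinder (T + 1)) z *\<^sub>R (growth * (1 + \<bar>\<alpha>e z\<bar> powr p)))"
      proof (cases "z \<in> cylinder T")
        case True
        then have z: "z \<in> cylinder (T + 1)" "\<alpha>e z = \<alpha> z"
          using cylinder_Un[OF T] by (auto simp: cylinder_def extend_def)
        have "\<bar>Fstar (snd z) (\<alpha> z)\<bar> \<le> \<bar>growth * (1 + \<bar>\<alpha> z\<bar> powr p)\<bar>"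
          using Fstar_growth[of "snd z" "\<alpha> z"] Fstar_nonneg[of "snd z" "\<alpha> z"] by linarith
        then show ?thesis using True z by simp
      qed simp
    qed
  qed (rule running_cost_measurable)
  have "(\<integral>\<^sup>+z. e2ennreal (coupling_conjugate f (snd z) (\<alpha> z)) * indicator (cylinder T) z \<partial>lborel)
      = (\<integral>\<^sup>+z. ennreal (indicator (cylinder T) z *\<^sub>R Fstar (snd z) (\<alpha> z)) \<partial>lborel)"
    by (intro nn_integral_cong) (auto simp: coupling_conjugate_eq e2ennreal_ereal indicator_def)
  also have "\<dots> = ennreal (LINT z:cylinder T|lborel. Fstar (snd z) (\<alpha> z))"
    unfolding set_lebesgue_integral_def by (rule nn_integral_eq_integral[OF i]) (simp add: Fstar_nonneg)
  finally have "(\<integral>\<^sup>+z. e2ennreal (coupling_conjugate f (snd z) (\<alpha> z)) * indicator (cylinder T) z \<partial>lborel)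
      = ennreal (LINT z:cylinder T|lborel. Fstar (snd z) (\<alpha> z))" .
  moreover have "0 \<le> (LINT z:cylinder T|lborel. Fstar (snd z) (\<alpha> z))"
    unfolding set_lebesgue_integral_def by (intro Bochner_Integration.integral_nonneg) (simp add: Fstar_nonneg)
  ultimately show ?thesis by (simp add: A_def enn2ereal_ennreal)
qed

lemma H_convex:
  assumes "0 \<le> s" "s \<le> 1"
  shows "H x ((1 - s) *\<^sub>R u + s *\<^sub>R v) \<le> (1 - s) * H x u + s * H x v"
proof -
  let ?y = "(1 - s) *\<^sub>R u + s *\<^sub>R v" and ?q = "DpH x ((1 - s) *\<^sub>R u + s *\<^sub>R v)"
  have "(1 - s) * (H x ?y + ?q \<bullet> (u - ?y)) + s * (H x ?y + ?q \<bullet> (v - ?y)) \<le> (1 - s) * H x u + s * H x v"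
    using assms by (intro add_mono mult_left_mono H_tangent) auto
  moreover have "(1 - s) * (H x ?y + ?q \<bullet> (u - ?y)) + s * (H x ?y + ?q \<bullet> (v - ?y))
      = H x ?y + ?q \<bullet> ((1 - s) *\<^sub>R (u - ?y) + s *\<^sub>R (v - ?y))"
    by (simp add: inner_add_right algebra_simps)
  moreover have "(1 - s) *\<^sub>R (u - ?y) + s *\<^sub>R (v - ?y) = 0"
    by (simp add: algebra_simps)
  ultimately show ?thesis by simp
qed

text \<open>The competitor: the mollified function, shrunk by the factor \<open>1 - s\<close> and corrected by a function
  of space alone so as to meet the terminal condition.  The shrinking leaves room for the correction
  in the convex Hamiltonian.\<close>

definition competitor :: "real \<Rightarrow> nat \<Rightarrow> real \<times> (real^'n) \<Rightarrow> real" where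
  "competitor s n z = (1 - s) * mollify n \<phi>e z + (\<phi>T (snd z) - (1 - s) * mollify n \<phi>e (T, snd z))"

definition competitor_gradient :: "real \<Rightarrow> nat \<Rightarrow> real \<times> (real^'n) \<Rightarrow> real \<times> (real^'n)" where
  "competitor_gradient s n z = (1 - s) *\<^sub>R gradient (mollify n \<phi>e) z
    + (0, D\<phi>T (snd z) - (1 - s) *\<^sub>R snd (gradient (mollify n \<phi>e) (T, snd z)))"

lemma competitor_derivative:
  "(competitor s n has_derivative (\<lambda>h. h \<bullet> competitor_gradient s n z)) (at z)"
proof -
  let ?G = "gradient (mollify n \<phi>e)"
  have 1: "(mollify n \<phi>e has_derivative (\<lambda>h. h \<bullet> ?G z)) (at z)" by (rule mollify_C1(1))
  have 2: "((\<lambda>z. \<phi>T (snd z)) has_derivative (\<lambda>h. snd h \<bullet> D\<phi>T (snd z))) (at z)"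
    by (rule has_derivative_compose[OF _ \<phi>T_derivative]) (auto intro!: derivative_eq_intros)
  have "((\<lambda>z :: real \<times> (real^'n). (T, snd z)) has_derivative (\<lambda>h. (0, snd h))) (at z)"
    by (auto intro!: derivative_eq_intros)
  from has_derivative_compose[OF this mollify_C1(1)]
  have 3: "((\<lambda>z. mollify n \<phi>e (T, snd z)) has_derivative (\<lambda>h. (0, snd h) \<bullet> ?G (T, snd z))) (at z)" .
  have "(competitor s n has_derivative (\<lambda>h. (1 - s) * (h \<bullet> ?G z)
      + (snd h \<bullet> D\<phi>T (snd z) - (1 - s) * ((0, snd h) \<bullet> ?G (T, snd z))))) (at z)"
    unfolding competitor_def[abs_def]
    by (intro has_derivative_add has_derivative_diff has_derivative_mult_right 1 2 3)
  moreover have "(\<lambda>h. (1 - s) * (h \<bullet> ?G z) + (snd h \<bullet> D\<phi>T (snd z) - (1 - s) * ((0, snd h) \<bullet> ?G (T, snd z))))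
      = (\<lambda>h. h \<bullet> competitor_gradient s n z)"
  proof
    fix h :: "real \<times> (real^'n)"
    show "(1 - s) * (h \<bullet> ?G z) + (snd h \<bullet> D\<phi>T (snd z) - (1 - s) * ((0, snd h) \<bullet> ?G (T, snd z)))
        = h \<bullet> competitor_gradient s n z"
      by (cases h; cases "?G z"; cases "?G (T, snd z)")
        (simp add: competitor_gradient_def inner_diff_right inner_add_right algebra_simps)
  qed
  ultimately show ?thesis by simp
qed

lemma competitor_gradient_continuous: "continuous_on S (competitor_gradient s n)"
proof -
  have c: "continuous_on UNIV (gradient (mollify n \<phi>e))" by (rule mollify_C1(2))
  have "continuous_on UNIV (competitor_gradient s n)"
    unfolding competitor_gradient_def[abs_def]
    by (intro continuous_intros c continuous_on_compose2[OF c] continuous_on_compose2[OF D\<phi>T_cont]) auto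
  then show ?thesis by (rule continuous_on_subset) simp
qed

lemma competitor_C1: "C1_closed_cylinder T (competitor s n)"
proof (rule C1_closed_cylinderI[OF T, where G = "competitor_gradient s n"])
  show "(competitor s n has_derivative (\<lambda>h. h \<bullet> competitor_gradient s n z)) (at z within slab T)" for z
    by (rule has_derivative_at_withinI[OF competitor_derivative])
  show "periodic (\<lambda>x. competitor s n (t, x))" for t
    using mollify_C1(3)[of n t] mollify_C1(3)[of n T] \<phi>T(1) by (simp add: periodic_def competitor_def)
qed (rule competitor_gradient_continuous)

lemma competitor_in_K0: "competitor s n \<in> K0 T \<phi>T"
  using competitor_C1 by (simp add: K0_def competitor_def)

lemma competitor_slab_gradient:
  assumes "z \<in> slab T" shows "slab_gradient T (competitor s n) z = competitor_gradient s n z"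
proof -
  have "partial_within (slab T) b (competitor s n) z = b \<bullet> competitor_gradient s n z" for b
    by (rule partial_within_slab[OF T assms has_derivative_at_withinI[OF competitor_derivative]])
  then show ?thesis
    by (simp add: slab_gradient_def inner_commute[of _ "competitor_gradient s n z"] euclidean_representation)
qed

text \<open>The residual is a convex combination of that of the mollified function and of the Hamiltonian at the
  vector \<open>b\<close>, which is \<open>1 / s\<close> times the gradient of the correction.  It is bounded independently of
  \<open>s\<close> because the mollified gradient is within \<open>s\<close> of \<open>D\<phi>T\<close> at the final time.\<close>

lemma competitor_cost:
  assumes s: "0 < s" "s < 1"
    and err: "commutator_error n \<le> s"
    and grad: "\<And>x. norm (snd (gradient (mollify n \<phi>e) (T, x)) - D\<phi>T x) \<le> s"
    and R: "\<And>x. norm (D\<phi>T x) + 1 \<le> R"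
    and z: "z \<in> cylinder T"
  shows "Fstar (snd z) (- time_deriv_within (slab T) (competitor s n) z + H (snd z) (space_grad_within (slab T) (competitor s n) z))
    \<le> Fstar (snd z) (mollify n \<alpha>e z) + s * Fstar (snd z) (CH * R powr r + CH + 1)"
proof -
  let ?G = "gradient (mollify n \<phi>e)" and ?x = "snd z"
  have zs: "z \<in> slab T" "fst z \<in> {0..T}" using z by (auto simp: cylinder_def slab_def)
  define b where "b = (1 / s) *\<^sub>R (D\<phi>T ?x - (1 - s) *\<^sub>R snd (?G (T, ?x)))"
  have sb: "s *\<^sub>R b = D\<phi>T ?x - (1 - s) *\<^sub>R snd (?G (T, ?x))" using s by (simp add: b_def)
  have "norm b \<le> R"
  proof -
    have "s *\<^sub>R b = s *\<^sub>R D\<phi>T ?x + (1 - s) *\<^sub>R (D\<phi>T ?x - snd (?G (T, ?x)))"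
      unfolding sb by (simp add: algebra_simps)
    then have "s * norm b \<le> norm (s *\<^sub>R D\<phi>T ?x) + norm ((1 - s) *\<^sub>R (D\<phi>T ?x - snd (?G (T, ?x))))"
      using s norm_triangle_ineq by (metis abs_of_pos norm_scaleR)
    also have "\<dots> = s * norm (D\<phi>T ?x) + (1 - s) * norm (snd (?G (T, ?x)) - D\<phi>T ?x)"
      using s by (simp add: norm_minus_commute)
    also have "\<dots> \<le> s * norm (D\<phi>T ?x) + 1 * s"
      using s grad[of ?x] by (intro add_mono mult_mono) auto
    also have "\<dots> = s * (norm (D\<phi>T ?x) + 1)" by (simp add: algebra_simps)
    also have "\<dots> \<le> s * R" using s R by (intro mult_left_mono) auto
    finally show ?thesis using s by simp
  qed
  then have Hb: "H ?x b \<le> CH * R powr r + CH"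
  proof -
    have "norm b powr r \<le> R powr r" using \<open>norm b \<le> R\<close> r by (intro powr_mono2) auto
    then have "CH * norm b powr r \<le> CH * R powr r" using CH by (intro mult_left_mono) auto
    then show ?thesis using H_abs[of ?x b] by linarith
  qed
  let ?a = "- time_deriv_within (slab T) (competitor s n) z + H ?x (space_grad_within (slab T) (competitor s n) z)"
  have sg: "space_grad_within (slab T) (competitor s n) z = (1 - s) *\<^sub>R snd (?G z) + s *\<^sub>R b"
    unfolding space_grad_slab competitor_slab_gradient[OF zs(1)] sb by (simp add: competitor_gradient_def)
  have td: "time_deriv_within (slab T) (competitor s n) z = (1 - s) * fst (?G z)"
    unfolding time_deriv_slab competitor_slab_gradient[OF zs(1)] by (simp add: competitor_gradient_def)
  have "?a \<le> - (1 - s) * fst (?G z) + ((1 - s) * H ?x (snd (?G z)) + s * H ?x b)"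
    unfolding sg td using H_convex[of s ?x "snd (?G z)" b] s by (simp add: algebra_simps)
  also have "\<dots> = (1 - s) * (- fst (?G z) + H ?x (snd (?G z))) + s * H ?x b" by (simp add: algebra_simps)
  also have "\<dots> \<le> (1 - s) * (mollify n \<alpha>e z + commutator_error n) + s * (CH * R powr r + CH)"
  proof (rule add_mono)
    show "(1 - s) * (- fst (?G z) + H ?x (snd (?G z))) \<le> (1 - s) * (mollify n \<alpha>e z + commutator_error n)"
      using s mollified_inequality[OF zs(2), of n] by (intro mult_left_mono) linarith+
    show "s * H ?x b \<le> s * (CH * R powr r + CH)" using s Hb by (intro mult_left_mono) auto
  qed
  also have "\<dots> \<le> (1 - s) * mollify n \<alpha>e z + s * (CH * R powr r + CH + 1)"
  proof -
    have "(1 - s) * commutator_error n \<le> 1 * s"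
      using s err commutator_error_nonneg[of n] by (intro mult_mono) auto
    then show ?thesis by (simp add: algebra_simps)
  qed
  finally have "Fstar ?x ?a \<le> Fstar ?x ((1 - s) * mollify n \<alpha>e z + s * (CH * R powr r + CH + 1))"
    by (rule Fstar_mono)
  also have "\<dots> \<le> (1 - s) * Fstar ?x (mollify n \<alpha>e z) + s * Fstar ?x (CH * R powr r + CH + 1)"
    using s by (intro Fstar_convex) auto
  also have "\<dots> \<le> 1 * Fstar ?x (mollify n \<alpha>e z) + s * Fstar ?x (CH * R powr r + CH + 1)"
    using s by (intro add_right_mono mult_right_mono Fstar_nonneg) auto
  finally show ?thesis by simp
qed

text \<open>The parameter \<open>s\<close> is fixed first, so small that the shrinking changes the costs by at most half
  of \<open>e\<close>; the scale of the mollification then depends on \<open>s\<close>.\<close>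

lemma approximation:
  assumes m0: "periodic m0" "continuous_on UNIV m0" "\<And>x. 0 \<le> m0 x" "(LINT x:unit_cell|lborel. m0 x) = 1"
    and e: "0 < e"
  shows "\<exists>\<psi>\<in>K0 T \<phi>T. A0 T f H m0 \<psi> \<le> A T f m0 \<phi> \<alpha> + ereal e"
proof -
  define I\<alpha> where "I\<alpha> = (LINT z:cylinder T|lborel. Fstar (snd z) (\<alpha> z))"
  define I0 where "I0 = (LINT x:unit_cell|lborel. initial_trace T \<phi> x * m0 x)"
  define IT where "IT = (LINT x:unit_cell|lborel. \<phi>T x * m0 x)"
  obtain R0 where R0: "\<And>x. norm (D\<phi>T x) \<le> R0" using periodic_bounded[OF D\<phi>T_periodic D\<phi>T_cont] by metis
  define R where "R = R0 + 1"
  have R: "norm (D\<phi>T x) + 1 \<le> R" for x using R0[of x] by (simp add: R_def)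
  define b where "b = CH * R powr r + CH + 1"
  define B where "B = growth * (1 + \<bar>b\<bar> powr p)"
  have B: "Fstar x b \<le> B" "0 \<le> B" for x using Fstar_growth growth_nonneg by (simp_all add: B_def)
  define C where "C = \<bar>T * B + I0 - IT\<bar>"
  define s where "s = min (1 / 2) (e / (2 * (C + 1)))"
  have C: "0 \<le> C" by (simp add: C_def)
  have s: "0 < s" "s < 1" using e C by (auto simp: s_def min_def)
  have sC: "s * (T * B + I0 - IT) \<le> e / 2"
  proof -
    have "s * (T * B + I0 - IT) \<le> s * (C + 1)" using s by (intro mult_left_mono) (auto simp: C_def)
    also have "\<dots> \<le> (e / (2 * (C + 1))) * (C + 1)" using C by (intro mult_right_mono) (auto simp: s_def)
    also have "\<dots> = e / 2" using C by (simp add: field_simps)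
    finally show ?thesis .
  qed
  \<comment> \<open>The error \<open>e1\<close> enters three times: in the running cost, the initial cost and the final value.\<close>
  define e1 where "e1 = e / 6"
  have e1: "0 < e1" using e by (simp add: e1_def)
  have "\<forall>\<^sub>F n in sequentially. commutator_error n < s"
    by (rule order_tendstoD(2)[OF commutator_error_tendsto s(1)])
  moreover note final_gradient_close[OF s(1)] final_value_close[OF e1]
  moreover have "\<forall>\<^sub>F n in sequentially. I0 - e1 < (LINT x:unit_cell|lborel. mollify n \<phi>e (0, x) * m0 x)"
    by (rule order_tendstoD(1)[OF mollify_initial_limit[OF m0(1,2)]]) (use e1 in \<open>simp add: I0_def\<close>)
  moreover have "\<forall>\<^sub>F n in sequentially. (LINT \<zeta>|lborel. layered_cost n \<zeta>) < I\<alpha> + e1"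
    by (rule order_tendstoD(2)[OF layered_cost_limit]) (use e1 in \<open>simp add: I\<alpha>_def\<close>)
  ultimately have "\<forall>\<^sub>F n in sequentially. commutator_error n < s
      \<and> (\<forall>x. norm (snd (gradient (mollify n \<phi>e) (T, x)) - D\<phi>T x) \<le> s)
      \<and> (\<forall>x. \<bar>mollify n \<phi>e (T, x) - \<phi>T x\<bar> \<le> e1)
      \<and> I0 - e1 < (LINT x:unit_cell|lborel. mollify n \<phi>e (0, x) * m0 x)
      \<and> (LINT \<zeta>|lborel. layered_cost n \<zeta>) < I\<alpha> + e1"
    by (intro eventually_conj)
  then obtain n where n: "commutator_error n < s"
      "\<forall>x. norm (snd (gradient (mollify n \<phi>e) (T, x)) - D\<phi>T x) \<le> s"
      "\<forall>x. \<bar>mollify n \<phi>e (T, x) - \<phi>T x\<bar> \<le> e1"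
      "I0 - e1 < (LINT x:unit_cell|lborel. mollify n \<phi>e (0, x) * m0 x)"
      "(LINT \<zeta>|lborel. layered_cost n \<zeta>) < I\<alpha> + e1"
    using eventually_happens'[OF sequentially_bot] by blast
  let ?\<psi> = "competitor s n"
  let ?a = "\<lambda>z. - time_deriv_within (slab T) ?\<psi> z + H (snd z) (space_grad_within (slab T) ?\<psi> z)"
  have meas: "(\<lambda>z. ennreal (Fstar (snd z) (mollify n \<alpha>e z))) \<in> borel_measurable (cylM 0 T)"
  proof -
    have "(\<lambda>z. Fstar (snd z) (mollify n \<alpha>e z)) \<in> borel_measurable borel"
      by (rule Fstar_measurable; intro borel_measurable_continuous_onI continuous_on_snd continuous_on_id
          mollify_continuous \<alpha>e_integrable)
    from measurable_compose[OF this measurable_ennreal] show ?thesis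
      using measurable_cong_sets[OF sets_cylM[of 0 T] refl] by blast
  qed
  have "(\<integral>\<^sup>+z. ennreal (Fstar (snd z) (?a z)) * indicator (cylinder T) z \<partial>lborel)
      \<le> (\<integral>\<^sup>+z. indicator ({0<..<T} \<times> unit_cell) z * (ennreal (Fstar (snd z) (mollify n \<alpha>e z)) + ennreal (s * B)) \<partial>lborel)"
  proof (rule nn_integral_mono)
    fix z :: "real \<times> (real^'n)"
    show "ennreal (Fstar (snd z) (?a z)) * indicator (cylinder T) z
        \<le> indicator ({0<..<T} \<times> unit_cell) z * (ennreal (Fstar (snd z) (mollify n \<alpha>e z)) + ennreal (s * B))"
    proof (cases "z \<in> cylinder T")
      case True
      have "Fstar (snd z) (?a z) \<le> Fstar (snd z) (mollify n \<alpha>e z) + s * Fstar (snd z) b"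
        unfolding b_def by (rule competitor_cost[OF s _ _ R True]) (use n in auto)
      also have "\<dots> \<le> Fstar (snd z) (mollify n \<alpha>e z) + s * B"
        using s B(1)[of "snd z"] by (intro add_left_mono mult_left_mono) auto
      finally have "ennreal (Fstar (snd z) (?a z)) \<le> ennreal (Fstar (snd z) (mollify n \<alpha>e z) + s * B)"
        by (rule ennreal_leI)
      also have "\<dots> = ennreal (Fstar (snd z) (mollify n \<alpha>e z)) + ennreal (s * B)"
        using s B(2) by (intro ennreal_plus Fstar_nonneg) simp
      finally show ?thesis using True by (simp add: cylinder_def)
    qed (simp add: cylinder_def)
  qed
  also have "\<dots> = (\<integral>\<^sup>+z. ennreal (Fstar (snd z) (mollify n \<alpha>e z)) + ennreal (s * B) \<partial>cylM 0 T)"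
  proof -
    have "(\<lambda>z. ennreal (Fstar (snd z) (mollify n \<alpha>e z)) + ennreal (s * B)) \<in> borel_measurable lborel"
      using meas measurable_cong_sets[OF sets_cylM[of 0 T, where 'a = 'n] refl, of "borel :: ennreal measure"] by auto
    then show ?thesis unfolding cylM_density by (intro nn_integral_density[symmetric]) auto
  qed
  also have "\<dots> = (\<integral>\<^sup>+z. ennreal (Fstar (snd z) (mollify n \<alpha>e z)) \<partial>cylM 0 T) + ennreal (s * B) * ennreal T"
  proof -
    have "emeasure (cylM 0 T :: (real \<times> (real^'n)) measure) UNIV = ennreal T"
      using emeasure_cylM[of 0 T] T by simp
    then show ?thesis using meas by (subst nn_integral_add) (simp_all add: nn_integral_const)
  qed
  also have "\<dots> \<le> ennreal (I\<alpha> + e1) + ennreal (s * B) * ennreal T"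
    by (intro add_right_mono order_trans[OF mollified_cost_le] ennreal_leI) (use n(5) in simp)
  also have "\<dots> = ennreal (I\<alpha> + e1 + s * B * T)"
  proof -
    have "0 \<le> I\<alpha>"
      unfolding I\<alpha>_def set_lebesgue_integral_def by (intro Bochner_Integration.integral_nonneg) (simp add: Fstar_nonneg)
    then show ?thesis using s B(2) T e1 by (simp add: ennreal_mult[symmetric] ennreal_plus[symmetric] del: ennreal_plus)
  qed
  finally have le: "(\<integral>\<^sup>+z. ennreal (Fstar (snd z) (?a z)) * indicator (cylinder T) z \<partial>lborel)
      \<le> ennreal (I\<alpha> + e1 + s * B * T)" .
  have run: "enn2ereal (\<integral>\<^sup>+z. ennreal (Fstar (snd z) (?a z)) * indicator (cylinder T) z \<partial>lborel)
      \<le> ereal (I\<alpha> + e1 + s * B * T)"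
  proof -
    have "0 \<le> I\<alpha>"
      unfolding I\<alpha>_def set_lebesgue_integral_def by (intro Bochner_Integration.integral_nonneg) (simp add: Fstar_nonneg)
    then have "0 \<le> I\<alpha> + e1 + s * B * T" using s B(2) T e1 by simp
    from enn2ereal_ennreal[OF this] le[unfolded less_eq_ennreal.rep_eq] show ?thesis by simp
  qed
  have cont_t: "continuous_on UNIV (\<lambda>x. mollify n \<phi>e (t, x))" for t
  proof (rule continuous_on_compose2[where g = "mollify n \<phi>e" and f = "\<lambda>x. (t, x)" and t = UNIV])
    show "continuous_on UNIV (mollify n \<phi>e)" by (rule mollify_continuous[OF \<phi>e_integrable])
  qed (auto intro!: continuous_intros)
  have to_cell: "(LINT x:unit_cell|lborel. u x) = (LINT x|cellM. u x)" "integrable cellM u"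
    if u: "continuous_on UNIV u" "periodic u" for u :: "real^'n \<Rightarrow> real"
  proof -
    obtain K where K: "\<And>x. norm (u x) \<le> K" using periodic_bounded[OF u(2,1)] by metis
    have m: "u \<in> borel_measurable borel" by (rule borel_measurable_continuous_onI[OF u(1)])
    show "(LINT x:unit_cell|lborel. u x) = (LINT x|cellM. u x)" by (rule set_integral_cell[OF m])
    show "integrable cellM u" by (rule integrable_cellM_bounded[OF m K])
  qed
  have per: "periodic (\<lambda>x. mollify n \<phi>e (t, x) * m0 x)" for t
    using mollify_C1(3)[of n t] m0(1) by (simp add: periodic_def)
  have cm: "continuous_on UNIV (\<lambda>x. mollify n \<phi>e (t, x) * m0 x)" for t
    by (intro continuous_intros cont_t m0(2))
  note im = to_cell[OF cm per]
  have iT: "(LINT x:unit_cell|lborel. \<phi>T x * m0 x) = (LINT x|cellM. \<phi>T x * m0 x)" "integrable cellM (\<lambda>x. \<phi>T x * m0 x)"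
    by (rule to_cell; use \<phi>T(1) m0(1) in \<open>auto intro!: continuous_intros \<phi>T_cont m0(2) simp: periodic_def\<close>)+
  have i\<psi>: "(LINT x:unit_cell|lborel. ?\<psi> (0, x) * m0 x) = (LINT x|cellM. ?\<psi> (0, x) * m0 x)"
  proof (rule to_cell(1))
    show "continuous_on UNIV (\<lambda>x. ?\<psi> (0, x) * m0 x)"
      unfolding competitor_def by (intro continuous_intros) (auto intro!: cont_t \<phi>T_cont m0(2))
    show "periodic (\<lambda>x. ?\<psi> (0, x) * m0 x)"
      using C1_closed_cylinderD(4)[OF competitor_C1[of s n], of 0] T m0(1) by (simp add: periodic_def)
  qed
  have im0: "(LINT x|cellM. m0 x) = 1" "integrable cellM m0"
    using to_cell[OF m0(2,1)] m0(4) by auto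
  have fin: "(LINT x|cellM. mollify n \<phi>e (T, x) * m0 x) \<le> IT + e1"
  proof -
    have "(LINT x|cellM. mollify n \<phi>e (T, x) * m0 x) \<le> (LINT x|cellM. \<phi>T x * m0 x + e1 * m0 x)"
    proof (rule Bochner_Integration.integral_mono)
      fix x
      have "mollify n \<phi>e (T, x) \<le> \<phi>T x + e1" using spec[OF n(3), of x] by linarith
      from mult_right_mono[OF this m0(3)[of x]]
      show "mollify n \<phi>e (T, x) * m0 x \<le> \<phi>T x * m0 x + e1 * m0 x" by (simp add: distrib_right)
    qed (use im iT im0 in auto)
    also have "\<dots> = IT + e1" using iT im0 by (simp add: IT_def)
    finally show ?thesis .
  qed
  have "(LINT x|cellM. ?\<psi> (0, x) * m0 x)
      = (LINT x|cellM. ((1 - s) * (mollify n \<phi>e (0, x) * m0 x) + \<phi>T x * m0 x) - (1 - s) * (mollify n \<phi>e (T, x) * m0 x))"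
    by (intro Bochner_Integration.integral_cong refl) (simp add: competitor_def algebra_simps)
  also have "\<dots> = (1 - s) * (LINT x|cellM. mollify n \<phi>e (0, x) * m0 x) + IT - (1 - s) * (LINT x|cellM. mollify n \<phi>e (T, x) * m0 x)"
    using im iT by (simp add: IT_def)
  finally have eq: "(LINT x:unit_cell|lborel. ?\<psi> (0, x) * m0 x)
      = (1 - s) * (LINT x|cellM. mollify n \<phi>e (0, x) * m0 x) + IT - (1 - s) * (LINT x|cellM. mollify n \<phi>e (T, x) * m0 x)"
    by (simp only: i\<psi>)
  have ini: "(1 - s) * (I0 - e1) + IT - (1 - s) * (IT + e1) \<le> (LINT x:unit_cell|lborel. ?\<psi> (0, x) * m0 x)"
    unfolding eq using s n(4) im(1)[of 0] fin by (intro diff_mono add_right_mono mult_left_mono) auto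
  have total: "(I\<alpha> + e1 + s * B * T) - (LINT x:unit_cell|lborel. ?\<psi> (0, x) * m0 x) \<le> I\<alpha> - I0 + e"
  proof -
    have "(I\<alpha> + e1 + s * B * T) - ((1 - s) * (I0 - e1) + IT - (1 - s) * (IT + e1))
        = I\<alpha> - I0 + s * (T * B + I0 - IT) + 3 * e1 - 2 * (s * e1)"
      by (simp add: algebra_simps)
    moreover have "0 \<le> s * e1" using s e1 by simp
    moreover have "6 * e1 = e" by (simp add: e1_def)
    moreover have "A - L \<le> I\<alpha> - I0 + e"
      if "A - Y = I\<alpha> - I0 + S + 3 * e1 - 2 * P" "0 \<le> P" "6 * e1 = e" "Y \<le> L" "S \<le> e / 2" for A Y P S L :: real
      using that by linarith
    ultimately show ?thesis using ini sC by blast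
  qed
  have "A0 T f H m0 ?\<psi> = enn2ereal (\<integral>\<^sup>+z. ennreal (Fstar (snd z) (?a z)) * indicator (cylinder T) z \<partial>lborel)
      - ereal (LINT x:unit_cell|lborel. ?\<psi> (0, x) * m0 x)"
    by (rule A0_eq_real[OF coupling_data_axioms])
  also have "\<dots> \<le> ereal (I\<alpha> + e1 + s * B * T) - ereal (LINT x:unit_cell|lborel. ?\<psi> (0, x) * m0 x)"
    by (rule ereal_minus_mono[OF run order_refl])
  also have "\<dots> \<le> ereal (I\<alpha> - I0 + e)" using total by simp
  also have "\<dots> = A T f m0 \<phi> \<alpha> + ereal e" by (simp add: relaxed_cost_eq I\<alpha>_def I0_def)
  finally show ?thesis using competitor_in_K0 by blast
qed

end

section \<open>Equality of the two infima\<close>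

text \<open>Restriction to the line through \<open>\<xi>\<close> and \<open>\<eta>\<close> reduces this to one variable.\<close>

lemma convex_gradient_tangent:
  fixes h :: "'a::real_inner \<Rightarrow> real"
  assumes "convex_on UNIV h" "GDERIV h \<xi> :> d"
  shows "h \<xi> + d \<bullet> (\<eta> - \<xi>) \<le> h \<eta>"
proof -
  let ?g = "\<lambda>t :: real. h (\<xi> + t *\<^sub>R (\<eta> - \<xi>))"
  have "convex_on UNIV ?g"
  proof (rule convex_onI)
    fix t x y :: real assume t: "0 < t" "t < 1"
    have "\<xi> + ((1 - t) * x + t * y) *\<^sub>R (\<eta> - \<xi>)
        = (1 - t) *\<^sub>R (\<xi> + x *\<^sub>R (\<eta> - \<xi>)) + t *\<^sub>R (\<xi> + y *\<^sub>R (\<eta> - \<xi>))"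
      by (simp add: algebra_simps)
    then show "?g ((1 - t) *\<^sub>R x + t *\<^sub>R y) \<le> (1 - t) * ?g x + t * ?g y"
      using convex_onD[OF assms(1), of t] t by simp
  qed simp
  moreover have "(?g has_real_derivative d \<bullet> (\<eta> - \<xi>)) (at 0)"
  proof -
    have "((\<lambda>t :: real. \<xi> + t *\<^sub>R (\<eta> - \<xi>)) has_derivative (\<lambda>t. t *\<^sub>R (\<eta> - \<xi>))) (at 0)"
      by (auto intro!: derivative_eq_intros)
    moreover have "(h has_derivative (\<lambda>v. v \<bullet> d)) (at (\<xi> + 0 *\<^sub>R (\<eta> - \<xi>)))"
      using assms(2) by (simp add: gderiv_def)
    ultimately have "(?g has_derivative (\<lambda>t. (t *\<^sub>R (\<eta> - \<xi>)) \<bullet> d)) (at 0)"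
      by (rule has_derivative_compose)
    moreover have "(\<lambda>t. (t *\<^sub>R (\<eta> - \<xi>)) \<bullet> d) = (*) (d \<bullet> (\<eta> - \<xi>))"
      by (simp add: fun_eq_iff inner_commute mult.commute)
    ultimately show ?thesis by (simp add: has_field_derivative_def)
  qed
  ultimately have "d \<bullet> (\<eta> - \<xi>) * (1 - 0) \<le> ?g 1 - ?g 0"
    by (intro convex_on_imp_above_tangent[where A = UNIV]) auto
  then show ?thesis by simp
qed

theorem proposition3p1:
  fixes T q p r \<theta> :: real
    and f :: "real^'n \<Rightarrow> real \<Rightarrow> real"
    and H :: "real^'n \<Rightarrow> real^'n \<Rightarrow> real"
    and \<phi>T m0 :: "real^'n \<Rightarrow> real"
  assumes T: "0 < T"
    and f_periodic: "\<And>m. 0 \<le> m \<Longrightarrow> periodic (\<lambda>x. f x m)"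
    and f_cont: "continuous_on (UNIV \<times> {0..}) (\<lambda>(x, m). f x m)"
    and f_mono: "\<And>x. strict_mono_on {0..} (f x)"
    and f_zero: "\<And>x. f x 0 = 0"
    and q: "1 < q"
    and f_growth: "\<exists>C>0. \<forall>x. \<forall>m\<ge>0.
          1 / C * m powr (q - 1) - C \<le> f x m \<and> f x m \<le> C * m powr (q - 1) + C"
    and p: "1 / p + 1 / q = 1"
    and H_periodic: "\<And>\<xi>. periodic (\<lambda>x. H x \<xi>)"
    and H_cont: "continuous_on UNIV (\<lambda>(x, \<xi>). H x \<xi>)"
    and H_convex: "\<And>x. convex_on UNIV (H x)"
    and H_diff: "\<exists>DpH. (\<forall>x \<xi>. GDERIV (H x) \<xi> :> DpH x \<xi>) \<and>
          continuous_on UNIV (\<lambda>(x, \<xi>). DpH x \<xi>)"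
    and r: "max (real CARD('n) * (q - 1)) 1 < r"
    and H_growth: "\<exists>C>0. \<forall>x \<xi>.
          1 / (r * C) * norm \<xi> powr r - C \<le> H x \<xi> \<and> H x \<xi> \<le> C / r * norm \<xi> powr r + C"
    and \<theta>: "0 \<le> \<theta>" "\<theta> < r / (real CARD('n) + 1)"
    and H_x: "\<exists>C>0. \<forall>x y \<xi>.
          \<bar>H x \<xi> - H y \<xi>\<bar> \<le> C * torus_dist x y * max (norm \<xi>) 1 powr \<theta>"
    and \<phi>T: "periodic \<phi>T" "Ck_on 1 UNIV \<phi>T"
    and m0: "periodic m0" "continuous_on UNIV m0" "\<And>x. 0 \<le> m0 x"
          "(LINT x:unit_cell|lborel. m0 x) = 1"
  shows "(INF \<phi>\<in>K0 T \<phi>T. A0 T f H m0 \<phi>) = (INF (\<phi>, \<alpha>)\<in>K T p r H \<phi>T. A T f m0 \<phi> \<alpha>)"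
proof -
  obtain Cf where Cf: "Cf > 0" "\<And>x m. 0 \<le> m \<Longrightarrow> 1 / Cf * m powr (q - 1) - Cf \<le> f x m"
    using f_growth by auto
  obtain CH where CH: "CH > 0" "\<And>x \<xi>. 1 / (r * CH) * norm \<xi> powr r - CH \<le> H x \<xi>"
      "\<And>x \<xi>. H x \<xi> \<le> CH / r * norm \<xi> powr r + CH"
    using H_growth by auto
  obtain Cx where Cx: "Cx > 0" "\<And>x y \<xi>. \<bar>H x \<xi> - H y \<xi>\<bar> \<le> Cx * torus_dist x y * max (norm \<xi>) 1 powr \<theta>"
    using H_x by auto
  obtain DpH where DpH: "\<And>x \<xi>. GDERIV (H x) \<xi> :> DpH x \<xi>" using H_diff by auto
  have r1: "1 < r" using r by simp
  have coupling: "coupling_data f q Cf p"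
    by unfold_locales (fact f_periodic f_cont f_mono f_zero q Cf p)+
  have Hamiltonian: "Hamiltonian_data T r \<theta> CH Cx H \<phi>T DpH"
    by unfold_locales
      (fact T r1 CH Cx H_periodic H_cont \<theta> \<phi>T convex_gradient_tangent[OF H_convex DpH])+
  have p1: "1 < p" by (rule coupling_data.p_gt_1[OF coupling])
  show ?thesis
  proof (rule antisym)
    show "(INF \<phi>\<in>K0 T \<phi>T. A0 T f H m0 \<phi>) \<le> (INF (\<phi>, \<alpha>)\<in>K T p r H \<phi>T. A T f m0 \<phi> \<alpha>)"
    proof (rule INF_greatest, clarify)
      fix \<phi> \<alpha> :: "real \<times> (real^'n) \<Rightarrow> real" assume K: "(\<phi>, \<alpha>) \<in> K T p r H \<phi>T"
      then obtain g0 w where *: "BV_cylinder T \<phi>" "Lp_cylinder T p \<alpha>" "BV_traces T \<phi> g0 \<phi>T"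
        "weak_space_gradient T \<phi> w" "Lp_cylinder T r w" "HJ_subsolution T H \<phi> w \<alpha>"
        unfolding K_def by blast
      have "relaxed_pair T r \<theta> CH Cx H \<phi>T DpH p \<phi> \<alpha> w g0"
        using Hamiltonian p1 * by (intro relaxed_pair.intro relaxed_pair_axioms.intro) (auto simp: BV_cylinder_def)
      then interpret relaxed_problem T r \<theta> CH Cx H \<phi>T DpH p \<phi> \<alpha> w g0 f q Cf
        using coupling by (rule relaxed_problem.intro)
      show "(INF \<phi>\<in>K0 T \<phi>T. A0 T f H m0 \<phi>) \<le> A T f m0 \<phi> \<alpha>"
      proof (rule ereal_le_epsilon2)
        fix e :: real assume "0 < e"
        then obtain \<psi> where "\<psi> \<in> K0 T \<phi>T" "A0 T f H m0 \<psi> \<le> A T f m0 \<phi> \<alpha> + ereal e"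
          using approximation[OF m0] by blast
        then show "(INF \<phi>\<in>K0 T \<phi>T. A0 T f H m0 \<phi>) \<le> A T f m0 \<phi> \<alpha> + ereal e"
          using order_trans[OF INF_lower[of \<psi> "K0 T \<phi>T" "A0 T f H m0"]] by blast
      qed
    qed
    show "(INF (\<phi>, \<alpha>)\<in>K T p r H \<phi>T. A T f m0 \<phi> \<alpha>) \<le> (INF \<phi>\<in>K0 T \<phi>T. A0 T f H m0 \<phi>)"
    proof (rule INF_greatest)
      fix \<phi> assume \<phi>: "\<phi> \<in> K0 T \<phi>T"
      let ?\<alpha> = "\<lambda>z. - time_deriv_within (slab T) \<phi> z + H (snd z) (space_grad_within (slab T) \<phi> z)"
      have in_K: "(\<phi>, ?\<alpha>) \<in> K T p r H \<phi>T"
        by (rule C1_in_K[OF T _ _ H_periodic H_cont \<phi>]) (use p1 r1 in auto)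
      have "BV_traces T \<phi> (\<lambda>x. \<phi> (0, x)) (\<lambda>x. \<phi> (T, x))"
        using \<phi> by (intro C1_BV_traces[OF T]) (simp add: K0_def)
      from initial_trace_integral[OF T this m0(1,2)]
      have "A T f m0 \<phi> ?\<alpha> = A0 T f H m0 \<phi>" by (simp add: A_def A0_def)
      then show "(INF (\<phi>, \<alpha>)\<in>K T p r H \<phi>T. A T f m0 \<phi> \<alpha>) \<le> A0 T f H m0 \<phi>"
        using INF_lower[OF in_K, of "\<lambda>(\<phi>, \<alpha>). A T f m0 \<phi> \<alpha>"] by simp
    qed
  qed
qed

end
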